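(* Let $\Omega\subset\mathbb{R}^N$ ($N\ge1$) be a bounded Lipschitz domain, $\mu_1,\mu_2>0$, $\beta\in\mathbb{R}$, $1+4/N<p\le2^*-1$ (no upper bound if $N=1,2$), and $(\rho_1,\rho_2)\in A$. Let $\bar\alpha\ge\lambda_1(\Omega)$ be such that $c_{\bar\alpha}<\hat c_{\bar\alpha}$ and, if $N\ge3$ and $p=2^*-1$, additionally $(\rho_1+\rho_2)(\bar\alpha-\lambda_1(\Omega))\le\Lambda^{-(N-2)/2}$. Then the set of local ground states $$G_{\bar\alpha}=\{(u_1,u_2)\in H^1_0(\Omega;\mathbb{C}^2):\ (|u_1|,|u_2|)\in\mathcal{B}_{\bar\alpha},\ \mathcal{E}(u_1,u_2)=c_{\bar\alpha}\}$$ is conditionally orbitally stable.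
   Context: $\beta^+=\max\{\beta,0\}$; $\lambda_1(\Omega)$ is the first Dirichlet eigenvalue of $-\Delta$. For $(u_1,u_2)\in H^1_0(\Omega;\mathbb{C}^2)$, $\mathcal{E}(u_1,u_2)=\frac12\int_\Omega(|\nabla u_1|^2+|\nabla u_2|^2)-\frac{1}{p+1}\int_\Omega(\mu_1|u_1|^{p+1}+2\beta|u_1|^{(p+1)/2}|u_2|^{(p+1)/2}+\mu_2|u_2|^{p+1})$. $\mathcal{M}=\{(u_1,u_2)\in H^1_0(\Omega;\mathbb{R}^2):\int_\Omega u_i^2=\rho_i\}$, $\mathcal{B}_\alpha=\{(u_1,u_2)\in\mathcal{M}:\int_\Omega|\nabla u_1|^2+|\nabla u_2|^2\le(\rho_1+\rho_2)\alpha\}$, $\mathcal{U}_\alpha$ the same with equality, $c_\alpha=\inf_{\mathcal{B}_\alpha}\mathcal{E}$, $\hat c_\alpha=\inf_{\mathcal{U}_\alpha}\mathcal{E}$. For $N\ge3$, $2^*=2N/(N-2)$, $S_N$ the smallest constant with $\|v\|_{L^{2^*}(\mathbb{R}^N)}^{2^*}\le S_N\|\nabla v\|_{L^2(\mathbb{R}^N)}^{2^*}$, and $\Lambda=\frac{2S_N}{2^*}\max_{x^2+y^2=1}(\mu_1|x|^{2^*}+\mu_2|y|^{2^*}+2\beta^+|xy|^{2^*/2})$. $A=\{(\rho_1,\rho_2)\in[0,\infty)^2: c_\alpha<\hat c_\alpha$ for some $\alpha\ge\lambda_1(\Omega)$, with $\alpha$ also satisfying $(\rho_1+\rho_2)(\alpha-\lambda_1(\Omega))\le\Lambda^{-(N-2)/2}$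 if $p=2^*-1\}\cup\{(0,0)\}$. Conditional orbital stability: consider $\mathrm{i}\partial_t\Psi_1+\Delta\Psi_1+\Psi_1(\mu_1|\Psi_1|^{p-1}+\beta|\Psi_1|^{(p-3)/2}|\Psi_2|^{(p+1)/2})=0$, $\mathrm{i}\partial_t\Psi_2+\Delta\Psi_2+\Psi_2(\mu_2|\Psi_2|^{p-1}+\beta|\Psi_2|^{(p-3)/2}|\Psi_1|^{(p+1)/2})=0$, $\Psi_i(t)\in H^1_0(\Omega;\mathbb{C})$, $\Psi_i(0)=\psi_i$. A set $\mathcal{G}\subset H^1_0(\Omega;\mathbb{C}^2)$ is conditionally orbitally stable if, assuming (1) for every $M>0$ there is $T_0(M)>0$ such that the Cauchy problem with any datum of $H^1_0$-norm at most $M$ has a unique solution on $[0,T_0)$, and (2) the masses $\int_\Omega|\Psi_i|^2$ and $\mathcal{E}$ are conserved along solutions, then for every $\varepsilon>0$ there is $\delta>0$ such that $\mathrm{dist}_{H^1_0}((\psi_1,\psi_2),\mathcal{G})<\delta$ implies that the solution extends to $[0,\infty)$ and $\sup_{t>0}\mathrm{dist}_{H^1_0}((\Psi_1(t),\Psi_2(t)),\mathcal{G})<\varepsilon$. *)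

theory Defs
  imports "HOL-Analysis.Analysis"
begin

text \<open>Lipschitz boundary: near every boundary point, after a rigid motion, the domain is
  the strict subgraph of a Lipschitz function of the remaining N-1 coordinates.\<close>
definition lipschitz_domain :: "'a::euclidean_space set \<Rightarrow> bool" where
  "lipschitz_domain \<Omega> \<longleftrightarrow> open \<Omega> \<and> connected \<Omega> \<and> \<Omega> \<noteq> {} \<and>
     (\<forall>x\<in>frontier \<Omega>. \<exists>r>0. \<exists>T b g L.
        orthogonal_transformation T \<and> b \<in> Basis \<and> lipschitz_on L UNIV (g :: 'a \<Rightarrow> real) \<and>
        (\<forall>y. g y = g (y - (y \<bullet> b) *\<^sub>R b)) \<and>
        \<Omega> \<inter> ball x r = {y \<in> ball x r. T (y - x) \<bullet> b < g (T (y - x))})"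

fun Ck :: "nat \<Rightarrow> ('a::euclidean_space \<Rightarrow> 'b::real_normed_vector) \<Rightarrow> bool" where
  "Ck 0 f = continuous_on UNIV f"
| "Ck (Suc k) f = ((\<forall>x. f differentiable (at x)) \<and>
      (\<forall>b\<in>Basis. Ck k (\<lambda>x. frechet_derivative f (at x) b)))"

definition smooth_fun :: "('a::euclidean_space \<Rightarrow> 'b::real_normed_vector) \<Rightarrow> bool" where
  "smooth_fun f \<longleftrightarrow> (\<forall>k. Ck k f)"

definition pd :: "('a::euclidean_space \<Rightarrow> 'b::real_normed_vector) \<Rightarrow> 'a \<Rightarrow> 'a \<Rightarrow> 'b" where
  "pd f b x = frechet_derivative f (at x) b"

definition testfun :: "'a::euclidean_space set \<Rightarrow> ('a \<Rightarrow> 'b::real_normed_vector) \<Rightarrow> bool" where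
  "testfun \<Omega> \<phi> \<longleftrightarrow> smooth_fun \<phi> \<and> (\<exists>K. compact K \<and> K \<subseteq> \<Omega> \<and> (\<forall>x. x \<notin> K \<longrightarrow> \<phi> x = 0))"

definition L2 :: "'a::euclidean_space set \<Rightarrow> ('a \<Rightarrow> complex) \<Rightarrow> bool" where
  "L2 \<Omega> u \<longleftrightarrow> set_borel_measurable lebesgue \<Omega> u \<and>
      set_integrable lebesgue \<Omega> (\<lambda>x. (cmod (u x))\<^sup>2)"

definition weak_partial :: "'a::euclidean_space set \<Rightarrow> ('a \<Rightarrow> complex) \<Rightarrow> 'a \<Rightarrow> ('a \<Rightarrow> complex) \<Rightarrow> bool" where
  "weak_partial \<Omega> u b g \<longleftrightarrow>
     (\<forall>\<phi>::'a \<Rightarrow> real. testfun \<Omega> \<phi> \<longrightarrow>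
        set_integrable lebesgue \<Omega> (\<lambda>x. u x * complex_of_real (pd \<phi> b x)) \<and>
        set_integrable lebesgue \<Omega> (\<lambda>x. g x * complex_of_real (\<phi> x)) \<and>
        set_lebesgue_integral lebesgue \<Omega> (\<lambda>x. u x * complex_of_real (pd \<phi> b x)) =
          - set_lebesgue_integral lebesgue \<Omega> (\<lambda>x. g x * complex_of_real (\<phi> x)))"

definition wgrad :: "'a::euclidean_space set \<Rightarrow> ('a \<Rightarrow> complex) \<Rightarrow> 'a \<Rightarrow> 'a \<Rightarrow> complex" where
  "wgrad \<Omega> u b = (SOME g. L2 \<Omega> g \<and> weak_partial \<Omega> u b g)"

definition H1 :: "'a::euclidean_space set \<Rightarrow> ('a \<Rightarrow> complex) \<Rightarrow> bool" where
  "H1 \<Omega> u \<longleftrightarrow> L2 \<Omega> u \<and> (\<forall>b\<in>Basis. \<exists>g. L2 \<Omega> g \<and> weak_partial \<Omega> u b g)"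

definition mass :: "'a::euclidean_space set \<Rightarrow> ('a \<Rightarrow> complex) \<Rightarrow> real" where
  "mass \<Omega> u = set_lebesgue_integral lebesgue \<Omega> (\<lambda>x. (cmod (u x))\<^sup>2)"

definition gradsq :: "'a::euclidean_space set \<Rightarrow> ('a \<Rightarrow> complex) \<Rightarrow> real" where
  "gradsq \<Omega> u = set_lebesgue_integral lebesgue \<Omega> (\<lambda>x. \<Sum>b\<in>Basis. (cmod (wgrad \<Omega> u b x))\<^sup>2)"

definition H10 :: "'a::euclidean_space set \<Rightarrow> ('a \<Rightarrow> complex) \<Rightarrow> bool" where
  "H10 \<Omega> u \<longleftrightarrow> H1 \<Omega> u \<and>
     (\<exists>\<phi>::nat \<Rightarrow> 'a \<Rightarrow> complex. (\<forall>k. testfun \<Omega> (\<phi> k)) \<and>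
        (\<lambda>k. mass \<Omega> (\<lambda>x. \<phi> k x - u x) +
             set_lebesgue_integral lebesgue \<Omega>
               (\<lambda>x. \<Sum>b\<in>Basis. (cmod (pd (\<phi> k) b x - wgrad \<Omega> u b x))\<^sup>2))
        \<longlonglongrightarrow> 0)"

type_synonym 'a cpair = "('a \<Rightarrow> complex) \<times> ('a \<Rightarrow> complex)"

definition H10pair :: "'a::euclidean_space set \<Rightarrow> 'a cpair \<Rightarrow> bool" where
  "H10pair \<Omega> u \<longleftrightarrow> H10 \<Omega> (fst u) \<and> H10 \<Omega> (snd u)"

definition h10norm :: "'a::euclidean_space set \<Rightarrow> 'a cpair \<Rightarrow> real" where
  "h10norm \<Omega> u = sqrt (gradsq \<Omega> (fst u) + gradsq \<Omega> (snd u))"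

definition h10dist :: "'a::euclidean_space set \<Rightarrow> 'a cpair \<Rightarrow> 'a cpair \<Rightarrow> real" where
  "h10dist \<Omega> u v = h10norm \<Omega> (\<lambda>x. fst u x - fst v x, \<lambda>x. snd u x - snd v x)"

text \<open>distance to a set (infinite for the empty set)\<close>
definition h10distset :: "'a::euclidean_space set \<Rightarrow> 'a cpair \<Rightarrow> 'a cpair set \<Rightarrow> ereal" where
  "h10distset \<Omega> u G = (INF v\<in>G. ereal (h10dist \<Omega> u v))"

definition ae_eq_pair :: "'a::euclidean_space set \<Rightarrow> 'a cpair \<Rightarrow> 'a cpair \<Rightarrow> bool" where
  "ae_eq_pair \<Omega> u v \<longleftrightarrow> (AE x in lebesgue. x \<in> \<Omega> \<longrightarrow> fst u x = fst v x \<and> snd u x = snd v x)"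

definition energy :: "'a::euclidean_space set \<Rightarrow> real \<Rightarrow> real \<Rightarrow> real \<Rightarrow> real \<Rightarrow> 'a cpair \<Rightarrow> real" where
  "energy \<Omega> \<mu>1 \<mu>2 \<beta> p u =
     1/2 * (gradsq \<Omega> (fst u) + gradsq \<Omega> (snd u))
     - 1/(p+1) * set_lebesgue_integral lebesgue \<Omega>
         (\<lambda>x. \<mu>1 * cmod (fst u x) powr (p+1)
              + 2 * \<beta> * cmod (fst u x) powr ((p+1)/2) * cmod (snd u x) powr ((p+1)/2)
              + \<mu>2 * cmod (snd u x) powr (p+1))"

definition Mset :: "'a::euclidean_space set \<Rightarrow> real \<Rightarrow> real \<Rightarrow> 'a cpair set" where
  "Mset \<Omega> \<rho>1 \<rho>2 = {u. H10pair \<Omega> u \<and> (\<forall>x\<in>\<Omega>. Im (fst u x) = 0 \<and> Im (snd u x) = 0) \<and>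
                        mass \<Omega> (fst u) = \<rho>1 \<and> mass \<Omega> (snd u) = \<rho>2}"

definition Bset :: "'a::euclidean_space set \<Rightarrow> real \<Rightarrow> real \<Rightarrow> real \<Rightarrow> 'a cpair set" where
  "Bset \<Omega> \<rho>1 \<rho>2 \<alpha> = {u \<in> Mset \<Omega> \<rho>1 \<rho>2. gradsq \<Omega> (fst u) + gradsq \<Omega> (snd u) \<le> (\<rho>1 + \<rho>2) * \<alpha>}"

definition Uset :: "'a::euclidean_space set \<Rightarrow> real \<Rightarrow> real \<Rightarrow> real \<Rightarrow> 'a cpair set" where
  "Uset \<Omega> \<rho>1 \<rho>2 \<alpha> = {u \<in> Mset \<Omega> \<rho>1 \<rho>2. gradsq \<Omega> (fst u) + gradsq \<Omega> (snd u) = (\<rho>1 + \<rho>2) * \<alpha>}"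

text \<open>c_alpha and hat c_alpha (extended reals: the infimum of the empty set is +infinity)\<close>
definition cB :: "'a::euclidean_space set \<Rightarrow> real \<Rightarrow> real \<Rightarrow> real \<Rightarrow> real \<Rightarrow> real \<Rightarrow> real \<Rightarrow> real \<Rightarrow> ereal" where
  "cB \<Omega> \<mu>1 \<mu>2 \<beta> p \<rho>1 \<rho>2 \<alpha> = (INF u\<in>Bset \<Omega> \<rho>1 \<rho>2 \<alpha>. ereal (energy \<Omega> \<mu>1 \<mu>2 \<beta> p u))"

definition cU :: "'a::euclidean_space set \<Rightarrow> real \<Rightarrow> real \<Rightarrow> real \<Rightarrow> real \<Rightarrow> real \<Rightarrow> real \<Rightarrow> real \<Rightarrow> ereal" where
  "cU \<Omega> \<mu>1 \<mu>2 \<beta> p \<rho>1 \<rho>2 \<alpha> = (INF u\<in>Uset \<Omega> \<rho>1 \<rho>2 \<alpha>. ereal (energy \<Omega> \<mu>1 \<mu>2 \<beta> p u))"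

text \<open>first Dirichlet eigenvalue of -Laplacian, via the Rayleigh quotient\<close>
definition lambda1 :: "'a::euclidean_space set \<Rightarrow> real" where
  "lambda1 \<Omega> = Inf {gradsq \<Omega> u / mass \<Omega> u | u. H10 \<Omega> u \<and> (\<forall>x\<in>\<Omega>. Im (u x) = 0) \<and> mass \<Omega> u \<noteq> 0}"

definition twostar :: "nat \<Rightarrow> real" where
  "twostar N = 2 * real N / (real N - 2)"

definition sobolevS :: "'a::euclidean_space itself \<Rightarrow> real" where
  "sobolevS (_ :: 'a itself) = Inf {S. S \<ge> 0 \<and>
     (\<forall>v :: 'a \<Rightarrow> real. testfun UNIV v \<longrightarrow>
        integral\<^sup>L lebesgue (\<lambda>x. \<bar>v x\<bar> powr twostar DIM('a))
        \<le> S * (integral\<^sup>L lebesgue (\<lambda>x. \<Sum>b\<in>Basis. (pd v b x)\<^sup>2)) powr (twostar DIM('a) / 2))}"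

definition Lambda :: "'a::euclidean_space itself \<Rightarrow> real \<Rightarrow> real \<Rightarrow> real \<Rightarrow> real" where
  "Lambda T \<mu>1 \<mu>2 \<beta> = 2 * sobolevS T / twostar DIM('a) *
     Sup {\<mu>1 * \<bar>x\<bar> powr twostar DIM('a) + \<mu>2 * \<bar>y\<bar> powr twostar DIM('a)
          + 2 * max \<beta> 0 * \<bar>x * y\<bar> powr (twostar DIM('a) / 2) | x y. x\<^sup>2 + y\<^sup>2 = 1}"

definition Aset :: "'a::euclidean_space set \<Rightarrow> real \<Rightarrow> real \<Rightarrow> real \<Rightarrow> real \<Rightarrow> (real \<times> real) set" where
  "Aset \<Omega> \<mu>1 \<mu>2 \<beta> p =
     {(\<rho>1, \<rho>2). \<rho>1 \<ge> 0 \<and> \<rho>2 \<ge> 0 \<and>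
        (\<exists>\<alpha> \<ge> lambda1 \<Omega>. cB \<Omega> \<mu>1 \<mu>2 \<beta> p \<rho>1 \<rho>2 \<alpha> < cU \<Omega> \<mu>1 \<mu>2 \<beta> p \<rho>1 \<rho>2 \<alpha> \<and>
           (DIM('a) \<ge> 3 \<and> p = twostar DIM('a) - 1 \<longrightarrow>
              (\<rho>1 + \<rho>2) * (\<alpha> - lambda1 \<Omega>)
                \<le> Lambda TYPE('a) \<mu>1 \<mu>2 \<beta> powr (- (real DIM('a) - 2) / 2)))}
     \<union> {(0, 0)}"

definition Gset :: "'a::euclidean_space set \<Rightarrow> real \<Rightarrow> real \<Rightarrow> real \<Rightarrow> real \<Rightarrow> real \<Rightarrow> real \<Rightarrow> real \<Rightarrow> 'a cpair set" where
  "Gset \<Omega> \<mu>1 \<mu>2 \<beta> p \<rho>1 \<rho>2 \<alpha> =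
     {u. H10pair \<Omega> u \<and>
         (\<lambda>x. complex_of_real (cmod (fst u x)), \<lambda>x. complex_of_real (cmod (snd u x))) \<in> Bset \<Omega> \<rho>1 \<rho>2 \<alpha> \<and>
         ereal (energy \<Omega> \<mu>1 \<mu>2 \<beta> p u) = cB \<Omega> \<mu>1 \<mu>2 \<beta> p \<rho>1 \<rho>2 \<alpha>}"

text \<open>Weak (time-integrated, tested against C_c^infinity(Omega)) H^1_0-valued solution on [0,T)
  with datum psi of
   i d_t Psi1 + Lap Psi1 + Psi1 (mu1 |Psi1|^(p-1) + beta |Psi1|^((p-3)/2) |Psi2|^((p+1)/2)) = 0 and
   symmetrically for Psi2.\<close>
definition nls_solution :: "'a::euclidean_space set \<Rightarrow> real \<Rightarrow> real \<Rightarrow> real \<Rightarrow> real \<Rightarrow>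
    'a cpair \<Rightarrow> ereal \<Rightarrow> (real \<Rightarrow> 'a cpair) \<Rightarrow> bool" where
  "nls_solution \<Omega> \<mu>1 \<mu>2 \<beta> p \<psi> T \<Psi> \<longleftrightarrow>
     (\<forall>t. 0 \<le> t \<and> ereal t < T \<longrightarrow> H10pair \<Omega> (\<Psi> t)) \<and>
     ae_eq_pair \<Omega> (\<Psi> 0) \<psi> \<and>
     (\<forall>t0. 0 \<le> t0 \<and> ereal t0 < T \<longrightarrow>
        ((\<lambda>t. h10dist \<Omega> (\<Psi> t) (\<Psi> t0)) \<longlongrightarrow> 0) (at t0 within {t. 0 \<le> t \<and> ereal t < T})) \<and>
     (\<forall>\<phi>::'a \<Rightarrow> real. testfun \<Omega> \<phi> \<longrightarrow> (\<forall>t. 0 \<le> t \<and> ereal t < T \<longrightarrow>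
        ((\<lambda>s. set_lebesgue_integral lebesgue \<Omega>
                 (\<lambda>x. \<Sum>b\<in>Basis. wgrad \<Omega> (fst (\<Psi> s)) b x * complex_of_real (pd \<phi> b x))
             - set_lebesgue_integral lebesgue \<Omega>
                 (\<lambda>x. fst (\<Psi> s) x *
                      complex_of_real (\<mu>1 * cmod (fst (\<Psi> s) x) powr (p - 1)
                        + \<beta> * cmod (fst (\<Psi> s) x) powr ((p - 3)/2) * cmod (snd (\<Psi> s) x) powr ((p + 1)/2))
                      * complex_of_real (\<phi> x)))
          has_integral
           (\<i> * (set_lebesgue_integral lebesgue \<Omega> (\<lambda>x. fst (\<Psi> t) x * complex_of_real (\<phi> x))
                 - set_lebesgue_integral lebesgue \<Omega> (\<lambda>x. fst \<psi> x * complex_of_real (\<phi> x))))) {0..t} \<and>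
        ((\<lambda>s. set_lebesgue_integral lebesgue \<Omega>
                 (\<lambda>x. \<Sum>b\<in>Basis. wgrad \<Omega> (snd (\<Psi> s)) b x * complex_of_real (pd \<phi> b x))
             - set_lebesgue_integral lebesgue \<Omega>
                 (\<lambda>x. snd (\<Psi> s) x *
                      complex_of_real (\<mu>2 * cmod (snd (\<Psi> s) x) powr (p - 1)
                        + \<beta> * cmod (snd (\<Psi> s) x) powr ((p - 3)/2) * cmod (fst (\<Psi> s) x) powr ((p + 1)/2))
                      * complex_of_real (\<phi> x)))
          has_integral
           (\<i> * (set_lebesgue_integral lebesgue \<Omega> (\<lambda>x. snd (\<Psi> t) x * complex_of_real (\<phi> x))
                 - set_lebesgue_integral lebesgue \<Omega> (\<lambda>x. snd \<psi> x * complex_of_real (\<phi> x))))) {0..t}))"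

definition local_wellposed :: "'a::euclidean_space set \<Rightarrow> real \<Rightarrow> real \<Rightarrow> real \<Rightarrow> real \<Rightarrow> bool" where
  "local_wellposed \<Omega> \<mu>1 \<mu>2 \<beta> p \<longleftrightarrow>
     (\<forall>M>0. \<exists>T0>0. \<forall>\<psi>. H10pair \<Omega> \<psi> \<and> h10norm \<Omega> \<psi> \<le> M \<longrightarrow>
        (\<exists>\<Psi>. nls_solution \<Omega> \<mu>1 \<mu>2 \<beta> p \<psi> (ereal T0) \<Psi>) \<and>
        (\<forall>\<Psi> \<Psi>'. nls_solution \<Omega> \<mu>1 \<mu>2 \<beta> p \<psi> (ereal T0) \<Psi> \<and>
                  nls_solution \<Omega> \<mu>1 \<mu>2 \<beta> p \<psi> (ereal T0) \<Psi>' \<longrightarrow>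
                  (\<forall>t. 0 \<le> t \<and> t < T0 \<longrightarrow> ae_eq_pair \<Omega> (\<Psi> t) (\<Psi>' t))))"

definition conservation :: "'a::euclidean_space set \<Rightarrow> real \<Rightarrow> real \<Rightarrow> real \<Rightarrow> real \<Rightarrow> bool" where
  "conservation \<Omega> \<mu>1 \<mu>2 \<beta> p \<longleftrightarrow>
     (\<forall>\<psi> T \<Psi>. nls_solution \<Omega> \<mu>1 \<mu>2 \<beta> p \<psi> T \<Psi> \<longrightarrow>
        (\<forall>t. 0 \<le> t \<and> ereal t < T \<longrightarrow>
           mass \<Omega> (fst (\<Psi> t)) = mass \<Omega> (fst \<psi>) \<and> mass \<Omega> (snd (\<Psi> t)) = mass \<Omega> (snd \<psi>) \<and>
           energy \<Omega> \<mu>1 \<mu>2 \<beta> p (\<Psi> t) = energy \<Omega> \<mu>1 \<mu>2 \<beta> p \<psi>))"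

definition cond_orbitally_stable :: "'a::euclidean_space set \<Rightarrow> real \<Rightarrow> real \<Rightarrow> real \<Rightarrow> real \<Rightarrow> 'a cpair set \<Rightarrow> bool" where
  "cond_orbitally_stable \<Omega> \<mu>1 \<mu>2 \<beta> p G \<longleftrightarrow>
     (local_wellposed \<Omega> \<mu>1 \<mu>2 \<beta> p \<and> conservation \<Omega> \<mu>1 \<mu>2 \<beta> p \<longrightarrow>
       (\<forall>\<epsilon>>0. \<exists>\<delta>>0. \<forall>\<psi>. H10pair \<Omega> \<psi> \<and> h10distset \<Omega> \<psi> G < ereal \<delta> \<longrightarrow>
          (\<exists>\<Psi>. nls_solution \<Omega> \<mu>1 \<mu>2 \<beta> p \<psi> \<infinity> \<Psi> \<and>
                (SUP t\<in>{0<..}. h10distset \<Omega> (\<Psi> t) G) < ereal \<epsilon>)))"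

end

theory Submission
  imports Defs "HOL-Complex_Analysis.Great_Picard" "HOL-Computational_Algebra.Polynomial" "HOL-Library.Diagonal_Subsequence"
begin

text \<open>
  On pairs with gradient norm at most \<open>(\<rho>\<^sub>1 + \<rho>\<^sub>2)\<alpha>\<close> a minimising sequence, even one whose masses and energy only
  converge to the prescribed values, is compact. In the Sobolev-subcritical range this follows from the
  compact embedding. In the critical case the Brezis--Lieb splitting leaves a remainder \<open>w\<close> of gradient norm at most
  \<open>(\<rho>\<^sub>1 + \<rho>\<^sub>2)(\<alpha> - \<lambda>\<^sub>1)\<close>, and the bound involving \<open>\<Lambda>\<close> is what makes the energy of \<open>w\<close>
  control its gradient. The strict gap between the two infima keeps the ground states uniformly away from the
  sphere of maximal gradient norm, so by compactness there is a sphere that no state with nearly the right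
  masses and nearly minimal energy can touch. Conservation and continuity in time trap a solution inside it; the
  trapped solution has bounded norm, hence is continued indefinitely by the uniform local existence time, and
  compactness once more places it near the ground states.
\<close>

subsection \<open>Calculus of smooth functions\<close>

text \<open>In the critical case the energy of the remainder \<open>w\<close> is at least
  \<open>X/2 - \<Lambda>/2 * X powr (N/(N-2))\<close>, where \<open>X\<close> is its gradient norm,
  and this is positive for \<open>0 < X < \<Lambda> powr (-(N-2)/2)\<close>. The limit already takes
  up \<open>(\<rho>1 + \<rho>2) * \<lambda>1\<close> by the Rayleigh quotient; working on a sphere
  strictly inside the gradient ball makes the bound on \<open>X\<close> strict, so a non-strict
  hypothesis suffices. The gap between the infima concerns real pairs with exact masses lying
  exactly on the boundary sphere, whereas the flow is complex and starts with nearby masses. Moduli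
  have no larger gradient and the same masses and nonlinear term, so a ground state and its modulus
  have equal energy. If ground states approached the sphere, a small change of one component would
  put their moduli on it with masses kept and energy almost unchanged, against the gap. Since
  \<open>wgrad\<close> is an arbitrary choice of weak derivative, gradient norms are handled as
  limits of Dirichlet integrals \<open>tgr\<close> of test functions.\<close>

lemma Ck_continuous: "Ck k f \<Longrightarrow> continuous_on UNIV f"
  by (cases k) (auto intro!: differentiable_imp_continuous_on simp: differentiable_on_def differentiable_at_withinI)

lemma Ck_Suc: "Ck (Suc k) f \<Longrightarrow> Ck k f"
proof (induction k arbitrary: f)
  case 0
  then show ?case using Ck_continuous[of "Suc 0" f] by simp
next
  case (Suc k)
  then show ?case by (metis Ck.simps(2))
qed

lemma frechet_derivativeI: "(f has_derivative f') (at x) \<Longrightarrow> frechet_derivative f (at x) = f'"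
  by (metis frechet_derivative_at)

lemma Ck_const: "Ck k (\<lambda>x. c)"
proof (induction k arbitrary: c)
  case (Suc k)
  have "frechet_derivative (\<lambda>x. c) (at x) = (\<lambda>_. 0)" for x :: 'a
    by (rule frechet_derivativeI) simp
  then show ?case using Suc by simp
qed simp

lemma Ck_bounded_linear:
  assumes "bounded_linear L" "Ck k f" shows "Ck k (\<lambda>x. L (f x))"
  using assms(2)
proof (induction k arbitrary: f)
  case 0
  then show ?case using assms(1) by (simp add: bounded_linear.continuous_on)
next
  case (Suc k)
  have d: "((\<lambda>x. L (f x)) has_derivative (\<lambda>h. L (frechet_derivative f (at x) h))) (at x)" for x
    using Suc.prems by (intro bounded_linear.has_derivative[OF assms(1)]) (auto simp: frechet_derivative_works[symmetric])
  show ?case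
    using Suc d by (auto simp: frechet_derivativeI[OF d] differentiable_def)
qed

lemma Ck_add:
  assumes "Ck k f" "Ck k g" shows "Ck k (\<lambda>x. f x + g x)"
  using assms
proof (induction k arbitrary: f g)
  case (Suc k)
  have d: "((\<lambda>x. f x + g x) has_derivative
     (\<lambda>h. frechet_derivative f (at x) h + frechet_derivative g (at x) h)) (at x)" for x
    using Suc.prems by (intro has_derivative_add) (auto simp: frechet_derivative_works[symmetric])
  show ?case
    using Suc d by (auto simp: frechet_derivativeI[OF d] differentiable_def)
qed (auto intro!: continuous_intros)

lemma Ck_bilinear:
  assumes bl: "bounded_bilinear B" and "Ck k f" "Ck k g" shows "Ck k (\<lambda>x. B (f x) (g x))"
  using assms(2,3)
proof (induction k arbitrary: f g)
  case 0
  then show ?case using bounded_bilinear.continuous_on[OF bl] by auto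
next
  case (Suc k)
  have d: "((\<lambda>x. B (f x) (g x)) has_derivative
     (\<lambda>h. B (f x) (frechet_derivative g (at x) h) + B (frechet_derivative f (at x) h) (g x))) (at x)" for x
    using Suc.prems by (intro bounded_bilinear.FDERIV[OF bl]) (auto simp: frechet_derivative_works[symmetric])
  show ?case
    using Suc d Ck_Suc[OF Suc.prems(1)] Ck_Suc[OF Suc.prems(2)]
    by (auto simp: frechet_derivativeI[OF d] differentiable_def intro!: Ck_add)
qed

text \<open>The outer function comes with the whole sequence \<open>d\<close> of its derivatives, so
  that the induction on \<open>k\<close> can pass from \<open>d n\<close> to
  \<open>d (Suc n)\<close>; the instance used is \<open>bump_deriv\<close>.\<close>

lemma Ck_compose_real:
  assumes "\<And>n x. (d n has_real_derivative d (Suc n) x) (at x)" and "Ck k (q :: 'a::euclidean_space \<Rightarrow> real)"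
  shows "Ck k (\<lambda>x. d n (q x))"
  using assms(2)
proof (induction k arbitrary: n)
  case 0
  have "continuous_on UNIV (d n)"
    using assms(1) by (meson DERIV_continuous_on has_field_derivative_at_within)
  then show ?case using 0 by (auto intro: continuous_on_compose2)
next
  case (Suc k)
  have d: "((\<lambda>x. d n (q x)) has_derivative
     (\<lambda>h. d (Suc n) (q x) * frechet_derivative q (at x) h)) (at x)" for x
    using Suc.prems assms(1)[of n "q x", unfolded has_field_derivative_def]
    by (intro has_derivative_compose[of q _ x UNIV "d n"]) (auto simp: frechet_derivative_works[symmetric])
  show ?case
    using Suc d Ck_Suc[OF Suc.prems]
    by (auto simp: frechet_derivativeI[OF d] differentiable_def intro!: Ck_bilinear[OF bounded_bilinear_mult])
qed

text \<open>Differentiation lowers the exponent, which is why \<open>s\<close> is generalised in the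
  induction. The case \<open>s = 1/2\<close> makes the regularised modulus smooth.\<close>

lemma Ck_powr:
  assumes "\<And>x. q x > 0" "Ck k (q :: 'a::euclidean_space \<Rightarrow> real)"
  shows "Ck k (\<lambda>x. q x powr s)"
  using assms(2)
proof (induction k arbitrary: s)
  case 0
  then show ?case using assms(1) by (auto intro!: continuous_intros simp: less_imp_neq[symmetric])
next
  case (Suc k)
  have d: "((\<lambda>x. q x powr s) has_derivative
     (\<lambda>h. (s * q x powr (s - 1)) * frechet_derivative q (at x) h)) (at x)" for x
    using Suc.prems has_real_derivative_powr[OF assms(1), of s x, unfolded has_field_derivative_def]
    by (intro has_derivative_compose[of q _ x UNIV "\<lambda>t. t powr s"]) (auto simp: frechet_derivative_works[symmetric])
  have "Ck k (\<lambda>x. s * q x powr (s - 1))"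
    by (rule Ck_bounded_linear[OF bounded_linear_mult_right]) (use Suc Ck_Suc in blast)
  then show ?case
    using Suc d Ck_Suc[OF Suc.prems]
    by (auto simp: frechet_derivativeI[OF d] differentiable_def intro!: Ck_bilinear[OF bounded_bilinear_mult])
qed

lemma Ck_prod:
  "finite A \<Longrightarrow> (\<And>i. i \<in> A \<Longrightarrow> Ck k (f i)) \<Longrightarrow> Ck k (\<lambda>x. \<Prod>i\<in>A. (f i x :: real))"
  by (induction A rule: finite_induct) (auto intro: Ck_const Ck_bilinear[OF bounded_bilinear_mult])

lemma Ck_id: "Ck k (\<lambda>x. x)"
proof (cases k)
  case (Suc j)
  have "frechet_derivative (\<lambda>x. x) (at x) = (\<lambda>h. h)" for x :: 'a
    by (rule frechet_derivativeI) (rule has_derivative_ident)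
  then show ?thesis using Suc by (simp add: Ck_const)
qed (auto intro: continuous_intros)

section \<open>The standard bump function and smooth approximations of box indicators\<close>

primrec bump_poly :: "nat \<Rightarrow> real poly" where
  "bump_poly 0 = 1"
| "bump_poly (Suc n) = monom 1 2 * (bump_poly n - pderiv (bump_poly n))"

text \<open>These are the successive derivatives of \<open>exp (- 1 / x)\<close>, continued by zero
  to \<open>x \<le> 0\<close>. With \<open>t = 1 / x\<close> the derivative of
  \<open>P(t) exp(-t)\<close> is \<open>t^2 (P - P')(t) exp(-t)\<close>, which is the recursion of
  \<open>bump_poly\<close>.\<close>

definition bump_deriv :: "nat \<Rightarrow> real \<Rightarrow> real" where
  "bump_deriv n x = (if x > 0 then poly (bump_poly n) (inverse x) * exp (- inverse x) else 0)"

lemma poly_mult_exp_tendsto_0: "((\<lambda>t::real. poly P t * exp (- t)) \<longlongrightarrow> 0) at_top"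
proof -
  have "((\<lambda>t::real. \<Sum>i\<le>degree P. coeff P i * (t ^ i / exp t)) \<longlongrightarrow> (\<Sum>i\<le>degree P. coeff P i * 0)) at_top"
    by (intro tendsto_intros tendsto_power_div_exp_0)
  then show ?thesis
    by (simp add: poly_altdef sum_distrib_right exp_minus divide_inverse mult.assoc)
qed

lemma bump_deriv_has_derivative: "(bump_deriv n has_real_derivative bump_deriv (Suc n) x) (at x)"
proof (cases "x = 0")
  case False
  show ?thesis
  proof (cases "x > 0")
    case True
    have "((\<lambda>x. poly (bump_poly n) (inverse x) * exp (- inverse x)) has_real_derivative
        bump_deriv (Suc n) x) (at x)"
      using True by (auto intro!: derivative_eq_intros poly_DERIV[THEN DERIV_chain2]
        simp: bump_deriv_def poly_monom field_simps power2_eq_square)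
    then show ?thesis
      by (rule DERIV_cong_ev[THEN iffD1, rotated 3])
        (use True in \<open>auto simp: bump_deriv_def eventually_nhds intro!: exI[of _ "{0<..}"]\<close>)
  next
    case F: False
    then have "x < 0" using \<open>x \<noteq> 0\<close> by simp
    have "((\<lambda>x. 0) has_real_derivative bump_deriv (Suc n) x) (at x)"
      using F by (auto simp: bump_deriv_def)
    then show ?thesis
      by (rule DERIV_cong_ev[THEN iffD1, rotated 3])
        (use \<open>x < 0\<close> in \<open>auto simp: bump_deriv_def eventually_nhds intro!: exI[of _ "{..<0}"]\<close>)
  qed
next
  case True
  have "((\<lambda>h. bump_deriv n h / h) \<longlongrightarrow> 0) (at_right 0)"
  proof -
    \<comment> \<open>\<open>pCons 0\<close> multiplies by \<open>t = 1 / h\<close> and so absorbs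
      the division by \<open>h\<close> in the difference quotient.\<close>
    have "((\<lambda>t::real. poly (pCons 0 (bump_poly n)) t * exp (- t)) \<longlongrightarrow> 0) at_top"
      by (rule poly_mult_exp_tendsto_0)
    then have "((\<lambda>h. poly (pCons 0 (bump_poly n)) (inverse h) * exp (- inverse h)) \<longlongrightarrow> 0) (at_right (0::real))"
      using filterlim_inverse_at_top_right filterlim_compose by blast
    then show ?thesis
      by (rule Lim_transform_eventually)
        (auto simp: eventually_at_right_field bump_deriv_def field_simps intro!: exI[of _ 1])
  qed
  moreover have "((\<lambda>h. bump_deriv n h / h) \<longlongrightarrow> 0) (at_left 0)"
    by (rule Lim_transform_eventually[OF tendsto_const])
      (auto simp: eventually_at_left_field bump_deriv_def intro!: exI[of _ "-1"])
  ultimately have "((\<lambda>h. bump_deriv n h / h) \<longlongrightarrow> 0) (at 0)"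
    by (simp add: filterlim_split_at)
  then show ?thesis
    using True by (simp add: DERIV_def bump_deriv_def)
qed

text \<open>One factor for each face of the box. A positive steepness \<open>k\<close> leaves the
  set of positivity unchanged and only drives the values inside to 1 as it grows, so tests against
  these functions become integrals over boxes.\<close>

definition box_bump :: "'a::euclidean_space \<Rightarrow> 'a \<Rightarrow> real \<Rightarrow> 'a \<Rightarrow> real" where
  "box_bump a c k x = (\<Prod>b\<in>Basis. bump_deriv 0 (k * (x \<bullet> b - a \<bullet> b)) * bump_deriv 0 (k * (c \<bullet> b - x \<bullet> b)))"

lemma smooth_box_bump: "smooth_fun (box_bump a c k)"
  unfolding smooth_fun_def
proof
  fix j
  have 1: "Ck j (\<lambda>x. k * (x \<bullet> b - a \<bullet> b))" for b :: 'a
  proof -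
    have "Ck j (\<lambda>x. k * (x \<bullet> b) + k * - (a \<bullet> b))"
      by (intro Ck_add Ck_const Ck_bounded_linear[OF _ Ck_id])
        (auto intro!: bounded_linear_intros)
    then show ?thesis by (simp add: algebra_simps)
  qed
  have 2: "Ck j (\<lambda>x. k * (c \<bullet> b - x \<bullet> b))" for b :: 'a
  proof -
    have "Ck j (\<lambda>x. (- k) * (x \<bullet> b) + k * (c \<bullet> b))"
      by (intro Ck_add Ck_const Ck_bounded_linear[OF _ Ck_id]
          bounded_linear_compose[OF bounded_linear_mult_right bounded_linear_inner_left])
    then show ?thesis by (simp add: algebra_simps)
  qed
  show "Ck j (box_bump a c k)"
    unfolding box_bump_def[abs_def]
    by (intro Ck_prod Ck_bilinear[OF bounded_bilinear_mult] Ck_compose_real[of bump_deriv] 1 2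
        bump_deriv_has_derivative) auto
qed

lemma bump_0_bounds: "0 \<le> bump_deriv 0 x" "bump_deriv 0 x \<le> 1"
  by (auto simp: bump_deriv_def)

lemma box_bump_bounds: "0 \<le> box_bump a c k x" "box_bump a c k x \<le> 1"
  unfolding box_bump_def
  by (auto intro!: prod_nonneg prod_le_1 mult_nonneg_nonneg mult_le_one simp: bump_0_bounds)

lemma box_bump_pos: "k > 0 \<Longrightarrow> 0 < box_bump a c k x \<longleftrightarrow> x \<in> box a c"
proof -
  assume k: "k > 0"
  have "0 < box_bump a c k x \<longleftrightarrow> box_bump a c k x \<noteq> 0"
    using box_bump_bounds(1)[of a c k x] by linarith
  also have "\<dots> \<longleftrightarrow> x \<in> box a c"
    using k by (auto simp: box_bump_def mem_box bump_deriv_def zero_less_mult_iff split: if_splits)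
  finally show ?thesis .
qed

lemma box_bump_zero: "k > 0 \<Longrightarrow> x \<notin> box a c \<Longrightarrow> box_bump a c k x = 0"
  using box_bump_pos[of k a c x] box_bump_bounds(1)[of a c k x] by linarith

lemma testfun_box_bump:
  assumes "cbox a c \<subseteq> \<Omega>" "k > 0" shows "testfun \<Omega> (box_bump a c k)"
  unfolding testfun_def
  using assms box_subset_cbox[of a c] by (intro conjI smooth_box_bump exI[of _ "cbox a c"]) (auto intro!: box_bump_zero)

lemma box_bump_tendsto:
  "(\<lambda>n. box_bump a c (real (Suc n)) x) \<longlonglongrightarrow> indicator (box a c) x"
proof (cases "x \<in> box a c")
  case True
  have *: "(\<lambda>n. bump_deriv 0 (real (Suc n) * y)) \<longlonglongrightarrow> 1" if "y > 0" for y
  proof -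
    have "(\<lambda>n. inverse y * inverse (real (Suc n))) \<longlonglongrightarrow> inverse y * 0"
      by (intro tendsto_intros LIMSEQ_inverse_real_of_nat)
    then have "(\<lambda>n. exp (- (inverse (real (Suc n) * y)))) \<longlonglongrightarrow> exp (- 0)"
      by (intro tendsto_intros) (simp add: mult.commute)
    moreover have "bump_deriv 0 (real (Suc n) * y) = exp (- (inverse (real (Suc n) * y)))" for n
      using that by (simp add: bump_deriv_def del: of_nat_Suc)
    ultimately show ?thesis by simp
  qed
  have "(\<lambda>n. box_bump a c (real (Suc n)) x) \<longlonglongrightarrow> (\<Prod>b\<in>(Basis::'a set). 1 * 1)"
    unfolding box_bump_def using True by (intro tendsto_intros *) (auto simp: mem_box)
  then show ?thesis using True by simp
qed (simp add: box_bump_zero)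

section \<open>Closure properties and derivatives of test functions\<close>

lemma testfun_add: "testfun \<Omega> f \<Longrightarrow> testfun \<Omega> g \<Longrightarrow> testfun \<Omega> (\<lambda>x. f x + g x)"
  unfolding testfun_def smooth_fun_def
  by (auto intro: Ck_add) (metis UnCI compact_Un le_sup_iff add_0)

lemma testfun_bounded_linear:
  assumes "bounded_linear L" "testfun \<Omega> f" shows "testfun \<Omega> (\<lambda>x. L (f x))"
  using assms unfolding testfun_def smooth_fun_def
  by (auto intro: Ck_bounded_linear simp: linear_simps(3))

lemma testfun_scaleR: "testfun \<Omega> f \<Longrightarrow> testfun \<Omega> (\<lambda>x. s *\<^sub>R f x)"
  by (rule testfun_bounded_linear[OF bounded_linear_scaleR_right])

lemma testfun_cmult: "testfun \<Omega> f \<Longrightarrow> testfun \<Omega> (\<lambda>x. complex_of_real s * f x)"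
  by (rule testfun_bounded_linear[OF bounded_linear_mult_right])

lemma testfun_diff: "testfun \<Omega> f \<Longrightarrow> testfun \<Omega> g \<Longrightarrow> testfun \<Omega> (\<lambda>x. f x - g x)"
  using testfun_add[of \<Omega> f "\<lambda>x. (-1) *\<^sub>R g x"] testfun_scaleR[of \<Omega> g "-1"] by simp

lemma testfun_bilinear:
  assumes "bounded_bilinear B" "testfun \<Omega> f" "testfun \<Omega> g" shows "testfun \<Omega> (\<lambda>x. B (f x) (g x))"
proof -
  obtain K where "compact K" "K \<subseteq> \<Omega>" "\<And>x. x \<notin> K \<Longrightarrow> f x = 0"
    using assms(2) unfolding testfun_def by auto
  moreover have "smooth_fun (\<lambda>x. B (f x) (g x))"
    using assms unfolding testfun_def smooth_fun_def by (metis Ck_bilinear)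
  ultimately show ?thesis
    unfolding testfun_def using bounded_bilinear.zero_left[OF assms(1)] by (metis (no_types))
qed

lemma testfun_zero: "testfun \<Omega> (\<lambda>x. 0)"
  unfolding testfun_def smooth_fun_def by (auto intro: Ck_const exI[of _ "{}"])

lemma testfun_mono: "testfun A f \<Longrightarrow> A \<subseteq> B \<Longrightarrow> testfun B f"
  unfolding testfun_def by blast

lemma testfun_has_derivative:
  assumes "testfun \<Omega> f" shows "(f has_derivative (\<lambda>h. pd f h x)) (at x)"
proof -
  have "Ck (Suc 0) f" using assms unfolding testfun_def smooth_fun_def by blast
  then have "f differentiable (at x)" by simp
  then show ?thesis unfolding pd_def using frechet_derivative_works by blast
qed

lemma testfun_cont: "testfun \<Omega> f \<Longrightarrow> continuous_on UNIV f"
  unfolding testfun_def smooth_fun_def using Ck_continuous by blast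

lemma testfun_pd_cont:
  assumes "testfun \<Omega> f" "b \<in> Basis" shows "continuous_on UNIV (pd f b)"
proof -
  have "Ck (Suc 0) f" using assms unfolding testfun_def smooth_fun_def by blast
  then show ?thesis using assms(2) by (simp add: pd_def[abs_def])
qed

lemma pd_expand:
  assumes "testfun \<Omega> f" shows "pd f h x = (\<Sum>b\<in>Basis. (h \<bullet> b) *\<^sub>R pd f b x)"
proof -
  interpret bounded_linear "\<lambda>h. pd f h x"
    using testfun_has_derivative[OF assms] has_derivative_bounded_linear by blast
  show ?thesis
    by (subst euclidean_representation[of h, symmetric]) (simp add: sum scaleR)
qed

lemma testfun_pd_cont': "testfun \<Omega> f \<Longrightarrow> continuous_on UNIV (pd f h)"
  using continuous_on_cong[of UNIV UNIV "pd f h" "\<lambda>x. \<Sum>b\<in>Basis. (h \<bullet> b) *\<^sub>R pd f b x"]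
  by (auto intro!: continuous_intros testfun_pd_cont simp: pd_expand)

lemma testfun_support:
  assumes "testfun \<Omega> f"
  obtains K where "compact K" "K \<subseteq> \<Omega>" "\<And>x. x \<notin> K \<Longrightarrow> f x = 0" "\<And>x h. x \<notin> K \<Longrightarrow> pd f h x = 0"
proof -
  obtain K where K: "compact K" "K \<subseteq> \<Omega>" "\<And>x. x \<notin> K \<Longrightarrow> f x = 0"
    using assms unfolding testfun_def by auto
  have "pd f h x = 0" if "x \<notin> K" for x h
  proof -
    have "((\<lambda>_. 0) has_derivative (\<lambda>h. pd f h x)) (at x)"
    proof (rule has_derivative_transform_within_open[OF testfun_has_derivative[OF assms]])
      show "open (- K)" using K by (simp add: compact_imp_closed open_Compl)
    qed (use that K in auto)
    then show ?thesis using has_derivative_unique[OF _ has_derivative_const] by metis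
  qed
  then show thesis using K that by blast
qed

lemma pd_eqI: "(f has_derivative f') (at x) \<Longrightarrow> pd f h x = f' h"
  unfolding pd_def by (simp add: frechet_derivativeI)

lemma pd_add: "testfun \<Omega> f \<Longrightarrow> testfun \<Omega> g \<Longrightarrow> pd (\<lambda>x. f x + g x) h x = pd f h x + pd g h x"
  by (rule pd_eqI) (intro has_derivative_add testfun_has_derivative)

lemma pd_diff: "testfun \<Omega> f \<Longrightarrow> testfun \<Omega> g \<Longrightarrow> pd (\<lambda>x. f x - g x) h x = pd f h x - pd g h x"
  by (rule pd_eqI) (intro has_derivative_diff testfun_has_derivative)

lemma pd_bounded_linear: "bounded_linear L \<Longrightarrow> testfun \<Omega> f \<Longrightarrow> pd (\<lambda>x. L (f x)) h x = L (pd f h x)"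
  by (rule pd_eqI) (rule bounded_linear.has_derivative[OF _ testfun_has_derivative])

lemma pd_cmult: "testfun \<Omega> f \<Longrightarrow> pd (\<lambda>x. complex_of_real s * f x) h x = complex_of_real s * pd f h x"
  by (rule pd_bounded_linear[OF bounded_linear_mult_right])

lemma pd_mult:
  fixes f :: "'a::euclidean_space \<Rightarrow> 'b::real_normed_algebra"
  shows "testfun \<Omega> f \<Longrightarrow> testfun \<Omega> g \<Longrightarrow> pd (\<lambda>x. f x * g x) h x = f x * pd g h x + pd f h x * g x"
  by (rule pd_eqI) (intro has_derivative_mult testfun_has_derivative)

subsection \<open>Square-integrable functions\<close>

text \<open>Kept general in the measure and the codomain: the same calculus serves
  \<open>lborel\<close> and \<open>lebesgue_on \<Omega>\<close>, real and complex functions.\<close>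

definition sqi :: "'x measure \<Rightarrow> ('x \<Rightarrow> 'b::euclidean_space) \<Rightarrow> bool" where
  "sqi M f \<longleftrightarrow> f \<in> borel_measurable M \<and> integrable M (\<lambda>x. (norm (f x))\<^sup>2)"

definition nsq :: "'x measure \<Rightarrow> ('x \<Rightarrow> 'b::euclidean_space) \<Rightarrow> real" where
  "nsq M f = (\<integral>x. (norm (f x))\<^sup>2 \<partial>M)"

text \<open>For complex values this is the real part of the Hermitian product, which is what
  expansions along real multiples produce.\<close>

definition ips :: "'x measure \<Rightarrow> ('x \<Rightarrow> 'b::euclidean_space) \<Rightarrow> ('x \<Rightarrow> 'b) \<Rightarrow> real" where
  "ips M f g = (\<integral>x. f x \<bullet> g x \<partial>M)"

lemma sqiD: "sqi M f \<Longrightarrow> f \<in> borel_measurable M" "sqi M f \<Longrightarrow> integrable M (\<lambda>x. (norm (f x))\<^sup>2)"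
  by (auto simp: sqi_def)

lemma nsq_nonneg [simp]: "nsq M f \<ge> 0"
  by (simp add: nsq_def)

lemma norm_add_sq_le: "(norm (a + b))\<^sup>2 \<le> 2 * (norm a)\<^sup>2 + 2 * (norm b)\<^sup>2"
proof -
  have "(norm (a + b))\<^sup>2 \<le> (norm a + norm b)\<^sup>2"
    by (intro power_mono norm_triangle_ineq) simp
  also have "\<dots> \<le> 2 * (norm a)\<^sup>2 + 2 * (norm b)\<^sup>2"
    using sum_squares_bound[of "norm a" "norm b"] by (simp add: power2_sum)
  finally show ?thesis .
qed

lemma sqi_add: assumes "sqi M f" "sqi M g" shows "sqi M (\<lambda>x. f x + g x)"
proof -
  note [measurable] = sqiD(1)[OF assms(1)] sqiD(1)[OF assms(2)]
  have "integrable M (\<lambda>x. (norm (f x + g x))\<^sup>2)"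
    by (rule Bochner_Integration.integrable_bound[of M "\<lambda>x. 2 * (norm (f x))\<^sup>2 + 2 * (norm (g x))\<^sup>2"])
      (use assms norm_add_sq_le in \<open>auto simp: sqi_def\<close>)
  then show ?thesis by (simp add: sqi_def)
qed

lemma sqi_scaleR: "sqi M f \<Longrightarrow> sqi M (\<lambda>x. s *\<^sub>R f x)"
  by (auto simp: sqi_def power_mult_distrib)

lemma sqi_diff: "sqi M f \<Longrightarrow> sqi M g \<Longrightarrow> sqi M (\<lambda>x. f x - g x)"
  using sqi_add[of M f "\<lambda>x. (-1) *\<^sub>R g x"] sqi_scaleR[of M g "-1"] by simp

lemma sqi_inner_integrable:
  assumes "sqi M f" "sqi M g" shows "integrable M (\<lambda>x. f x \<bullet> g x)"
proof -
  note [measurable] = sqiD(1)[OF assms(1)] sqiD(1)[OF assms(2)]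
  show ?thesis
  proof (rule Bochner_Integration.integrable_bound[of M "\<lambda>x. (norm (f x))\<^sup>2 + (norm (g x))\<^sup>2"])
    show "AE x in M. norm (f x \<bullet> g x) \<le> norm ((norm (f x))\<^sup>2 + (norm (g x))\<^sup>2)"
    proof (rule AE_I2)
      fix x
      have "\<bar>f x \<bullet> g x\<bar> \<le> norm (f x) * norm (g x)" by (rule Cauchy_Schwarz_ineq2)
      also have "\<dots> \<le> (norm (f x))\<^sup>2 + (norm (g x))\<^sup>2"
        using sum_squares_bound[of "norm (f x)" "norm (g x)"]
          mult_nonneg_nonneg[OF norm_ge_zero[of "f x"] norm_ge_zero[of "g x"]] by linarith
      finally show "norm (f x \<bullet> g x) \<le> norm ((norm (f x))\<^sup>2 + (norm (g x))\<^sup>2)" by simp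
    qed
  qed (use assms in \<open>auto simp: sqi_def\<close>)
qed

lemma sqi_norm: "sqi M f \<Longrightarrow> sqi M (\<lambda>x. norm (f x))"
  by (auto simp: sqi_def)

lemma nsq_expand:
  assumes "sqi M f" "sqi M g"
  shows "nsq M (\<lambda>x. f x + s *\<^sub>R g x) = nsq M f + 2 * s * ips M f g + s\<^sup>2 * nsq M g"
proof -
  have "(norm (f x + s *\<^sub>R g x))\<^sup>2 = (norm (f x))\<^sup>2 + 2 * s * (f x \<bullet> g x) + s\<^sup>2 * (norm (g x))\<^sup>2" for x
    unfolding power2_norm_eq_inner
    by (simp add: inner_add_left inner_add_right inner_commute power2_eq_square)
  then show ?thesis
    using assms sqi_inner_integrable[OF assms] by (simp add: nsq_def ips_def sqi_def)
qed

text \<open>Cauchy--Schwarz as a statement on discriminants, detached from integrals so that it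
  applies to \<open>nsq\<close> and to \<open>gradsq\<close> alike, including degenerate forms with
  \<open>c = 0\<close>.\<close>

lemma nonneg_quadratic_bound:
  fixes a b c :: real
  assumes "\<And>s. a + 2 * s * b + s\<^sup>2 * c \<ge> 0" "c \<ge> 0"
  shows "\<bar>b\<bar> \<le> sqrt a * sqrt c"
proof (cases "c = 0")
  case True
  have "b = 0"
  proof (rule ccontr)
    assume "b \<noteq> 0"
    then show False using assms(1)[of "- (a + 1) / (2 * b)"] True by (simp add: field_simps)
  qed
  then show ?thesis using assms(1)[of 0] assms(2) by (simp add: mult_nonneg_nonneg)
next
  case False
  then have c: "c > 0" using assms(2) by simp
  have "a + 2 * (- b / c) * b + (- b / c)\<^sup>2 * c \<ge> 0" using assms(1) .
  then have "b\<^sup>2 \<le> a * c" using c by (simp add: field_simps power2_eq_square)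
  then have "sqrt (b\<^sup>2) \<le> sqrt (a * c)" by (rule real_sqrt_le_mono)
  then show ?thesis by (simp add: real_sqrt_mult)
qed

lemma sqrt_quadratic_triangle:
  fixes a b c :: real
  assumes "\<And>s. a + 2 * s * b + s\<^sup>2 * c \<ge> 0" "c \<ge> 0"
  shows "sqrt (a + 2 * b + c) \<le> sqrt a + sqrt c"
proof -
  have a: "a \<ge> 0" using assms(1)[of 0] by simp
  have "a + 2 * b + c \<le> (sqrt a + sqrt c)\<^sup>2"
    using nonneg_quadratic_bound[OF assms] a assms(2) by (simp add: power2_sum abs_le_iff)
  then have "sqrt (a + 2 * b + c) \<le> sqrt ((sqrt a + sqrt c)\<^sup>2)" by (rule real_sqrt_le_mono)
  then show ?thesis using a assms(2) by simp
qed

lemma ips_bound: "sqi M f \<Longrightarrow> sqi M g \<Longrightarrow> \<bar>ips M f g\<bar> \<le> sqrt (nsq M f) * sqrt (nsq M g)"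
  by (rule nonneg_quadratic_bound) (auto simp: nsq_expand[symmetric])

lemma nsq_triangle:
  assumes "sqi M f" "sqi M g"
  shows "sqrt (nsq M (\<lambda>x. f x + g x)) \<le> sqrt (nsq M f) + sqrt (nsq M g)"
  using sqrt_quadratic_triangle[of "nsq M f" "ips M f g" "nsq M g"] nsq_expand[OF assms, symmetric]
    nsq_expand[OF assms, of 1] by simp

lemma nsq_scaleR [simp]: "nsq M (\<lambda>x. s *\<^sub>R f x) = s\<^sup>2 * nsq M f"
  by (simp add: nsq_def power_mult_distrib)

lemma nsq_minus_commute: "nsq M (\<lambda>x. f x - g x) = nsq M (\<lambda>x. g x - f x)"
  by (simp add: nsq_def norm_minus_commute)

lemma integral_norm_mult_bound:
  fixes f :: "'x \<Rightarrow> 'b::euclidean_space" and g :: "'x \<Rightarrow> 'c::euclidean_space"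
  assumes "sqi M f" "sqi M g"
  shows "integrable M (\<lambda>x. norm (f x) * norm (g x))"
    "(\<integral>x. norm (f x) * norm (g x) \<partial>M) \<le> sqrt (nsq M f) * sqrt (nsq M g)"
proof -
  have s: "sqi M (\<lambda>x. norm (f x))" "sqi M (\<lambda>x. norm (g x))"
    using assms by (auto intro: sqi_norm)
  show "integrable M (\<lambda>x. norm (f x) * norm (g x))"
    using sqi_inner_integrable[OF s] by simp
  show "(\<integral>x. norm (f x) * norm (g x) \<partial>M) \<le> sqrt (nsq M f) * sqrt (nsq M g)"
    using ips_bound[OF s] by (simp add: ips_def nsq_def)
qed

text \<open>Riesz--Fischer: an almost everywhere convergent subsequence supplies the limit, and Fatou's
  lemma turns the Cauchy property into convergence.\<close>
lemma sqi_complete: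
  fixes f :: "nat \<Rightarrow> 'x \<Rightarrow> 'b::euclidean_space"
  assumes f: "\<And>n. sqi M (f n)"
    and Cauchy: "\<And>e. e > 0 \<Longrightarrow> \<exists>N. \<forall>m\<ge>N. \<forall>n\<ge>N. nsq M (\<lambda>x. f m x - f n x) < e"
  obtains g where "sqi M g" "(\<lambda>n. nsq M (\<lambda>x. f n x - g x)) \<longlonglongrightarrow> 0"
proof -
  note [measurable] = f[THEN sqiD(1)]
  have "\<exists>r. \<forall>k. (\<forall>m\<ge>r k. \<forall>n\<ge>r k. nsq M (\<lambda>x. f m x - f n x) < (1/4) ^ k) \<and> r k < r (Suc k)"
  proof (rule dependent_nat_choice)
    fix x k
    obtain N where N: "\<forall>m\<ge>N. \<forall>n\<ge>N. nsq M (\<lambda>x. f m x - f n x) < (1/4) ^ Suc k"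
      using Cauchy[of "(1/4) ^ Suc k"] by auto
    show "\<exists>y. (\<forall>m\<ge>y. \<forall>n\<ge>y. nsq M (\<lambda>x. f m x - f n x) < (1/4) ^ Suc k) \<and> x < y"
      by (rule exI[of _ "max N (Suc x)"]) (use N in auto)
  qed (use Cauchy[of "(1/4)^0"] in auto)
  then obtain r where r: "\<And>k m n. m \<ge> r k \<Longrightarrow> n \<ge> r k \<Longrightarrow> nsq M (\<lambda>x. f m x - f n x) < (1/4) ^ k"
    and mono: "\<And>k. r k < r (Suc k)" by blast
  have rm: "strict_mono r" using mono by (simp add: strict_mono_Suc_iff)
  define d where "d k x = f (r (Suc k)) x - f (r k) x" for k x
  have [measurable]: "d k \<in> borel_measurable M" for k unfolding d_def by measurable
  \<comment> \<open>The weight \<open>2 ^ k\<close> against squared increments of order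
    \<open>(1/4) ^ k\<close> leaves a summable series. Convergence of the weighted sum then bounds
    \<open>norm (d k x)\<close> by a multiple of \<open>sqrt (1/2) ^ k\<close> at almost every
    \<open>x\<close>, so the telescoping series converges absolutely there.\<close>
  have dsq: "(\<integral>\<^sup>+x. ennreal (2 ^ k * (norm (d k x))\<^sup>2) \<partial>M) \<le> ennreal ((1/2) ^ k)" for k
  proof -
    have i: "integrable M (\<lambda>x. (norm (d k x))\<^sup>2)"
      using sqi_diff[OF f f] unfolding d_def sqi_def by blast
    have "(\<integral>\<^sup>+x. ennreal (2 ^ k * (norm (d k x))\<^sup>2) \<partial>M) = ennreal (\<integral>x. 2 ^ k * (norm (d k x))\<^sup>2 \<partial>M)"
      using i by (intro nn_integral_eq_integral) auto
    also have "(\<integral>x. 2 ^ k * (norm (d k x))\<^sup>2 \<partial>M) = 2 ^ k * nsq M (d k)" by (simp add: nsq_def)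
    also have "\<dots> \<le> 2 ^ k * (1/4) ^ k"
      using r[of k "r (Suc k)" "r k"] mono[of k] by (intro mult_left_mono) (auto simp: d_def[abs_def] less_imp_le)
    also have "\<dots> = (1/2) ^ k" by (simp add: power_mult_distrib[symmetric])
    finally show ?thesis by (simp add: ennreal_leI)
  qed
  have "(\<integral>\<^sup>+x. (\<Sum>k. ennreal (2 ^ k * (norm (d k x))\<^sup>2)) \<partial>M) = (\<Sum>k. \<integral>\<^sup>+x. ennreal (2 ^ k * (norm (d k x))\<^sup>2) \<partial>M)"
    by (rule nn_integral_suminf) measurable
  also have "\<dots> \<le> (\<Sum>k. ennreal ((1/2) ^ k))" using dsq by (intro suminf_le) auto
  also have "\<dots> = ennreal (\<Sum>k. (1/2) ^ k)" by (intro suminf_ennreal2) auto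
  also have "\<dots> < \<infinity>" by simp
  finally have "AE x in M. (\<Sum>k. ennreal (2 ^ k * (norm (d k x))\<^sup>2)) \<noteq> \<infinity>"
    by (intro nn_integral_noteq_infinite) auto
  then have conv: "AE x in M. convergent (\<lambda>k. f (r k) x)"
  proof eventually_elim
    case (elim x)
    then have "summable (\<lambda>k. 2 ^ k * (norm (d k x))\<^sup>2)"
      by (intro summable_suminf_not_top) auto
    then have "(\<lambda>k. 2 ^ k * (norm (d k x))\<^sup>2) \<longlonglongrightarrow> 0" by (rule summable_LIMSEQ_zero)
    then have "Bseq (\<lambda>k. 2 ^ k * (norm (d k x))\<^sup>2)" by (intro convergent_imp_Bseq convergentI)
    then obtain C where C: "\<And>k. norm (2 ^ k * (norm (d k x))\<^sup>2) \<le> C"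
      unfolding Bseq_def by blast
    have "norm (d k x) \<le> sqrt C * (sqrt (1/2)) ^ k" for k
    proof -
      have "(norm (d k x))\<^sup>2 \<le> C * (1/2) ^ k" using C[of k] by (simp add: field_simps power_divide)
      then have "norm (d k x) \<le> sqrt (C * (1/2) ^ k)" by (rule real_le_rsqrt)
      then show ?thesis by (simp add: real_sqrt_mult real_sqrt_power)
    qed
    moreover have "summable (\<lambda>k. sqrt C * (sqrt (1/2)) ^ k)"
      by (intro summable_mult summable_geometric) (simp add: real_sqrt_lt_1_iff)
    ultimately have "summable (\<lambda>k. d k x)"
      using summable_comparison_test'[of "\<lambda>k. sqrt C * (sqrt (1/2)) ^ k" 0 "\<lambda>k. d k x"] by blast
    then have "convergent (\<lambda>n. \<Sum>k<n. d k x)" by (simp add: summable_iff_convergent)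
    moreover have "(\<Sum>k<n. d k x) = f (r n) x - f (r 0) x" for n
      unfolding d_def by (rule sum_lessThan_telescope)
    ultimately have "convergent (\<lambda>n. (f (r n) x - f (r 0) x) + f (r 0) x)"
      by (intro convergent_add convergent_const) simp
    then show ?case by simp
  qed
  define g where "g x = lim (\<lambda>k. f (r k) x)" for x
  have g[measurable]: "g \<in> borel_measurable M" unfolding g_def by measurable
  have lim: "AE x in M. (\<lambda>k. f (r k) x) \<longlonglongrightarrow> g x"
    using conv by eventually_elim (simp add: g_def convergent_LIMSEQ_iff)
  have key: "(\<integral>\<^sup>+x. ennreal ((norm (f m x - g x))\<^sup>2) \<partial>M) \<le> ennreal e"
    if N: "\<And>n. n \<ge> N \<Longrightarrow> nsq M (\<lambda>x. f m x - f n x) \<le> e" for m N e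
  proof -
    have "(\<integral>\<^sup>+x. ennreal ((norm (f m x - g x))\<^sup>2) \<partial>M)
        = (\<integral>\<^sup>+x. liminf (\<lambda>k. ennreal ((norm (f m x - f (r k) x))\<^sup>2)) \<partial>M)"
    proof (rule nn_integral_cong_AE)
      show "AE x in M. ennreal ((norm (f m x - g x))\<^sup>2) = liminf (\<lambda>k. ennreal ((norm (f m x - f (r k) x))\<^sup>2))"
        using lim
      proof eventually_elim
        case (elim x)
        then have "(\<lambda>k. ennreal ((norm (f m x - f (r k) x))\<^sup>2)) \<longlonglongrightarrow> ennreal ((norm (f m x - g x))\<^sup>2)"
          by (intro tendsto_intros)
        then show ?case by (rule lim_imp_Liminf[OF trivial_limit_sequentially, symmetric])
      qed
    qed
    also have "\<dots> \<le> liminf (\<lambda>k. \<integral>\<^sup>+x. ennreal ((norm (f m x - f (r k) x))\<^sup>2) \<partial>M)"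
      by (rule nn_integral_liminf) measurable
    also have "\<dots> \<le> ennreal e"
    proof (rule Liminf_le)
      show "\<forall>\<^sub>F k in sequentially. (\<integral>\<^sup>+x. ennreal ((norm (f m x - f (r k) x))\<^sup>2) \<partial>M) \<le> ennreal e"
        unfolding eventually_sequentially
      proof (intro exI allI impI)
        fix k assume "N \<le> k"
        then have "nsq M (\<lambda>x. f m x - f (r k) x) \<le> e"
          using N[of "r k"] seq_suble[OF rm, of k] by linarith
        moreover have "(\<integral>\<^sup>+x. ennreal ((norm (f m x - f (r k) x))\<^sup>2) \<partial>M) = ennreal (nsq M (\<lambda>x. f m x - f (r k) x))"
          unfolding nsq_def using sqi_diff[OF f f] by (intro nn_integral_eq_integral) (auto simp: sqi_def)
        ultimately show "(\<integral>\<^sup>+x. ennreal ((norm (f m x - f (r k) x))\<^sup>2) \<partial>M) \<le> ennreal e"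
          by (simp add: ennreal_leI)
      qed
    qed simp
    finally show ?thesis .
  qed
  have sq: "sqi M (\<lambda>x. f m x - g x)" if "m \<ge> r 0" for m
  proof -
    have "(\<integral>\<^sup>+x. ennreal ((norm (f m x - g x))\<^sup>2) \<partial>M) \<le> ennreal 1"
      by (rule key[of "r 0"]) (use r[of 0 m] that in \<open>auto simp: less_imp_le\<close>)
    then have "integrable M (\<lambda>x. (norm (f m x - g x))\<^sup>2)"
      by (intro integrableI_bounded) (auto intro: le_less_trans)
    then show ?thesis by (simp add: sqi_def)
  qed
  have "sqi M (\<lambda>x. f (r 0) x - (f (r 0) x - g x))" by (intro sqi_diff f sq) simp
  then have gs: "sqi M g" by simp
  moreover have "(\<lambda>n. nsq M (\<lambda>x. f n x - g x)) \<longlonglongrightarrow> 0"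
  proof (rule LIMSEQ_I)
    fix e :: real assume e: "e > 0"
    obtain N where N: "\<And>m n. m \<ge> N \<Longrightarrow> n \<ge> N \<Longrightarrow> nsq M (\<lambda>x. f m x - f n x) < e / 2"
      using Cauchy[of "e / 2"] e by auto
    show "\<exists>no. \<forall>n\<ge>no. norm (nsq M (\<lambda>x. f n x - g x) - 0) < e"
    proof (intro exI[of _ N] allI impI)
      fix m assume m: "N \<le> m"
      have "(\<integral>\<^sup>+x. ennreal ((norm (f m x - g x))\<^sup>2) \<partial>M) \<le> ennreal (e / 2)"
        by (rule key[of N]) (use N m in \<open>auto simp: less_imp_le\<close>)
      moreover have "(\<integral>\<^sup>+x. ennreal ((norm (f m x - g x))\<^sup>2) \<partial>M) = ennreal (nsq M (\<lambda>x. f m x - g x))"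
        unfolding nsq_def using sqi_diff[OF f gs] by (intro nn_integral_eq_integral) (auto simp: sqi_def)
      ultimately have "nsq M (\<lambda>x. f m x - g x) \<le> e / 2" using e by (simp add: ennreal_le_iff)
      then show "norm (nsq M (\<lambda>x. f m x - g x) - 0) < e" using e by simp
    qed
  qed
  ultimately show thesis using that by blast
qed

lemma tendsto_0_bound: "(\<And>n. norm (a n) \<le> b n) \<Longrightarrow> b \<longlonglongrightarrow> 0 \<Longrightarrow> a \<longlonglongrightarrow> (0::'b::real_normed_vector)"
  using Lim_null_comparison[of a b sequentially] by simp

lemma nsq_tendsto_diff:
  assumes "\<And>n. sqi M (f n)" "sqi M g" "(\<lambda>n. nsq M (\<lambda>x. f n x - g x)) \<longlonglongrightarrow> 0"
  shows "(\<lambda>n. nsq M (f n)) \<longlonglongrightarrow> nsq M g"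
proof -
  have "\<bar>sqrt (nsq M (f n)) - sqrt (nsq M g)\<bar> \<le> sqrt (nsq M (\<lambda>x. f n x - g x))" for n
  proof -
    have "sqrt (nsq M (f n)) \<le> sqrt (nsq M (\<lambda>x. f n x - g x)) + sqrt (nsq M g)"
      using nsq_triangle[OF sqi_diff[OF assms(1,2)] assms(2), of n] by simp
    moreover have "sqrt (nsq M g) \<le> sqrt (nsq M (\<lambda>x. g x - f n x)) + sqrt (nsq M (f n))"
      using nsq_triangle[OF sqi_diff[OF assms(2,1)] assms(1), of n n] by simp
    moreover have "nsq M (\<lambda>x. g x - f n x) = nsq M (\<lambda>x. f n x - g x)" by (rule nsq_minus_commute)
    ultimately show ?thesis by (simp add: abs_le_iff)
  qed
  moreover have "(\<lambda>n. sqrt (nsq M (\<lambda>x. f n x - g x))) \<longlonglongrightarrow> 0"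
    using tendsto_real_sqrt[OF assms(3)] by simp
  ultimately have "(\<lambda>n. sqrt (nsq M (f n)) - sqrt (nsq M g)) \<longlonglongrightarrow> 0"
    using tendsto_0_bound[of "\<lambda>n. sqrt (nsq M (f n)) - sqrt (nsq M g)" "\<lambda>n. sqrt (nsq M (\<lambda>x. f n x - g x))"] by simp
  then have "(\<lambda>n. sqrt (nsq M (f n))) \<longlonglongrightarrow> sqrt (nsq M g)" by (simp add: LIM_zero_iff)
  from tendsto_power[OF this, of 2] show ?thesis by simp
qed

subsection \<open>Integrals of test functions\<close>

lemma compact_support_integrable:
  fixes f :: "'a::euclidean_space \<Rightarrow> 'b::euclidean_space"
  assumes "continuous_on UNIV f" "compact K" "\<And>x. x \<notin> K \<Longrightarrow> f x = 0"
  shows "integrable lborel f"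
proof -
  have "integrable lborel (\<lambda>x. indicator K x *\<^sub>R f x)"
    using assms by (intro borel_integrable_compact continuous_on_subset[OF assms(1)]) auto
  moreover have "(\<lambda>x. indicator K x *\<^sub>R f x) = f" using assms(3) by (auto simp: indicator_def)
  ultimately show ?thesis by simp
qed

lemma sqi_compact_support:
  fixes f :: "'a::euclidean_space \<Rightarrow> 'b::euclidean_space"
  assumes "continuous_on UNIV f" "compact K" "\<And>x. x \<notin> K \<Longrightarrow> f x = 0"
  shows "sqi lborel f"
  unfolding sqi_def using assms
  by (auto intro!: compact_support_integrable[of _ K] continuous_intros borel_measurable_continuous_onI)

lemma testfun_sqi:
  fixes f :: "'a::euclidean_space \<Rightarrow> 'b::euclidean_space"
  assumes "testfun \<Omega> f" shows "sqi lborel f" "sqi lborel (pd f h)"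
proof -
  obtain K where K: "compact K" "K \<subseteq> \<Omega>" "\<And>x. x \<notin> K \<Longrightarrow> f x = 0" "\<And>x h. x \<notin> K \<Longrightarrow> pd f h x = 0"
    using testfun_support[OF assms] by blast
  show "sqi lborel f" "sqi lborel (pd f h)"
    by (rule sqi_compact_support[OF testfun_cont[OF assms] K(1,3)], assumption)
      (rule sqi_compact_support[OF testfun_pd_cont'[OF assms] K(1,4)])
qed

section \<open>Translations and difference quotients\<close>

lemma lborel_shift: "distr lborel borel (\<lambda>x. x + c) = (lborel :: 'a::euclidean_space measure)"
proof -
  have "(\<lambda>x. x + c) = (+) c" by (auto simp: add.commute)
  then show ?thesis using lborel_distr_plus[of c] by simp
qed

lemma sqi_shift:
  fixes f :: "'a::euclidean_space \<Rightarrow> 'b::euclidean_space"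
  assumes "sqi lborel f"
  shows "sqi lborel (\<lambda>x. f (x + c))" "nsq lborel (\<lambda>x. f (x + c)) = nsq lborel f"
proof -
  have [measurable]: "f \<in> borel_measurable borel" using assms by (simp add: sqi_def)
  have "integrable (distr lborel borel (\<lambda>x. x + c)) (\<lambda>x. (norm (f x))\<^sup>2)"
    unfolding lborel_shift using assms by (simp add: sqi_def)
  then have "integrable lborel (\<lambda>x. (norm (f (x + c)))\<^sup>2)"
    by (subst (asm) integrable_distr_eq) auto
  then show "sqi lborel (\<lambda>x. f (x + c))" by (simp add: sqi_def)
  have "nsq (distr lborel borel (\<lambda>x. x + c)) f = nsq lborel (\<lambda>x. f (x + c))"
    unfolding nsq_def by (rule integral_distr) auto
  then show "nsq lborel (\<lambda>x. f (x + c)) = nsq lborel f" by (simp add: lborel_shift)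
qed

lemma integral_shift:
  fixes f :: "'a::euclidean_space \<Rightarrow> 'b::euclidean_space"
  assumes [measurable]: "f \<in> borel_measurable borel"
  shows "(\<integral>x. f (x + c) \<partial>lborel) = (\<integral>x. f x \<partial>lborel)"
  using integral_distr[of "\<lambda>x. x + c" lborel borel f] by (simp add: lborel_shift)

lemma testfun_shift_bound:
  fixes f :: "'a::euclidean_space \<Rightarrow> 'b::euclidean_space"
  assumes "testfun \<Omega> f"
  obtains B where "\<And>x. norm (f x) \<le> B" "\<And>x. norm (pd f h x) \<le> B" "\<And>x s. norm (f (x + s *\<^sub>R h) - f x) \<le> B * \<bar>s\<bar>"
proof -
  obtain K where K: "compact K" "K \<subseteq> \<Omega>" "\<And>x. x \<notin> K \<Longrightarrow> f x = 0" "\<And>x h. x \<notin> K \<Longrightarrow> pd f h x = 0"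
    using testfun_support[OF assms] by blast
  have "bounded (pd f h ` K)" "bounded (f ` K)"
    using K(1) testfun_pd_cont'[OF assms] testfun_cont[OF assms]
    by (meson compact_continuous_image compact_imp_bounded continuous_on_subset subset_UNIV)+
  then obtain B1 B2 where B1: "\<And>x. x \<in> K \<Longrightarrow> norm (pd f h x) \<le> B1" and B2: "\<And>x. x \<in> K \<Longrightarrow> norm (f x) \<le> B2"
    unfolding bounded_iff by blast
  define B where "B = max 0 (max B1 B2)"
  have 1: "norm (f x) \<le> B" "norm (pd f h x) \<le> B" for x
    using B1[of x] B2[of x] K(3,4)[of x] by (cases "x \<in> K"; fastforce simp: B_def)+
  have "norm (f (x + s *\<^sub>R h) - f x) \<le> B * \<bar>s\<bar>" for x s
  proof -
    have "norm (f (x + s *\<^sub>R h) - f (x + 0 *\<^sub>R h)) \<le> B * norm (s - 0)"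
    proof (rule differentiable_bound[where S = UNIV and f' = "\<lambda>t r. r *\<^sub>R pd f h (x + t *\<^sub>R h)"])
      fix t :: real
      have bl: "bounded_linear (\<lambda>k. pd f k (x + t *\<^sub>R h))"
        using testfun_has_derivative[OF assms] has_derivative_bounded_linear by blast
      have "((\<lambda>t. f (x + t *\<^sub>R h)) has_derivative (\<lambda>r. pd f (r *\<^sub>R h) (x + t *\<^sub>R h))) (at t)"
        by (rule has_derivative_compose[OF _ testfun_has_derivative[OF assms]])
          (auto intro!: derivative_eq_intros)
      then show "((\<lambda>t. f (x + t *\<^sub>R h)) has_derivative (\<lambda>r. r *\<^sub>R pd f h (x + t *\<^sub>R h))) (at t within UNIV)"
        by (simp add: linear_simps(5)[OF bl])
      show "onorm (\<lambda>r. r *\<^sub>R pd f h (x + t *\<^sub>R h)) \<le> B"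
      proof (rule onorm_bound)
        show "norm (r *\<^sub>R pd f h (x + t *\<^sub>R h)) \<le> B * norm r" for r :: real
          using mult_left_mono[OF 1(2)[of "x + t *\<^sub>R h"] abs_ge_zero[of r]] by (simp add: mult.commute)
      qed (rule order_trans[OF norm_ge_zero 1(1)])
    qed auto
    then show ?thesis by simp
  qed
  then show thesis using 1 that by blast
qed

lemma testfun_dq_tendsto:
  fixes f :: "'a::euclidean_space \<Rightarrow> 'b::euclidean_space"
  assumes "testfun \<Omega> f"
  shows "(\<lambda>n. real (Suc n) *\<^sub>R (f (x + (1 / real (Suc n)) *\<^sub>R h) - f x)) \<longlonglongrightarrow> pd f h x"
proof -
  have bl: "bounded_linear (\<lambda>k. pd f k x)"
    using testfun_has_derivative[OF assms] has_derivative_bounded_linear by blast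
  have "((\<lambda>t. f (x + t *\<^sub>R h)) has_derivative (\<lambda>r. pd f (r *\<^sub>R h) (x + 0 *\<^sub>R h))) (at 0)"
    by (rule has_derivative_compose[OF _ testfun_has_derivative[OF assms]])
      (auto intro!: derivative_eq_intros)
  then have "((\<lambda>t. f (x + t *\<^sub>R h)) has_vector_derivative pd f h x) (at 0)"
    by (simp add: has_vector_derivative_def linear_simps(5)[OF bl])
  then have "((\<lambda>t. (f (x + t *\<^sub>R h) - f x) /\<^sub>R t) \<longlongrightarrow> pd f h x) (at 0)"
  proof -
    assume "((\<lambda>t. f (x + t *\<^sub>R h)) has_vector_derivative pd f h x) (at 0)"
    then have "((\<lambda>y. norm ((f (x + y *\<^sub>R h) - f x - y *\<^sub>R pd f h x) /\<^sub>R \<bar>y\<bar>)) \<longlongrightarrow> 0) (at 0)"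
      by (simp add: has_vector_derivative_def has_derivative_at divide_inverse mult.commute)
    then have "((\<lambda>y. norm ((f (x + y *\<^sub>R h) - f x) /\<^sub>R y - pd f h x)) \<longlongrightarrow> 0) (at 0)"
    proof (rule Lim_transform_eventually)
      have "norm ((f (x + y *\<^sub>R h) - f x - y *\<^sub>R pd f h x) /\<^sub>R \<bar>y\<bar>) = norm ((f (x + y *\<^sub>R h) - f x) /\<^sub>R y - pd f h x)"
        if "y \<noteq> 0" for y
      proof -
        have "(f (x + y *\<^sub>R h) - f x) /\<^sub>R y - pd f h x = (f (x + y *\<^sub>R h) - f x - y *\<^sub>R pd f h x) /\<^sub>R y"
          using that by (simp add: scaleR_diff_right)
        then show ?thesis by simp
      qed
      then show "\<forall>\<^sub>F y in at 0. norm ((f (x + y *\<^sub>R h) - f x - y *\<^sub>R pd f h x) /\<^sub>R \<bar>y\<bar>) = norm ((f (x + y *\<^sub>R h) - f x) /\<^sub>R y - pd f h x)"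
        by (auto simp: eventually_at_filter)
    qed
    then show ?thesis by (rule LIM_zero_cancel[OF tendsto_norm_zero_cancel])
  qed
  moreover have "filterlim (\<lambda>n. 1 / real (Suc n)) (at 0) sequentially"
    using LIMSEQ_inverse_real_of_nat by (auto simp: filterlim_at inverse_eq_divide)
  ultimately have "(\<lambda>n. (f (x + (1 / real (Suc n)) *\<^sub>R h) - f x) /\<^sub>R (1 / real (Suc n))) \<longlonglongrightarrow> pd f h x"
    by (rule filterlim_compose)
  then show ?thesis by simp
qed

text \<open>Steps of length at most 1 keep every difference quotient inside one ball; with the bound
  of \<open>testfun_shift_bound\<close> this gives the majorant for dominated convergence.\<close>

lemma testfun_dq_support:
  fixes f :: "'a::euclidean_space \<Rightarrow> 'b::euclidean_space"
  assumes "testfun \<Omega> f"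
  obtains R where "\<And>(x::'a) s. \<bar>s\<bar> \<le> 1 \<Longrightarrow> x \<notin> cball 0 R \<Longrightarrow> f (x + s *\<^sub>R h) - f x = 0" "\<And>x::'a. x \<notin> cball 0 R \<Longrightarrow> pd f h x = 0"
proof -
  obtain K where K: "compact K" "K \<subseteq> \<Omega>" "\<And>x. x \<notin> K \<Longrightarrow> f x = 0" "\<And>x h. x \<notin> K \<Longrightarrow> pd f h x = 0"
    using testfun_support[OF assms] by blast
  obtain R where R: "\<And>x. x \<in> K \<Longrightarrow> norm x \<le> R" using K(1) compact_imp_bounded[of K] unfolding bounded_iff by blast
  show thesis
  proof (rule that[of "R + norm h"])
    fix x :: 'a and s :: real assume s: "\<bar>s\<bar> \<le> 1" and x: "x \<notin> cball 0 (R + norm h)"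
    have "norm x \<le> norm (x + s *\<^sub>R h) + norm (s *\<^sub>R h)"
      using norm_triangle_ineq4[of "x + s *\<^sub>R h" "s *\<^sub>R h"] by simp
    moreover have "norm (s *\<^sub>R h) \<le> norm h" using s mult_right_mono[of "\<bar>s\<bar>" 1 "norm h"] by simp
    ultimately have "\<not> norm (x + s *\<^sub>R h) \<le> R" "\<not> norm x \<le> R"
      using x norm_ge_zero[of h] unfolding mem_cball_0 by linarith+
    then have "x + s *\<^sub>R h \<notin> K" "x \<notin> K" using R by blast+
    then show "f (x + s *\<^sub>R h) - f x = 0" using K by simp
  next
    fix x :: 'a assume "x \<notin> cball 0 (R + norm h)"
    then have "\<not> norm x \<le> R" using norm_ge_zero[of h] unfolding mem_cball_0 by linarith
    then have "x \<notin> K" using R by blast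
    then show "pd f h x = 0" using K by simp
  qed
qed

text \<open>By translation invariance each difference quotient has integral zero, and dominated
  convergence passes this to the derivative. Applied to a product it becomes integration by
  parts.\<close>

lemma integral_pd_zero:
  fixes f :: "'a::euclidean_space \<Rightarrow> 'b::euclidean_space"
  assumes f: "testfun \<Omega> f" shows "(\<integral>x. pd f h x \<partial>lborel) = 0"
proof -
  obtain B where B: "\<And>x s. norm (f (x + s *\<^sub>R h) - f x) \<le> B * \<bar>s\<bar>"
    by (rule testfun_shift_bound[OF f, of h]) blast
  obtain R where R: "\<And>x s. \<bar>s\<bar> \<le> 1 \<Longrightarrow> x \<notin> cball 0 R \<Longrightarrow> f (x + s *\<^sub>R h) - f x = 0"
    by (rule testfun_dq_support[OF f, of h]) blast
  have [measurable]: "f \<in> borel_measurable borel" "pd f h \<in> borel_measurable borel"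
    using testfun_cont[OF f] testfun_pd_cont'[OF f] by (auto intro: borel_measurable_continuous_onI)
  have fi: "integrable lborel f"
    using f unfolding testfun_def by (auto intro: compact_support_integrable testfun_cont[OF f])
  have fsi: "integrable lborel (\<lambda>x. f (x + c))" for c
    using integrable_distr_eq[of "\<lambda>x. x + c" lborel borel f] fi by (simp add: lborel_shift)
  have "(\<lambda>n. \<integral>x. real (Suc n) *\<^sub>R (f (x + (1 / real (Suc n)) *\<^sub>R h) - f x) \<partial>lborel) \<longlonglongrightarrow> (\<integral>x. pd f h x \<partial>lborel)"
  proof (rule integral_dominated_convergence[where w = "\<lambda>x. indicator (cball 0 R) x * B"])
    show "integrable lborel (\<lambda>x::'a. indicator (cball 0 R) x * B)"
      by (intro integrable_real_indicator integrable_mult_left) (auto intro: emeasure_bounded_finite[OF bounded_cball, unfolded infinity_ennreal_def])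
    show "AE x in lborel. (\<lambda>n. real (Suc n) *\<^sub>R (f (x + (1 / real (Suc n)) *\<^sub>R h) - f x)) \<longlonglongrightarrow> pd f h x"
      using testfun_dq_tendsto[OF f] by auto
    fix n
    show "AE x in lborel. norm (real (Suc n) *\<^sub>R (f (x + (1 / real (Suc n)) *\<^sub>R h) - f x)) \<le> indicator (cball 0 R) x * B"
    proof (rule AE_I2)
      fix x
      show "norm (real (Suc n) *\<^sub>R (f (x + (1 / real (Suc n)) *\<^sub>R h) - f x)) \<le> indicator (cball 0 R) x * B"
        using R[of "1 / real (Suc n)" x] B[of x "1 / real (Suc n)"]
        by (cases "x \<in> cball 0 R")
          (auto simp: pos_le_divide_eq mult.commute simp del: of_nat_Suc scaleR_right_diff_distrib)
    qed
  qed measurable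
  moreover have "(\<integral>x. real (Suc n) *\<^sub>R (f (x + (1 / real (Suc n)) *\<^sub>R h) - f x) \<partial>lborel) = 0" for n
    using fi fsi integral_shift[of f "(1 / real (Suc n)) *\<^sub>R h"] by simp
  ultimately show ?thesis using LIMSEQ_unique[OF _ tendsto_const] by simp
qed

text \<open>Splitting the translation by h into n steps, the triangle inequality bounds the difference by
  the norm of the n-th difference quotient.\<close>
lemma translation_estimate:
  fixes f :: "'a::euclidean_space \<Rightarrow> 'b::euclidean_space"
  assumes f: "testfun \<Omega> f" shows "nsq lborel (\<lambda>x. f (x + h) - f x) \<le> nsq lborel (pd f h)"
proof -
  obtain B where B: "\<And>x s. norm (f (x + s *\<^sub>R h) - f x) \<le> B * \<bar>s\<bar>"
    by (rule testfun_shift_bound[OF f, of h]) blast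
  obtain R where R: "\<And>x s. \<bar>s\<bar> \<le> 1 \<Longrightarrow> x \<notin> cball 0 R \<Longrightarrow> f (x + s *\<^sub>R h) - f x = 0"
    by (rule testfun_dq_support[OF f, of h]) blast
  have [measurable]: "f \<in> borel_measurable borel" "pd f h \<in> borel_measurable borel"
    using testfun_cont[OF f] testfun_pd_cont'[OF f] by (auto intro: borel_measurable_continuous_onI)
  have s: "sqi lborel f" "\<And>c. sqi lborel (\<lambda>x. f (x + c))"
    using testfun_sqi(1)[OF f] sqi_shift by auto
  define q where "q n x = real (Suc n) *\<^sub>R (f (x + (1 / real (Suc n)) *\<^sub>R h) - f x)" for n x
  have step: "sqrt (nsq lborel (\<lambda>x. f (x + real j *\<^sub>R k) - f x)) \<le> real j * sqrt (nsq lborel (\<lambda>x. f (x + k) - f x))" for j k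
  proof (induction j)
    case 0 then show ?case by (simp add: nsq_def)
  next
    case (Suc j)
    have "sqrt (nsq lborel (\<lambda>x. (f ((x + real j *\<^sub>R k) + k) - f (x + real j *\<^sub>R k)) + (f (x + real j *\<^sub>R k) - f x)))
      \<le> sqrt (nsq lborel (\<lambda>x. f ((x + real j *\<^sub>R k) + k) - f (x + real j *\<^sub>R k))) + sqrt (nsq lborel (\<lambda>x. f (x + real j *\<^sub>R k) - f x))"
      by (intro nsq_triangle sqi_diff s) (simp add: add.assoc s)
    also have "nsq lborel (\<lambda>x. f ((x + real j *\<^sub>R k) + k) - f (x + real j *\<^sub>R k)) = nsq lborel (\<lambda>x. f (x + k) - f x)"
      by (rule sqi_shift(2)) (intro sqi_diff s)
    finally show ?case using Suc by (simp add: algebra_simps)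
  qed
  have le: "sqrt (nsq lborel (\<lambda>x. f (x + h) - f x)) \<le> sqrt (nsq lborel (q n))" for n
  proof -
    have "nsq lborel (q n) = (real (Suc n))\<^sup>2 * nsq lborel (\<lambda>x. f (x + (1 / real (Suc n)) *\<^sub>R h) - f x)"
      unfolding q_def by (rule nsq_scaleR)
    then have "sqrt (nsq lborel (q n)) = real (Suc n) * sqrt (nsq lborel (\<lambda>x. f (x + (1 / real (Suc n)) *\<^sub>R h) - f x))"
      by (simp add: real_sqrt_mult)
    then show ?thesis using step[of "Suc n" "(1 / real (Suc n)) *\<^sub>R h"] by simp
  qed
  have "(\<lambda>n. \<integral>x. (norm (q n x))\<^sup>2 \<partial>lborel) \<longlonglongrightarrow> (\<integral>x. (norm (pd f h x))\<^sup>2 \<partial>lborel)"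
  proof (rule integral_dominated_convergence[where w = "\<lambda>x. indicator (cball 0 R) x * B\<^sup>2"])
    show "integrable lborel (\<lambda>x::'a. indicator (cball 0 R) x * B\<^sup>2)"
      by (intro integrable_real_indicator integrable_mult_left) (auto intro: emeasure_bounded_finite[OF bounded_cball, unfolded infinity_ennreal_def])
    show "AE x in lborel. (\<lambda>n. (norm (q n x))\<^sup>2) \<longlonglongrightarrow> (norm (pd f h x))\<^sup>2"
      unfolding q_def by (intro AE_I2 tendsto_intros testfun_dq_tendsto[OF f])
    fix n
    show "AE x in lborel. norm ((norm (q n x))\<^sup>2) \<le> indicator (cball 0 R) x * B\<^sup>2"
    proof (rule AE_I2)
      fix x
      have "norm (q n x) \<le> B" using B[of x "1 / real (Suc n)"] by (simp add: q_def pos_le_divide_eq mult.commute del: of_nat_Suc scaleR_right_diff_distrib)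
      then show "norm ((norm (q n x))\<^sup>2) \<le> indicator (cball 0 R) x * B\<^sup>2"
        using R[of "1 / real (Suc n)" x]
        by (cases "x \<in> cball 0 R") (auto simp: q_def simp del: of_nat_Suc intro: power_mono)
    qed
  qed (auto simp: q_def)
  then have "(\<lambda>n. sqrt (nsq lborel (q n))) \<longlonglongrightarrow> sqrt (nsq lborel (pd f h))"
    unfolding nsq_def by (rule tendsto_real_sqrt)
  then have "sqrt (nsq lborel (\<lambda>x. f (x + h) - f x)) \<le> sqrt (nsq lborel (pd f h))"
    by (rule LIMSEQ_le_const) (use le in blast)
  then show ?thesis by simp
qed

subsection \<open>Test functions and the Sobolev space with zero boundary values\<close>

text \<open>Open boxes are an intersection-stable generator of the Borel sets, so the vanishing
  spreads to all Borel sets; the sets where the function is positive or negative then decide.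
  Cutting off to \<open>box a c\<close> beforehand turns the integral over the whole space into one
  over a box, as the complement step requires.\<close>

lemma integral_zero_on_boxes_imp_AE:
  fixes k :: "'a::euclidean_space \<Rightarrow> real"
  assumes int: "integrable lborel k" and zero: "\<And>p q. box p q \<subseteq> box a c \<Longrightarrow> (\<integral>x. indicator (box p q) x * k x \<partial>lborel) = 0"
  shows "AE x in lborel. x \<in> box a c \<longrightarrow> k x = 0"
proof -
  define f where "f x = indicator (box a c) x * k x" for x
  have f: "integrable lborel f" unfolding f_def using int by (intro integrable_mult_indicator[of _ _ k, simplified]) auto
  have [measurable]: "f \<in> borel_measurable lborel" using f by auto
  have fi: "integrable lborel (\<lambda>x. indicator A x * f x)" if "A \<in> sets borel" for A
    using integrable_mult_indicator[of A lborel f] f that by simp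
  have all: "(\<integral>x. indicator A x * f x \<partial>lborel) = 0" if "A \<in> sets borel" for A
  proof -
    have "Int_stable (range (\<lambda>(a, b). box a b :: 'a set))"
      by (auto simp: Int_stable_def box_Int_box)
    moreover have "range (\<lambda>(a, b). box a b :: 'a set) \<subseteq> Pow UNIV" by simp
    moreover have "A \<in> sigma_sets UNIV (range (\<lambda>(a, b). box a b :: 'a set))"
      using that by (simp add: borel_eq_box)
    ultimately show ?thesis
    proof (induction rule: sigma_sets_induct_disjoint)
      case (basic A)
      then obtain p q where A: "A = box p q" by auto
      then obtain p' q' where pq: "A \<inter> box a c = box p' q'" by (auto simp: box_Int_box)
      have "(\<lambda>x. indicator A x * f x) = (\<lambda>x. indicator (box p' q') x * k x)"
        unfolding f_def pq[symmetric] by (auto simp: indicator_def)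
      then show ?case using zero[of p' q'] pq by (metis inf_le2)
    next
      case empty then show ?case by simp
    next
      case (compl A)
      then have A: "A \<in> sets borel" by (simp add: borel_eq_box)
      have "(\<integral>x. f x \<partial>lborel) = 0" using zero[of a c] by (simp add: f_def)
      moreover have "indicator (UNIV - A) x * f x = f x - indicator A x * f x" for x
        by (auto simp: indicator_def)
      ultimately show ?case using f fi[OF A] compl by simp
    next
      case (union A)
      then have A: "\<And>i. A i \<in> sets borel" by (auto simp: borel_eq_box)
      have "set_lebesgue_integral lborel (\<Union>i. A i) f = (\<Sum>i. set_lebesgue_integral lborel (A i) f)"
        using A union(1) fi[of "\<Union>i. A i"]
        by (intro lebesgue_integral_countable_add) (auto simp: disjoint_family_on_def set_integrable_def)
      then show ?case using union by (simp add: set_lebesgue_integral_def)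
    qed
  qed
  have pos: "AE x in lborel. \<not> s * f x > 0" if "s = 1 \<or> s = -1" for s :: real
  proof -
    define A where "A = {x. s * f x > 0}"
    have A: "A \<in> sets borel" unfolding A_def by measurable
    have "AE x in lborel. s * (indicator A x * f x) = 0"
    proof (subst integral_nonneg_eq_0_iff_AE[symmetric])
      show "integrable lborel (\<lambda>x. s * (indicator A x * f x))" using fi[OF A] by simp
      show "AE x in lborel. 0 \<le> s * (indicator A x * f x)" by (auto simp: A_def indicator_def)
      show "(\<integral>x. s * (indicator A x * f x) \<partial>lborel) = 0" using all[OF A] by simp
    qed
    then show ?thesis by eventually_elim (use that in \<open>auto simp: A_def indicator_def split: if_splits\<close>)
  qed
  have "AE x in lborel. f x = 0" using pos[OF disjI1[OF refl]] pos[OF disjI2[OF refl]] by eventually_elim auto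
  then show ?thesis by eventually_elim (auto simp: f_def)
qed

text \<open>The Dirichlet integral of a test function by classical derivatives over the whole space.
  It stands in for \<open>gradsq\<close>, which rests on the arbitrary choice in
  \<open>wgrad\<close>; the two agree on test functions by \<open>H10_test\<close>.\<close>

definition tgr :: "('a::euclidean_space \<Rightarrow> 'b::euclidean_space) \<Rightarrow> real" where
  "tgr \<phi> = (\<Sum>b\<in>Basis. nsq lborel (pd \<phi> b))"

lemma tgr_nonneg [simp]: "tgr \<phi> \<ge> 0" by (simp add: tgr_def sum_nonneg)

lemma nsq_pd_le_tgr: "b \<in> Basis \<Longrightarrow> nsq lborel (pd \<phi> b) \<le> tgr \<phi>"
  unfolding tgr_def by (rule member_le_sum) auto

lemma tgr_expand:
  fixes \<phi> :: "'a::euclidean_space \<Rightarrow> complex"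
  assumes "testfun A \<phi>" "testfun A \<psi>"
  shows "tgr (\<lambda>x. \<phi> x + complex_of_real s * \<psi> x) = tgr \<phi> + 2 * s * (\<Sum>b\<in>Basis. ips lborel (pd \<phi> b) (pd \<psi> b)) + s\<^sup>2 * tgr \<psi>"
proof -
  have "pd (\<lambda>x. \<phi> x + complex_of_real s * \<psi> x) b = (\<lambda>x. pd \<phi> b x + s *\<^sub>R pd \<psi> b x)" for b
    using pd_add[OF assms(1) testfun_cmult[OF assms(2)]] pd_cmult[OF assms(2)] by (auto simp: scaleR_conv_of_real)
  then have "nsq lborel (pd (\<lambda>x. \<phi> x + complex_of_real s * \<psi> x) b)
      = nsq lborel (pd \<phi> b) + 2 * s * ips lborel (pd \<phi> b) (pd \<psi> b) + s\<^sup>2 * nsq lborel (pd \<psi> b)" for b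
    by (simp add: nsq_expand testfun_sqi(2)[OF assms(1)] testfun_sqi(2)[OF assms(2)])
  then show ?thesis by (simp add: tgr_def sum.distrib sum_distrib_left algebra_simps)
qed

locale bounded_open =
  fixes \<Omega> :: "'a::euclidean_space set"
  assumes open\<Omega>: "open \<Omega>" and bounded\<Omega>: "bounded \<Omega>"
begin

abbreviation LO where "LO \<equiv> lebesgue_on \<Omega>"

lemma meas\<Omega>: "\<Omega> \<in> sets lebesgue" "\<Omega> \<in> sets borel" "\<Omega> \<inter> space lebesgue \<in> sets lebesgue"
  using open\<Omega> by auto

lemma finite_measure_LO: "finite_measure LO"
proof
  have "emeasure lborel \<Omega> < \<infinity>" using bounded\<Omega> by (rule emeasure_bounded_finite)
  then show "emeasure LO (space LO) \<noteq> \<infinity>"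
    using meas\<Omega> by (simp add: emeasure_restrict_space less_top)
qed

lemma set_int_LO: "set_lebesgue_integral lebesgue \<Omega> (f :: 'a \<Rightarrow> 'b::{banach, second_countable_topology}) = integral\<^sup>L LO f"
  unfolding set_lebesgue_integral_def using integral_restrict_space[OF meas\<Omega>(3)] by metis

lemma set_integrable_LO: "set_integrable lebesgue \<Omega> (f :: 'a \<Rightarrow> 'b::{banach, second_countable_topology}) \<longleftrightarrow> integrable LO f"
  unfolding set_integrable_def using integrable_restrict_space[OF meas\<Omega>(3)] by metis

lemma L2_iff: "L2 \<Omega> u \<longleftrightarrow> sqi LO u"
  unfolding L2_def sqi_def set_integrable_LO set_borel_measurable_def
  using borel_measurable_restrict_space_iff[OF meas\<Omega>(3), of u] by simp

lemma mass_eq: "mass \<Omega> u = nsq LO u"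
  by (simp add: mass_def nsq_def set_int_LO)

text \<open>Bridge between two settings: the Sobolev space lives on Lebesgue measure restricted to
  \<open>\<Omega>\<close>, while translations and Fubini are used on \<open>lborel\<close>.\<close>

lemma LO_lborel:
  fixes f :: "'a \<Rightarrow> 'b::{banach, second_countable_topology}"
  assumes "f \<in> borel_measurable borel" "\<And>x. x \<notin> \<Omega> \<Longrightarrow> f x = 0"
  shows "integral\<^sup>L LO f = integral\<^sup>L lborel f" "integrable LO f \<longleftrightarrow> integrable lborel f"
proof -
  have "(\<lambda>x. indicator \<Omega> x *\<^sub>R f x) = f" using assms(2) by (auto simp: indicator_def)
  then show "integral\<^sup>L LO f = integral\<^sup>L lborel f" "integrable LO f \<longleftrightarrow> integrable lborel f"
    using assms(1) by (auto simp: integral_restrict_space[OF meas\<Omega>(3)] integrable_restrict_space[OF meas\<Omega>(3)]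
        integral_completion integrable_completion)
qed

lemma borel_LO: "f \<in> borel_measurable borel \<Longrightarrow> f \<in> borel_measurable LO"
  by (simp add: measurable_restrict_space1 measurable_completion)

lemma sqi_LO:
  fixes f :: "'a \<Rightarrow> 'b::euclidean_space"
  assumes "sqi lborel f" "\<And>x. x \<notin> \<Omega> \<Longrightarrow> f x = 0"
  shows "sqi LO f" "nsq LO f = nsq lborel f"
proof -
  have [measurable]: "f \<in> borel_measurable borel" using assms(1) by (simp add: sqi_def)
  have "integral\<^sup>L LO (\<lambda>x. (norm (f x))\<^sup>2) = integral\<^sup>L lborel (\<lambda>x. (norm (f x))\<^sup>2)"
    "integrable LO (\<lambda>x. (norm (f x))\<^sup>2) \<longleftrightarrow> integrable lborel (\<lambda>x. (norm (f x))\<^sup>2)"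
    by (rule LO_lborel; simp add: assms(2))+
  then show "sqi LO f" "nsq LO f = nsq lborel f"
    using sqiD(2)[OF assms(1)] borel_LO[of f] unfolding sqi_def nsq_def by simp_all
qed

lemma testfun_outside:
  assumes t: "testfun \<Omega> \<phi>" and x: "x \<notin> \<Omega>" shows "\<phi> x = 0" "pd \<phi> h x = 0"
proof -
  obtain K where "K \<subseteq> \<Omega>" "\<And>x. x \<notin> K \<Longrightarrow> \<phi> x = 0" "\<And>x h. x \<notin> K \<Longrightarrow> pd \<phi> h x = 0"
    by (rule testfun_support[OF t]) blast
  then show "\<phi> x = 0" "pd \<phi> h x = 0" using x by blast+
qed

lemma testfun_LO:
  fixes \<phi> :: "'a \<Rightarrow> 'b::euclidean_space"
  assumes "testfun \<Omega> \<phi>"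
  shows "sqi LO \<phi>" "nsq LO \<phi> = nsq lborel \<phi>" "sqi LO (pd \<phi> h)" "nsq LO (pd \<phi> h) = nsq lborel (pd \<phi> h)"
  using sqi_LO[OF testfun_sqi(1)[OF assms]] sqi_LO[OF testfun_sqi(2)[OF assms]] testfun_outside[OF assms] by auto

lemma sqi_const: "sqi LO (\<lambda>x. c)"
  using finite_measure.integrable_const[OF finite_measure_LO] by (simp add: sqi_def)

lemma sqi_integrable:
  fixes u :: "'a \<Rightarrow> 'b::euclidean_space"
  assumes "sqi LO u" shows "integrable LO u"
proof -
  have "integrable LO (\<lambda>x. norm (u x) * norm (1::real))"
    by (rule integral_norm_mult_bound(1)[OF assms sqi_const])
  then show ?thesis using sqiD(1)[OF assms] integrable_norm_iff[of u LO] by simp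
qed

lemma sqi_mult_integrable:
  fixes u :: "'a \<Rightarrow> complex" and g :: "'a \<Rightarrow> real"
  assumes "sqi LO u" "sqi LO g" shows "integrable LO (\<lambda>x. u x * complex_of_real (g x))"
proof -
  note [measurable] = sqiD(1)[OF assms(1)] sqiD(1)[OF assms(2)]
  have "integrable LO (\<lambda>x. norm (u x * complex_of_real (g x)))"
    using integral_norm_mult_bound(1)[OF assms] by (simp add: norm_mult)
  then show ?thesis by (subst (asm) integrable_norm_iff) measurable
qed

lemma sqi_mult_tendsto:
  fixes u :: "'a \<Rightarrow> complex" and g :: "'a \<Rightarrow> real"
  assumes "\<And>n. sqi LO (f n)" "sqi LO u" "sqi LO g" "(\<lambda>n. nsq LO (\<lambda>x. f n x - u x)) \<longlonglongrightarrow> 0"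
  shows "(\<lambda>n. integral\<^sup>L LO (\<lambda>x. f n x * complex_of_real (g x))) \<longlonglongrightarrow> integral\<^sup>L LO (\<lambda>x. u x * complex_of_real (g x))"
proof -
  have "(\<lambda>n. integral\<^sup>L LO (\<lambda>x. f n x * complex_of_real (g x)) - integral\<^sup>L LO (\<lambda>x. u x * complex_of_real (g x))) \<longlonglongrightarrow> 0"
  proof (rule tendsto_0_bound)
    fix n
    have "integral\<^sup>L LO (\<lambda>x. f n x * complex_of_real (g x)) - integral\<^sup>L LO (\<lambda>x. u x * complex_of_real (g x))
       = integral\<^sup>L LO (\<lambda>x. (f n x - u x) * complex_of_real (g x))"
      using Bochner_Integration.integral_diff[OF sqi_mult_integrable[OF assms(1)[of n] assms(3)] sqi_mult_integrable[OF assms(2,3)]]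
      by (simp add: left_diff_distrib)
    also have "norm \<dots> \<le> integral\<^sup>L LO (\<lambda>x. norm (f n x - u x) * norm (g x))"
      using integral_norm_bound[of LO "\<lambda>x. (f n x - u x) * complex_of_real (g x)"] by (simp add: norm_mult)
    also have "\<dots> \<le> sqrt (nsq LO (\<lambda>x. f n x - u x)) * sqrt (nsq LO g)"
      by (rule integral_norm_mult_bound(2)) (use assms in \<open>auto intro: sqi_diff\<close>)
    finally show "norm (integral\<^sup>L LO (\<lambda>x. f n x * complex_of_real (g x)) - integral\<^sup>L LO (\<lambda>x. u x * complex_of_real (g x)))
       \<le> sqrt (nsq LO (\<lambda>x. f n x - u x)) * sqrt (nsq LO g)" .
  next
    show "(\<lambda>n. sqrt (nsq LO (\<lambda>x. f n x - u x)) * sqrt (nsq LO g)) \<longlonglongrightarrow> 0"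
      using tendsto_mult_right[OF tendsto_real_sqrt[OF assms(4)], of "sqrt (nsq LO g)"] by simp
  qed
  then show ?thesis by (simp add: LIM_zero_iff)
qed

text \<open>Bumps converge boundedly to indicators of open boxes, so \<open>h\<close> integrates to
  zero over every open box whose closure lies in \<open>\<Omega>\<close>; countably many such closed
  boxes exhaust \<open>\<Omega>\<close>.\<close>

lemma fundamental_lemma:
  fixes h :: "'a \<Rightarrow> real"
  assumes h: "integrable LO h" and z: "\<And>\<phi> :: 'a \<Rightarrow> real. testfun \<Omega> \<phi> \<Longrightarrow> integral\<^sup>L LO (\<lambda>x. h x * \<phi> x) = 0"
  shows "AE x in LO. h x = 0"
proof -
  define k where "k x = indicator \<Omega> x * h x" for x
  have k: "integrable lebesgue k"
    using h unfolding k_def by (simp add: integrable_restrict_space[OF meas\<Omega>(3)])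
  \<comment> \<open>The lemma on boxes concerns \<open>lborel\<close>, but \<open>h\<close> is only
    Lebesgue measurable; a Borel function equal to it almost everywhere takes its place.\<close>
  then obtain k' where k'm: "k' \<in> borel_measurable lborel" and AEk: "AE x in lborel. k x = k' x"
    using completion_ex_borel_measurable_real[of k lborel] by auto
  have AEk': "AE x in lebesgue. k x = k' x" using AEk by (rule AE_completion)
  have k': "integrable lborel k'"
  proof -
    have "integrable lebesgue k'"
      using k AEk' k'm by (subst integrable_cong_AE[where g = k]) (auto simp: measurable_completion elim: eventually_mono)
    then show ?thesis using k'm by (simp add: integrable_completion)
  qed
  have boxz: "(\<integral>x. indicator (box a c) x * k' x \<partial>lborel) = 0" if ac: "cbox a c \<subseteq> \<Omega>" for a c
  proof -
    have "(\<lambda>n. integral\<^sup>L LO (\<lambda>x. h x * box_bump a c (real (Suc n)) x)) \<longlonglongrightarrow> integral\<^sup>L LO (\<lambda>x. h x * indicator (box a c) x)"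
    proof (rule integral_dominated_convergence[where w = "\<lambda>x. norm (h x)"])
      show "integrable LO (\<lambda>x. norm (h x))" using h by (rule integrable_norm)
      show "AE x in LO. (\<lambda>n. h x * box_bump a c (real (Suc n)) x) \<longlonglongrightarrow> h x * indicator (box a c) x"
        by (intro AE_I2 tendsto_intros box_bump_tendsto)
      show "AE x in LO. norm (h x * box_bump a c (real (Suc n)) x) \<le> norm (h x)" for n
      proof (rule AE_I2)
        fix x
        show "norm (h x * box_bump a c (real (Suc n)) x) \<le> norm (h x)"
          using box_bump_bounds[of a c "real (Suc n)" x] mult_left_mono[of "\<bar>box_bump a c (real (Suc n)) x\<bar>" 1 "\<bar>h x\<bar>"]
          by (simp add: abs_mult)
      qed
      have [measurable]: "h \<in> borel_measurable LO" using h by auto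
      have "(indicator (box a c) :: 'a \<Rightarrow> real) \<in> borel_measurable LO" by (rule borel_LO) simp
      then show "(\<lambda>x. h x * indicator (box a c) x) \<in> borel_measurable LO" by measurable
      have "box_bump a c (real (Suc n)) \<in> borel_measurable LO" for n
        by (rule borel_LO, rule borel_measurable_continuous_onI, rule testfun_cont[of \<Omega>],
            rule testfun_box_bump[OF ac]) simp
      then show "(\<lambda>x. h x * box_bump a c (real (Suc n)) x) \<in> borel_measurable LO" for n by measurable
    qed
    moreover have "integral\<^sup>L LO (\<lambda>x. h x * box_bump a c (real (Suc n)) x) = 0" for n
      by (rule z[OF testfun_box_bump[OF ac]]) simp
    ultimately have "integral\<^sup>L LO (\<lambda>x. h x * indicator (box a c) x) = 0"
      using LIMSEQ_unique[OF _ tendsto_const] by simp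
    moreover have "integral\<^sup>L LO (\<lambda>x. h x * indicator (box a c) x) = integral\<^sup>L lebesgue (\<lambda>x. indicator (box a c) x * k x)"
      by (subst integral_restrict_space[OF meas\<Omega>(3)]) (simp add: k_def mult.commute mult.left_commute)
    moreover have "\<dots> = integral\<^sup>L lebesgue (\<lambda>x. indicator (box a c) x * k' x)"
    proof (rule integral_cong_AE)
      have [measurable]: "k \<in> borel_measurable lebesgue" "k' \<in> borel_measurable lebesgue" "indicat_real (box a c) \<in> borel_measurable lebesgue"
        using k k'm by (auto intro: measurable_completion)
      show "(\<lambda>x. indicator (box a c) x * k x) \<in> borel_measurable lebesgue"
        "(\<lambda>x. indicator (box a c) x * k' x) \<in> borel_measurable lebesgue" by measurable
      show "AE x in lebesgue. indicator (box a c) x * k x = indicator (box a c) x * k' x"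
        using AEk' by eventually_elim simp
    qed
    moreover have "\<dots> = (\<integral>x. indicator (box a c) x * k' x \<partial>lborel)"
      using k'm by (intro integral_completion) auto
    ultimately show ?thesis by simp
  qed
  have AEX: "AE x in lebesgue. x \<in> cbox a c \<longrightarrow> h x = 0" if ac: "cbox a c \<subseteq> \<Omega>" for a c
  proof -
    have "AE x in lborel. x \<in> box a c \<longrightarrow> k' x = 0"
    proof (rule integral_zero_on_boxes_imp_AE[OF k'])
      fix p q :: 'a assume pq: "box p q \<subseteq> box a c"
      show "(\<integral>x. indicator (box p q) x * k' x \<partial>lborel) = 0"
      proof (cases "box p q = {}")
        case False
        then have "cbox p q = closure (box p q)" by (simp add: closure_box)
        also have "\<dots> \<subseteq> cbox a c" using pq box_subset_cbox[of a c] by (meson closure_minimal closed_cbox order_trans)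
        finally show ?thesis using boxz ac by (meson order_trans)
      qed simp
    qed
    then have 1: "AE x in lebesgue. x \<in> box a c \<longrightarrow> k' x = 0" by (rule AE_completion)
    \<comment> \<open>Open boxes were tested, but \<open>\<Omega>\<close> is covered by closed ones;
      the faces are null.\<close>
    have "cbox a c - box a c \<in> null_sets lebesgue"
      using negligible_frontier_interval[of a c] by (simp add: negligible_iff_null_sets)
    then have 2: "AE x in lebesgue. x \<notin> cbox a c - box a c" by (rule AE_not_in)
    show ?thesis using 1 2 AEk' by eventually_elim (use ac in \<open>auto simp: k_def\<close>)
  qed
  obtain D where D: "countable D" "D \<subseteq> Pow \<Omega>" "\<And>X. X \<in> D \<Longrightarrow> \<exists>a b. X = cbox a b" "\<Union>D = \<Omega>"
    using open_countable_Union_open_cbox[OF open\<Omega>] by metis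
  have "AE x in lebesgue. \<forall>X\<in>D. x \<in> X \<longrightarrow> h x = 0"
  proof (subst AE_ball_countable[OF D(1)], rule ballI)
    fix X assume X: "X \<in> D"
    then obtain a c where "X = cbox a c" using D(3) by blast
    then show "AE x in lebesgue. x \<in> X \<longrightarrow> h x = 0" using AEX D(2) X by auto
  qed
  then have "AE x in lebesgue. x \<in> \<Omega> \<longrightarrow> h x = 0" by eventually_elim (use D(4) in blast)
  then show ?thesis by (simp add: AE_restrict_space_iff[OF meas\<Omega>(3)])
qed

text \<open>This makes the choice in \<open>wgrad\<close> harmless: every square-integrable weak
  derivative agrees with it almost everywhere. Test functions are real, so real and imaginary parts
  are treated separately.\<close>

lemma weak_partial_unique:
  assumes "weak_partial \<Omega> u b g1" "weak_partial \<Omega> u b g2" "sqi LO g1" "sqi LO g2"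
  shows "AE x in LO. g1 x = g2 x"
proof -
  have I: "integrable LO (\<lambda>x. g1 x - g2 x)" using assms by (intro sqi_integrable sqi_diff)
  have z: "integral\<^sup>L LO (\<lambda>x. (g1 x - g2 x) * complex_of_real (\<phi> x)) = 0"
    and i: "integrable LO (\<lambda>x. (g1 x - g2 x) * complex_of_real (\<phi> x))" if "testfun \<Omega> \<phi>" for \<phi>
    using assms(1,2) that unfolding weak_partial_def set_int_LO set_integrable_LO by (auto simp: left_diff_distrib)
  have "AE x in LO. Re (g1 x - g2 x) = 0"
  proof (rule fundamental_lemma)
    show "integrable LO (\<lambda>x. Re (g1 x - g2 x))" using I by (rule integrable_Re)
    fix \<phi> :: "'a \<Rightarrow> real" assume "testfun \<Omega> \<phi>"
    then show "integral\<^sup>L LO (\<lambda>x. Re (g1 x - g2 x) * \<phi> x) = 0"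
      using z i integral_Re[of LO "\<lambda>x. (g1 x - g2 x) * complex_of_real (\<phi> x)"] by simp
  qed
  moreover have "AE x in LO. Im (g1 x - g2 x) = 0"
  proof (rule fundamental_lemma)
    show "integrable LO (\<lambda>x. Im (g1 x - g2 x))" using I by (rule integrable_Im)
    fix \<phi> :: "'a \<Rightarrow> real" assume "testfun \<Omega> \<phi>"
    then show "integral\<^sup>L LO (\<lambda>x. Im (g1 x - g2 x) * \<phi> x) = 0"
      using z i integral_Im[of LO "\<lambda>x. (g1 x - g2 x) * complex_of_real (\<phi> x)"] by simp
  qed
  ultimately show ?thesis by eventually_elim (simp add: complex_eq_iff)
qed

lemma testfun_by_parts:
  fixes \<phi> :: "'a \<Rightarrow> complex" and \<psi> :: "'a \<Rightarrow> real"
  assumes \<phi>: "testfun \<Omega> \<phi>" and \<psi>: "testfun \<Omega> \<psi>"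
  shows "integral\<^sup>L LO (\<lambda>x. \<phi> x * complex_of_real (pd \<psi> b x)) = - integral\<^sup>L LO (\<lambda>x. pd \<phi> b x * complex_of_real (\<psi> x))"
proof -
  have \<psi>c: "testfun \<Omega> (\<lambda>x. complex_of_real (\<psi> x))" by (rule testfun_bounded_linear[OF bounded_linear_of_real \<psi>])
  have t: "testfun \<Omega> (\<lambda>x. \<phi> x * complex_of_real (\<psi> x))" by (rule testfun_bilinear[OF bounded_bilinear_mult \<phi> \<psi>c])
  have d: "pd (\<lambda>x. \<phi> x * complex_of_real (\<psi> x)) b x = \<phi> x * complex_of_real (pd \<psi> b x) + pd \<phi> b x * complex_of_real (\<psi> x)" for x
  proof -
    have "pd (\<lambda>x. complex_of_real (\<psi> x)) b x = complex_of_real (pd \<psi> b x)"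
      by (rule pd_bounded_linear[OF bounded_linear_of_real \<psi>])
    then show ?thesis using pd_mult[OF \<phi> \<psi>c] by simp
  qed
  have "0 = integral\<^sup>L lborel (pd (\<lambda>x. \<phi> x * complex_of_real (\<psi> x)) b)" using integral_pd_zero[OF t] by simp
  also have "\<dots> = integral\<^sup>L LO (pd (\<lambda>x. \<phi> x * complex_of_real (\<psi> x)) b)"
    by (rule LO_lborel(1)[symmetric]) (auto intro: borel_measurable_continuous_onI testfun_pd_cont'[OF t] testfun_outside[OF t])
  also have "\<dots> = integral\<^sup>L LO (\<lambda>x. \<phi> x * complex_of_real (pd \<psi> b x)) + integral\<^sup>L LO (\<lambda>x. pd \<phi> b x * complex_of_real (\<psi> x))"
    unfolding d[abs_def] using testfun_LO(1,3)[OF \<phi>] testfun_LO(1,3)[OF \<psi>] by (intro Bochner_Integration.integral_add sqi_mult_integrable)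
  finally show ?thesis by (simp add: eq_neg_iff_add_eq_0)
qed

lemma gradsq_eq:
  assumes "\<And>b. b \<in> Basis \<Longrightarrow> sqi LO (wgrad \<Omega> u b)"
  shows "gradsq \<Omega> u = (\<Sum>b\<in>Basis. nsq LO (wgrad \<Omega> u b))"
  unfolding gradsq_def set_int_LO nsq_def using assms by (intro Bochner_Integration.integral_sum) (auto simp: sqi_def)

text \<open>Together with its converse \<open>H10E\<close> this eliminates weak derivatives: the space is the set of
  limits in mean square of test functions that are Cauchy for the Dirichlet integral.\<close>
lemma H10I:
  assumes u: "sqi LO u" and \<phi>: "\<And>k. testfun \<Omega> (\<phi> k)" and lim: "(\<lambda>k. nsq LO (\<lambda>x. \<phi> k x - u x)) \<longlonglongrightarrow> 0"
    and Cauchy: "\<And>e. e > 0 \<Longrightarrow> \<exists>N. \<forall>m\<ge>N. \<forall>n\<ge>N. tgr (\<lambda>x. \<phi> m x - \<phi> n x) < e"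
  shows "H10 \<Omega> u" "(\<lambda>k. tgr (\<phi> k)) \<longlonglongrightarrow> gradsq \<Omega> u"
proof -
  have "\<exists>g. sqi LO g \<and> (\<lambda>n. nsq LO (\<lambda>x. pd (\<phi> n) b x - g x)) \<longlonglongrightarrow> 0" if b: "b \<in> Basis" for b
  proof -
    have "\<exists>N. \<forall>m\<ge>N. \<forall>n\<ge>N. nsq LO (\<lambda>x. pd (\<phi> m) b x - pd (\<phi> n) b x) < e" if e: "e > 0" for e
    proof -
      obtain N where N: "\<forall>m\<ge>N. \<forall>n\<ge>N. tgr (\<lambda>x. \<phi> m x - \<phi> n x) < e" using Cauchy[OF e] by blast
      have "nsq LO (\<lambda>x. pd (\<phi> m) b x - pd (\<phi> n) b x) \<le> tgr (\<lambda>x. \<phi> m x - \<phi> n x)" for m n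
      proof -
        have "(\<lambda>x. pd (\<phi> m) b x - pd (\<phi> n) b x) = pd (\<lambda>x. \<phi> m x - \<phi> n x) b"
          using pd_diff[OF \<phi> \<phi>] by auto
        then show ?thesis
          using nsq_pd_le_tgr[OF b] testfun_LO(4)[OF testfun_diff[OF \<phi> \<phi>]] by metis
      qed
      then show ?thesis using N by (meson le_less_trans)
    qed
    then obtain g where "sqi LO g" "(\<lambda>n. nsq LO (\<lambda>x. pd (\<phi> n) b x - g x)) \<longlonglongrightarrow> 0"
      by (rule sqi_complete[of LO "\<lambda>n. pd (\<phi> n) b", OF testfun_LO(3)[OF \<phi>]])
    then show ?thesis by blast
  qed
  then have "\<exists>g. \<forall>b\<in>Basis. sqi LO (g b) \<and> (\<lambda>n. nsq LO (\<lambda>x. pd (\<phi> n) b x - g b x)) \<longlonglongrightarrow> 0"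
    by (intro bchoice) blast
  then obtain g where g: "\<And>b. b \<in> Basis \<Longrightarrow> sqi LO (g b)"
    and glim: "\<And>b. b \<in> Basis \<Longrightarrow> (\<lambda>n. nsq LO (\<lambda>x. pd (\<phi> n) b x - g b x)) \<longlonglongrightarrow> 0" by blast
  have wp: "weak_partial \<Omega> u b (g b)" if b: "b \<in> Basis" for b
    unfolding weak_partial_def set_int_LO set_integrable_LO
  proof (intro allI impI conjI)
    fix \<psi> :: "'a \<Rightarrow> real" assume \<psi>: "testfun \<Omega> \<psi>"
    show "integrable LO (\<lambda>x. u x * complex_of_real (pd \<psi> b x))" "integrable LO (\<lambda>x. g b x * complex_of_real (\<psi> x))"
      by (rule sqi_mult_integrable[OF u testfun_LO(3)[OF \<psi>]]) (rule sqi_mult_integrable[OF g[OF b] testfun_LO(1)[OF \<psi>]])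
    have "(\<lambda>n. integral\<^sup>L LO (\<lambda>x. \<phi> n x * complex_of_real (pd \<psi> b x))) \<longlonglongrightarrow> integral\<^sup>L LO (\<lambda>x. u x * complex_of_real (pd \<psi> b x))"
      by (rule sqi_mult_tendsto[OF testfun_LO(1)[OF \<phi>] u testfun_LO(3)[OF \<psi>] lim])
    moreover have "(\<lambda>n. - integral\<^sup>L LO (\<lambda>x. pd (\<phi> n) b x * complex_of_real (\<psi> x))) \<longlonglongrightarrow> - integral\<^sup>L LO (\<lambda>x. g b x * complex_of_real (\<psi> x))"
      by (rule tendsto_minus[OF sqi_mult_tendsto[OF testfun_LO(3)[OF \<phi>] g[OF b] testfun_LO(1)[OF \<psi>] glim[OF b]]])
    ultimately show "integral\<^sup>L LO (\<lambda>x. u x * complex_of_real (pd \<psi> b x)) = - integral\<^sup>L LO (\<lambda>x. g b x * complex_of_real (\<psi> x))"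
      unfolding testfun_by_parts[OF \<phi> \<psi>] by (rule LIMSEQ_unique)
  qed
  have w: "sqi LO (wgrad \<Omega> u b)" "weak_partial \<Omega> u b (wgrad \<Omega> u b)" if b: "b \<in> Basis" for b
    using someI_ex[of "\<lambda>g. L2 \<Omega> g \<and> weak_partial \<Omega> u b g"] wp[OF b] g[OF b] unfolding wgrad_def L2_iff by blast+
  \<comment> \<open>\<open>wgrad\<close> is an unspecified choice; uniqueness identifies it almost
    everywhere with the mean-square limit \<open>g b\<close>.\<close>
  have wlim: "(\<lambda>n. nsq LO (\<lambda>x. pd (\<phi> n) b x - wgrad \<Omega> u b x)) \<longlonglongrightarrow> 0" if b: "b \<in> Basis" for b
  proof -
    have ae: "AE x in LO. g b x = wgrad \<Omega> u b x" using weak_partial_unique wp w g b by blast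
    have "nsq LO (\<lambda>x. pd (\<phi> n) b x - g b x) = nsq LO (\<lambda>x. pd (\<phi> n) b x - wgrad \<Omega> u b x)" for n
      unfolding nsq_def
      by (rule integral_cong_AE[OF borel_measurable_integrable[OF sqiD(2)[OF sqi_diff[OF testfun_LO(3)[OF \<phi>] g[OF b]]]]
            borel_measurable_integrable[OF sqiD(2)[OF sqi_diff[OF testfun_LO(3)[OF \<phi>] w(1)[OF b]]]]])
        (use ae in \<open>auto elim: eventually_mono\<close>)
    then show ?thesis using glim[OF b] by simp
  qed
  have "(\<lambda>k. nsq LO (\<lambda>x. \<phi> k x - u x) + (\<Sum>b\<in>Basis. nsq LO (\<lambda>x. pd (\<phi> k) b x - wgrad \<Omega> u b x))) \<longlonglongrightarrow> 0 + (\<Sum>b\<in>(Basis::'a set). 0)"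
    by (intro tendsto_intros lim wlim)
  moreover have "integral\<^sup>L LO (\<lambda>x. \<Sum>b\<in>Basis. (cmod (pd (\<phi> k) b x - wgrad \<Omega> u b x))\<^sup>2) = (\<Sum>b\<in>Basis. nsq LO (\<lambda>x. pd (\<phi> k) b x - wgrad \<Omega> u b x))" for k
    unfolding nsq_def using sqi_diff[OF testfun_LO(3)[OF \<phi>] w(1)] by (intro Bochner_Integration.integral_sum) (auto simp: sqi_def)
  ultimately show "H10 \<Omega> u"
    unfolding H10_def H1_def L2_iff mass_eq set_int_LO using u \<phi> w by (auto intro!: exI[of _ \<phi>]) blast
  have "(\<lambda>k. \<Sum>b\<in>Basis. nsq LO (pd (\<phi> k) b)) \<longlonglongrightarrow> (\<Sum>b\<in>Basis. nsq LO (wgrad \<Omega> u b))"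
    by (intro tendsto_sum nsq_tendsto_diff testfun_LO(3)[OF \<phi>] w(1) wlim)
  then show "(\<lambda>k. tgr (\<phi> k)) \<longlonglongrightarrow> gradsq \<Omega> u"
    using gradsq_eq[OF w(1)] by (simp add: tgr_def testfun_LO(4)[OF \<phi>])
qed

lemma H10E:
  assumes "H10 \<Omega> u"
  obtains \<phi> where "sqi LO u" "\<And>k. testfun \<Omega> (\<phi> k)" "(\<lambda>k. nsq LO (\<lambda>x. \<phi> k x - u x)) \<longlonglongrightarrow> 0"
    "\<And>e. e > 0 \<Longrightarrow> \<exists>N. \<forall>m\<ge>N. \<forall>n\<ge>N. tgr (\<lambda>x. \<phi> m x - \<phi> n x) < e" "(\<lambda>k. tgr (\<phi> k)) \<longlonglongrightarrow> gradsq \<Omega> u"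
proof -
  have u: "sqi LO u" using assms unfolding H10_def H1_def L2_iff by blast
  have w: "sqi LO (wgrad \<Omega> u b)" if b: "b \<in> Basis" for b
    using someI_ex[of "\<lambda>g. L2 \<Omega> g \<and> weak_partial \<Omega> u b g"] assms b unfolding wgrad_def H10_def H1_def L2_iff by blast
  obtain \<phi> where \<phi>: "\<And>k. testfun \<Omega> (\<phi> k)" and lim: "(\<lambda>k. nsq LO (\<lambda>x. \<phi> k x - u x) + integral\<^sup>L LO (\<lambda>x. \<Sum>b\<in>Basis. (cmod (pd (\<phi> k) b x - wgrad \<Omega> u b x))\<^sup>2)) \<longlonglongrightarrow> 0"
    using assms unfolding H10_def mass_eq set_int_LO by blast
  define S where "S k = (\<Sum>b\<in>Basis. nsq LO (\<lambda>x. pd (\<phi> k) b x - wgrad \<Omega> u b x))" for k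
  have S: "integral\<^sup>L LO (\<lambda>x. \<Sum>b\<in>Basis. (cmod (pd (\<phi> k) b x - wgrad \<Omega> u b x))\<^sup>2) = S k" for k
    unfolding nsq_def S_def using sqi_diff[OF testfun_LO(3)[OF \<phi>] w] by (intro Bochner_Integration.integral_sum) (auto simp: sqi_def)
  have S0: "S k \<ge> 0" for k unfolding S_def by (simp add: sum_nonneg)
  have l1: "(\<lambda>k. nsq LO (\<lambda>x. \<phi> k x - u x)) \<longlonglongrightarrow> 0"
    by (rule tendsto_0_bound[OF _ lim]) (use S S0 in auto)
  have l2: "S \<longlonglongrightarrow> 0"
    by (rule tendsto_0_bound[OF _ lim]) (use S S0 in auto)
  have le: "tgr (\<lambda>x. \<phi> m x - \<phi> n x) \<le> 2 * S m + 2 * S n" for m n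
  proof -
    have "nsq lborel (pd (\<lambda>x. \<phi> m x - \<phi> n x) b) \<le> 2 * nsq LO (\<lambda>x. pd (\<phi> m) b x - wgrad \<Omega> u b x) + 2 * nsq LO (\<lambda>x. pd (\<phi> n) b x - wgrad \<Omega> u b x)"
      if b: "b \<in> Basis" for b
    proof -
      have s: "sqi LO (\<lambda>x. pd (\<phi> k) b x - wgrad \<Omega> u b x)" for k using sqi_diff[OF testfun_LO(3)[OF \<phi>] w[OF b]] .
      have eq: "pd (\<lambda>x. \<phi> m x - \<phi> n x) b x = (pd (\<phi> m) b x - wgrad \<Omega> u b x) + (- 1) *\<^sub>R (pd (\<phi> n) b x - wgrad \<Omega> u b x)" for x
        using pd_diff[OF \<phi> \<phi>] by simp
      have "nsq lborel (pd (\<lambda>x. \<phi> m x - \<phi> n x) b) = nsq LO (pd (\<lambda>x. \<phi> m x - \<phi> n x) b)"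
        using testfun_LO(4)[OF testfun_diff[OF \<phi> \<phi>]] by simp
      also have "\<dots> \<le> integral\<^sup>L LO (\<lambda>x. 2 * (norm (pd (\<phi> m) b x - wgrad \<Omega> u b x))\<^sup>2 + 2 * (norm ((- 1) *\<^sub>R (pd (\<phi> n) b x - wgrad \<Omega> u b x)))\<^sup>2)"
        unfolding nsq_def
      proof (rule integral_mono)
        show "integrable LO (\<lambda>x. (cmod (pd (\<lambda>x. \<phi> m x - \<phi> n x) b x))\<^sup>2)"
          using testfun_LO(3)[OF testfun_diff[OF \<phi> \<phi>]] by (simp add: sqi_def)
        show "integrable LO (\<lambda>x. 2 * (norm (pd (\<phi> m) b x - wgrad \<Omega> u b x))\<^sup>2 + 2 * (norm ((- 1) *\<^sub>R (pd (\<phi> n) b x - wgrad \<Omega> u b x)))\<^sup>2)"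
          using s by (simp add: sqi_def norm_minus_commute)
        show "(cmod (pd (\<lambda>x. \<phi> m x - \<phi> n x) b x))\<^sup>2 \<le> 2 * (norm (pd (\<phi> m) b x - wgrad \<Omega> u b x))\<^sup>2 + 2 * (norm ((- 1) *\<^sub>R (pd (\<phi> n) b x - wgrad \<Omega> u b x)))\<^sup>2" for x
          unfolding eq by (rule norm_add_sq_le)
      qed
      also have "\<dots> = 2 * nsq LO (\<lambda>x. pd (\<phi> m) b x - wgrad \<Omega> u b x) + 2 * nsq LO (\<lambda>x. pd (\<phi> n) b x - wgrad \<Omega> u b x)"
        using s by (simp add: nsq_def sqi_def norm_minus_commute)
      finally show ?thesis .
    qed
    then have "tgr (\<lambda>x. \<phi> m x - \<phi> n x) \<le> (\<Sum>b\<in>Basis. 2 * nsq LO (\<lambda>x. pd (\<phi> m) b x - wgrad \<Omega> u b x) + 2 * nsq LO (\<lambda>x. pd (\<phi> n) b x - wgrad \<Omega> u b x))"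
      unfolding tgr_def by (intro sum_mono)
    then show ?thesis by (simp add: S_def sum.distrib sum_distrib_left)
  qed
  have C: "\<exists>N. \<forall>m\<ge>N. \<forall>n\<ge>N. tgr (\<lambda>x. \<phi> m x - \<phi> n x) < e" if e: "e > 0" for e
  proof -
    obtain N where N: "\<And>n. n \<ge> N \<Longrightarrow> S n < e / 4"
      using order_tendstoD(2)[OF l2, of "e / 4"] e unfolding eventually_sequentially by auto
    have "tgr (\<lambda>x. \<phi> m x - \<phi> n x) < e" if "m \<ge> N" "n \<ge> N" for m n
      using le[of m n] N[OF that(1)] N[OF that(2)] by linarith
    then show ?thesis by blast
  qed
  show thesis using that[OF u \<phi> l1 C H10I(2)[OF u \<phi> l1 C]] .
qed

end

subsection \<open>Poincare inequality and Rellich compactness\<close>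

lemma nsq_pd_le:
  fixes \<phi> :: "'a::euclidean_space \<Rightarrow> 'b::euclidean_space"
  assumes "testfun A \<phi>" shows "nsq lborel (pd \<phi> h) \<le> (norm h)\<^sup>2 * tgr \<phi>"
proof -
  have i: "integrable lborel (\<lambda>x. (norm (pd \<phi> b x))\<^sup>2)" for b
    using testfun_sqi(2)[OF assms] by (simp add: sqi_def)
  have "(norm (pd \<phi> h x))\<^sup>2 \<le> (norm h)\<^sup>2 * (\<Sum>b\<in>Basis. (norm (pd \<phi> b x))\<^sup>2)" for x
  proof -
    have "norm (pd \<phi> h x) \<le> (\<Sum>b\<in>Basis. \<bar>h \<bullet> b\<bar> * norm (pd \<phi> b x))"
      unfolding pd_expand[OF assms, of h] by (rule order_trans[OF norm_sum]) simp
    then have "(norm (pd \<phi> h x))\<^sup>2 \<le> (\<Sum>b\<in>Basis. \<bar>h \<bullet> b\<bar> * norm (pd \<phi> b x))\<^sup>2"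
      by (rule power_mono) simp
    also have "\<dots> \<le> (\<Sum>b\<in>Basis. \<bar>h \<bullet> b\<bar>\<^sup>2) * (\<Sum>b\<in>Basis. (norm (pd \<phi> b x))\<^sup>2)"
      by (rule Cauchy_Schwarz_ineq_sum)
    also have "(\<Sum>b\<in>Basis. \<bar>h \<bullet> b\<bar>\<^sup>2) = (norm h)\<^sup>2"
      unfolding power2_norm_eq_inner euclidean_inner[of h h] by (simp add: power2_eq_square)
    finally show ?thesis .
  qed
  then have "nsq lborel (pd \<phi> h) \<le> (\<integral>x. (norm h)\<^sup>2 * (\<Sum>b\<in>Basis. (norm (pd \<phi> b x))\<^sup>2) \<partial>lborel)"
    unfolding nsq_def using i by (intro integral_mono) auto
  also have "\<dots> = (norm h)\<^sup>2 * tgr \<phi>" using i by (simp add: tgr_def nsq_def)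
  finally show ?thesis .
qed

lemma translation_tgr:
  fixes \<phi> :: "'a::euclidean_space \<Rightarrow> 'b::euclidean_space"
  assumes "testfun A \<phi>" shows "nsq lborel (\<lambda>x. \<phi> (x + h) - \<phi> x) \<le> (norm h)\<^sup>2 * tgr \<phi>"
  using translation_estimate[OF assms] nsq_pd_le[OF assms] by (rule order_trans)

text \<open>A translate with disjoint support doubles the mass of the difference.\<close>
lemma poincare_test:
  fixes \<phi> :: "'a::euclidean_space \<Rightarrow> 'b::euclidean_space"
  assumes \<phi>: "testfun A \<phi>" and h: "\<And>x. x \<in> A \<Longrightarrow> x + h \<notin> A"
  shows "2 * nsq lborel \<phi> \<le> (norm h)\<^sup>2 * tgr \<phi>"
proof -
  have z: "x \<notin> A \<Longrightarrow> \<phi> x = 0" for x using \<phi> unfolding testfun_def by blast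
  have s: "sqi lborel \<phi>" "sqi lborel (\<lambda>x. \<phi> (x + h))" using testfun_sqi(1)[OF \<phi>] sqi_shift by auto
  have "(norm (\<phi> (x + h) - \<phi> x))\<^sup>2 = (norm (\<phi> (x + h)))\<^sup>2 + (norm (\<phi> x))\<^sup>2" for x
    using z[of x] z[of "x + h"] h[of x] by (cases "x \<in> A") auto
  then have "nsq lborel (\<lambda>x. \<phi> (x + h) - \<phi> x) = nsq lborel (\<lambda>x. \<phi> (x + h)) + nsq lborel \<phi>"
    using s by (simp add: nsq_def sqi_def)
  then show ?thesis using translation_tgr[OF \<phi>, of h] sqi_shift(2)[OF s(1)] by simp
qed

text \<open>The mean of \<open>\<phi>\<close> over the cube of side \<open>r\<close> with corner
  \<open>x\<close>. The cube is kept fixed and \<open>\<phi>\<close> is shifted, so that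
  \<open>x\<close> enters through translation alone. These means are the equicontinuous approximants
  in Rellich's theorem.\<close>

definition cube_avg :: "real \<Rightarrow> ('a::euclidean_space \<Rightarrow> complex) \<Rightarrow> 'a \<Rightarrow> complex" where
  "cube_avg r \<phi> x = (\<integral>y. indicator (cbox 0 (r *\<^sub>R One)) y *\<^sub>R \<phi> (x + y) \<partial>lborel) /\<^sub>R r ^ DIM('a)"

context
  fixes r :: real and A :: "'a::euclidean_space set" and \<phi> :: "'a \<Rightarrow> complex"
  assumes r: "r > 0" and \<phi>: "testfun A \<phi>"
begin

private abbreviation "Q \<equiv> (cbox 0 (r *\<^sub>R One) :: 'a set)"

private lemma Vpos: "(r ^ DIM('a)) > 0" using r by simp

private lemma emQ: "emeasure lborel Q = ennreal (r ^ DIM('a))" "Q \<in> sets lborel"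
  using r by (auto simp: emeasure_lborel_cbox_eq inner_Basis inner_sum_left ennreal_power)

private lemma sqiQ: "sqi lborel (indicator Q :: 'a \<Rightarrow> real)" "nsq lborel (indicator Q :: 'a \<Rightarrow> real) = (r ^ DIM('a))"
proof -
  have e: "(\<lambda>x. (norm (indicator Q x :: real))\<^sup>2) = indicator Q" by (auto simp: indicator_def)
  have m: "measure lborel Q = (r ^ DIM('a))" using emQ(1) Vpos by (simp add: measure_def)
  show "sqi lborel (indicator Q :: 'a \<Rightarrow> real)" unfolding sqi_def e using emQ by auto
  show "nsq lborel (indicator Q :: 'a \<Rightarrow> real) = (r ^ DIM('a))" unfolding nsq_def e using m by simp
qed

private lemma sqi\<phi>: "sqi lborel (\<lambda>y. \<phi> (x + y))" "nsq lborel (\<lambda>y. \<phi> (x + y)) = nsq lborel \<phi>"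
  using sqi_shift[OF testfun_sqi(1)[OF \<phi>], of x] by (simp_all add: add.commute)

private lemma intQ:
  fixes f :: "'a \<Rightarrow> complex"
  assumes "sqi lborel f"
  shows "integrable lborel (\<lambda>y. indicator Q y *\<^sub>R f y)"
    "norm ((\<integral>y. indicator Q y *\<^sub>R f y \<partial>lborel) /\<^sub>R (r ^ DIM('a))) \<le> sqrt (nsq lborel f) / sqrt (r ^ DIM('a))"
proof -
  have [measurable]: "f \<in> borel_measurable borel" using assms by (simp add: sqi_def)
  have i: "integrable lborel (\<lambda>y. norm (indicator Q y :: real) * norm (f y))"
    by (rule integral_norm_mult_bound(1)[OF sqiQ(1) assms])
  then have "integrable lborel (\<lambda>y. norm (indicator Q y *\<^sub>R f y))" by simp
  then show "integrable lborel (\<lambda>y. indicator Q y *\<^sub>R f y)"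
    by (rule integrable_norm_cancel) measurable
  have "norm (\<integral>y. indicator Q y *\<^sub>R f y \<partial>lborel) \<le> (\<integral>y. norm (indicator Q y :: real) * norm (f y) \<partial>lborel)"
    using integral_norm_bound[of lborel "\<lambda>y. indicator Q y *\<^sub>R f y"] by simp
  also have "\<dots> \<le> sqrt (r ^ DIM('a)) * sqrt (nsq lborel f)"
    using integral_norm_mult_bound(2)[OF sqiQ(1) assms] by (simp only: sqiQ(2))
  finally have "norm (\<integral>y. indicator Q y *\<^sub>R f y \<partial>lborel) / (r ^ DIM('a)) \<le> sqrt (r ^ DIM('a)) * sqrt (nsq lborel f) / (r ^ DIM('a))"
    using Vpos by (intro divide_right_mono) auto
  also have "\<dots> = sqrt (nsq lborel f) / sqrt (r ^ DIM('a))"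
  proof -
    have "sqrt (r ^ DIM('a)) * sqrt (r ^ DIM('a)) = (r ^ DIM('a))" using Vpos by simp
    then show ?thesis using Vpos by (metis (no_types) mult.commute mult_divide_mult_cancel_left real_sqrt_gt_0_iff less_numeral_extra(3))
  qed
  finally show "norm ((\<integral>y. indicator Q y *\<^sub>R f y \<partial>lborel) /\<^sub>R (r ^ DIM('a))) \<le> sqrt (nsq lborel f) / sqrt (r ^ DIM('a))"
    using Vpos by (simp add: divide_inverse mult.commute)
qed

lemma cube_avg_bound: "norm (cube_avg r \<phi> x) \<le> sqrt (nsq lborel \<phi>) / sqrt (r ^ DIM('a))"
  unfolding cube_avg_def using intQ(2)[OF sqi\<phi>(1)[of x]] by (simp only: sqi\<phi>(2))

text \<open>A difference of two averages is the average of a translated difference, so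
  Cauchy--Schwarz on the cube converts the mean-square translation estimate into a pointwise
  Lipschitz bound.\<close>

lemma cube_avg_lipschitz:
  "norm (cube_avg r \<phi> x - cube_avg r \<phi> x') \<le> norm (x - x') * (sqrt (tgr \<phi>) / sqrt (r ^ DIM('a)))"
proof -
  have "nsq lborel (\<lambda>y. \<phi> (x + y) - \<phi> (x' + y)) = nsq lborel (\<lambda>y. \<phi> ((y + x') + (x - x')) - \<phi> (y + x'))"
    by (simp add: add.commute)
  also have "\<dots> = nsq lborel (\<lambda>y. \<phi> (y + (x - x')) - \<phi> y)"
    by (rule sqi_shift(2)[of "\<lambda>y. \<phi> (y + (x - x')) - \<phi> y"]) (intro sqi_diff sqi_shift testfun_sqi(1)[OF \<phi>])
  also have "\<dots> \<le> (norm (x - x'))\<^sup>2 * tgr \<phi>" by (rule translation_tgr[OF \<phi>])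
  finally have "sqrt (nsq lborel (\<lambda>y. \<phi> (x + y) - \<phi> (x' + y))) \<le> sqrt ((norm (x - x'))\<^sup>2 * tgr \<phi>)"
    by (rule real_sqrt_le_mono)
  then have le: "sqrt (nsq lborel (\<lambda>y. \<phi> (x + y) - \<phi> (x' + y))) \<le> norm (x - x') * sqrt (tgr \<phi>)"
    by (simp add: real_sqrt_mult)
  have "cube_avg r \<phi> x - cube_avg r \<phi> x' = (\<integral>y. indicator Q y *\<^sub>R (\<phi> (x + y) - \<phi> (x' + y)) \<partial>lborel) /\<^sub>R (r ^ DIM('a))"
    unfolding cube_avg_def using intQ(1)[OF sqi\<phi>(1)] by (simp add: scaleR_diff_right)
  also have "norm \<dots> \<le> sqrt (nsq lborel (\<lambda>y. \<phi> (x + y) - \<phi> (x' + y))) / sqrt (r ^ DIM('a))"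
    by (rule intQ(2)) (intro sqi_diff sqi\<phi>)
  also have "\<dots> \<le> (norm (x - x') * sqrt (tgr \<phi>)) / sqrt (r ^ DIM('a))" using le Vpos by (intro divide_right_mono) auto
  finally show ?thesis by simp
qed

lemma cube_avg_continuous: "continuous_on UNIV (cube_avg r \<phi>)"
proof -
  define L where "L = sqrt (tgr \<phi>) / sqrt (r ^ DIM('a))"
  have "L \<ge> 0" using Vpos by (simp add: L_def)
  have "lipschitz_on L UNIV (cube_avg r \<phi>)"
    by (rule lipschitz_onI) (use cube_avg_lipschitz \<open>L \<ge> 0\<close> in \<open>auto simp: dist_norm L_def mult.commute\<close>)
  then show ?thesis by (rule lipschitz_on_continuous_on)
qed

text \<open>The squared error at a point is at most the mean over the cube of the squared
  differences. Tonelli exchanges that mean with the integral in \<open>x\<close>, and each shift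
  \<open>y\<close> in the cube costs at most \<open>(norm y)\<^sup>2 * tgr \<phi>\<close> with
  \<open>(norm y)\<^sup>2\<close> bounded by \<open>DIM('a) * r\<^sup>2\<close>.\<close>

lemma cube_avg_approx:
  "sqi lborel (\<lambda>x. cube_avg r \<phi> x - \<phi> x)" "nsq lborel (\<lambda>x. cube_avg r \<phi> x - \<phi> x) \<le> real DIM('a) * r\<^sup>2 * tgr \<phi>"
proof -
  have [measurable]: "\<phi> \<in> borel_measurable borel" "cube_avg r \<phi> \<in> borel_measurable borel"
    using testfun_cont[OF \<phi>] cube_avg_continuous by (auto intro: borel_measurable_continuous_onI)
  obtain B where B: "\<And>x. norm (\<phi> x) \<le> B" by (rule testfun_shift_bound[OF \<phi>, of 0]) blast
  have pt: "ennreal ((norm (cube_avg r \<phi> x - \<phi> x))\<^sup>2) \<le> (\<integral>\<^sup>+y. ennreal (indicator Q y / (r ^ DIM('a))) * ennreal ((norm (\<phi> (x + y) - \<phi> x))\<^sup>2) \<partial>lborel)" for x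
  proof -
    define f where "f y = indicator Q y *\<^sub>R (\<phi> (x + y) - \<phi> x)" for y
    have fm[measurable]: "f \<in> borel_measurable borel" unfolding f_def by measurable
    have iQ: "integrable lborel (\<lambda>y. indicator Q y * (2 * B)\<^sup>2)" using emQ by (intro integrable_mult_left) auto
    have nf: "(norm (f y))\<^sup>2 = indicator Q y * (norm (\<phi> (x + y) - \<phi> x))\<^sup>2" for y
      by (auto simp: f_def indicator_def)
    have "(norm (\<phi> (x + y) - \<phi> x))\<^sup>2 \<le> (2 * B)\<^sup>2" for y
      using norm_triangle_ineq4[of "\<phi> (x + y)" "\<phi> x"] B[of "x + y"] B[of x] by (intro power_mono) auto
    then have fi: "integrable lborel (\<lambda>y. (norm (f y))\<^sup>2)"
      by (intro Bochner_Integration.integrable_bound[OF iQ]) (auto simp: nf indicator_def)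
    then have fs: "sqi lborel f" by (simp add: sqi_def)
    have "(\<integral>y. indicator Q y *\<^sub>R \<phi> x \<partial>lborel) = (r ^ DIM('a)) *\<^sub>R \<phi> x"
      using emQ Vpos by (simp add: measure_def)
    moreover have "integrable lborel (\<lambda>y. indicator Q y *\<^sub>R \<phi> x)" using emQ by (intro integrable_scaleR_left) auto
    ultimately have "(\<integral>y. f y \<partial>lborel) = (\<integral>y. indicator Q y *\<^sub>R \<phi> (x + y) \<partial>lborel) - (r ^ DIM('a)) *\<^sub>R \<phi> x"
      unfolding f_def using intQ(1)[OF sqi\<phi>(1)[of x]] by (simp add: scaleR_diff_right)
    moreover have "indicator Q y *\<^sub>R f y = f y" for y by (auto simp: f_def indicator_def)
    ultimately have "cube_avg r \<phi> x - \<phi> x = (\<integral>y. indicator Q y *\<^sub>R f y \<partial>lborel) /\<^sub>R (r ^ DIM('a))"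
      using left_inverse[OF less_imp_neq[OF Vpos, symmetric]] by (simp add: cube_avg_def scaleR_diff_right)
    then have "norm (cube_avg r \<phi> x - \<phi> x) \<le> sqrt (nsq lborel f) / sqrt (r ^ DIM('a))" using intQ(2)[OF fs] by simp
    then have "(norm (cube_avg r \<phi> x - \<phi> x))\<^sup>2 \<le> (sqrt (nsq lborel f) / sqrt (r ^ DIM('a)))\<^sup>2" by (rule power_mono) simp
    also have "\<dots> = nsq lborel f / (r ^ DIM('a))" using Vpos by (simp add: power_divide)
    also have "\<dots> = (\<integral>y. (norm (f y))\<^sup>2 / (r ^ DIM('a)) \<partial>lborel)" by (simp add: nsq_def)
    finally have "ennreal ((norm (cube_avg r \<phi> x - \<phi> x))\<^sup>2) \<le> ennreal (\<integral>y. (norm (f y))\<^sup>2 / (r ^ DIM('a)) \<partial>lborel)" by (rule ennreal_leI)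
    also have "\<dots> = (\<integral>\<^sup>+y. ennreal ((norm (f y))\<^sup>2 / (r ^ DIM('a))) \<partial>lborel)"
      using fi Vpos by (intro nn_integral_eq_integral[symmetric]) auto
    also have "\<dots> = (\<integral>\<^sup>+y. ennreal (indicator Q y / (r ^ DIM('a))) * ennreal ((norm (\<phi> (x + y) - \<phi> x))\<^sup>2) \<partial>lborel)"
      using Vpos by (intro nn_integral_cong) (simp add: nf ennreal_mult[symmetric])
    finally show ?thesis .
  qed
  have inner: "(\<integral>\<^sup>+x. ennreal ((norm (\<phi> (x + y) - \<phi> x))\<^sup>2) \<partial>lborel) \<le> ennreal (real DIM('a) * r\<^sup>2 * tgr \<phi>)" if y: "y \<in> Q" for y
  proof -
    have s: "sqi lborel (\<lambda>x. \<phi> (x + y) - \<phi> x)" by (intro sqi_diff sqi_shift testfun_sqi(1)[OF \<phi>])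
    have "(norm y)\<^sup>2 = (\<Sum>b\<in>Basis. (y \<bullet> b)\<^sup>2)"
      unfolding power2_norm_eq_inner euclidean_inner[of y y] by (simp add: power2_eq_square)
    also have "\<dots> \<le> (\<Sum>b\<in>(Basis::'a set). r\<^sup>2)"
      using y by (intro sum_mono power_mono) (auto simp: mem_box inner_Basis inner_sum_left)
    finally have "(norm y)\<^sup>2 \<le> real DIM('a) * r\<^sup>2" by simp
    then have "nsq lborel (\<lambda>x. \<phi> (x + y) - \<phi> x) \<le> real DIM('a) * r\<^sup>2 * tgr \<phi>"
      using translation_tgr[OF \<phi>, of y] by (meson mult_right_mono order_trans tgr_nonneg)
    moreover have "(\<integral>\<^sup>+x. ennreal ((norm (\<phi> (x + y) - \<phi> x))\<^sup>2) \<partial>lborel) = ennreal (nsq lborel (\<lambda>x. \<phi> (x + y) - \<phi> x))"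
      unfolding nsq_def using s by (intro nn_integral_eq_integral) (auto simp: sqi_def)
    ultimately show ?thesis by (simp add: ennreal_leI)
  qed
  have "(\<integral>\<^sup>+x. ennreal ((norm (cube_avg r \<phi> x - \<phi> x))\<^sup>2) \<partial>lborel)
      \<le> (\<integral>\<^sup>+x. \<integral>\<^sup>+y. ennreal (indicator Q y / (r ^ DIM('a))) * ennreal ((norm (\<phi> (x + y) - \<phi> x))\<^sup>2) \<partial>lborel \<partial>lborel)"
    by (intro nn_integral_mono pt)
  also have "\<dots> = (\<integral>\<^sup>+y. \<integral>\<^sup>+x. ennreal (indicator Q y / (r ^ DIM('a))) * ennreal ((norm (\<phi> (x + y) - \<phi> x))\<^sup>2) \<partial>lborel \<partial>lborel)"
    by (rule lborel_pair.Fubini') measurable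
  also have "\<dots> = (\<integral>\<^sup>+y. ennreal (indicator Q y / (r ^ DIM('a))) * (\<integral>\<^sup>+x. ennreal ((norm (\<phi> (x + y) - \<phi> x))\<^sup>2) \<partial>lborel) \<partial>lborel)"
    by (intro nn_integral_cong nn_integral_cmult) measurable
  also have "\<dots> \<le> (\<integral>\<^sup>+y. ennreal (real DIM('a) * r\<^sup>2 * tgr \<phi> / (r ^ DIM('a))) * indicator Q y \<partial>lborel)"
  proof (intro nn_integral_mono)
    fix y
    show "ennreal (indicator Q y / (r ^ DIM('a))) * (\<integral>\<^sup>+x. ennreal ((norm (\<phi> (x + y) - \<phi> x))\<^sup>2) \<partial>lborel) \<le> ennreal (real DIM('a) * r\<^sup>2 * tgr \<phi> / (r ^ DIM('a))) * indicator Q y"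
    proof (cases "y \<in> Q")
      case True
      have "ennreal (1 / (r ^ DIM('a))) * (\<integral>\<^sup>+x. ennreal ((norm (\<phi> (x + y) - \<phi> x))\<^sup>2) \<partial>lborel) \<le> ennreal (1 / (r ^ DIM('a))) * ennreal (real DIM('a) * r\<^sup>2 * tgr \<phi>)"
        by (intro mult_left_mono inner[OF True]) simp
      also have "\<dots> = ennreal (real DIM('a) * r\<^sup>2 * tgr \<phi> / (r ^ DIM('a)))"
        using Vpos by (subst ennreal_mult[symmetric]) auto
      finally show ?thesis using True by simp
    qed simp
  qed
  also have "\<dots> = ennreal (real DIM('a) * r\<^sup>2 * tgr \<phi> / (r ^ DIM('a))) * ennreal (r ^ DIM('a))" using emQ by (simp add: nn_integral_cmult_indicator)
  also have "\<dots> = ennreal (real DIM('a) * r\<^sup>2 * tgr \<phi>)" using Vpos by (subst ennreal_mult[symmetric]) auto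
  finally have *: "(\<integral>\<^sup>+x. ennreal ((norm (cube_avg r \<phi> x - \<phi> x))\<^sup>2) \<partial>lborel) \<le> ennreal (real DIM('a) * r\<^sup>2 * tgr \<phi>)" .
  then have "(\<integral>\<^sup>+x. ennreal ((norm (cube_avg r \<phi> x - \<phi> x))\<^sup>2) \<partial>lborel) < \<infinity>"
    using ennreal_less_top le_less_trans infinity_ennreal_def by metis
  then have i: "integrable lborel (\<lambda>x. (norm (cube_avg r \<phi> x - \<phi> x))\<^sup>2)"
    by (intro integrableI_bounded) auto
  then show "sqi lborel (\<lambda>x. cube_avg r \<phi> x - \<phi> x)" by (simp add: sqi_def)
  have "(\<integral>\<^sup>+x. ennreal ((norm (cube_avg r \<phi> x - \<phi> x))\<^sup>2) \<partial>lborel) = ennreal (nsq lborel (\<lambda>x. cube_avg r \<phi> x - \<phi> x))"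
    unfolding nsq_def using i by (intro nn_integral_eq_integral) auto
  then show "nsq lborel (\<lambda>x. cube_avg r \<phi> x - \<phi> x) \<le> real DIM('a) * r\<^sup>2 * tgr \<phi>"
    using * by (simp add: ennreal_le_iff)
qed

end

context bounded_open
begin

lemma poincare_ex: "\<exists>C>0. \<forall>\<phi> :: 'a \<Rightarrow> complex. testfun \<Omega> \<phi> \<longrightarrow> nsq lborel \<phi> \<le> C * tgr \<phi>"
proof -
  obtain R where R: "\<And>x. x \<in> \<Omega> \<Longrightarrow> norm x \<le> R" using bounded\<Omega> unfolding bounded_iff by blast
  obtain b :: 'a where b: "b \<in> Basis" using nonempty_Basis by blast
  \<comment> \<open>A shift longer than the diameter moves every point of \<open>\<Omega>\<close>
    out of \<open>\<Omega>\<close>; the extra 1 makes this strict and the constant positive.\<close>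
  define h where "h = (2 * \<bar>R\<bar> + 1) *\<^sub>R b"
  have nh: "norm h = 2 * \<bar>R\<bar> + 1" using b by (simp add: h_def)
  have "x + h \<notin> \<Omega>" if "x \<in> \<Omega>" for x
  proof
    assume "x + h \<in> \<Omega>"
    then show False using R[of "x + h"] R[of x] that norm_triangle_ineq4[of "x + h" x] nh by simp
  qed
  then have "nsq lborel \<phi> \<le> ((norm h)\<^sup>2 / 2) * tgr \<phi>" if "testfun \<Omega> \<phi>" for \<phi> :: "'a \<Rightarrow> complex"
    using poincare_test[OF that, of h] by simp
  moreover have "(norm h)\<^sup>2 / 2 > 0" unfolding nh by simp
  ultimately show ?thesis by blast
qed

lemma nsq_LO_le_lborel:
  fixes f :: "'a \<Rightarrow> 'b::euclidean_space"
  assumes "sqi lborel f" shows "sqi LO f" "nsq LO f \<le> nsq lborel f"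
proof -
  have [measurable]: "f \<in> borel_measurable borel" using assms by (simp add: sqi_def)
  have i: "integrable lebesgue (\<lambda>x. (norm (f x))\<^sup>2)" using assms by (simp add: sqi_def integrable_completion)
  have i2: "integrable lebesgue (\<lambda>x. indicator \<Omega> x *\<^sub>R (norm (f x))\<^sup>2)"
    using integrable_mult_indicator[OF meas\<Omega>(1) i] .
  then have "integrable LO (\<lambda>x. (norm (f x))\<^sup>2)" by (simp add: integrable_restrict_space[OF meas\<Omega>(3)])
  then show "sqi LO f" using borel_LO[of f] by (simp add: sqi_def)
  have "nsq LO f = integral\<^sup>L lebesgue (\<lambda>x. indicator \<Omega> x *\<^sub>R (norm (f x))\<^sup>2)"
    unfolding nsq_def by (rule integral_restrict_space[OF meas\<Omega>(3)])
  also have "\<dots> \<le> integral\<^sup>L lebesgue (\<lambda>x. (norm (f x))\<^sup>2)"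
    using i i2 by (intro integral_mono) (auto simp: indicator_def)
  also have "\<dots> = nsq lborel f" unfolding nsq_def by (intro integral_completion) measurable
  finally show "nsq LO f \<le> nsq lborel f" .
qed

lemma nsq_LO_bounded:
  fixes f :: "'a \<Rightarrow> 'b::euclidean_space"
  assumes "f \<in> borel_measurable LO" "\<And>x. x \<in> \<Omega> \<Longrightarrow> norm (f x) \<le> B"
  shows "sqi LO f" "nsq LO f \<le> B\<^sup>2 * measure LO \<Omega>"
proof -
  interpret finite_measure LO by (rule finite_measure_LO)
  have le: "(norm (f x))\<^sup>2 \<le> B\<^sup>2" if "x \<in> \<Omega>" for x using assms(2)[OF that] by (intro power_mono) auto
  have i: "integrable LO (\<lambda>x. (norm (f x))\<^sup>2)"
    by (rule integrable_const_bound[of _ "B\<^sup>2"]) (use assms(1) le in \<open>auto intro!: AE_I2\<close>)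
  then show "sqi LO f" using assms(1) by (simp add: sqi_def)
  have "nsq LO f \<le> integral\<^sup>L LO (\<lambda>x. B\<^sup>2)" unfolding nsq_def using i le by (intro integral_mono) auto
  then show "nsq LO f \<le> B\<^sup>2 * measure LO \<Omega>" by (simp add: mult.commute)
qed

text \<open>For one tolerance \<open>e\<close>: averages over small cubes are close in mean square,
  and Arzela--Ascoli on the compact closure makes a subsequence of the averages converge uniformly.
  The side of the cube depends on \<open>e\<close>, so the full statement needs a diagonal
  sequence.\<close>

lemma rellich_step:
  fixes \<phi> :: "nat \<Rightarrow> 'a \<Rightarrow> complex"
  assumes \<phi>: "\<And>n. testfun \<Omega> (\<phi> n)" and K: "\<And>n. tgr (\<phi> n) \<le> K" and e: "e > 0"
  shows "\<exists>s::nat\<Rightarrow>nat. strict_mono s \<and> (\<exists>N. \<forall>i\<ge>N. \<forall>j\<ge>N. sqrt (nsq LO (\<lambda>x. \<phi> (s i) x - \<phi> (s j) x)) < e)"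
proof -
  have K0: "K \<ge> 0" using K[of 0] tgr_nonneg[of "\<phi> 0"] by linarith
  \<comment> \<open>The added 1 covers \<open>K = 0\<close>. With \<open>r = e / (4 * D)\<close>
    each function is within \<open>e / 4\<close> of its average; together with \<open>e / 4\<close>
    for the difference of two averages this stays below \<open>e\<close>.\<close>
  define D where "D = sqrt (real DIM('a) * K) + 1"
  have den: "D > 0" using K0 by (simp add: add_nonneg_pos D_def)
  define r where "r = e / (4 * D)"
  have r: "r > 0" using e den by (simp add: r_def)
  have rb: "r * sqrt (real DIM('a) * K) \<le> e / 4"
  proof -
    have "r * sqrt (real DIM('a) * K) \<le> r * D" using r by (simp add: D_def)
    also have "\<dots> = e / 4" using den by (simp add: r_def)
    finally show ?thesis .
  qed
  define V where "V = sqrt (r ^ DIM('a))"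
  have V: "V > 0" using r by (simp add: V_def)
  obtain C where C: "C > 0" "\<And>\<psi> :: 'a \<Rightarrow> complex. testfun \<Omega> \<psi> \<Longrightarrow> nsq lborel \<psi> \<le> C * tgr \<psi>"
    using poincare_ex by blast
  define g where "g n = cube_avg r (\<phi> n)" for n
  have gb: "norm (g n x) \<le> sqrt (C * K) / V" for n x
  proof -
    have "nsq lborel (\<phi> n) \<le> C * K" using C(2)[OF \<phi>[of n]] K[of n] C(1) by (meson mult_left_mono order_trans less_imp_le)
    then show ?thesis using cube_avg_bound[OF r \<phi>[of n], of x] V unfolding g_def V_def[symmetric]
      by (meson divide_right_mono less_imp_le order_trans real_sqrt_le_mono)
  qed
  define L where "L = sqrt K / V"
  have L: "L \<ge> 0" using V K0 by (simp add: L_def)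
  have gl: "norm (g n x - g n y) \<le> norm (x - y) * L" for n x y
  proof -
    have "norm (g n x - g n y) \<le> norm (x - y) * (sqrt (tgr (\<phi> n)) / V)"
      using cube_avg_lipschitz[OF r \<phi>[of n], of x y] by (simp add: g_def V_def)
    also have "\<dots> \<le> norm (x - y) * L"
      unfolding L_def using V K[of n] by (intro mult_left_mono divide_right_mono) auto
    finally show ?thesis .
  qed
  have "compact (closure \<Omega>)" using bounded\<Omega> by (simp add: compact_closure)
  then obtain G s where s: "strict_mono (s :: nat \<Rightarrow> nat)"
    and G: "\<And>e. 0 < e \<Longrightarrow> \<exists>N. \<forall>n x. n \<ge> N \<and> x \<in> closure \<Omega> \<longrightarrow> norm (g (s n) x - G x) < e"
  proof (rule Arzela_Ascoli[of "closure \<Omega>" g "sqrt (C * K) / V"])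
    fix x and d :: real assume "0 < d"
    show "\<exists>\<delta>>0. \<forall>n y. y \<in> closure \<Omega> \<and> norm (x - y) < \<delta> \<longrightarrow> norm (g n x - g n y) < d"
    proof (intro exI[of _ "d / (L + 1)"] conjI allI impI)
      show "0 < d / (L + 1)" using L \<open>0 < d\<close> by simp
      fix n y assume "y \<in> closure \<Omega> \<and> norm (x - y) < d / (L + 1)"
      then have "norm (x - y) * (L + 1) < d" using L by (simp add: pos_less_divide_eq)
      then show "norm (g n x - g n y) < d" using gl[of n x y] norm_ge_zero[of "x - y"] unfolding distrib_left mult_1_right by linarith
    qed
  qed (use gb in auto)
  define m where "m = sqrt (measure LO \<Omega>)"
  have m: "m \<ge> 0" by (simp add: m_def)
  \<comment> \<open>Two averages then differ uniformly by at most \<open>e / (4 * (m + 1))\<close>,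
    hence in mean square over \<open>\<Omega>\<close> by at most \<open>e / 4\<close>,
    \<open>m\<close> being the root of the measure of \<open>\<Omega>\<close>.\<close>
  obtain N where N: "\<And>n x. n \<ge> N \<Longrightarrow> x \<in> closure \<Omega> \<Longrightarrow> norm (g (s n) x - G x) < e / (8 * (m + 1))"
    using G[of "e / (8 * (m + 1))"] e m by auto
  have "sqrt (nsq LO (\<lambda>x. \<phi> (s i) x - \<phi> (s j) x)) < e" if ij: "i \<ge> N" "j \<ge> N" for i j
  proof -
    have gm: "g n \<in> borel_measurable LO" for n
      unfolding g_def using cube_avg_continuous[OF r \<phi>] by (intro borel_LO borel_measurable_continuous_onI)
    have near: "norm (g (s i) x - g (s j) x) \<le> e / (4 * (m + 1))" if "x \<in> \<Omega>" for x
    proof -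
      have "norm (g (s i) x - g (s j) x) \<le> norm (g (s i) x - G x) + norm (g (s j) x - G x)"
        using norm_triangle_ineq4[of "g (s i) x - G x" "g (s j) x - G x"] by simp
      moreover have "e / (4 * (m + 1)) = e / (8 * (m + 1)) + e / (8 * (m + 1))" using m by (simp add: divide_simps)
      moreover have "x \<in> closure \<Omega>" using that closure_subset[of \<Omega>] by blast
      ultimately show ?thesis using N[OF ij(1)] N[OF ij(2)] by (smt (verit, best))
    qed
    have mid: "sqi LO (\<lambda>x. g (s i) x - g (s j) x)" "sqrt (nsq LO (\<lambda>x. g (s i) x - g (s j) x)) \<le> e / 4"
    proof -
      note * = nsq_LO_bounded[of "\<lambda>x. g (s i) x - g (s j) x" "e / (4 * (m + 1))", OF borel_measurable_diff[OF gm gm] near]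
      show "sqi LO (\<lambda>x. g (s i) x - g (s j) x)" by (rule *(1))
      have "sqrt (nsq LO (\<lambda>x. g (s i) x - g (s j) x)) \<le> sqrt ((e / (4 * (m + 1)))\<^sup>2 * measure LO \<Omega>)"
        by (rule real_sqrt_le_mono[OF *(2)])
      also have "\<dots> = e / (4 * (m + 1)) * m" using e m by (simp add: real_sqrt_mult m_def)
      also have "\<dots> \<le> e / 4" using e m by (simp add: field_simps)
      finally show "sqrt (nsq LO (\<lambda>x. g (s i) x - g (s j) x)) \<le> e / 4" .
    qed
    have app: "sqi LO (\<lambda>x. g n x - \<phi> n x)" "sqrt (nsq LO (\<lambda>x. g n x - \<phi> n x)) \<le> e / 4" for n
    proof -
      have s: "sqi lborel (\<lambda>x. g n x - \<phi> n x)" unfolding g_def by (rule cube_avg_approx(1)[OF r \<phi>])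
      show "sqi LO (\<lambda>x. g n x - \<phi> n x)" by (rule nsq_LO_le_lborel(1)[OF s])
      have "nsq LO (\<lambda>x. g n x - \<phi> n x) \<le> nsq lborel (\<lambda>x. g n x - \<phi> n x)" by (rule nsq_LO_le_lborel(2)[OF s])
      also have "\<dots> \<le> real DIM('a) * r\<^sup>2 * tgr (\<phi> n)" unfolding g_def by (rule cube_avg_approx(2)[OF r \<phi>])
      also have "\<dots> \<le> real DIM('a) * r\<^sup>2 * K" using K[of n] by (intro mult_left_mono) auto
      also have "\<dots> = r\<^sup>2 * (real DIM('a) * K)" by simp
      finally have "sqrt (nsq LO (\<lambda>x. g n x - \<phi> n x)) \<le> sqrt (r\<^sup>2 * (real DIM('a) * K))" by (rule real_sqrt_le_mono)
      also have "\<dots> = r * sqrt (real DIM('a) * K)" using r by (simp add: real_sqrt_mult)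
      finally show "sqrt (nsq LO (\<lambda>x. g n x - \<phi> n x)) \<le> e / 4" using rb by linarith
    qed
    have "sqrt (nsq LO (\<lambda>x. ((g (s i) x - g (s j) x) + (g (s j) x - \<phi> (s j) x)) + (\<phi> (s i) x - g (s i) x)))
       \<le> sqrt (nsq LO (\<lambda>x. (g (s i) x - g (s j) x) + (g (s j) x - \<phi> (s j) x))) + sqrt (nsq LO (\<lambda>x. \<phi> (s i) x - g (s i) x))"
      by (rule nsq_triangle[OF sqi_add[OF mid(1) app(1)]]) (use sqi_scaleR[OF app(1)[of "s i"], of "-1"] in simp)
    also have "nsq LO (\<lambda>x. \<phi> (s i) x - g (s i) x) = nsq LO (\<lambda>x. g (s i) x - \<phi> (s i) x)" by (rule nsq_minus_commute)
    finally show ?thesis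
      using nsq_triangle[OF mid(1) app(1)[of "s j"]] mid(2) app(2)[of "s i"] app(2)[of "s j"] e by (simp add: algebra_simps)
  qed
  then show ?thesis using s by blast
qed

lemma rellich_test:
  fixes \<phi> :: "nat \<Rightarrow> 'a \<Rightarrow> complex"
  assumes \<phi>: "\<And>n. testfun \<Omega> (\<phi> n)" and K: "\<And>n. tgr (\<phi> n) \<le> K"
  obtains s u where "strict_mono (s :: nat \<Rightarrow> nat)" "sqi LO u" "(\<lambda>n. nsq LO (\<lambda>x. \<phi> (s n) x - u x)) \<longlonglongrightarrow> 0"
proof -
  define P where "P n s \<longleftrightarrow> (\<exists>N. \<forall>i\<ge>N. \<forall>j\<ge>N. sqrt (nsq LO (\<lambda>x. \<phi> (s i) x - \<phi> (s j) x)) < 1 / real (Suc n))" for n and s :: "nat \<Rightarrow> nat"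
  interpret subseqs P
  proof
    fix n and s :: "nat \<Rightarrow> nat" assume "strict_mono s"
    show "\<exists>r'. strict_mono r' \<and> P n (s \<circ> r')"
      using rellich_step[of "\<lambda>n. \<phi> (s n)" K "1 / real (Suc n)"] \<phi> K by (simp add: P_def)
  qed
  \<comment> \<open>The property only concerns tails, so it passes to further subsequences; this is
    what the diagonal construction needs.\<close>
  have stable: "P n (s \<circ> r)" if r: "strict_mono r" and s: "P n s" for r s n
  proof -
    obtain N where N: "\<And>i j. i \<ge> N \<Longrightarrow> j \<ge> N \<Longrightarrow> sqrt (nsq LO (\<lambda>x. \<phi> (s i) x - \<phi> (s j) x)) < 1 / real (Suc n)"
      using s unfolding P_def by blast
    have "i \<le> r i" for i using seq_suble[OF r] .
    then have "sqrt (nsq LO (\<lambda>x. \<phi> ((s \<circ> r) i) x - \<phi> ((s \<circ> r) j) x)) < 1 / real (Suc n)" if "i \<ge> N" "j \<ge> N" for i j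
      using N[of "r i" "r j"] that order_trans by fastforce
    then show ?thesis unfolding P_def by blast
  qed
  \<comment> \<open>Only the part of the diagonal sequence from index \<open>Suc k\<close> on is
    known to satisfy \<open>P k\<close>; the shift is undone below by taking indices beyond
    \<open>Suc k + N\<close>.\<close>
  have diag: "P k (diagseq \<circ> ((+) (Suc k)))" for k by (rule diagseq_holds[OF stable])
  have "\<exists>N. \<forall>m\<ge>N. \<forall>n\<ge>N. nsq LO (\<lambda>x. \<phi> (diagseq m) x - \<phi> (diagseq n) x) < e" if e: "e > 0" for e
  proof -
    obtain k where k: "1 / real (Suc k) < sqrt e"
      using reals_Archimedean[of "sqrt e"] e by (auto simp: inverse_eq_divide)
    obtain N where N: "\<And>i j. i \<ge> N \<Longrightarrow> j \<ge> N \<Longrightarrow> sqrt (nsq LO (\<lambda>x. \<phi> (diagseq (Suc k + i)) x - \<phi> (diagseq (Suc k + j)) x)) < 1 / real (Suc k)"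
      using diag[of k] unfolding P_def by auto
    have "nsq LO (\<lambda>x. \<phi> (diagseq m) x - \<phi> (diagseq n) x) < e" if "m \<ge> Suc k + N" "n \<ge> Suc k + N" for m n
    proof -
      have "sqrt (nsq LO (\<lambda>x. \<phi> (diagseq m) x - \<phi> (diagseq n) x)) < sqrt e"
      proof -
        have "N \<le> m - Suc k" "N \<le> n - Suc k" "Suc k + (m - Suc k) = m" "Suc k + (n - Suc k) = n" using that by auto
        then have "sqrt (nsq LO (\<lambda>x. \<phi> (diagseq m) x - \<phi> (diagseq n) x)) < 1 / real (Suc k)"
          using N[of "m - Suc k" "n - Suc k"] by metis
        then show ?thesis using k by (rule less_trans)
      qed
      then show ?thesis by simp
    qed
    then show ?thesis by blast
  qed
  then obtain u where "sqi LO u" "(\<lambda>n. nsq LO (\<lambda>x. \<phi> (diagseq n) x - u x)) \<longlonglongrightarrow> 0"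
    by (rule sqi_complete[of LO "\<lambda>n. \<phi> (diagseq n)", OF testfun_LO(1)[OF \<phi>]])
  then show thesis using that subseq_diagseq by blast
qed

end

subsection \<open>The Dirichlet form on the zero-boundary Sobolev space\<close>

text \<open>The parallelogram law with the term for \<open>f - s g\<close> dropped.\<close>

lemma tgr_add_le:
  fixes f g :: "'a::euclidean_space \<Rightarrow> complex"
  assumes "testfun A f" "testfun A g"
  shows "tgr (\<lambda>x. f x + complex_of_real s * g x) \<le> 2 * tgr f + 2 * s\<^sup>2 * tgr g"
proof -
  define X where "X = (\<Sum>b\<in>Basis. ips lborel (pd f b) (pd g b))"
  have "0 \<le> tgr f + 2 * (- s) * X + (- s)\<^sup>2 * tgr g"
    using tgr_expand[OF assms, of "- s"] tgr_nonneg[of "\<lambda>x. f x + complex_of_real (- s) * g x"] unfolding X_def by metis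
  moreover have "2 * (- s) * X = - (2 * s * X)" "(- s)\<^sup>2 * tgr g = s\<^sup>2 * tgr g" "2 * s\<^sup>2 * tgr g = 2 * (s\<^sup>2 * tgr g)" by auto
  ultimately show ?thesis using tgr_expand[OF assms, of s] unfolding X_def[symmetric] by linarith
qed

lemma tgr_zero [simp]: "tgr (\<lambda>x. 0 :: 'b::euclidean_space) = 0"
proof -
  have "pd (\<lambda>x. 0 :: 'b) b x = 0" for b x :: 'a
    by (rule pd_eqI[where f' = "\<lambda>_. 0"]) (rule has_derivative_const)
  then show ?thesis by (simp add: tgr_def nsq_def)
qed

context bounded_open
begin

lemma H10_sqi: "H10 \<Omega> u \<Longrightarrow> sqi LO u"
  unfolding H10_def H1_def L2_iff by blast

lemma gradsq_nonneg [simp]: "gradsq \<Omega> u \<ge> 0"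
  unfolding gradsq_def set_int_LO by (intro Bochner_Integration.integral_nonneg sum_nonneg) auto

lemma sqi_cmult: "sqi LO u \<Longrightarrow> sqi LO (\<lambda>x. complex_of_real s * u x)"
  using sqi_scaleR[of LO u s] by (simp add: scaleR_conv_of_real)

lemma nsq_cmult: "nsq LO (\<lambda>x. complex_of_real s * u x) = s\<^sup>2 * nsq LO u"
  using nsq_scaleR[of LO s u] by (simp add: scaleR_conv_of_real)

lemma nsq_add_tendsto_0:
  fixes f g :: "nat \<Rightarrow> 'a \<Rightarrow> 'b::euclidean_space"
  assumes "\<And>n. sqi LO (f n)" "\<And>n. sqi LO (g n)" "(\<lambda>n. nsq LO (f n)) \<longlonglongrightarrow> 0" "(\<lambda>n. nsq LO (g n)) \<longlonglongrightarrow> 0"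
  shows "(\<lambda>n. nsq LO (\<lambda>x. f n x + g n x)) \<longlonglongrightarrow> 0"
proof -
  have "nsq LO (\<lambda>x. f n x + g n x) \<le> 2 * nsq LO (f n) + 2 * nsq LO (g n)" for n
  proof -
    have "nsq LO (\<lambda>x. f n x + g n x) \<le> integral\<^sup>L LO (\<lambda>x. 2 * (norm (f n x))\<^sup>2 + 2 * (norm (g n x))\<^sup>2)"
      unfolding nsq_def using sqi_add[OF assms(1)[of n] assms(2)[of n]] assms(1)[of n] assms(2)[of n]
      by (intro integral_mono norm_add_sq_le) (auto simp: sqi_def)
    then show ?thesis using assms(1)[of n] assms(2)[of n] by (simp add: nsq_def sqi_def)
  qed
  moreover have "(\<lambda>n. 2 * nsq LO (f n) + 2 * nsq LO (g n)) \<longlonglongrightarrow> 2 * 0 + 2 * 0"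
    by (intro tendsto_intros assms)
  ultimately show ?thesis
    using tendsto_0_bound[of "\<lambda>n. nsq LO (\<lambda>x. f n x + g n x)" "\<lambda>n. 2 * nsq LO (f n) + 2 * nsq LO (g n)"] by simp
qed

text \<open>The gradient \<open>wgrad\<close> of a sum need not be the sum of the chosen gradients.
  Instead the mixed products \<open>b k\<close> of approximating test functions are recorded: they
  do not depend on \<open>s\<close>, so their limit at \<open>s = 1\<close> determines the expansion
  for every \<open>s\<close>.\<close>

lemma H10_lin_aux:
  assumes "H10 \<Omega> u" "H10 \<Omega> v"
  shows "\<exists>b. \<forall>s. H10 \<Omega> (\<lambda>x. u x + complex_of_real s * v x) \<and>
    (\<lambda>k. b k * (2 * s)) \<longlonglongrightarrow> gradsq \<Omega> (\<lambda>x. u x + complex_of_real s * v x) - gradsq \<Omega> u - s\<^sup>2 * gradsq \<Omega> v"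
proof -
  obtain \<phi> where u: "sqi LO u" and \<phi>: "\<And>k. testfun \<Omega> (\<phi> k)" and lu: "(\<lambda>k. nsq LO (\<lambda>x. \<phi> k x - u x)) \<longlonglongrightarrow> 0"
    and Cu: "\<And>e. e > 0 \<Longrightarrow> \<exists>N. \<forall>m\<ge>N. \<forall>n\<ge>N. tgr (\<lambda>x. \<phi> m x - \<phi> n x) < e" and gu: "(\<lambda>k. tgr (\<phi> k)) \<longlonglongrightarrow> gradsq \<Omega> u"
    by (rule H10E[OF assms(1)]) blast
  obtain \<psi> where v: "sqi LO v" and \<psi>: "\<And>k. testfun \<Omega> (\<psi> k)" and lv: "(\<lambda>k. nsq LO (\<lambda>x. \<psi> k x - v x)) \<longlonglongrightarrow> 0"
    and Cv: "\<And>e. e > 0 \<Longrightarrow> \<exists>N. \<forall>m\<ge>N. \<forall>n\<ge>N. tgr (\<lambda>x. \<psi> m x - \<psi> n x) < e" and gv: "(\<lambda>k. tgr (\<psi> k)) \<longlonglongrightarrow> gradsq \<Omega> v"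
    by (rule H10E[OF assms(2)]) blast
  define b where "b k = (\<Sum>c\<in>Basis. ips lborel (pd (\<phi> k) c) (pd (\<psi> k) c))" for k
  have "H10 \<Omega> (\<lambda>x. u x + complex_of_real s * v x) \<and>
    (\<lambda>k. b k * (2 * s)) \<longlonglongrightarrow> gradsq \<Omega> (\<lambda>x. u x + complex_of_real s * v x) - gradsq \<Omega> u - s\<^sup>2 * gradsq \<Omega> v" for s
  proof -
    define f where "f k x = \<phi> k x + complex_of_real s * \<psi> k x" for k x
    have f: "testfun \<Omega> (f k)" for k unfolding f_def by (intro testfun_add testfun_cmult \<phi> \<psi>)
    have w: "sqi LO (\<lambda>x. u x + complex_of_real s * v x)" by (intro sqi_add sqi_cmult u v)
    have "(\<lambda>k. nsq LO (\<lambda>x. (\<phi> k x - u x) + complex_of_real s * (\<psi> k x - v x))) \<longlonglongrightarrow> 0"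
    proof (rule nsq_add_tendsto_0)
      show "(\<lambda>k. nsq LO (\<lambda>x. complex_of_real s * (\<psi> k x - v x))) \<longlonglongrightarrow> 0"
        unfolding nsq_cmult using tendsto_mult_left[OF lv, of "s\<^sup>2"] by simp
    qed (intro sqi_diff sqi_cmult testfun_LO(1) \<phi> \<psi> u v lu)+
    then have l: "(\<lambda>k. nsq LO (\<lambda>x. f k x - (u x + complex_of_real s * v x))) \<longlonglongrightarrow> 0"
      by (simp add: f_def algebra_simps)
    have C: "\<exists>N. \<forall>m\<ge>N. \<forall>n\<ge>N. tgr (\<lambda>x. f m x - f n x) < e" if e: "e > 0" for e
    proof -
      obtain N1 where N1: "\<And>m n. m \<ge> N1 \<Longrightarrow> n \<ge> N1 \<Longrightarrow> tgr (\<lambda>x. \<phi> m x - \<phi> n x) < e / 4" using Cu[of "e / 4"] e by auto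
      obtain N2 where N2: "\<And>m n. m \<ge> N2 \<Longrightarrow> n \<ge> N2 \<Longrightarrow> tgr (\<lambda>x. \<psi> m x - \<psi> n x) < e / (4 * (s\<^sup>2 + 1))"
        using Cv[of "e / (4 * (s\<^sup>2 + 1))"] e by (auto simp: add_nonneg_pos)
      have "tgr (\<lambda>x. f m x - f n x) < e" if mn: "m \<ge> max N1 N2" "n \<ge> max N1 N2" for m n
      proof -
        have "tgr (\<lambda>x. f m x - f n x) = tgr (\<lambda>x. (\<phi> m x - \<phi> n x) + complex_of_real s * (\<psi> m x - \<psi> n x))"
          by (simp add: f_def algebra_simps)
        also have "\<dots> \<le> 2 * tgr (\<lambda>x. \<phi> m x - \<phi> n x) + 2 * s\<^sup>2 * tgr (\<lambda>x. \<psi> m x - \<psi> n x)"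
          by (rule tgr_add_le[OF testfun_diff[OF \<phi> \<phi>] testfun_diff[OF \<psi> \<psi>]])
        finally have 1: "tgr (\<lambda>x. f m x - f n x) \<le> 2 * tgr (\<lambda>x. \<phi> m x - \<phi> n x) + 2 * (s\<^sup>2 * tgr (\<lambda>x. \<psi> m x - \<psi> n x))" by simp
        have "s\<^sup>2 * tgr (\<lambda>x. \<psi> m x - \<psi> n x) \<le> (s\<^sup>2 + 1) * tgr (\<lambda>x. \<psi> m x - \<psi> n x)" by (intro mult_right_mono) auto
        also have "\<dots> \<le> (s\<^sup>2 + 1) * (e / (4 * (s\<^sup>2 + 1)))" using N2[of m n] mn by (intro mult_left_mono) auto
        also have "\<dots> = e / 4"
        proof -
          have "s\<^sup>2 + 1 \<noteq> 0" using zero_le_power2[of s] by linarith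
          then show ?thesis by (simp add: divide_simps)
        qed
        finally show ?thesis using 1 N1[of m n] mn by simp
      qed
      then show ?thesis by blast
    qed
    have "(\<lambda>k. tgr (f k) - tgr (\<phi> k) - s\<^sup>2 * tgr (\<psi> k)) \<longlonglongrightarrow> gradsq \<Omega> (\<lambda>x. u x + complex_of_real s * v x) - gradsq \<Omega> u - s\<^sup>2 * gradsq \<Omega> v"
      by (intro tendsto_intros H10I(2)[OF w f l C] gu gv)
    moreover have "tgr (f k) - tgr (\<phi> k) - s\<^sup>2 * tgr (\<psi> k) = b k * (2 * s)" for k
      unfolding f_def[abs_def] tgr_expand[OF \<phi> \<psi>] b_def by simp
    ultimately show ?thesis using H10I(1)[OF w f l C] by simp
  qed
  then show ?thesis by blast
qed

text \<open>Obtained by polarisation from \<open>gradsq\<close>, so that no pointwise product of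
  chosen weak gradients has to be formed.\<close>

definition gip :: "('a \<Rightarrow> complex) \<Rightarrow> ('a \<Rightarrow> complex) \<Rightarrow> real" where
  "gip u v = (gradsq \<Omega> (\<lambda>x. u x + v x) - gradsq \<Omega> u - gradsq \<Omega> v) / 2"

lemma H10_lin: "H10 \<Omega> u \<Longrightarrow> H10 \<Omega> v \<Longrightarrow> H10 \<Omega> (\<lambda>x. u x + complex_of_real s * v x)"
  using H10_lin_aux by blast

lemma gradsq_expand:
  assumes "H10 \<Omega> u" "H10 \<Omega> v"
  shows "gradsq \<Omega> (\<lambda>x. u x + complex_of_real s * v x) = gradsq \<Omega> u + 2 * s * gip u v + s\<^sup>2 * gradsq \<Omega> v"
proof -
  obtain b where b: "\<And>s. (\<lambda>k. b k * (2 * s)) \<longlonglongrightarrow> gradsq \<Omega> (\<lambda>x. u x + complex_of_real s * v x) - gradsq \<Omega> u - s\<^sup>2 * gradsq \<Omega> v"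
    using H10_lin_aux[OF assms] by blast
  have "(\<lambda>k. b k * (2 * s)) \<longlonglongrightarrow> (gradsq \<Omega> (\<lambda>x. u x + v x) - gradsq \<Omega> u - gradsq \<Omega> v) * s"
    using tendsto_mult_right[OF b[of 1], of s] by (simp add: mult.assoc)
  moreover have "(gradsq \<Omega> (\<lambda>x. u x + v x) - gradsq \<Omega> u - gradsq \<Omega> v) * s = 2 * s * gip u v" by (simp add: gip_def)
  ultimately have "(\<lambda>k. b k * (2 * s)) \<longlonglongrightarrow> 2 * s * gip u v" by (simp only:)
  then show ?thesis using LIMSEQ_unique[OF b[of s]] by fastforce
qed

lemma H10_test: "testfun \<Omega> \<phi> \<Longrightarrow> H10 \<Omega> \<phi>" "testfun \<Omega> \<phi> \<Longrightarrow> gradsq \<Omega> \<phi> = tgr \<phi>"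
proof -
  assume t: "testfun \<Omega> \<phi>"
  have l: "(\<lambda>k. nsq LO (\<lambda>x. \<phi> x - \<phi> x)) \<longlonglongrightarrow> 0" by (simp add: nsq_def)
  show "H10 \<Omega> \<phi>" by (rule H10I(1)[OF testfun_LO(1)[OF t] t l]) auto
  have "(\<lambda>k::nat. tgr \<phi>) \<longlonglongrightarrow> gradsq \<Omega> \<phi>" by (rule H10I(2)[OF testfun_LO(1)[OF t] t l]) auto
  then show "gradsq \<Omega> \<phi> = tgr \<phi>" using LIMSEQ_unique tendsto_const by blast
qed

lemma H10_cong:
  assumes "H10 \<Omega> u" "sqi LO v" "nsq LO (\<lambda>x. u x - v x) = 0"
  shows "H10 \<Omega> v" "gradsq \<Omega> v = gradsq \<Omega> u"
proof -
  obtain \<phi> where u: "sqi LO u" and \<phi>: "\<And>k. testfun \<Omega> (\<phi> k)" and lu: "(\<lambda>k. nsq LO (\<lambda>x. \<phi> k x - u x)) \<longlonglongrightarrow> 0"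
    and Cu: "\<And>e. e > 0 \<Longrightarrow> \<exists>N. \<forall>m\<ge>N. \<forall>n\<ge>N. tgr (\<lambda>x. \<phi> m x - \<phi> n x) < e" and gu: "(\<lambda>k. tgr (\<phi> k)) \<longlonglongrightarrow> gradsq \<Omega> u"
    by (rule H10E[OF assms(1)]) blast
  have "(\<lambda>k. nsq LO (\<lambda>x. (\<phi> k x - u x) + (u x - v x))) \<longlonglongrightarrow> 0"
    by (rule nsq_add_tendsto_0) (auto intro: sqi_diff testfun_LO(1) \<phi> u assms(2) lu simp: assms(3))
  then have l: "(\<lambda>k. nsq LO (\<lambda>x. \<phi> k x - v x)) \<longlonglongrightarrow> 0" by simp
  show "H10 \<Omega> v" by (rule H10I(1)[OF assms(2) \<phi> l Cu])
  show "gradsq \<Omega> v = gradsq \<Omega> u" using LIMSEQ_unique[OF H10I(2)[OF assms(2) \<phi> l Cu] gu] .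
qed

lemma H10_zero: "H10 \<Omega> (\<lambda>x. 0)" "gradsq \<Omega> (\<lambda>x. 0) = 0"
  using H10_test[OF testfun_zero] by auto

lemma H10_null:
  assumes "sqi LO u" "nsq LO u = 0" shows "H10 \<Omega> u" "gradsq \<Omega> u = 0"
  using H10_cong[OF H10_zero(1) assms(1)] assms(2) H10_zero(2) by (simp_all add: nsq_def)

lemma H10_cmult: "H10 \<Omega> u \<Longrightarrow> H10 \<Omega> (\<lambda>x. complex_of_real s * u x)"
  using H10_lin[OF H10_zero(1)] by simp

lemma gradsq_cmult: "H10 \<Omega> u \<Longrightarrow> gradsq \<Omega> (\<lambda>x. complex_of_real s * u x) = s\<^sup>2 * gradsq \<Omega> u"
  using gradsq_expand[OF H10_zero(1), of u s] by (simp add: gip_def H10_zero)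

lemma H10_diff: "H10 \<Omega> u \<Longrightarrow> H10 \<Omega> v \<Longrightarrow> H10 \<Omega> (\<lambda>x. u x - v x)"
  using H10_lin[of u v "-1"] by simp

lemma gradsq_triangle:
  assumes "H10 \<Omega> u" "H10 \<Omega> v"
  shows "sqrt (gradsq \<Omega> (\<lambda>x. u x + v x)) \<le> sqrt (gradsq \<Omega> u) + sqrt (gradsq \<Omega> v)"
  using sqrt_quadratic_triangle[of "gradsq \<Omega> u" "gip u v" "gradsq \<Omega> v"] gradsq_expand[OF assms, symmetric]
    gradsq_expand[OF assms, of 1] by simp

lemma gip_bound: "H10 \<Omega> u \<Longrightarrow> H10 \<Omega> v \<Longrightarrow> \<bar>gip u v\<bar> \<le> sqrt (gradsq \<Omega> u) * sqrt (gradsq \<Omega> v)"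
  by (rule nonneg_quadratic_bound) (auto simp: gradsq_expand[symmetric])

lemma gradsq_minus_commute:
  assumes "H10 \<Omega> u" "H10 \<Omega> v" shows "gradsq \<Omega> (\<lambda>x. u x - v x) = gradsq \<Omega> (\<lambda>x. v x - u x)"
  using gradsq_cmult[OF H10_diff[OF assms], of "-1"] by simp

lemma poincare_H10: "\<exists>C>0. \<forall>u. H10 \<Omega> u \<longrightarrow> nsq LO u \<le> C * gradsq \<Omega> u"
proof -
  obtain C where C: "C > 0" "\<And>\<phi> :: 'a \<Rightarrow> complex. testfun \<Omega> \<phi> \<Longrightarrow> nsq lborel \<phi> \<le> C * tgr \<phi>"
    using poincare_ex by blast
  have "nsq LO u \<le> C * gradsq \<Omega> u" if H: "H10 \<Omega> u" for u
  proof -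
    obtain \<phi> where u: "sqi LO u" and \<phi>: "\<And>k. testfun \<Omega> (\<phi> k)" and lu: "(\<lambda>k. nsq LO (\<lambda>x. \<phi> k x - u x)) \<longlonglongrightarrow> 0"
      and gu: "(\<lambda>k. tgr (\<phi> k)) \<longlonglongrightarrow> gradsq \<Omega> u"
      by (rule H10E[OF H]) blast
    have "(\<lambda>k. nsq LO (\<phi> k)) \<longlonglongrightarrow> nsq LO u" by (rule nsq_tendsto_diff[OF testfun_LO(1)[OF \<phi>] u lu])
    moreover have "(\<lambda>k. C * tgr (\<phi> k)) \<longlonglongrightarrow> C * gradsq \<Omega> u" by (intro tendsto_intros gu)
    ultimately show ?thesis
      by (rule LIMSEQ_le) (use C(2)[OF \<phi>] testfun_LO(2)[OF \<phi>] in auto)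
  qed
  then show ?thesis using C(1) by blast
qed

text \<open>Weak lower semicontinuity without weak limits: test functions that almost minimise the
  Dirichlet integral over shrinking balls around u are Cauchy by the parallelogram law.\<close>
lemma H10_closed:
  assumes u: "sqi LO u" and v: "\<And>n. H10 \<Omega> (v n)" and lim: "(\<lambda>n. nsq LO (\<lambda>x. v n x - u x)) \<longlonglongrightarrow> 0"
    and K: "\<And>n. gradsq \<Omega> (v n) \<le> K n" "K \<longlonglongrightarrow> L"
  shows "H10 \<Omega> u" "gradsq \<Omega> u \<le> L"
proof -
  define \<epsilon> where "\<epsilon> n = 1 / real (Suc n)" for n
  have \<epsilon>: "\<epsilon> n > 0" for n by (simp add: \<epsilon>_def)
  have \<epsilon>mono: "\<epsilon> k \<le> \<epsilon> n" if "n \<le> k" for n k using that by (simp add: \<epsilon>_def frac_le)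
  have \<epsilon>0: "\<epsilon> \<longlonglongrightarrow> 0" unfolding \<epsilon>_def using LIMSEQ_inverse_real_of_nat by (simp add: inverse_eq_divide)
  \<comment> \<open>Dirichlet integrals of the test functions in the mean-square ball of radius
    \<open>\<epsilon> n\<close> around \<open>u\<close>. The infima \<open>m n\<close> increase as
    the balls shrink and stay below \<open>L\<close>, hence converge.\<close>
  define S where "S n = {tgr \<phi> | \<phi>. testfun \<Omega> \<phi> \<and> sqrt (nsq LO (\<lambda>x. \<phi> x - u x)) \<le> \<epsilon> n}" for n
  define m where "m n = Inf (S n)" for n
  have Sne: "\<exists>t\<in>S n. t \<le> L + d" if d: "d > 0" for n d
  proof -
    have "(\<lambda>n. sqrt (nsq LO (\<lambda>x. v n x - u x))) \<longlonglongrightarrow> 0" using tendsto_real_sqrt[OF lim] by simp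
    then have "\<forall>\<^sub>F j in sequentially. sqrt (nsq LO (\<lambda>x. v j x - u x)) < \<epsilon> n / 2" using \<epsilon>[of n] by (intro order_tendstoD) auto
    moreover have "\<forall>\<^sub>F j in sequentially. K j < L + d / 2" using K(2) d by (intro order_tendstoD) auto
    ultimately have "\<forall>\<^sub>F j in sequentially. sqrt (nsq LO (\<lambda>x. v j x - u x)) < \<epsilon> n / 2 \<and> K j < L + d / 2" by eventually_elim simp
    then obtain j where j: "sqrt (nsq LO (\<lambda>x. v j x - u x)) < \<epsilon> n / 2" "K j < L + d / 2" unfolding eventually_sequentially by auto
    obtain \<phi> where vj: "sqi LO (v j)" and \<phi>: "\<And>k. testfun \<Omega> (\<phi> k)" and lv: "(\<lambda>k. nsq LO (\<lambda>x. \<phi> k x - v j x)) \<longlonglongrightarrow> 0"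
      and gv: "(\<lambda>k. tgr (\<phi> k)) \<longlonglongrightarrow> gradsq \<Omega> (v j)"
      by (rule H10E[OF v[of j]]) blast
    have "(\<lambda>k. sqrt (nsq LO (\<lambda>x. \<phi> k x - v j x))) \<longlonglongrightarrow> 0" using tendsto_real_sqrt[OF lv] by simp
    then have "\<forall>\<^sub>F k in sequentially. sqrt (nsq LO (\<lambda>x. \<phi> k x - v j x)) < \<epsilon> n / 2" using \<epsilon>[of n] by (intro order_tendstoD) auto
    moreover have "\<forall>\<^sub>F k in sequentially. tgr (\<phi> k) < L + d"
      by (rule order_tendstoD(2)[OF gv]) (use j(2) K(1)[of j] d in linarith)
    ultimately have "\<forall>\<^sub>F k in sequentially. sqrt (nsq LO (\<lambda>x. \<phi> k x - v j x)) < \<epsilon> n / 2 \<and> tgr (\<phi> k) < L + d" by eventually_elim simp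
    then obtain k where k: "sqrt (nsq LO (\<lambda>x. \<phi> k x - v j x)) < \<epsilon> n / 2" "tgr (\<phi> k) < L + d" unfolding eventually_sequentially by auto
    have "sqrt (nsq LO (\<lambda>x. (\<phi> k x - v j x) + (v j x - u x))) \<le> sqrt (nsq LO (\<lambda>x. \<phi> k x - v j x)) + sqrt (nsq LO (\<lambda>x. v j x - u x))"
      by (intro nsq_triangle sqi_diff testfun_LO(1)[OF \<phi>] vj u)
    then have "sqrt (nsq LO (\<lambda>x. \<phi> k x - u x)) \<le> \<epsilon> n" using k(1) j(1) by simp
    then have "tgr (\<phi> k) \<in> S n" unfolding S_def using \<phi> by blast
    then show ?thesis using k(2) by (intro bexI[of _ "tgr (\<phi> k)"]) auto
  qed
  have bdd: "bdd_below (S n)" for n unfolding S_def by (rule bdd_belowI[of _ 0]) auto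
  have Sne': "S n \<noteq> {}" for n using Sne[of 1 n] by auto
  have mL: "m n \<le> L" for n
  proof (rule field_le_epsilon)
    fix d :: real assume "d > 0"
    then obtain t where "t \<in> S n" "t \<le> L + d" using Sne by blast
    then show "m n \<le> L + d" unfolding m_def using cInf_lower[OF _ bdd] by (meson order_trans)
  qed
  have mmono: "m n \<le> m k" if "n \<le> k" for n k
    unfolding m_def by (rule cInf_superset_mono[OF Sne' bdd]) (use \<epsilon>mono[OF that] in \<open>auto simp: S_def intro: order_trans\<close>)
  have "\<exists>\<phi>. testfun \<Omega> \<phi> \<and> sqrt (nsq LO (\<lambda>x. \<phi> x - u x)) \<le> \<epsilon> n \<and> tgr \<phi> < m n + \<epsilon> n" for n
  proof -
    have "\<exists>t\<in>S n. t < m n + \<epsilon> n" using \<epsilon>[of n] cInf_lessD[OF Sne', of n "m n + \<epsilon> n"] by (simp add: m_def)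
    then show ?thesis unfolding S_def by blast
  qed
  then obtain \<phi> where \<phi>: "\<And>n. testfun \<Omega> (\<phi> n)" and near: "\<And>n. sqrt (nsq LO (\<lambda>x. \<phi> n x - u x)) \<le> \<epsilon> n"
    and tm: "\<And>n. tgr (\<phi> n) < m n + \<epsilon> n" by metis
  \<comment> \<open>The midpoint of \<open>\<phi> n\<close> and \<open>\<phi> k\<close> lies in the
    larger, convex ball of index \<open>n\<close>, so its Dirichlet integral is at least
    \<open>m n\<close>. The parallelogram law then leaves only the small quantities
    \<open>m k - m n\<close> and \<open>\<epsilon> n\<close>.\<close>
  have par: "tgr (\<lambda>x. \<phi> n x - \<phi> k x) \<le> 2 * (m k - m n) + 4 * \<epsilon> n" if nk: "n \<le> k" for n k
  proof -
    define w where "w x = complex_of_real (1/2) * (\<phi> n x + \<phi> k x)" for x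
    have sum: "testfun \<Omega> (\<lambda>x. \<phi> n x + \<phi> k x)" by (intro testfun_add \<phi>)
    have w: "testfun \<Omega> w" unfolding w_def by (intro testfun_cmult sum)
    have "sqrt (nsq LO (\<lambda>x. w x - u x)) = sqrt (nsq LO (\<lambda>x. complex_of_real (1/2) * ((\<phi> n x - u x) + (\<phi> k x - u x))))"
      by (simp add: w_def algebra_simps)
    also have "\<dots> = (1/2) * sqrt (nsq LO (\<lambda>x. (\<phi> n x - u x) + (\<phi> k x - u x)))"
      unfolding nsq_cmult by (simp add: real_sqrt_mult real_sqrt_divide power_divide)
    also have "\<dots> \<le> (1/2) * (sqrt (nsq LO (\<lambda>x. \<phi> n x - u x)) + sqrt (nsq LO (\<lambda>x. \<phi> k x - u x)))"
      by (intro mult_left_mono nsq_triangle sqi_diff testfun_LO(1)[OF \<phi>] u) auto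
    also have "\<dots> \<le> \<epsilon> n" using near[of n] near[of k] \<epsilon>mono[OF nk] by simp
    finally have "tgr w \<in> S n" unfolding S_def using w by blast
    then have mw: "m n \<le> tgr w" unfolding m_def by (rule cInf_lower[OF _ bdd])
    have "pd w b x = (1/2) *\<^sub>R pd (\<lambda>x. \<phi> n x + \<phi> k x) b x" for b x
      unfolding w_def using pd_cmult[OF sum, of "1/2" b x] by (simp add: scaleR_conv_of_real)
    then have "pd w b = (\<lambda>x. (1/2) *\<^sub>R pd (\<lambda>x. \<phi> n x + \<phi> k x) b x)" for b by auto
    then have tw: "tgr w = tgr (\<lambda>x. \<phi> n x + \<phi> k x) / 4"
      unfolding tgr_def by (simp only: nsq_scaleR) (simp add: power_divide sum_divide_distrib)
    have "tgr (\<lambda>x. \<phi> n x - \<phi> k x) = 2 * tgr (\<phi> n) + 2 * tgr (\<phi> k) - tgr (\<lambda>x. \<phi> n x + \<phi> k x)"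
      using tgr_expand[OF \<phi> \<phi>, of n 1 k] tgr_expand[OF \<phi> \<phi>, of n "-1" k] by simp
    then show ?thesis using mw tw tm[of n] tm[of k] \<epsilon>mono[OF nk] by simp
  qed
  have "incseq m" using mmono by (simp add: incseq_def)
  moreover have "bdd_above (range m)" using mL by (auto intro: bdd_aboveI[of _ L])
  ultimately obtain M where M: "m \<longlonglongrightarrow> M" using LIMSEQ_incseq_SUP by blast
  have mM: "m n \<le> M" for n using \<open>incseq m\<close> M by (rule incseq_le)
  have C: "\<exists>N. \<forall>m\<ge>N. \<forall>n\<ge>N. tgr (\<lambda>x. \<phi> m x - \<phi> n x) < e" if e: "e > 0" for e
  proof -
    have "\<forall>\<^sub>F n in sequentially. m n > M - e / 4" using M e by (intro order_tendstoD) auto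
    moreover have "\<forall>\<^sub>F n in sequentially. \<epsilon> n < e / 8" using \<epsilon>0 e by (intro order_tendstoD) auto
    ultimately have "\<forall>\<^sub>F n in sequentially. m n > M - e / 4 \<and> \<epsilon> n < e / 8" by eventually_elim simp
    then obtain N where N: "\<And>n. n \<ge> N \<Longrightarrow> m n > M - e / 4 \<and> \<epsilon> n < e / 8" unfolding eventually_sequentially by auto
    have 1: "tgr (\<lambda>x. \<phi> i x - \<phi> j x) < e" if "N \<le> i" "i \<le> j" for i j
    proof -
      have "m j - m i < e / 4" "\<epsilon> i < e / 8" using N[OF that(1)] mM[of j] by auto
      then show ?thesis using par[OF that(2)] by simp
    qed
    have "tgr (\<lambda>x. \<phi> i x - \<phi> j x) < e" if "N \<le> i" "N \<le> j" for i j
    proof (cases "i \<le> j")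
      case False
      have "tgr (\<lambda>x. \<phi> i x - \<phi> j x) = tgr (\<lambda>x. \<phi> j x - \<phi> i x)"
        using tgr_expand[OF \<phi> \<phi>, of i "-1" j] tgr_expand[OF \<phi> \<phi>, of j "-1" i]
        by (simp add: ips_def inner_commute)
      then show ?thesis using 1[of j i] that False by simp
    qed (use 1 that in auto)
    then show ?thesis by blast
  qed
  have l: "(\<lambda>n. nsq LO (\<lambda>x. \<phi> n x - u x)) \<longlonglongrightarrow> 0"
  proof (rule tendsto_0_bound)
    have "(sqrt (nsq LO (\<lambda>x. \<phi> n x - u x)))\<^sup>2 \<le> (\<epsilon> n)\<^sup>2" for n by (intro power_mono near) simp
    then show "norm (nsq LO (\<lambda>x. \<phi> n x - u x)) \<le> (\<epsilon> n)\<^sup>2" for n by simp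
    show "(\<lambda>n. (\<epsilon> n)\<^sup>2) \<longlonglongrightarrow> 0" using tendsto_power[OF \<epsilon>0, of 2] by simp
  qed
  show "H10 \<Omega> u" by (rule H10I(1)[OF u \<phi> l C])
  have "(\<lambda>n. L + \<epsilon> n) \<longlonglongrightarrow> L + 0" by (intro tendsto_intros \<epsilon>0)
  moreover have "tgr (\<phi> n) \<le> L + \<epsilon> n" for n using tm[of n] mL[of n] by linarith
  ultimately show "gradsq \<Omega> u \<le> L" using LIMSEQ_le[OF H10I(2)[OF u \<phi> l C]] by auto
qed

lemma rellich_H10:
  assumes v: "\<And>n. H10 \<Omega> (v n)" and K: "\<And>n. gradsq \<Omega> (v n) \<le> K"
  obtains s u where "strict_mono (s :: nat \<Rightarrow> nat)" "sqi LO u" "(\<lambda>n. nsq LO (\<lambda>x. v (s n) x - u x)) \<longlonglongrightarrow> 0"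
proof -
  have "\<exists>\<phi>. testfun \<Omega> \<phi> \<and> nsq LO (\<lambda>x. \<phi> x - v n x) < 1 / real (Suc n) \<and> tgr \<phi> < K + 1" for n
  proof -
    obtain \<phi> where \<phi>: "\<And>k. testfun \<Omega> (\<phi> k)" and lv: "(\<lambda>k. nsq LO (\<lambda>x. \<phi> k x - v n x)) \<longlonglongrightarrow> 0"
      and gv: "(\<lambda>k. tgr (\<phi> k)) \<longlonglongrightarrow> gradsq \<Omega> (v n)"
      by (rule H10E[OF v[of n]]) blast
    have "\<forall>\<^sub>F k in sequentially. nsq LO (\<lambda>x. \<phi> k x - v n x) < 1 / real (Suc n)" using lv by (intro order_tendstoD) auto
    moreover have "\<forall>\<^sub>F k in sequentially. tgr (\<phi> k) < K + 1" by (rule order_tendstoD(2)[OF gv]) (use K[of n] in linarith)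
    ultimately have "\<forall>\<^sub>F k in sequentially. nsq LO (\<lambda>x. \<phi> k x - v n x) < 1 / real (Suc n) \<and> tgr (\<phi> k) < K + 1" by eventually_elim simp
    then show ?thesis using \<phi> unfolding eventually_sequentially by auto
  qed
  then obtain \<phi> where \<phi>: "\<And>n. testfun \<Omega> (\<phi> n)" and near: "\<And>n. nsq LO (\<lambda>x. \<phi> n x - v n x) < 1 / real (Suc n)"
    and t: "\<And>n. tgr (\<phi> n) < K + 1" by metis
  obtain s u where s: "strict_mono (s :: nat \<Rightarrow> nat)" and u: "sqi LO u" and l: "(\<lambda>n. nsq LO (\<lambda>x. \<phi> (s n) x - u x)) \<longlonglongrightarrow> 0"
    by (rule rellich_test[OF \<phi> less_imp_le[OF t]])
  have "(\<lambda>n. nsq LO (\<lambda>x. v n x - \<phi> n x)) \<longlonglongrightarrow> 0"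
  proof (rule tendsto_0_bound)
    show "norm (nsq LO (\<lambda>x. v n x - \<phi> n x)) \<le> inverse (real (Suc n))" for n
      using near[of n] nsq_minus_commute[of LO "v n" "\<phi> n"] by (simp add: inverse_eq_divide)
  qed (rule LIMSEQ_inverse_real_of_nat)
  then have "(\<lambda>n. nsq LO (\<lambda>x. v (s n) x - \<phi> (s n) x)) \<longlonglongrightarrow> 0"
    using LIMSEQ_subseq_LIMSEQ[OF _ s, of "\<lambda>n. nsq LO (\<lambda>x. v n x - \<phi> n x)"] by (simp add: o_def)
  then have "(\<lambda>n. nsq LO (\<lambda>x. (v (s n) x - \<phi> (s n) x) + (\<phi> (s n) x - u x))) \<longlonglongrightarrow> 0"
    by (intro nsq_add_tendsto_0 sqi_diff H10_sqi[OF v] testfun_LO(1)[OF \<phi>] u l)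
  then show thesis using that[OF s u] by simp
qed

text \<open>Stated for eventual indices because the gradient norms need not converge; infinitely
  many exceptions would form a subsequence contradicting \<open>H10_closed\<close>.\<close>

lemma gradsq_lsc:
  assumes u: "H10 \<Omega> u" and v: "\<And>n. H10 \<Omega> (v n)" and lim: "(\<lambda>n. nsq LO (\<lambda>x. v n x - u x)) \<longlonglongrightarrow> 0"
    and e: "e > 0"
  shows "\<forall>\<^sub>F n in sequentially. gradsq \<Omega> (v n) > gradsq \<Omega> u - e"
proof (rule ccontr)
  assume "\<not> ?thesis"
  then have fr: "\<exists>n>m. gradsq \<Omega> (v n) \<le> gradsq \<Omega> u - e" for m
    unfolding eventually_sequentially by (metis less_le_not_le nle_le not_less Suc_le_eq)
  have "\<exists>s. \<forall>n. gradsq \<Omega> (v (s n)) \<le> gradsq \<Omega> u - e \<and> s n < s (Suc n)"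
    by (rule dependent_nat_choice) (use fr in blast)+
  then obtain s where s: "\<And>n. gradsq \<Omega> (v (s n)) \<le> gradsq \<Omega> u - e" "\<And>n. s n < s (Suc n)" by blast
  have "strict_mono s" using s(2) by (simp add: strict_mono_Suc_iff)
  then have "(\<lambda>n. nsq LO (\<lambda>x. v (s n) x - u x)) \<longlonglongrightarrow> 0"
    using LIMSEQ_subseq_LIMSEQ[OF lim] by (simp add: o_def)
  then have "gradsq \<Omega> u \<le> gradsq \<Omega> u - e"
    by (rule H10_closed(2)[OF H10_sqi[OF u] v _ s(1) tendsto_const])
  then show False using e by simp
qed

text \<open>Lower semicontinuity along \<open>u + t z\<close> for both signs of a small t forces the mixed term to
  vanish; this replaces weak convergence of the gradients.\<close>
lemma gip_tendsto_0:
  assumes u: "H10 \<Omega> u" and z: "\<And>n. H10 \<Omega> (z n)" and lim: "(\<lambda>n. nsq LO (z n)) \<longlonglongrightarrow> 0"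
    and Z: "\<And>n. gradsq \<Omega> (z n) \<le> Z"
  shows "(\<lambda>n. gip u (z n)) \<longlonglongrightarrow> 0"
proof (rule LIMSEQ_I)
  fix e :: real assume e: "e > 0"
  have Z0: "Z \<ge> 0" using Z[of 0] gradsq_nonneg[of "z 0"] by linarith
  \<comment> \<open>Chosen so that \<open>t\<^sup>2 * (Z + 1) = t * e\<close>: the quadratic term
    costs \<open>t\<^sup>2 * Z\<close> and the slack in lower semicontinuity
    \<open>t\<^sup>2\<close>, and division by \<open>t\<close> leaves \<open>e\<close>.\<close>
  define t where "t = e / (Z + 1)"
  have t: "t > 0" using e Z0 by (simp add: t_def)
  have ev: "\<forall>\<^sub>F n in sequentially. 2 * r * gip u (z n) > - t\<^sup>2 * (Z + 1)" if r: "\<bar>r\<bar> = t" for r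
  proof -
    have r2: "r\<^sup>2 = t\<^sup>2" using r power2_abs[of r] by simp
    have "(\<lambda>n. nsq LO (\<lambda>x. (u x + complex_of_real r * z n x) - u x)) \<longlonglongrightarrow> 0"
      using tendsto_mult_left[OF lim, of "r\<^sup>2"] by (simp add: nsq_cmult)
    then have "\<forall>\<^sub>F n in sequentially. gradsq \<Omega> (\<lambda>x. u x + complex_of_real r * z n x) > gradsq \<Omega> u - t\<^sup>2"
      by (rule gradsq_lsc[OF u H10_lin[OF u z]]) (use t in simp)
    then show ?thesis
    proof eventually_elim
      case (elim n)
      have "t\<^sup>2 * gradsq \<Omega> (z n) \<le> t\<^sup>2 * Z" using Z by (intro mult_left_mono) auto
      then show ?case using elim unfolding gradsq_expand[OF u z] r2 by (simp add: algebra_simps)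
    qed
  qed
  have "\<forall>\<^sub>F n in sequentially. norm (gip u (z n) - 0) < e"
  proof -
    have e1: "\<forall>\<^sub>F n in sequentially. 2 * t * gip u (z n) > - t\<^sup>2 * (Z + 1)" using ev[of t] t by simp
    have e2: "\<forall>\<^sub>F n in sequentially. 2 * (- t) * gip u (z n) > - t\<^sup>2 * (Z + 1)" using ev[of "- t"] t by simp
    from e1 e2 show ?thesis
    proof eventually_elim
    case (elim n)
    have tt: "t\<^sup>2 * (Z + 1) = t * e" using Z0 by (simp add: t_def power2_eq_square)
    have "t * (2 * gip u (z n)) > t * (- e)" "t * (2 * gip u (z n)) < t * e" using elim tt by (simp_all add: algebra_simps)
    then have "2 * gip u (z n) > - e" "2 * gip u (z n) < e" using t by (simp_all only: mult_less_cancel_left_pos)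
    then show ?case using e by (auto simp: abs_less_iff)
    qed
  qed
  then show "\<exists>no. \<forall>n\<ge>no. norm (gip u (z n) - 0) < e" unfolding eventually_sequentially by blast
qed

end

subsection \<open>Moduli of Sobolev functions\<close>

text \<open>The \<open>\<epsilon>\<close> under the root restores smoothness at zeros, and
  subtracting \<open>\<epsilon>\<close> restores the compact support. Taking the modulus of a pair
  lets a scalar Sobolev inequality pass to pairs without loss in the constant, on which
  \<open>Lambda\<close> depends.\<close>

definition smooth_modulus :: "real \<Rightarrow> ('a \<Rightarrow> complex) \<Rightarrow> ('a \<Rightarrow> complex) \<Rightarrow> 'a \<Rightarrow> real" where
  "smooth_modulus \<epsilon> \<phi> \<psi> x = (\<phi> x \<bullet> \<phi> x + \<psi> x \<bullet> \<psi> x + \<epsilon>\<^sup>2) powr (1/2) - \<epsilon>"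

lemma smooth_modulus_near:
  assumes "\<epsilon> > 0" shows "\<bar>smooth_modulus \<epsilon> \<phi> \<psi> x - norm (\<phi> x, \<psi> x)\<bar> \<le> \<epsilon>"
proof -
  define s where "s = \<phi> x \<bullet> \<phi> x + \<psi> x \<bullet> \<psi> x"
  have s: "s \<ge> 0" by (simp add: s_def)
  have e: "smooth_modulus \<epsilon> \<phi> \<psi> x = sqrt (s + \<epsilon>\<^sup>2) - \<epsilon>"
    using s unfolding smooth_modulus_def s_def by (subst powr_half_sqrt) (auto simp: add_nonneg_nonneg)
  have n: "norm (\<phi> x, \<psi> x) = sqrt s" by (simp add: norm_Pair s_def power2_norm_eq_inner)
  have "sqrt (s + \<epsilon>\<^sup>2) \<le> sqrt s + sqrt (\<epsilon>\<^sup>2)" by (rule sqrt_add_le_add_sqrt) (use s in auto)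
  moreover have "sqrt s \<le> sqrt (s + \<epsilon>\<^sup>2)" by simp
  ultimately show ?thesis unfolding e n using assms by (simp add: abs_le_iff)
qed

text \<open>The derivative is the inner product of the pair of derivatives with a vector of length
  less than 1, so Cauchy--Schwarz in \<open>complex \<times> complex\<close> gives the bound
  pointwise in every direction.\<close>

lemma smooth_modulus_test:
  fixes \<phi> \<psi> :: "'a::euclidean_space \<Rightarrow> complex"
  assumes \<phi>: "testfun A \<phi>" and \<psi>: "testfun A \<psi>" and \<epsilon>: "\<epsilon> > 0"
  shows "testfun A (smooth_modulus \<epsilon> \<phi> \<psi>)" "tgr (smooth_modulus \<epsilon> \<phi> \<psi>) \<le> tgr \<phi> + tgr \<psi>"
proof -
  define q where "q x = (\<phi> x \<bullet> \<phi> x + \<psi> x \<bullet> \<psi> x) + \<epsilon>\<^sup>2" for x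
  have q: "q x > 0" for x unfolding q_def using \<epsilon> by (intro add_nonneg_pos add_nonneg_nonneg) auto
  have "Ck k (\<lambda>x. q x powr (1/2) + (- \<epsilon>))" for k
  proof (intro Ck_add Ck_const Ck_powr[OF q])
    show "Ck k q" unfolding q_def[abs_def]
      using \<phi> \<psi> unfolding testfun_def smooth_fun_def by (intro Ck_add Ck_const Ck_bilinear[OF bounded_bilinear_inner]) auto
  qed
  then have sm: "smooth_fun (smooth_modulus \<epsilon> \<phi> \<psi>)"
    unfolding smooth_fun_def smooth_modulus_def[abs_def] q_def by simp
  obtain K1 where K1: "compact K1" "K1 \<subseteq> A" "\<And>x. x \<notin> K1 \<Longrightarrow> \<phi> x = 0" using \<phi> unfolding testfun_def by blast
  obtain K2 where K2: "compact K2" "K2 \<subseteq> A" "\<And>x. x \<notin> K2 \<Longrightarrow> \<psi> x = 0" using \<psi> unfolding testfun_def by blast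
  have "smooth_modulus \<epsilon> \<phi> \<psi> x = 0" if "x \<notin> K1 \<union> K2" for x
    using that K1(3)[of x] K2(3)[of x] \<epsilon> by (simp add: smooth_modulus_def powr_half_sqrt)
  then show t: "testfun A (smooth_modulus \<epsilon> \<phi> \<psi>)"
    unfolding testfun_def using sm K1 K2 by (intro conjI exI[of _ "K1 \<union> K2"]) auto
  have pt: "(norm (pd (smooth_modulus \<epsilon> \<phi> \<psi>) h x))\<^sup>2 \<le> (norm (pd \<phi> h x))\<^sup>2 + (norm (pd \<psi> h x))\<^sup>2" for h x
  proof -
    have dq: "(q has_derivative (\<lambda>h. 2 * (\<phi> x \<bullet> pd \<phi> h x + \<psi> x \<bullet> pd \<psi> h x))) (at x)"
      unfolding q_def[abs_def]
      by (rule has_derivative_eq_rhs, (rule derivative_intros testfun_has_derivative[OF \<phi>] testfun_has_derivative[OF \<psi>])+)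
        (auto simp: inner_commute algebra_simps)
    have "((\<lambda>x. q x powr (1/2)) has_derivative (\<lambda>h. (1/2 * q x powr (1/2 - 1)) * (2 * (\<phi> x \<bullet> pd \<phi> h x + \<psi> x \<bullet> pd \<psi> h x)))) (at x)"
      using has_derivative_compose[OF dq, of "\<lambda>t. t powr (1/2)"] has_real_derivative_powr[OF q, of "1/2" x]
      unfolding has_field_derivative_def by blast
    then have "((\<lambda>x. q x powr (1/2) - \<epsilon>) has_derivative (\<lambda>h. (1/2 * q x powr (1/2 - 1)) * (2 * (\<phi> x \<bullet> pd \<phi> h x + \<psi> x \<bullet> pd \<psi> h x)) - 0)) (at x)"
      by (rule has_derivative_diff[OF _ has_derivative_const])
    then have "pd (smooth_modulus \<epsilon> \<phi> \<psi>) h x = (1/2 * q x powr (1/2 - 1)) * (2 * (\<phi> x \<bullet> pd \<phi> h x + \<psi> x \<bullet> pd \<psi> h x)) - 0"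
      unfolding smooth_modulus_def[abs_def] q_def by (rule pd_eqI)
    moreover have "(1/2 * q x powr (1/2 - 1)) * (2 * Y) - 0 = q x powr (- (1/2)) * Y" for Y by simp
    ultimately have p: "pd (smooth_modulus \<epsilon> \<phi> \<psi>) h x = q x powr (- (1/2)) * ((\<phi> x, \<psi> x) \<bullet> (pd \<phi> h x, pd \<psi> h x))"
      by (simp only: inner_Pair)
    have "((\<phi> x, \<psi> x) \<bullet> (pd \<phi> h x, pd \<psi> h x))\<^sup>2 \<le> ((\<phi> x, \<psi> x) \<bullet> (\<phi> x, \<psi> x)) * ((pd \<phi> h x, pd \<psi> h x) \<bullet> (pd \<phi> h x, pd \<psi> h x))"
      by (rule Cauchy_Schwarz_ineq)
    also have "\<dots> \<le> q x * ((pd \<phi> h x, pd \<psi> h x) \<bullet> (pd \<phi> h x, pd \<psi> h x))"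
      by (intro mult_right_mono) (auto simp: q_def)
    finally have c: "((\<phi> x, \<psi> x) \<bullet> (pd \<phi> h x, pd \<psi> h x))\<^sup>2 \<le> q x * ((norm (pd \<phi> h x))\<^sup>2 + (norm (pd \<psi> h x))\<^sup>2)"
      by (simp add: power2_norm_eq_inner)
    have "(q x powr (- (1/2)))\<^sup>2 = inverse (q x)"
    proof -
      have "(q x powr (- (1/2)))\<^sup>2 = q x powr (- 1)" by (simp add: power2_eq_square powr_add[symmetric])
      then show ?thesis using powr_minus[of "q x" 1] q[of x] by simp
    qed
    then have "(norm (pd (smooth_modulus \<epsilon> \<phi> \<psi>) h x))\<^sup>2 = inverse (q x) * ((\<phi> x, \<psi> x) \<bullet> (pd \<phi> h x, pd \<psi> h x))\<^sup>2"
      unfolding p by (simp add: power_mult_distrib)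
    also have "\<dots> \<le> inverse (q x) * (q x * ((norm (pd \<phi> h x))\<^sup>2 + (norm (pd \<psi> h x))\<^sup>2))"
      using c q[of x] by (intro mult_left_mono) auto
    also have "\<dots> = (norm (pd \<phi> h x))\<^sup>2 + (norm (pd \<psi> h x))\<^sup>2"
      using q[of x] by (simp add: mult.assoc[symmetric])
    finally show ?thesis .
  qed
  have "nsq lborel (pd (smooth_modulus \<epsilon> \<phi> \<psi>) b) \<le> nsq lborel (pd \<phi> b) + nsq lborel (pd \<psi> b)" for b
  proof -
    have i: "integrable lborel (\<lambda>x. (norm (pd \<phi> b x))\<^sup>2)" "integrable lborel (\<lambda>x. (norm (pd \<psi> b x))\<^sup>2)"
      "integrable lborel (\<lambda>x. (norm (pd (smooth_modulus \<epsilon> \<phi> \<psi>) b x))\<^sup>2)"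
      using testfun_sqi(2)[OF \<phi>] testfun_sqi(2)[OF \<psi>] testfun_sqi(2)[OF t] by (auto simp: sqi_def)
    then have "nsq lborel (pd (smooth_modulus \<epsilon> \<phi> \<psi>) b) \<le> (\<integral>x. (norm (pd \<phi> b x))\<^sup>2 + (norm (pd \<psi> b x))\<^sup>2 \<partial>lborel)"
      unfolding nsq_def by (intro integral_mono pt) auto
    then show ?thesis using i by (simp add: nsq_def)
  qed
  then have "tgr (smooth_modulus \<epsilon> \<phi> \<psi>) \<le> (\<Sum>b\<in>Basis. nsq lborel (pd \<phi> b) + nsq lborel (pd \<psi> b))"
    unfolding tgr_def by (intro sum_mono)
  then show "tgr (smooth_modulus \<epsilon> \<phi> \<psi>) \<le> tgr \<phi> + tgr \<psi>" by (simp add: tgr_def sum.distrib)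
qed

context bounded_open
begin

lemma modulus_sqi:
  fixes u v :: "'a \<Rightarrow> complex"
  assumes "sqi LO u" "sqi LO v" shows "sqi LO (\<lambda>x. norm (u x, v x))" "nsq LO (\<lambda>x. norm (u x, v x)) = nsq LO u + nsq LO v"
proof -
  note [measurable] = sqiD(1)[OF assms(1)] sqiD(1)[OF assms(2)]
  have m: "(\<lambda>x. norm (u x, v x)) \<in> borel_measurable LO" unfolding norm_Pair by measurable
  have e: "(norm (norm (u x, v x)))\<^sup>2 = (norm (u x))\<^sup>2 + (norm (v x))\<^sup>2" for x by (simp add: norm_Pair)
  show "sqi LO (\<lambda>x. norm (u x, v x))" "nsq LO (\<lambda>x. norm (u x, v x)) = nsq LO u + nsq LO v"
    using m assms unfolding sqi_def nsq_def e by auto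
qed

text \<open>Regularised moduli of approximants with \<open>\<epsilon> = 1 / (k + 1)\<close>. The
  regularisation error is uniformly small on a set of finite measure; the rest is the reverse
  triangle inequality. Both the bound on moduli and the transfer of Sobolev inequalities start
  here.\<close>

lemma modulus_approx:
  assumes u: "H10 \<Omega> u" and v: "H10 \<Omega> v"
  obtains f :: "nat \<Rightarrow> 'a \<Rightarrow> real" and K where "\<And>k. testfun \<Omega> (f k)" "(\<lambda>k. nsq LO (\<lambda>x. f k x - norm (u x, v x))) \<longlonglongrightarrow> 0"
    "\<And>k. tgr (f k) \<le> K k" "K \<longlonglongrightarrow> gradsq \<Omega> u + gradsq \<Omega> v"
proof -
  obtain \<phi> where su: "sqi LO u" and \<phi>: "\<And>k. testfun \<Omega> (\<phi> k)" and lu: "(\<lambda>k. nsq LO (\<lambda>x. \<phi> k x - u x)) \<longlonglongrightarrow> 0"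
    and gu: "(\<lambda>k. tgr (\<phi> k)) \<longlonglongrightarrow> gradsq \<Omega> u"
    by (rule H10E[OF u]) blast
  obtain \<psi> where sv: "sqi LO v" and \<psi>: "\<And>k. testfun \<Omega> (\<psi> k)" and lv: "(\<lambda>k. nsq LO (\<lambda>x. \<psi> k x - v x)) \<longlonglongrightarrow> 0"
    and gv: "(\<lambda>k. tgr (\<psi> k)) \<longlonglongrightarrow> gradsq \<Omega> v"
    by (rule H10E[OF v]) blast
  define f where "f k = smooth_modulus (inverse (real (Suc k))) (\<phi> k) (\<psi> k)" for k
  have e: "inverse (real (Suc k)) > 0" for k by simp
  have f: "testfun \<Omega> (f k)" "tgr (f k) \<le> tgr (\<phi> k) + tgr (\<psi> k)" for k
    unfolding f_def using smooth_modulus_test[OF \<phi> \<psi> e] by blast+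
  have m\<phi>: "sqi LO (\<lambda>x. norm (\<phi> k x, \<psi> k x))" for k by (rule modulus_sqi(1)) (intro testfun_LO(1) \<phi> \<psi>)+
  have muv: "sqi LO (\<lambda>x. norm (u x, v x))" by (rule modulus_sqi(1)[OF su sv])
  have "(\<lambda>k. nsq LO (\<lambda>x. (f k x - norm (\<phi> k x, \<psi> k x)) + (norm (\<phi> k x, \<psi> k x) - norm (u x, v x)))) \<longlonglongrightarrow> 0"
  proof (rule nsq_add_tendsto_0)
    show "sqi LO (\<lambda>x. f k x - norm (\<phi> k x, \<psi> k x))" "sqi LO (\<lambda>x. norm (\<phi> k x, \<psi> k x) - norm (u x, v x))" for k
      by (intro sqi_diff testfun_LO(1) f m\<phi> muv)+
    show "(\<lambda>k. nsq LO (\<lambda>x. f k x - norm (\<phi> k x, \<psi> k x))) \<longlonglongrightarrow> 0"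
    proof (rule tendsto_0_bound)
      fix k
      have "nsq LO (\<lambda>x. f k x - norm (\<phi> k x, \<psi> k x)) \<le> (inverse (real (Suc k)))\<^sup>2 * measure LO \<Omega>"
      proof (rule nsq_LO_bounded(2))
        show "(\<lambda>x. f k x - norm (\<phi> k x, \<psi> k x)) \<in> borel_measurable LO"
          using sqiD(1)[OF sqi_diff[OF testfun_LO(1)[OF f(1)] m\<phi>]] .
        show "norm (f k x - norm (\<phi> k x, \<psi> k x)) \<le> inverse (real (Suc k))" for x
          unfolding f_def using smooth_modulus_near[OF e, of k "\<phi> k" "\<psi> k" x] by simp
      qed
      then show "norm (nsq LO (\<lambda>x. f k x - norm (\<phi> k x, \<psi> k x))) \<le> (inverse (real (Suc k)))\<^sup>2 * measure LO \<Omega>" by simp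
    next
      show "(\<lambda>k. (inverse (real (Suc k)))\<^sup>2 * measure LO \<Omega>) \<longlonglongrightarrow> 0"
        using tendsto_mult_right[OF tendsto_power[OF LIMSEQ_inverse_real_of_nat, of 2], of "measure LO \<Omega>"] by simp
    qed
    show "(\<lambda>k. nsq LO (\<lambda>x. norm (\<phi> k x, \<psi> k x) - norm (u x, v x))) \<longlonglongrightarrow> 0"
    proof (rule tendsto_0_bound)
      fix k
      have s1: "sqi LO (\<lambda>x. \<phi> k x - u x)" "sqi LO (\<lambda>x. \<psi> k x - v x)" by (intro sqi_diff testfun_LO(1) \<phi> \<psi> su sv)+
      have "nsq LO (\<lambda>x. norm (\<phi> k x, \<psi> k x) - norm (u x, v x)) \<le> nsq LO (\<lambda>x. norm (\<phi> k x - u x, \<psi> k x - v x))"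
        unfolding nsq_def
      proof (rule integral_mono)
        show "integrable LO (\<lambda>x. (norm (norm (\<phi> k x, \<psi> k x) - norm (u x, v x)))\<^sup>2)"
          by (rule sqiD(2)[OF sqi_diff[OF m\<phi> muv]])
        show "integrable LO (\<lambda>x. (norm (norm (\<phi> k x - u x, \<psi> k x - v x)))\<^sup>2)"
          by (rule sqiD(2)[OF modulus_sqi(1)[OF s1]])
        show "(norm (norm (\<phi> k x, \<psi> k x) - norm (u x, v x)))\<^sup>2 \<le> (norm (norm (\<phi> k x - u x, \<psi> k x - v x)))\<^sup>2" for x
          using norm_triangle_ineq3[of "(\<phi> k x, \<psi> k x)" "(u x, v x)"] by (intro power_mono) auto
      qed
      then show "norm (nsq LO (\<lambda>x. norm (\<phi> k x, \<psi> k x) - norm (u x, v x))) \<le> nsq LO (\<lambda>x. \<phi> k x - u x) + nsq LO (\<lambda>x. \<psi> k x - v x)"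
        using modulus_sqi(2)[OF s1] by simp
    next
      show "(\<lambda>k. nsq LO (\<lambda>x. \<phi> k x - u x) + nsq LO (\<lambda>x. \<psi> k x - v x)) \<longlonglongrightarrow> 0"
        using tendsto_add[OF lu lv] by simp
    qed
  qed
  then have l: "(\<lambda>k. nsq LO (\<lambda>x. f k x - norm (u x, v x))) \<longlonglongrightarrow> 0" by simp
  show thesis by (rule that[OF f(1) l f(2) tendsto_add[OF gu gv]])
qed

lemma tgr_of_real:
  assumes "testfun A (f :: 'a \<Rightarrow> real)" shows "testfun A (\<lambda>x. complex_of_real (f x))" "tgr (\<lambda>x. complex_of_real (f x)) = tgr f"
proof -
  show "testfun A (\<lambda>x. complex_of_real (f x))" by (rule testfun_bounded_linear[OF bounded_linear_of_real assms])
  have "pd (\<lambda>x. complex_of_real (f x)) b x = complex_of_real (pd f b x)" for b x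
    by (rule pd_bounded_linear[OF bounded_linear_of_real assms])
  then show "tgr (\<lambda>x. complex_of_real (f x)) = tgr f" by (simp add: tgr_def nsq_def)
qed

lemma H10_modulus:
  assumes u: "H10 \<Omega> u" and v: "H10 \<Omega> v"
  shows "H10 \<Omega> (\<lambda>x. complex_of_real (norm (u x, v x)))" "gradsq \<Omega> (\<lambda>x. complex_of_real (norm (u x, v x))) \<le> gradsq \<Omega> u + gradsq \<Omega> v"
proof -
  obtain f :: "nat \<Rightarrow> 'a \<Rightarrow> real" and K where f: "\<And>k. testfun \<Omega> (f k)" "(\<lambda>k. nsq LO (\<lambda>x. f k x - norm (u x, v x))) \<longlonglongrightarrow> 0"
    and K: "\<And>k. tgr (f k) \<le> K k" "K \<longlonglongrightarrow> gradsq \<Omega> u + gradsq \<Omega> v"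
    by (rule modulus_approx[OF u v]) blast
  have s: "sqi LO (\<lambda>x. complex_of_real (norm (u x, v x)))"
    using modulus_sqi(1)[OF H10_sqi[OF u] H10_sqi[OF v]] by (auto simp: sqi_def)
  have l: "(\<lambda>k. nsq LO (\<lambda>x. complex_of_real (f k x) - complex_of_real (norm (u x, v x)))) \<longlonglongrightarrow> 0"
    using f(2) by (simp add: nsq_def of_real_diff[symmetric] del: of_real_diff)
  have g: "gradsq \<Omega> (\<lambda>x. complex_of_real (f k x)) \<le> K k" for k
    using H10_test(2)[OF tgr_of_real(1)[OF f(1)]] tgr_of_real(2)[OF f(1)] K(1)[of k] by simp
  show "H10 \<Omega> (\<lambda>x. complex_of_real (norm (u x, v x)))" "gradsq \<Omega> (\<lambda>x. complex_of_real (norm (u x, v x))) \<le> gradsq \<Omega> u + gradsq \<Omega> v"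
    using H10_closed[OF s H10_test(1)[OF tgr_of_real(1)[OF f(1)]] l g K(2)] by blast+
qed

lemma H10_abs:
  assumes u: "H10 \<Omega> u"
  shows "H10 \<Omega> (\<lambda>x. complex_of_real (cmod (u x)))" "gradsq \<Omega> (\<lambda>x. complex_of_real (cmod (u x))) \<le> gradsq \<Omega> u"
  using H10_modulus[OF u H10_zero(1)] H10_zero(2) by (simp_all add: norm_Pair)

lemma AE_subseq_of_nsq:
  fixes f :: "nat \<Rightarrow> 'a \<Rightarrow> 'b::euclidean_space"
  assumes "\<And>n. sqi LO (f n)" "(\<lambda>n. nsq LO (f n)) \<longlonglongrightarrow> 0"
  shows "\<exists>s::nat\<Rightarrow>nat. strict_mono s \<and> (AE x in LO. (\<lambda>n. f (s n) x) \<longlonglongrightarrow> 0)"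
proof -
  have "\<exists>s::nat\<Rightarrow>nat. strict_mono s \<and> (AE x in LO. (\<lambda>n. (norm (f (s n) x))\<^sup>2) \<longlonglongrightarrow> 0)"
    by (rule tendsto_L1_AE_subseq) (use assms in \<open>auto simp: sqi_def nsq_def\<close>)
  then obtain s :: "nat \<Rightarrow> nat" where s: "strict_mono s" "AE x in LO. (\<lambda>n. (norm (f (s n) x))\<^sup>2) \<longlonglongrightarrow> 0" by blast
  have "AE x in LO. (\<lambda>n. f (s n) x) \<longlonglongrightarrow> 0" using s(2)
  proof eventually_elim
    case (elim x)
    then have "(\<lambda>n. sqrt ((norm (f (s n) x))\<^sup>2)) \<longlonglongrightarrow> sqrt 0" by (rule tendsto_real_sqrt)
    then show ?case by (simp add: tendsto_norm_zero_iff)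
  qed
  then show ?thesis using s(1) by blast
qed

text \<open>A Sobolev inequality for real test functions extends, with the same constant, to pairs in the
  Sobolev space: regularised moduli have the smaller Dirichlet integral, and Fatou's lemma applies.\<close>
lemma sobolev_transfer:
  assumes C: "C \<ge> 0" and r: "r > 0"
    and sob: "\<And>f :: 'a \<Rightarrow> real. testfun \<Omega> f \<Longrightarrow> (\<integral>x. \<bar>f x\<bar> powr r \<partial>lborel) \<le> C * tgr f powr (r / 2)"
    and u: "H10 \<Omega> u" and v: "H10 \<Omega> v"
  shows "integrable LO (\<lambda>x. norm (u x, v x) powr r)"
    "integral\<^sup>L LO (\<lambda>x. norm (u x, v x) powr r) \<le> C * (gradsq \<Omega> u + gradsq \<Omega> v) powr (r / 2)"
proof -
  obtain f :: "nat \<Rightarrow> 'a \<Rightarrow> real" and K where f: "\<And>k. testfun \<Omega> (f k)" "(\<lambda>k. nsq LO (\<lambda>x. f k x - norm (u x, v x))) \<longlonglongrightarrow> 0"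
    and K: "\<And>k. tgr (f k) \<le> K k" "K \<longlonglongrightarrow> gradsq \<Omega> u + gradsq \<Omega> v"
    by (rule modulus_approx[OF u v]) blast
  note muv = modulus_sqi(1)[OF H10_sqi[OF u] H10_sqi[OF v]]
  obtain s :: "nat \<Rightarrow> nat" where s: "strict_mono s" and ae: "AE x in LO. (\<lambda>k. f (s k) x - norm (u x, v x)) \<longlonglongrightarrow> 0"
    using AE_subseq_of_nsq[OF sqi_diff[OF testfun_LO(1)[OF f(1)] muv] f(2)] by blast
  have fm[measurable]: "f k \<in> borel_measurable borel" for k using testfun_cont[OF f(1)] by (rule borel_measurable_continuous_onI)
  have fl: "f k \<in> borel_measurable LO" for k by (rule borel_LO[OF fm])
  have m: "(\<lambda>x. norm (u x, v x)) \<in> borel_measurable LO" using muv by (simp add: sqi_def)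
  define L where "L = C * (gradsq \<Omega> u + gradsq \<Omega> v) powr (r / 2)"
  have nn: "(\<integral>\<^sup>+x. ennreal (\<bar>f k x\<bar> powr r) \<partial>LO) \<le> ennreal (C * K k powr (r / 2))" for k
  proof -
    have c: "continuous_on UNIV (\<lambda>x. \<bar>f k x\<bar> powr r)"
      using testfun_cont[OF f(1)] r by (intro continuous_on_powr' continuous_intros) auto
    obtain Q where Q: "compact Q" "\<And>x. x \<notin> Q \<Longrightarrow> f k x = 0" using f(1)[of k] unfolding testfun_def by blast
    have i: "integrable lborel (\<lambda>x. \<bar>f k x\<bar> powr r)"
      by (rule compact_support_integrable[OF c Q(1)]) (use Q(2) in auto)
    have o: "\<And>x. x \<notin> \<Omega> \<Longrightarrow> \<bar>f k x\<bar> powr r = 0" using testfun_outside(1)[OF f(1)] by simp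
    have iL: "integrable LO (\<lambda>x. \<bar>f k x\<bar> powr r)" "integral\<^sup>L LO (\<lambda>x. \<bar>f k x\<bar> powr r) = integral\<^sup>L lborel (\<lambda>x. \<bar>f k x\<bar> powr r)"
      using LO_lborel[of "\<lambda>x. \<bar>f k x\<bar> powr r"] o i by auto
    have "(\<integral>\<^sup>+x. ennreal (\<bar>f k x\<bar> powr r) \<partial>LO) = ennreal (integral\<^sup>L lborel (\<lambda>x. \<bar>f k x\<bar> powr r))"
      using iL by (subst nn_integral_eq_integral) auto
    also have "\<dots> \<le> ennreal (C * K k powr (r / 2))"
    proof (rule ennreal_leI)
      have "tgr (f k) powr (r / 2) \<le> K k powr (r / 2)" using K(1) r by (intro powr_mono2) auto
      then show "integral\<^sup>L lborel (\<lambda>x. \<bar>f k x\<bar> powr r) \<le> C * K k powr (r / 2)"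
        using sob[OF f(1), of k] mult_left_mono[OF _ C] by (meson order_trans)
    qed
    finally show ?thesis .
  qed
  have "(\<integral>\<^sup>+x. ennreal (norm (u x, v x) powr r) \<partial>LO) = (\<integral>\<^sup>+x. liminf (\<lambda>k. ennreal (\<bar>f (s k) x\<bar> powr r)) \<partial>LO)"
  proof (rule nn_integral_cong_AE)
    show "AE x in LO. ennreal (norm (u x, v x) powr r) = liminf (\<lambda>k. ennreal (\<bar>f (s k) x\<bar> powr r))"
      using ae
    proof eventually_elim
      case (elim x)
      then have "(\<lambda>k. f (s k) x) \<longlonglongrightarrow> norm (u x, v x)" by (simp add: LIM_zero_iff)
      then have "(\<lambda>k. \<bar>f (s k) x\<bar> powr r) \<longlonglongrightarrow> \<bar>norm (u x, v x)\<bar> powr r"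
        using r by (intro tendsto_powr' tendsto_rabs tendsto_const) auto
      then have "(\<lambda>k. ennreal (\<bar>f (s k) x\<bar> powr r)) \<longlonglongrightarrow> ennreal (norm (u x, v x) powr r)" by (intro tendsto_ennrealI) simp
      then show ?case by (rule lim_imp_Liminf[OF trivial_limit_sequentially, symmetric])
    qed
  qed
  also have "\<dots> \<le> liminf (\<lambda>k. \<integral>\<^sup>+x. ennreal (\<bar>f (s k) x\<bar> powr r) \<partial>LO)"
  proof (rule nn_integral_liminf)
    show "(\<lambda>x. ennreal (\<bar>f (s k) x\<bar> powr r)) \<in> borel_measurable LO" for k using fl[of "s k"] by measurable
  qed
  also have "\<dots> \<le> liminf (\<lambda>k. ennreal (C * K (s k) powr (r / 2)))"
    by (rule Liminf_mono) (use nn in auto)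
  also have "\<dots> = ennreal L"
  proof (rule lim_imp_Liminf[OF trivial_limit_sequentially])
    have "(\<lambda>k. K (s k)) \<longlonglongrightarrow> gradsq \<Omega> u + gradsq \<Omega> v" using LIMSEQ_subseq_LIMSEQ[OF K(2) s] by (simp add: o_def)
    moreover have "K k \<ge> 0" for k using K(1)[of k] tgr_nonneg[of "f k"] by linarith
    ultimately have "(\<lambda>k. K (s k) powr (r / 2)) \<longlonglongrightarrow> (gradsq \<Omega> u + gradsq \<Omega> v) powr (r / 2)"
      using r by (intro tendsto_powr' tendsto_const) auto
    then show "(\<lambda>k. ennreal (C * K (s k) powr (r / 2))) \<longlonglongrightarrow> ennreal L"
      unfolding L_def by (intro tendsto_ennrealI tendsto_mult_left)
  qed
  finally have fin: "(\<integral>\<^sup>+x. ennreal (norm (u x, v x) powr r) \<partial>LO) \<le> ennreal L" .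
  have "(\<integral>\<^sup>+x. ennreal (norm (norm (u x, v x) powr r)) \<partial>LO) < \<infinity>"
    using le_less_trans[OF fin ennreal_less_top] by simp
  then show i: "integrable LO (\<lambda>x. norm (u x, v x) powr r)"
    using m by (intro integrableI_bounded) auto
  have "(\<integral>\<^sup>+x. ennreal (norm (u x, v x) powr r) \<partial>LO) = ennreal (integral\<^sup>L LO (\<lambda>x. norm (u x, v x) powr r))"
    using i by (intro nn_integral_eq_integral) auto
  moreover have "L \<ge> 0" unfolding L_def using C by simp
  ultimately show "integral\<^sup>L LO (\<lambda>x. norm (u x, v x) powr r) \<le> C * (gradsq \<Omega> u + gradsq \<Omega> v) powr (r / 2)"
    using fin by (simp add: ennreal_le_iff L_def)
qed

end

subsection \<open>The Gagliardo--Nirenberg--Sobolev inequality\<close>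

text \<open>A real power on \<open>ennreal\<close> with \<open>top\<close> kept fixed, needed
  because the iterated line integrals below are not known to be finite.\<close>

definition ennroot :: "real \<Rightarrow> ennreal \<Rightarrow> ennreal" where
  "ennroot \<theta> x = (if x = top then top else ennreal (enn2real x powr \<theta>))"

lemma ennroot_measurable [measurable]: "ennroot \<theta> \<in> borel_measurable borel"
  unfolding ennroot_def[abs_def] by measurable

lemma ennroot_simps: "\<theta> > 0 \<Longrightarrow> ennroot \<theta> 0 = 0" "a \<ge> 0 \<Longrightarrow> ennroot \<theta> (ennreal a) = ennreal (a powr \<theta>)" "ennroot \<theta> top = top"
  by (auto simp: ennroot_def)

lemma ennroot_mono: "\<theta> > 0 \<Longrightarrow> x \<le> y \<Longrightarrow> ennroot \<theta> x \<le> ennroot \<theta> y"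
  unfolding ennroot_def
  by (auto simp: top_unique less_top intro!: ennreal_leI powr_mono2 enn2real_mono)

lemma ennroot_eq_0: "\<theta> > 0 \<Longrightarrow> ennroot \<theta> x = 0 \<longleftrightarrow> x = 0"
  unfolding ennroot_def by (auto simp: enn2real_eq_0_iff)

lemma ennreal_prod_mono:
  fixes f g :: "'i \<Rightarrow> ennreal"
  shows "(\<And>i. i \<in> A \<Longrightarrow> f i \<le> g i) \<Longrightarrow> (\<Prod>i\<in>A. f i) \<le> (\<Prod>i\<in>A. g i)"
  by (induction A rule: infinite_finite_induct) (auto intro!: mult_mono)

text \<open>The inequality of arithmetic and geometric means for the normalised factors
  \<open>h i / c i\<close>. With \<open>c i\<close> the integral of \<open>h i\<close>, integrating
  it gives Hoelder's inequality.\<close>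

lemma ennroot_amgm:
  fixes h c :: "'i \<Rightarrow> ennreal"
  assumes A: "finite A" "A \<noteq> {}" and c: "\<And>i. i \<in> A \<Longrightarrow> c i \<noteq> 0 \<and> c i \<noteq> top"
  shows "(\<Prod>i\<in>A. ennroot (1 / card A) (h i)) \<le> (\<Prod>i\<in>A. ennroot (1 / card A) (c i)) * ((\<Sum>i\<in>A. h i / c i) / of_nat (card A))"
proof (cases "\<exists>i\<in>A. h i = top")
  case True
  then obtain i where i: "i \<in> A" "h i = top" by blast
  have pos: "card A > 0" using A by (simp add: card_gt_0_iff)
  have "h i / c i = top" using i c[OF i(1)] by (simp add: ennreal_top_divide)
  moreover have "h i / c i \<le> (\<Sum>i\<in>A. h i / c i)" using i A by (intro member_le_sum) auto
  ultimately have "(\<Sum>i\<in>A. h i / c i) = top" by (simp add: top_unique)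
  then have t: "(\<Sum>i\<in>A. h i / c i) / of_nat (card A) = top" by (simp add: ennreal_top_divide)
  define P where "P = (\<Prod>i\<in>A. ennroot (1 / card A) (c i))"
  have "P \<noteq> 0" unfolding P_def using A c pos by (auto simp: ennroot_eq_0)
  then have "P * ((\<Sum>i\<in>A. h i / c i) / of_nat (card A)) = top" unfolding t by (simp add: ennreal_mult_top)
  then show ?thesis unfolding P_def by simp
next
  case False
  define h' c' where "h' i = enn2real (h i)" and "c' i = enn2real (c i)" for i
  have h': "h i = ennreal (h' i)" "h' i \<ge> 0" if "i \<in> A" for i using False that by (auto simp: h'_def less_top)
  have c': "c i = ennreal (c' i)" "c' i > 0" if "i \<in> A" for i
    using c[OF that] by (auto simp: c'_def less_top enn2real_positive_iff zero_less_iff_neq_zero)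
  have pos: "card A > 0" using A by (simp add: card_gt_0_iff)
  have hc: "h' i / c' i \<ge> 0" if "i \<in> A" for i using h'(2)[OF that] c'(2)[OF that] by simp
  have nz: "(\<Prod>i\<in>A. c' i powr (1 / card A)) > 0" using c'(2) by (intro prod_pos) fastforce
  have "(\<Prod>i\<in>A. h' i powr (1 / card A)) = (\<Prod>i\<in>A. c' i powr (1 / card A)) * (\<Prod>i\<in>A. h' i / c' i) powr (1 / card A)"
  proof -
    have "(\<Prod>i\<in>A. h' i / c' i) powr (1 / card A) = (\<Prod>i\<in>A. (h' i / c' i) powr (1 / card A))"
      using hc by (intro prod_powr_distrib)
    also have "\<dots> = (\<Prod>i\<in>A. h' i powr (1 / card A)) / (\<Prod>i\<in>A. c' i powr (1 / card A))"
      unfolding prod_dividef[symmetric] using h' c' by (intro prod.cong) (auto intro!: powr_divide less_imp_le)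
    finally show ?thesis using nz by simp
  qed
  also have "\<dots> \<le> (\<Prod>i\<in>A. c' i powr (1 / card A)) * (\<Sum>i\<in>A. (h' i / c' i) / card A)"
    using nz by (intro mult_left_mono arith_geom_mean A hc) auto
  finally have "ennreal (\<Prod>i\<in>A. h' i powr (1 / card A)) \<le> ennreal ((\<Prod>i\<in>A. c' i powr (1 / card A)) * ((\<Sum>i\<in>A. h' i / c' i) / card A))"
    by (intro ennreal_leI) (simp add: sum_divide_distrib)
  also have "ennreal ((\<Prod>i\<in>A. c' i powr (1 / card A)) * ((\<Sum>i\<in>A. h' i / c' i) / card A))
      = ennreal (\<Prod>i\<in>A. c' i powr (1 / card A)) * ennreal ((\<Sum>i\<in>A. h' i / c' i) / card A)"
    using nz by (intro ennreal_mult divide_nonneg_nonneg sum_nonneg hc) auto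
  also have "ennreal ((\<Sum>i\<in>A. h' i / c' i) / card A) = (\<Sum>i\<in>A. h i / c i) / of_nat (card A)"
  proof -
    have "ennreal ((\<Sum>i\<in>A. h' i / c' i) / card A) = ennreal (\<Sum>i\<in>A. h' i / c' i) / ennreal (real (card A))"
      using pos by (intro divide_ennreal[symmetric] sum_nonneg hc) auto
    also have "ennreal (\<Sum>i\<in>A. h' i / c' i) = (\<Sum>i\<in>A. ennreal (h' i / c' i))"
      by (intro sum_ennreal[symmetric] hc)
    also have "\<dots> = (\<Sum>i\<in>A. h i / c i)"
      using h' c' by (intro sum.cong) (auto simp: divide_ennreal)
    finally show ?thesis by (simp add: ennreal_of_nat_eq_real_of_nat)
  qed
  also have "ennreal (\<Prod>i\<in>A. c' i powr (1 / card A)) = (\<Prod>i\<in>A. ennroot (1 / card A) (c i))"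
    using c' by (subst prod_ennreal[symmetric]) (auto simp: ennroot_simps less_imp_le intro!: prod.cong)
  also have "ennreal (\<Prod>i\<in>A. h' i powr (1 / card A)) = (\<Prod>i\<in>A. ennroot (1 / card A) (h i))"
    using h' by (subst prod_ennreal[symmetric]) (auto simp: ennroot_simps intro!: prod.cong)
  finally show ?thesis .
qed

text \<open>Hoelder's inequality for \<open>card A\<close> factors with equal exponents: after
  normalisation the product is bounded by a mean of functions of integral 1.\<close>

lemma holder_prod:
  fixes h :: "'i \<Rightarrow> 'x \<Rightarrow> ennreal"
  assumes A: "finite A" "A \<noteq> {}" and h[measurable]: "\<And>i. i \<in> A \<Longrightarrow> h i \<in> borel_measurable M"
  shows "(\<integral>\<^sup>+x. (\<Prod>i\<in>A. ennroot (1 / card A) (h i x)) \<partial>M) \<le> (\<Prod>i\<in>A. ennroot (1 / card A) (\<integral>\<^sup>+x. h i x \<partial>M))"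
proof -
  have pos: "card A > 0" using A by (simp add: card_gt_0_iff)
  define c where "c i = (\<integral>\<^sup>+x. h i x \<partial>M)" for i
  \<comment> \<open>An infinite integral makes the right-hand side infinite only if no other factor
    is zero, so vanishing integrals are split off before infinite ones.\<close>
  consider (zero) i where "i \<in> A" "c i = 0" | (top) i where "i \<in> A" "c i = top" "\<And>j. j \<in> A \<Longrightarrow> c j \<noteq> 0"
    | (fin) "\<And>i. i \<in> A \<Longrightarrow> c i \<noteq> 0 \<and> c i \<noteq> top" by blast
  then show ?thesis
  proof cases
    case zero
    then have "AE x in M. h i x = 0" using h[OF zero(1)] by (simp add: c_def nn_integral_0_iff_AE)
    then have "AE x in M. (\<Prod>i\<in>A. ennroot (1 / card A) (h i x)) = 0"
    proof eventually_elim
      case (elim x)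
      then show ?case using zero(1) A pos by (intro prod_zero) (auto simp: ennroot_simps intro!: bexI[of _ i])
    qed
    then have "(\<integral>\<^sup>+x. (\<Prod>i\<in>A. ennroot (1 / card A) (h i x)) \<partial>M) = (\<integral>\<^sup>+x. 0 \<partial>M)" by (rule nn_integral_cong_AE)
    then show ?thesis by simp
  next
    case top
    have "(\<Prod>i\<in>A. ennroot (1 / card A) (c i)) = ennroot (1 / card A) (c i) * (\<Prod>i\<in>A - {i}. ennroot (1 / card A) (c i))"
      using top(1) A by (simp add: prod.remove)
    moreover have "(\<Prod>i\<in>A - {i}. ennroot (1 / card A) (c i)) \<noteq> 0"
      using A top(3) pos by (auto simp: ennroot_eq_0)
    ultimately have "(\<Prod>i\<in>A. ennroot (1 / card A) (c i)) = top" using top(2) by (simp add: ennroot_simps ennreal_top_mult)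
    then show ?thesis by (simp add: c_def)
  next
    case fin
    define P where "P = (\<Prod>i\<in>A. ennroot (1 / card A) (c i))"
    have "(\<integral>\<^sup>+x. (\<Prod>i\<in>A. ennroot (1 / card A) (h i x)) \<partial>M) \<le> (\<integral>\<^sup>+x. P * ((\<Sum>i\<in>A. h i x / c i) / of_nat (card A)) \<partial>M)"
      unfolding P_def by (intro nn_integral_mono ennroot_amgm A fin)
    also have "\<dots> = P * ((\<Sum>i\<in>A. (\<integral>\<^sup>+x. h i x \<partial>M) / c i) / of_nat (card A))"
      by (simp add: nn_integral_cmult nn_integral_divide nn_integral_sum)
    also have "(\<Sum>i\<in>A. (\<integral>\<^sup>+x. h i x \<partial>M) / c i) = (\<Sum>i\<in>A. 1)"
      using fin by (intro sum.cong) (auto simp: c_def[symmetric] less_top intro!: ennreal_divide_self)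
    also have "P * ((\<Sum>i\<in>A. 1) / of_nat (card A)) = P"
    proof -
      have "of_nat (card A) / of_nat (card A) = (1::ennreal)" using pos by (intro ennreal_divide_self) (auto simp: of_nat_less_top)
      then show ?thesis by simp
    qed
    finally show ?thesis unfolding P_def c_def .
  qed
qed

section \<open>Integration along lines and the Loomis--Whitney inequality\<close>

definition line_int :: "'a::euclidean_space \<Rightarrow> ('a \<Rightarrow> ennreal) \<Rightarrow> 'a \<Rightarrow> ennreal" where
  "line_int b f x = (\<integral>\<^sup>+t. f (x + t *\<^sub>R b) \<partial>(lborel :: real measure))"

text \<open>Iterated integration over a list of directions, so that Loomis--Whitney can be proved by
  induction on the list; over a list of the whole basis it is the integral over the space.\<close>

fun lines_int :: "'a::euclidean_space list \<Rightarrow> ('a \<Rightarrow> ennreal) \<Rightarrow> 'a \<Rightarrow> ennreal" where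
  "lines_int [] f = f"
| "lines_int (b # bs) f = line_int b (lines_int bs f)"

lemma line_int_measurable [measurable]:
  assumes [measurable]: "f \<in> borel_measurable borel" shows "line_int b f \<in> borel_measurable borel"
  unfolding line_int_def[abs_def] by measurable

lemma lines_int_measurable [measurable]: "f \<in> borel_measurable borel \<Longrightarrow> lines_int bs f \<in> borel_measurable borel"
  by (induction bs) auto

lemma line_int_shift:
  assumes [measurable]: "f \<in> borel_measurable borel" shows "line_int b f (x + s *\<^sub>R b) = line_int b f x"
proof -
  have "line_int b f x = (\<integral>\<^sup>+t. f (x + t *\<^sub>R b) \<partial>distr lborel borel (\<lambda>t. t + s))"
    unfolding line_int_def lborel_shift by simp
  also have "\<dots> = (\<integral>\<^sup>+t. f (x + (t + s) *\<^sub>R b) \<partial>lborel)" by (subst nn_integral_distr) auto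
  finally show ?thesis by (simp add: line_int_def algebra_simps)
qed

lemma lines_int_invariant:
  assumes "\<And>x s. f (x + s *\<^sub>R k) = f x" shows "lines_int bs f (x + s *\<^sub>R k) = lines_int bs f x"
proof (induction bs arbitrary: x)
  case (Cons b bs)
  have "lines_int bs f ((x + s *\<^sub>R k) + t *\<^sub>R b) = lines_int bs f (x + t *\<^sub>R b)" for t
    using Cons[of "x + t *\<^sub>R b"] by (simp add: add_ac)
  then show ?case by (simp add: line_int_def)
qed (use assms in simp)

lemma lines_int_append: "lines_int (as @ bs) f = lines_int as (lines_int bs f)"
  by (induction as) auto

lemma lines_int_PiM:
  assumes f[measurable]: "f \<in> borel_measurable borel" and "distinct bs"
  shows "lines_int bs f x = (\<integral>\<^sup>+y. f (x + (\<Sum>b\<in>set bs. y b *\<^sub>R b)) \<partial>(\<Pi>\<^sub>M b\<in>set bs. (lborel :: real measure)))"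
  using assms(2)
proof (induction bs arbitrary: x)
  case Nil
  interpret product_sigma_finite "\<lambda>b::'a. (lborel :: real measure)" by standard
  show ?case by (simp add: PiM_empty)
next
  case (Cons b bs)
  interpret product_sigma_finite "\<lambda>b::'a. (lborel :: real measure)" by standard
  have m: "(\<lambda>y. f (x + (\<Sum>c\<in>insert b (set bs). y c *\<^sub>R c))) \<in> borel_measurable (\<Pi>\<^sub>M b\<in>insert b (set bs). (lborel :: real measure))"
    by measurable
  have "(\<integral>\<^sup>+y. f (x + (\<Sum>c\<in>set (b # bs). y c *\<^sub>R c)) \<partial>(\<Pi>\<^sub>M b\<in>set (b # bs). (lborel :: real measure)))
     = (\<integral>\<^sup>+t. (\<integral>\<^sup>+y. f (x + (\<Sum>c\<in>insert b (set bs). (y(b := t)) c *\<^sub>R c)) \<partial>(\<Pi>\<^sub>M b\<in>set bs. (lborel :: real measure))) \<partial>lborel)"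
    using product_nn_integral_insert_rev[of "set bs" b, OF _ _ m] Cons.prems by simp
  also have "\<dots> = (\<integral>\<^sup>+t. (\<integral>\<^sup>+y. f ((x + t *\<^sub>R b) + (\<Sum>c\<in>set bs. y c *\<^sub>R c)) \<partial>(\<Pi>\<^sub>M b\<in>set bs. (lborel :: real measure))) \<partial>lborel)"
  proof -
    have "(\<Sum>c\<in>insert b (set bs). (y(b := t)) c *\<^sub>R c) = t *\<^sub>R b + (\<Sum>c\<in>set bs. y c *\<^sub>R c)" for y :: "'a \<Rightarrow> real" and t
    proof -
      have "(\<Sum>c\<in>set bs. (y(b := t)) c *\<^sub>R c) = (\<Sum>c\<in>set bs. y c *\<^sub>R c)"
        using Cons.prems by (intro sum.cong) auto
      then show ?thesis using Cons.prems by simp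
    qed
    then show ?thesis by (simp add: add.assoc)
  qed
  finally show ?case using Cons by (simp add: line_int_def)
qed

lemma lines_int_Basis:
  assumes f[measurable]: "f \<in> borel_measurable borel" and "distinct bs" "set bs = (Basis :: 'a::euclidean_space set)"
  shows "lines_int bs f (0::'a) = (\<integral>\<^sup>+x. f x \<partial>lborel)"
proof -
  have "(\<integral>\<^sup>+x. f x \<partial>lborel) = (\<integral>\<^sup>+x. f x \<partial>distr (\<Pi>\<^sub>M b\<in>Basis. lborel) borel (\<lambda>f. \<Sum>b\<in>Basis. f b *\<^sub>R b))"
    by (subst lborel_eq) simp
  also have "\<dots> = (\<integral>\<^sup>+y. f (\<Sum>b\<in>Basis. y b *\<^sub>R b) \<partial>(\<Pi>\<^sub>M b\<in>Basis. lborel))"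
    by (rule nn_integral_distr) measurable
  finally show ?thesis using lines_int_PiM[OF assms(1,2), of 0] assms(3) by simp
qed

text \<open>When integrating along \<open>k\<close>, the factor with \<open>i = k\<close> is
  constant on the line, as it was already integrated in that direction, and comes out. Hoelder with
  \<open>DIM - 1\<close> factors handles the others, each of which picks up an integration along
  \<open>k\<close>. The filter records which directions factor \<open>i\<close> has received in
  addition to its own.\<close>

lemma loomis_whitney_aux:
  fixes f :: "'a::euclidean_space \<Rightarrow> 'a \<Rightarrow> ennreal"
  assumes N: "DIM('a) \<ge> 2" and \<theta>: "\<theta> = 1 / real (DIM('a) - 1)"
    and f[measurable]: "\<And>i. i \<in> Basis \<Longrightarrow> f i \<in> borel_measurable borel"
    and bs: "distinct bs" "set bs \<subseteq> Basis"
  shows "lines_int bs (\<lambda>x. \<Prod>i\<in>Basis. ennroot \<theta> (line_int i (f i) x)) x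
     \<le> (\<Prod>i\<in>Basis. ennroot \<theta> (lines_int (filter (\<lambda>c. c \<noteq> i) bs) (line_int i (f i)) x))"
  using bs
proof (induction bs arbitrary: x)
  case (Cons k bs)
  then have k: "k \<in> Basis" "k \<notin> set bs" by auto
  have card: "card (Basis - {k}) = DIM('a) - 1" "finite (Basis - {k})" using k by auto
  have ne: "Basis - {k} \<noteq> {}" using card(1) N by (metis card.empty diff_is_0_eq not_less_eq_eq numeral_2_eq_2 zero_less_diff less_numeral_extra(3) Suc_le_eq diff_Suc_1 le_antisym)
  define G where "G i = lines_int (filter (\<lambda>c. c \<noteq> i) bs) (line_int i (f i))" for i
  have G[measurable]: "i \<in> Basis \<Longrightarrow> G i \<in> borel_measurable borel" for i unfolding G_def by measurable
  have Gk: "G k (x + t *\<^sub>R k) = G k x" for t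
    unfolding G_def by (rule lines_int_invariant, rule line_int_shift) (use f k in auto)
  have "lines_int (k # bs) (\<lambda>x. \<Prod>i\<in>Basis. ennroot \<theta> (line_int i (f i) x)) x
     \<le> (\<integral>\<^sup>+t. (\<Prod>i\<in>Basis. ennroot \<theta> (G i (x + t *\<^sub>R k))) \<partial>lborel)"
    unfolding lines_int.simps line_int_def[of k "lines_int bs _"] G_def using Cons by (intro nn_integral_mono) auto
  also have "\<dots> = (\<integral>\<^sup>+t. ennroot \<theta> (G k x) * (\<Prod>i\<in>Basis - {k}. ennroot \<theta> (G i (x + t *\<^sub>R k))) \<partial>lborel)"
    using k by (intro nn_integral_cong) (simp add: prod.remove[of Basis k] Gk)
  also have "\<dots> = ennroot \<theta> (G k x) * (\<integral>\<^sup>+t. (\<Prod>i\<in>Basis - {k}. ennroot \<theta> (G i (x + t *\<^sub>R k))) \<partial>lborel)"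
    by (rule nn_integral_cmult) measurable
  also have "\<dots> \<le> ennroot \<theta> (G k x) * (\<Prod>i\<in>Basis - {k}. ennroot \<theta> (\<integral>\<^sup>+t. G i (x + t *\<^sub>R k) \<partial>lborel))"
  proof (rule mult_left_mono)
    have "(\<lambda>t. G i (x + t *\<^sub>R k)) \<in> borel_measurable lborel" if "i \<in> Basis - {k}" for i
    proof -
      have [measurable]: "G i \<in> borel_measurable borel" using that G by blast
      show ?thesis by measurable
    qed
    then show "(\<integral>\<^sup>+t. (\<Prod>i\<in>Basis - {k}. ennroot \<theta> (G i (x + t *\<^sub>R k))) \<partial>lborel) \<le> (\<Prod>i\<in>Basis - {k}. ennroot \<theta> (\<integral>\<^sup>+t. G i (x + t *\<^sub>R k) \<partial>lborel))"
      using holder_prod[OF card(2) ne, of "\<lambda>i t. G i (x + t *\<^sub>R k)" lborel] unfolding card(1) \<theta> by simp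
  qed simp
  also have "\<dots> = (\<Prod>i\<in>Basis. ennroot \<theta> (lines_int (filter (\<lambda>c. c \<noteq> i) (k # bs)) (line_int i (f i)) x))"
  proof -
    have e1: "lines_int (filter (\<lambda>c. c \<noteq> i) (k # bs)) (line_int i (f i)) x = (\<integral>\<^sup>+t. G i (x + t *\<^sub>R k) \<partial>lborel)" if "i \<noteq> k" for i
      using that by (simp add: line_int_def[of k] G_def)
    have e2: "lines_int (filter (\<lambda>c. c \<noteq> k) (k # bs)) (line_int k (f k)) x = G k x" by (simp add: G_def)
    have e3: "(\<Prod>i\<in>Basis. ennroot \<theta> (L i)) = ennroot \<theta> (L k) * (\<Prod>i\<in>Basis - {k}. ennroot \<theta> (L i))" for L :: "'a \<Rightarrow> ennreal"
      using k by (simp add: prod.remove[of Basis k])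
    have "(\<Prod>i\<in>Basis - {k}. ennroot \<theta> (\<integral>\<^sup>+t. G i (x + t *\<^sub>R k) \<partial>lborel))
       = (\<Prod>i\<in>Basis - {k}. ennroot \<theta> (lines_int (filter (\<lambda>c. c \<noteq> i) (k # bs)) (line_int i (f i)) x))"
    proof (rule prod.cong[OF refl])
      fix i assume "i \<in> Basis - {k}"
      then have "i \<noteq> k" by simp
      from e1[OF this] show "ennroot \<theta> (\<integral>\<^sup>+t. G i (x + t *\<^sub>R k) \<partial>lborel) = ennroot \<theta> (lines_int (filter (\<lambda>c. c \<noteq> i) (k # bs)) (line_int i (f i)) x)"
        by (simp only:)
    qed
    then show ?thesis unfolding e3[of "\<lambda>i. lines_int (filter (\<lambda>c. c \<noteq> i) (k # bs)) (line_int i (f i)) x"] e2 by (simp only:)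
  qed
  finally show ?case .
qed (simp)

text \<open>For the full basis, the list without \<open>i\<close> followed by the line integral
  along \<open>i\<close> runs through every direction once, so each factor ends as a full
  integral.\<close>

lemma loomis_whitney:
  fixes f :: "'a::euclidean_space \<Rightarrow> 'a \<Rightarrow> ennreal"
  assumes N: "DIM('a) \<ge> 2" and \<theta>: "\<theta> = 1 / real (DIM('a) - 1)"
    and f[measurable]: "\<And>i. i \<in> Basis \<Longrightarrow> f i \<in> borel_measurable borel"
  shows "(\<integral>\<^sup>+x. (\<Prod>i\<in>Basis. ennroot \<theta> (line_int i (f i) x)) \<partial>lborel) \<le> (\<Prod>i\<in>Basis. ennroot \<theta> (\<integral>\<^sup>+x. f i x \<partial>lborel))"
proof -
  obtain bs where bs: "distinct bs" "set bs = (Basis :: 'a set)" using finite_distinct_list[OF finite_Basis] by blast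
  have "(\<integral>\<^sup>+x. (\<Prod>i\<in>Basis. ennroot \<theta> (line_int i (f i) x)) \<partial>lborel) = lines_int bs (\<lambda>x. \<Prod>i\<in>Basis. ennroot \<theta> (line_int i (f i) x)) 0"
    by (rule lines_int_Basis[symmetric, OF _ bs]) measurable
  also have "\<dots> \<le> (\<Prod>i\<in>Basis. ennroot \<theta> (lines_int (filter (\<lambda>c. c \<noteq> i) bs) (line_int i (f i)) 0))"
    by (rule loomis_whitney_aux[OF N \<theta> f bs(1)]) (use bs in auto)
  also have "\<dots> = (\<Prod>i\<in>Basis. ennroot \<theta> (\<integral>\<^sup>+x. f i x \<partial>lborel))"
  proof (rule prod.cong[OF refl])
    fix i :: 'a assume i: "i \<in> Basis"
    have "lines_int (filter (\<lambda>c. c \<noteq> i) bs) (line_int i (f i)) 0 = lines_int (filter (\<lambda>c. c \<noteq> i) bs @ [i]) (f i) 0"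
      by (simp add: lines_int_append)
    also have "\<dots> = (\<integral>\<^sup>+x. f i x \<partial>lborel)"
      by (rule lines_int_Basis[OF f[OF i]]) (use bs i in auto)
    finally show "ennroot \<theta> (lines_int (filter (\<lambda>c. c \<noteq> i) bs) (line_int i (f i)) 0) = ennroot \<theta> (\<integral>\<^sup>+x. f i x \<partial>lborel)" by simp
  qed
  finally show ?thesis .
qed

section \<open>Sobolev inequalities for test functions from bounds along lines\<close>

lemma abs_powr_has_derivative:
  assumes "\<gamma> > 1" shows "((\<lambda>t::real. \<bar>t\<bar> powr \<gamma>) has_real_derivative \<gamma> * (\<bar>t\<bar> powr (\<gamma> - 1) * sgn t)) (at t)"
proof (cases "t = 0")
  case False
  show ?thesis
  proof (cases "t > 0")
    case True
    have "((\<lambda>t. t powr \<gamma>) has_real_derivative \<gamma> * t powr (\<gamma> - 1)) (at t)" by (rule has_real_derivative_powr[OF True])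
    then have "((\<lambda>t. \<bar>t\<bar> powr \<gamma>) has_real_derivative \<gamma> * t powr (\<gamma> - 1)) (at t)"
      by (rule DERIV_cong_ev[THEN iffD1, rotated 3]) (use True in \<open>auto simp: eventually_nhds intro!: exI[of _ "{0<..}"]\<close>)
    then show ?thesis using True by simp
  next
    case F: False
    then have t: "- t > 0" using False by simp
    have "((\<lambda>t. (- t) powr \<gamma>) has_real_derivative - (\<gamma> * (- t) powr (\<gamma> - 1))) (at t)"
      using DERIV_chain'[OF DERIV_minus[OF DERIV_ident] has_real_derivative_powr[OF t, of \<gamma>]] by simp
    then have "((\<lambda>t. \<bar>t\<bar> powr \<gamma>) has_real_derivative - (\<gamma> * (- t) powr (\<gamma> - 1))) (at t)"
      by (rule DERIV_cong_ev[THEN iffD1, rotated 3]) (use t in \<open>auto simp: eventually_nhds intro!: exI[of _ "{..<0}"]\<close>)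
    then show ?thesis using t by simp
  qed
next
  case True
  have "((\<lambda>h::real. \<bar>h\<bar> powr (\<gamma> - 1)) \<longlongrightarrow> \<bar>0\<bar> powr (\<gamma> - 1)) (at 0)"
    using assms by (intro tendsto_powr' tendsto_intros) auto
  then have l: "((\<lambda>h::real. \<bar>h\<bar> powr (\<gamma> - 1)) \<longlongrightarrow> 0) (at 0)" using assms by simp
  have "((\<lambda>h::real. \<bar>h\<bar> powr \<gamma> / h) \<longlongrightarrow> 0) (at 0)"
  proof (rule Lim_null_comparison[OF always_eventually l], rule allI)
    fix h :: real
    have "\<bar>h\<bar> powr \<gamma> = \<bar>h\<bar> powr (\<gamma> - 1) * \<bar>h\<bar>" if "h \<noteq> 0" using that powr_add[of "\<bar>h\<bar>" "\<gamma> - 1" 1] by simp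
    then show "norm (\<bar>h\<bar> powr \<gamma> / h) \<le> \<bar>h\<bar> powr (\<gamma> - 1)" by (cases "h = 0") auto
  qed
  then show ?thesis using True assms by (simp add: DERIV_def)
qed

lemma abs_powr_sgn_continuous:
  assumes "a > 0" shows "continuous_on UNIV (\<lambda>t::real. \<bar>t\<bar> powr a * sgn t)"
  unfolding continuous_on_eq_continuous_at[OF open_UNIV]
proof
  fix t :: real
  show "isCont (\<lambda>t. \<bar>t\<bar> powr a * sgn t) t"
  proof (cases "t = 0")
    case False
    then show ?thesis by (intro continuous_intros isCont_sgn) auto
  next
    case True
    have "((\<lambda>h::real. \<bar>h\<bar> powr a) \<longlongrightarrow> \<bar>0\<bar> powr a) (at 0)"
      using assms by (intro tendsto_powr' tendsto_intros) auto
    then have l: "((\<lambda>h::real. \<bar>h\<bar> powr a) \<longlongrightarrow> 0) (at 0)" using assms by simp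
    have "((\<lambda>h::real. \<bar>h\<bar> powr a * sgn h) \<longlongrightarrow> 0) (at 0)"
      by (rule Lim_null_comparison[OF always_eventually l]) (auto simp: abs_mult abs_sgn_eq)
    then show ?thesis using True by (simp add: isCont_def)
  qed
qed

lemma testfun_powr_line_bound:
  fixes v :: "'a::euclidean_space \<Rightarrow> real"
  assumes v: "testfun A v" and \<gamma>: "\<gamma> > 1" and b: "b \<in> Basis"
  shows "ennreal (\<bar>v x\<bar> powr \<gamma>) \<le> line_int b (\<lambda>y. ennreal (\<gamma> * \<bar>v y\<bar> powr (\<gamma> - 1) * \<bar>pd v b y\<bar>)) x"
proof -
  obtain K where K: "compact K" "\<And>x. x \<notin> K \<Longrightarrow> v x = 0" using v unfolding testfun_def by blast
  obtain R where R: "\<And>y. y \<in> K \<Longrightarrow> norm y \<le> R" using compact_imp_bounded[OF K(1)] unfolding bounded_iff by blast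
  \<comment> \<open>Far enough back on the line to leave the support, so that the fundamental
    theorem of calculus starts from the value zero.\<close>
  define T where "T = \<bar>R\<bar> + norm x + 1"
  have T: "T > 0" by (simp add: T_def add_nonneg_pos)
  have vT: "v (x + (- T) *\<^sub>R b) = 0"
  proof (rule K(2), rule notI)
    assume "x + (- T) *\<^sub>R b \<in> K"
    then have "norm (x + (- T) *\<^sub>R b) \<le> R" by (rule R)
    moreover have "norm ((- T) *\<^sub>R b) \<le> norm (x + (- T) *\<^sub>R b) + norm x"
      using norm_triangle_ineq4[of "x + (- T) *\<^sub>R b" x] by simp
    moreover have "norm ((- T) *\<^sub>R b) = T" using b T by simp
    ultimately show False by (simp add: T_def)
  qed
  define F where "F t = \<bar>v (x + t *\<^sub>R b)\<bar> powr \<gamma>" for t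
  define f where "f t = \<gamma> * (\<bar>v (x + t *\<^sub>R b)\<bar> powr (\<gamma> - 1) * sgn (v (x + t *\<^sub>R b))) * pd v b (x + t *\<^sub>R b)" for t
  have bl: "bounded_linear (\<lambda>k. pd v k y)" for y
    using testfun_has_derivative[OF v] has_derivative_bounded_linear by blast
  have dF: "(F has_real_derivative f t) (at t)" for t
  proof -
    have "((\<lambda>t. v (x + t *\<^sub>R b)) has_derivative (\<lambda>r. pd v (r *\<^sub>R b) (x + t *\<^sub>R b))) (at t)"
      by (rule has_derivative_compose[OF _ testfun_has_derivative[OF v]]) (auto intro!: derivative_eq_intros)
    then have "((\<lambda>t. v (x + t *\<^sub>R b)) has_real_derivative pd v b (x + t *\<^sub>R b)) (at t)"
    proof -
      assume *: "((\<lambda>t. v (x + t *\<^sub>R b)) has_derivative (\<lambda>r. pd v (r *\<^sub>R b) (x + t *\<^sub>R b))) (at t)"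
      have "(\<lambda>r. pd v (r *\<^sub>R b) (x + t *\<^sub>R b)) = (*) (pd v b (x + t *\<^sub>R b))"
        by (rule ext) (simp add: linear_simps(5)[OF bl])
      then show ?thesis using * by (simp only: has_field_derivative_def)
    qed
    from DERIV_chain2[OF abs_powr_has_derivative[OF \<gamma>] this] show ?thesis unfolding F_def[abs_def] f_def .
  qed
  have cl: "continuous_on UNIV (\<lambda>t. x + t *\<^sub>R b)" by (intro continuous_intros)
  have cv: "continuous_on UNIV (\<lambda>t. v (x + t *\<^sub>R b))" "continuous_on UNIV (\<lambda>t. pd v b (x + t *\<^sub>R b))"
    by (rule continuous_on_compose2[OF testfun_cont[OF v] cl subset_UNIV])
      (rule continuous_on_compose2[OF testfun_pd_cont'[OF v] cl subset_UNIV])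
  have cs: "continuous_on UNIV (\<lambda>t. \<bar>v (x + t *\<^sub>R b)\<bar> powr (\<gamma> - 1) * sgn (v (x + t *\<^sub>R b)))"
    by (rule continuous_on_compose2[OF abs_powr_sgn_continuous cv(1) subset_UNIV]) (use \<gamma> in simp)
  have cf: "continuous_on UNIV f" unfolding f_def[abs_def]
    by (intro continuous_on_mult continuous_on_const cs cv(2))
  have "(\<integral>t. indicator {- T..0} t *\<^sub>R f t \<partial>lborel) = F 0 - F (- T)"
    by (rule integral_FTC_Icc)
      (use T dF cf in \<open>auto intro: continuous_on_subset has_field_derivative_at_within simp: has_real_derivative_iff_has_vector_derivative[symmetric]\<close>)
  then have e: "\<bar>v x\<bar> powr \<gamma> = (\<integral>t. indicator {- T..0} t *\<^sub>R f t \<partial>lborel)" using vT \<gamma> by (simp add: F_def)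
  have i: "integrable lborel (\<lambda>t. indicator {- T..0} t *\<^sub>R f t)"
    by (intro borel_integrable_compact continuous_on_subset[OF cf]) auto
  have "ennreal (\<bar>v x\<bar> powr \<gamma>) \<le> ennreal (\<integral>t. norm (indicator {- T..0} t *\<^sub>R f t) \<partial>lborel)"
    unfolding e by (intro ennreal_leI order_trans[OF _ integral_norm_bound]) simp
  also have "\<dots> = (\<integral>\<^sup>+t. ennreal (norm (indicator {- T..0} t *\<^sub>R f t)) \<partial>lborel)"
    using i by (intro nn_integral_eq_integral[symmetric]) auto
  also have "\<dots> \<le> (\<integral>\<^sup>+t. ennreal (\<gamma> * \<bar>v (x + t *\<^sub>R b)\<bar> powr (\<gamma> - 1) * \<bar>pd v b (x + t *\<^sub>R b)\<bar>) \<partial>lborel)"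
    using \<gamma> by (intro nn_integral_mono ennreal_leI) (auto simp: f_def indicator_def abs_mult abs_sgn_eq)
  finally show ?thesis by (simp add: line_int_def)
qed

lemma powr_integrable:
  fixes v :: "'a::euclidean_space \<Rightarrow> real"
  assumes v: "testfun A v" and r: "r > 0"
  shows "integrable lborel (\<lambda>x. \<bar>v x\<bar> powr r)"
proof -
  obtain K where K: "compact K" "\<And>x. x \<notin> K \<Longrightarrow> v x = 0" using v unfolding testfun_def by blast
  have "continuous_on UNIV (\<lambda>x. \<bar>v x\<bar> powr r)"
    using testfun_cont[OF v] r by (intro continuous_on_powr' continuous_intros) auto
  then show ?thesis by (rule compact_support_integrable[OF _ K(1)]) (use K(2) in auto)
qed

lemma grad_term_bound:
  fixes v :: "'a::euclidean_space \<Rightarrow> real"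
  assumes v: "testfun A v" and \<gamma>: "\<gamma> > 1" and b: "b \<in> Basis"
  shows "(\<integral>\<^sup>+x. ennreal (\<gamma> * \<bar>v x\<bar> powr (\<gamma> - 1) * \<bar>pd v b x\<bar>) \<partial>lborel)
     \<le> ennreal (\<gamma> * sqrt (\<integral>x. \<bar>v x\<bar> powr (2 * (\<gamma> - 1)) \<partial>lborel) * sqrt (tgr v))"
proof -
  have [measurable]: "v \<in> borel_measurable borel" using testfun_cont[OF v] by (rule borel_measurable_continuous_onI)
  have e: "(norm (\<bar>v x\<bar> powr (\<gamma> - 1)))\<^sup>2 = \<bar>v x\<bar> powr (2 * (\<gamma> - 1))" for x
    by (simp add: power2_eq_square powr_add[symmetric])
  have s: "sqi lborel (\<lambda>x. \<bar>v x\<bar> powr (\<gamma> - 1))"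
    unfolding sqi_def e using powr_integrable[OF v, of "2 * (\<gamma> - 1)"] \<gamma> by simp
  have n: "nsq lborel (\<lambda>x. \<bar>v x\<bar> powr (\<gamma> - 1)) = (\<integral>x. \<bar>v x\<bar> powr (2 * (\<gamma> - 1)) \<partial>lborel)"
    unfolding nsq_def e by simp
  note hb = integral_norm_mult_bound[OF s testfun_sqi(2)[OF v, of b]]
  have "(\<integral>\<^sup>+x. ennreal (\<gamma> * \<bar>v x\<bar> powr (\<gamma> - 1) * \<bar>pd v b x\<bar>) \<partial>lborel) = (\<integral>\<^sup>+x. ennreal (\<gamma> * (norm (\<bar>v x\<bar> powr (\<gamma> - 1)) * norm (pd v b x))) \<partial>lborel)"
    by (simp add: mult.assoc)
  also have "\<dots> = ennreal (\<integral>x. \<gamma> * (norm (\<bar>v x\<bar> powr (\<gamma> - 1)) * norm (pd v b x)) \<partial>lborel)"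
    using hb(1) \<gamma> by (intro nn_integral_eq_integral) auto
  also have "(\<integral>x. \<gamma> * (norm (\<bar>v x\<bar> powr (\<gamma> - 1)) * norm (pd v b x)) \<partial>lborel) = \<gamma> * (\<integral>x. norm (\<bar>v x\<bar> powr (\<gamma> - 1)) * norm (pd v b x) \<partial>lborel)"
    by simp
  also have "ennreal \<dots> \<le> ennreal (\<gamma> * (sqrt (\<integral>x. \<bar>v x\<bar> powr (2 * (\<gamma> - 1)) \<partial>lborel) * sqrt (tgr v)))"
  proof (intro ennreal_leI mult_left_mono)
    have "sqrt (nsq lborel (pd v b)) \<le> sqrt (tgr v)" by (intro real_sqrt_le_mono nsq_pd_le_tgr b)
    then show "(\<integral>x. norm (\<bar>v x\<bar> powr (\<gamma> - 1)) * norm (pd v b x) \<partial>lborel) \<le> sqrt (\<integral>x. \<bar>v x\<bar> powr (2 * (\<gamma> - 1)) \<partial>lborel) * sqrt (tgr v)"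
      using hb(2) unfolding n by (meson mult_left_mono order_trans real_sqrt_ge_zero Bochner_Integration.integral_nonneg powr_ge_zero)
  qed (use \<gamma> in simp)
  finally show ?thesis by (simp add: mult.assoc)
qed

text \<open>Bounding \<open>\<bar>v x\<bar> powr \<gamma>\<close> by a line integral in each of the
  \<open>DIM\<close> directions, multiplying the \<open>1 / (DIM - 1)\<close> powers and applying
  Loomis--Whitney. The exponent \<open>\<gamma>\<close> stays free: one choice gives the critical
  inequality, integer choices in dimension two an induction over exponents.\<close>

lemma gagliardo:
  fixes v :: "'a::euclidean_space \<Rightarrow> real"
  assumes v: "testfun A v" and \<gamma>: "\<gamma> > 1" and N: "DIM('a) \<ge> 2"
  shows "(\<integral>x. \<bar>v x\<bar> powr (\<gamma> * real DIM('a) / real (DIM('a) - 1)) \<partial>lborel)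
    \<le> (\<gamma> * sqrt (\<integral>x. \<bar>v x\<bar> powr (2 * (\<gamma> - 1)) \<partial>lborel) * sqrt (tgr v)) powr (real DIM('a) / real (DIM('a) - 1))"
proof -
  define \<theta> where "\<theta> = 1 / real (DIM('a) - 1)"
  have \<theta>: "\<theta> > 0" using N by (simp add: \<theta>_def)
  define B where "B = \<gamma> * sqrt (\<integral>x. \<bar>v x\<bar> powr (2 * (\<gamma> - 1)) \<partial>lborel) * sqrt (tgr v)"
  have B: "B \<ge> 0" using \<gamma> by (simp add: B_def)
  have [measurable]: "v \<in> borel_measurable borel" "pd v b \<in> borel_measurable borel" for b
    using testfun_cont[OF v] testfun_pd_cont'[OF v] by (auto intro: borel_measurable_continuous_onI)
  define f where "f b y = ennreal (\<gamma> * \<bar>v y\<bar> powr (\<gamma> - 1) * \<bar>pd v b y\<bar>)" for b y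
  have f: "f b \<in> borel_measurable borel" for b unfolding f_def[abs_def] by measurable
  have pw: "(\<Prod>b\<in>(Basis::'a set). ennreal (a powr \<theta>)) = ennreal (a powr (real DIM('a) * \<theta>))" if "a \<ge> 0" for a
  proof (cases "a = 0")
    case False
    then show ?thesis using that by (simp add: ennreal_power powr_power mult.commute)
  qed (use N in simp)
  have ex: "(\<bar>v x\<bar> powr \<gamma>) powr (real DIM('a) * \<theta>) = \<bar>v x\<bar> powr (\<gamma> * real DIM('a) / real (DIM('a) - 1))" for x
    by (simp add: powr_powr \<theta>_def)
  have "(\<integral>\<^sup>+x. ennreal (\<bar>v x\<bar> powr (\<gamma> * real DIM('a) / real (DIM('a) - 1))) \<partial>lborel)
      \<le> (\<integral>\<^sup>+x. (\<Prod>b\<in>Basis. ennroot \<theta> (line_int b (f b) x)) \<partial>lborel)"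
  proof (rule nn_integral_mono)
    fix x
    have "ennreal (\<bar>v x\<bar> powr (\<gamma> * real DIM('a) / real (DIM('a) - 1))) = (\<Prod>b\<in>(Basis::'a set). ennroot \<theta> (ennreal (\<bar>v x\<bar> powr \<gamma>)))"
      unfolding ex[symmetric] by (simp only: ennroot_simps(2)[OF powr_ge_zero] pw[OF powr_ge_zero])
    also have "\<dots> \<le> (\<Prod>b\<in>Basis. ennroot \<theta> (line_int b (f b) x))"
      using testfun_powr_line_bound[OF v \<gamma>] unfolding f_def by (intro ennreal_prod_mono ennroot_mono \<theta>) auto
    finally show "ennreal (\<bar>v x\<bar> powr (\<gamma> * real DIM('a) / real (DIM('a) - 1))) \<le> (\<Prod>b\<in>Basis. ennroot \<theta> (line_int b (f b) x))" .
  qed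
  also have "\<dots> \<le> (\<Prod>b\<in>Basis. ennroot \<theta> (\<integral>\<^sup>+x. f b x \<partial>lborel))"
    by (rule loomis_whitney[OF N \<theta>_def f])
  also have "\<dots> \<le> (\<Prod>b\<in>(Basis::'a set). ennroot \<theta> (ennreal B))"
    unfolding f_def B_def by (intro ennreal_prod_mono ennroot_mono \<theta> grad_term_bound[OF v \<gamma>])
  also have "\<dots> = ennreal (B powr (real DIM('a) * \<theta>))" by (simp only: ennroot_simps(2)[OF B] pw[OF B])
  finally have le: "(\<integral>\<^sup>+x. ennreal (\<bar>v x\<bar> powr (\<gamma> * real DIM('a) / real (DIM('a) - 1))) \<partial>lborel) \<le> ennreal (B powr (real DIM('a) * \<theta>))" .
  have "\<gamma> * real DIM('a) / real (DIM('a) - 1) > 0" using \<gamma> N by simp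
  then have "(\<integral>\<^sup>+x. ennreal (\<bar>v x\<bar> powr (\<gamma> * real DIM('a) / real (DIM('a) - 1))) \<partial>lborel) = ennreal (\<integral>x. \<bar>v x\<bar> powr (\<gamma> * real DIM('a) / real (DIM('a) - 1)) \<partial>lborel)"
    by (intro nn_integral_eq_integral powr_integrable[OF v]) auto
  then show ?thesis using le by (simp add: ennreal_le_iff B_def \<theta>_def)
qed

text \<open>The constant obtained here is not sharp. Its existence shows that the set defining
  \<open>sobolevS\<close> is non-empty; the sharp constant is recovered from the infimum in
  \<open>sobolevS_test\<close>.\<close>

lemma sobolev_critical:
  assumes N: "DIM('a::euclidean_space) \<ge> 3"
  shows "\<exists>S\<ge>0. \<forall>v :: 'a \<Rightarrow> real. testfun UNIV v \<longrightarrow>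
     (\<integral>x. \<bar>v x\<bar> powr twostar DIM('a) \<partial>lborel) \<le> S * tgr v powr (twostar DIM('a) / 2)"
proof -
  define n where "n = real DIM('a)"
  have n: "n \<ge> 3" "real (DIM('a) - 1) = n - 1" using N by (auto simp: n_def)
  define p where "p = twostar DIM('a)"
  have p: "p = 2 * n / (n - 2)" "p > 0" using n by (auto simp: p_def twostar_def n_def)
  \<comment> \<open>The choice for which both sides of \<open>gagliardo\<close> carry the same
    integral: \<open>2 * (\<gamma> - 1)\<close> and \<open>\<gamma> * n / (n - 1)\<close> both equal
    \<open>p\<close>.\<close>
  define \<gamma> where "\<gamma> = 2 * (n - 1) / (n - 2)"
  have \<gamma>: "\<gamma> > 1" "2 * (\<gamma> - 1) = p" using n(1) by (auto simp: \<gamma>_def p(1) field_simps)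
  have \<gamma>3: "\<gamma> * n / (n - 1) = p"
  proof -
    have *: "2 * a / c * m / a = 2 * m / c" if "a \<noteq> 0" for a c m :: real using that by simp
    show ?thesis unfolding \<gamma>_def p(1) by (rule *) (use n(1) in simp)
  qed
  have p2: "p / 2 = n / (n - 2)"
  proof -
    have "2 * n / c / 2 = n / c" for c by simp
    then show ?thesis unfolding p(1) .
  qed
  have "(\<integral>x. \<bar>v x\<bar> powr p \<partial>lborel) \<le> (\<gamma>\<^sup>2) powr (p / 2) * tgr v powr (p / 2)" if v: "testfun UNIV v" for v :: "'a \<Rightarrow> real"
  proof -
    define X where "X = (\<integral>x. \<bar>v x\<bar> powr p \<partial>lborel)"
    have X0: "X \<ge> 0" by (simp add: X_def)
    show ?thesis
    proof (cases "X = 0")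
      case True
      then show ?thesis using \<gamma> by (simp add: X_def)
    next
      case False
      then have X: "X > 0" using X0 by simp
      have g: "X \<le> (\<gamma> * sqrt X * sqrt (tgr v)) powr (n / (n - 1))"
        using gagliardo[OF v \<gamma>(1)] N \<gamma>(2) \<gamma>3 n(2) unfolding X_def n_def by simp
      define Y where "Y = \<gamma>\<^sup>2 * tgr v"
      have Y: "Y \<ge> 0" by (simp add: Y_def)
      have "\<gamma> * sqrt X * sqrt (tgr v) = sqrt (X * Y)" using \<gamma>(1) by (simp add: Y_def real_sqrt_mult)
      also have "\<dots> = (X * Y) powr (1/2)" using X Y by (simp add: powr_half_sqrt)
      finally have "X \<le> (X * Y) powr (n / (2 * (n - 1)))" using g by (simp add: powr_powr)
      also have "\<dots> = X powr (n / (2 * (n - 1))) * Y powr (n / (2 * (n - 1)))" using X Y by (simp add: powr_mult)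
      \<comment> \<open>On the right \<open>X\<close> has the exponent
        \<open>n / (2 * (n - 1)) < 1\<close>, so it is absorbed into the left-hand side;
        \<open>X\<close> is finite and positive here.\<close>
      finally have "X powr (- (n / (2 * (n - 1)))) * X \<le> X powr (- (n / (2 * (n - 1)))) * (X powr (n / (2 * (n - 1))) * Y powr (n / (2 * (n - 1))))"
        by (rule mult_left_mono) simp
      also have "\<dots> = Y powr (n / (2 * (n - 1)))" using X by (simp add: mult.assoc[symmetric] powr_add[symmetric])
      also have "X powr (- (n / (2 * (n - 1)))) * X = X powr ((n - 2) / (2 * (n - 1)))"
      proof -
        have "- (n / (2 * (n - 1))) + 1 = (n - 2) / (2 * (n - 1))" using n by (simp add: field_simps)
        then show ?thesis using X powr_add[of X "- (n / (2 * (n - 1)))" 1] by simp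
      qed
      finally have "(X powr ((n - 2) / (2 * (n - 1)))) powr (2 * (n - 1) / (n - 2)) \<le> (Y powr (n / (2 * (n - 1)))) powr (2 * (n - 1) / (n - 2))"
        using n by (intro powr_mono2) auto
      moreover have "a / (2 * b) * (2 * b / a) = 1" "c / (2 * b) * (2 * b / a) = c / a" if "a \<noteq> 0" "b \<noteq> 0" for a b c :: real
        using that by auto
      from this[of "n - 2" "n - 1"] n(1)
      have "(n - 2) / (2 * (n - 1)) * (2 * (n - 1) / (n - 2)) = 1" "n / (2 * (n - 1)) * (2 * (n - 1) / (n - 2)) = n / (n - 2)" by auto
      ultimately have "X powr 1 \<le> Y powr (p / 2)" unfolding p2 by (simp only: powr_powr)
      then show ?thesis using X \<gamma> by (simp add: Y_def powr_mult X_def)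
    qed
  qed
  then show ?thesis unfolding p_def by (intro exI[of _ "(\<gamma>\<^sup>2) powr (twostar DIM('a) / 2)"]) auto
qed

subsection \<open>Homogeneous nonlinearities\<close>

lemma homogeneous_bound:
  fixes f :: "'e::euclidean_space \<Rightarrow> real"
  assumes cont: "continuous_on UNIV f" and hom: "\<And>t z. t \<ge> 0 \<Longrightarrow> f (t *\<^sub>R z) = t powr q * f z" and q: "q > 0"
  shows "\<exists>m\<ge>0. \<forall>z. \<bar>f z\<bar> \<le> m * norm z powr q"
proof -
  have "bounded (f ` sphere 0 1)"
    by (intro compact_imp_bounded compact_continuous_image continuous_on_subset[OF cont]) auto
  then obtain m where "\<forall>y\<in>f ` sphere 0 1. norm y \<le> m" unfolding bounded_iff by blast
  then have m: "\<And>z. norm z = 1 \<Longrightarrow> \<bar>f z\<bar> \<le> m" by auto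
  have "\<bar>f z\<bar> \<le> max m 0 * norm z powr q" for z
  proof (cases "z = 0")
    case True
    then show ?thesis using hom[of 0 z] q by simp
  next
    case False
    have "f z = norm z powr q * f (z /\<^sub>R norm z)" using hom[of "norm z" "z /\<^sub>R norm z"] False by simp
    then have "\<bar>f z\<bar> = norm z powr q * \<bar>f (z /\<^sub>R norm z)\<bar>" by (simp add: abs_mult)
    also have "\<dots> \<le> norm z powr q * max m 0"
      using m[of "z /\<^sub>R norm z"] False by (intro mult_left_mono) auto
    finally show ?thesis by (simp add: mult.commute)
  qed
  then show ?thesis by (intro exI[of _ "max m 0"]) auto
qed

text \<open>By homogeneity \<open>z\<close> may be scaled to unit length. If \<open>w\<close> is
  small compared with \<open>z\<close>, uniform continuity on a ball gives the \<open>\<eta>\<close>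
  term; otherwise \<open>z\<close> is bounded by a multiple of \<open>w\<close>, and the growth
  bound gives the \<open>C\<close> term.\<close>

lemma homogeneous_increment:
  fixes f :: "'e::euclidean_space \<Rightarrow> real"
  assumes cont: "continuous_on UNIV f" and hom: "\<And>t z. t \<ge> 0 \<Longrightarrow> f (t *\<^sub>R z) = t powr q * f z" and q: "q > 0" and \<eta>: "\<eta> > 0"
  shows "\<exists>C\<ge>0. \<forall>z w. \<bar>f (z + w) - f z\<bar> \<le> \<eta> * norm z powr q + C * norm w powr q"
proof -
  obtain m where m: "m \<ge> 0" "\<And>z. \<bar>f z\<bar> \<le> m * norm z powr q" using homogeneous_bound[OF cont hom q] by blast
  have "uniformly_continuous_on (cball 0 2) f"
    by (intro compact_uniformly_continuous continuous_on_subset[OF cont]) auto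
  then obtain d where d: "d > 0" "\<And>x y. x \<in> cball 0 2 \<Longrightarrow> y \<in> cball 0 2 \<Longrightarrow> dist y x < d \<Longrightarrow> dist (f y) (f x) < \<eta>"
    using \<eta> unfolding uniformly_continuous_on_def by metis
  define \<delta> where "\<delta> = min d 1"
  have \<delta>: "\<delta> > 0" "\<delta> \<le> d" "\<delta> \<le> 1" using d by (auto simp: \<delta>_def)
  define C where "C = m * (1 + 1 / \<delta>) powr q + m * (1 / \<delta>) powr q"
  have C: "C \<ge> 0" using m by (simp add: C_def)
  have "\<bar>f (z + w) - f z\<bar> \<le> \<eta> * norm z powr q + C * norm w powr q" for z w
  proof (cases "norm w < \<delta> * norm z")
    case True
    then have z: "norm z > 0" using \<delta> by (metis mult_zero_right norm_ge_zero not_less zero_less_norm_iff norm_eq_zero)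
    define z' w' where "z' = z /\<^sub>R norm z" and "w' = w /\<^sub>R norm z"
    have n: "norm z' = 1" "norm w' < \<delta>" using z True by (auto simp: z'_def w'_def field_simps)
    have eq: "z = norm z *\<^sub>R z'" "z + w = norm z *\<^sub>R (z' + w')" using z by (auto simp: z'_def w'_def scaleR_add_right)
    have "dist (f (z' + w')) (f z') < \<eta>"
    proof (rule d(2))
      show "z' + w' \<in> cball 0 2" using n \<delta> norm_triangle_ineq[of z' w'] by simp
    qed (use n \<delta> in \<open>auto simp: dist_norm\<close>)
    then have "norm z powr q * \<bar>f (z' + w') - f z'\<bar> \<le> norm z powr q * \<eta>"
      by (intro mult_left_mono) (auto simp: dist_real_def)
    moreover have "f (z + w) - f z = norm z powr q * (f (z' + w') - f z')"
      using hom[of "norm z" z'] hom[of "norm z" "z' + w'"] eq by (simp add: right_diff_distrib)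
    ultimately have "\<bar>f (z + w) - f z\<bar> \<le> \<eta> * norm z powr q" by (simp add: abs_mult mult.commute)
    then show ?thesis using C by (simp add: add_increasing2)
  next
    case False
    then have zw: "norm z \<le> norm w * (1 / \<delta>)" using \<delta> by (simp add: field_simps)
    have "norm (z + w) \<le> norm w * (1 + 1 / \<delta>)" using norm_triangle_ineq[of z w] zw by (simp add: distrib_left)
    then have "norm (z + w) powr q \<le> (norm w * (1 + 1 / \<delta>)) powr q" using q by (intro powr_mono2) auto
    then have 1: "norm (z + w) powr q \<le> norm w powr q * (1 + 1 / \<delta>) powr q" using \<delta> by (simp add: powr_mult)
    have "norm z powr q \<le> (norm w * (1 / \<delta>)) powr q" using q zw by (intro powr_mono2) auto
    moreover have "(norm w * (1 / \<delta>)) powr q = norm w powr q * (1 / \<delta>) powr q" by (rule powr_mult)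
    ultimately have 2: "norm z powr q \<le> norm w powr q * (1 / \<delta>) powr q" by (simp only:)
    have "\<bar>f (z + w) - f z\<bar> \<le> m * norm (z + w) powr q + m * norm z powr q"
      using m(2)[of "z + w"] m(2)[of z] by linarith
    also have "\<dots> \<le> m * (norm w powr q * (1 + 1 / \<delta>) powr q) + m * (norm w powr q * (1 / \<delta>) powr q)"
      using m(1) 1 2 by (intro add_mono mult_left_mono) auto
    also have "\<dots> = C * norm w powr q" by (simp add: C_def algebra_simps)
    finally show ?thesis using \<eta> by (simp add: add_increasing)
  qed
  then show ?thesis using C by blast
qed

text \<open>Brezis--Lieb: the part of the defect exceeding an \<open>\<eta>\<close>-fraction of \<open>|z n|^q\<close> is dominated.\<close>
lemma brezis_lieb:
  fixes f :: "'e::euclidean_space \<Rightarrow> real" and u :: "'x \<Rightarrow> 'e"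
  assumes cont: "continuous_on UNIV f" and hom: "\<And>t z. t \<ge> 0 \<Longrightarrow> f (t *\<^sub>R z) = t powr q * f z" and q: "q > 0"
    and u[measurable]: "u \<in> borel_measurable M" and z[measurable]: "\<And>n. z n \<in> borel_measurable M"
    and iu: "integrable M (\<lambda>x. norm (u x) powr q)" and iz: "\<And>n. integrable M (\<lambda>x. norm (z n x) powr q)"
    and B: "\<And>n. (\<integral>x. norm (z n x) powr q \<partial>M) \<le> B" and ae: "AE x in M. (\<lambda>n. z n x) \<longlonglongrightarrow> 0"
  shows "(\<lambda>n. \<integral>x. \<bar>f (z n x + u x) - f (z n x) - f (u x)\<bar> \<partial>M) \<longlonglongrightarrow> 0"
    "\<And>n. integrable M (\<lambda>x. f (z n x + u x) - f (z n x) - f (u x))"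
proof -
  obtain m where m: "m \<ge> 0" "\<And>z. \<bar>f z\<bar> \<le> m * norm z powr q" using homogeneous_bound[OF cont hom q] by blast
  have [measurable]: "f \<in> borel_measurable borel" using cont by (rule borel_measurable_continuous_onI)
  have f0: "f 0 = 0" using m(2)[of 0] q by simp
  define g where "g n x = \<bar>f (z n x + u x) - f (z n x) - f (u x)\<bar>" for n x
  have [measurable]: "g n \<in> borel_measurable M" for n unfolding g_def by measurable
  have gb: "\<exists>C\<ge>0. \<forall>n x. g n x \<le> \<eta> * norm (z n x) powr q + C * norm (u x) powr q" if \<eta>: "\<eta> > 0" for \<eta>
  proof -
    obtain C where C: "C \<ge> 0" "\<And>z w. \<bar>f (z + w) - f z\<bar> \<le> \<eta> * norm z powr q + C * norm w powr q"
      using homogeneous_increment[OF cont hom q \<eta>] by blast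
    have "g n x \<le> \<eta> * norm (z n x) powr q + (C + m) * norm (u x) powr q" for n x
      using C(2)[of "z n x" "u x"] m(2)[of "u x"] by (simp add: g_def distrib_right)
    then show ?thesis using C(1) m(1) by (intro exI[of _ "C + m"]) auto
  qed
  have gi: "integrable M (g n)" for n
  proof -
    obtain C where C: "C \<ge> 0" "\<And>n x. g n x \<le> 1 * norm (z n x) powr q + C * norm (u x) powr q" using gb[of 1] by auto
    show ?thesis
      by (rule Bochner_Integration.integrable_bound[of M "\<lambda>x. 1 * norm (z n x) powr q + C * norm (u x) powr q"])
        (use iu iz C in \<open>auto simp: g_def\<close>)
  qed
  then show "\<And>n. integrable M (\<lambda>x. f (z n x + u x) - f (z n x) - f (u x))"
    unfolding g_def by (subst (asm) integrable_abs_iff) auto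
  have B0: "B \<ge> 0" using order_trans[OF _ B[of 0]] by simp
  have "(\<lambda>n. \<integral>x. g n x \<partial>M) \<longlonglongrightarrow> 0"
  proof (rule LIMSEQ_I)
    fix e :: real assume e: "e > 0"
    define \<eta> where "\<eta> = e / (2 * (B + 1))"
    have \<eta>: "\<eta> > 0" using e B0 by (simp add: \<eta>_def)
    have \<eta>B: "\<eta> * B \<le> e / 2"
    proof -
      have "\<eta> * B \<le> \<eta> * (B + 1)" using \<eta> by simp
      also have "\<dots> = e / 2"
      proof -
        have "e / (2 * b) * b = e / 2" if "b \<noteq> 0" for b :: real using that by simp
        then show ?thesis unfolding \<eta>_def using B0 by (metis add_nonneg_pos less_irrefl zero_less_one)
      qed
      finally show ?thesis .
    qed
    obtain C where C: "C \<ge> 0" "\<And>n x. g n x \<le> \<eta> * norm (z n x) powr q + C * norm (u x) powr q" using gb[OF \<eta>] by blast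
    define W where "W n x = max 0 (g n x - \<eta> * norm (z n x) powr q)" for n x
    have [measurable]: "W n \<in> borel_measurable M" for n unfolding W_def by measurable
    have W: "norm (W n x) \<le> C * norm (u x) powr q" for n x
      using C(2)[of n x] C(1) by (auto simp: W_def)
    have iW: "integrable M (W n)" for n
      by (rule Bochner_Integration.integrable_bound[of M "\<lambda>x. C * norm (u x) powr q"])
        (use iu W[of n] C(1) in \<open>auto intro: order_trans\<close>)
    have "(\<lambda>n. \<integral>x. W n x \<partial>M) \<longlonglongrightarrow> (\<integral>x. 0 \<partial>M)"
    proof (rule integral_dominated_convergence[where w = "\<lambda>x. C * norm (u x) powr q"])
      show "AE x in M. (\<lambda>n. W n x) \<longlonglongrightarrow> 0" using ae
      proof eventually_elim
        case (elim x)
        have cf: "isCont f a" for a using cont by (simp add: continuous_on_eq_continuous_at)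
        have "(\<lambda>n. z n x + u x) \<longlonglongrightarrow> 0 + u x" by (intro tendsto_intros elim)
        then have "(\<lambda>n. f (z n x + u x)) \<longlonglongrightarrow> f (u x)" using isCont_tendsto_compose[OF cf] by fastforce
        moreover have "(\<lambda>n. f (z n x)) \<longlonglongrightarrow> f 0" by (rule isCont_tendsto_compose[OF cf elim])
        ultimately have "(\<lambda>n. \<bar>f (z n x + u x) - f (z n x) - f (u x)\<bar>) \<longlonglongrightarrow> \<bar>f (u x) - f 0 - f (u x)\<bar>"
          by (intro tendsto_intros)
        then have "(\<lambda>n. g n x) \<longlonglongrightarrow> 0" by (simp add: g_def f0)
        then show ?case
          by (rule tendsto_0_bound[rotated]) (use \<eta> in \<open>auto simp: W_def g_def\<close>)
      qed
    qed (use iu W in auto)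
    then have "\<forall>\<^sub>F n in sequentially. (\<integral>x. W n x \<partial>M) < e / 2" using e by (intro order_tendstoD(2)[where y = 0]) auto
    then obtain N where N: "\<And>n. n \<ge> N \<Longrightarrow> (\<integral>x. W n x \<partial>M) < e / 2" unfolding eventually_sequentially by auto
    have "(\<integral>x. g n x \<partial>M) < e" if "n \<ge> N" for n
    proof -
      have "(\<integral>x. g n x \<partial>M) \<le> (\<integral>x. W n x + \<eta> * norm (z n x) powr q \<partial>M)"
        using gi iW iz by (intro integral_mono) (auto simp: W_def)
      also have "\<dots> = (\<integral>x. W n x \<partial>M) + \<eta> * (\<integral>x. norm (z n x) powr q \<partial>M)" using iW iz by simp
      also have "\<dots> \<le> (\<integral>x. W n x \<partial>M) + \<eta> * B" using B[of n] \<eta> by simp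
      finally show ?thesis using N[OF that] \<eta>B by linarith
    qed
    moreover have "(\<integral>x. g n x \<partial>M) \<ge> 0" for n by (simp add: g_def)
    ultimately show "\<exists>no. \<forall>n\<ge>no. norm ((\<integral>x. g n x \<partial>M) - 0) < e" by (intro exI[of _ N]) auto
  qed
  then show "(\<lambda>n. \<integral>x. \<bar>f (z n x + u x) - f (z n x) - f (u x)\<bar> \<partial>M) \<longlonglongrightarrow> 0" by (simp add: g_def)
qed

lemma powr_interpolate:
  assumes "2 \<le> q" "q \<le> r" "t \<ge> (0::real)" shows "t powr q \<le> t\<^sup>2 + t powr r"
proof (cases "t \<le> 1")
  case True
  show ?thesis
  proof (cases "t = 0")
    case False
    then have "t powr q \<le> t powr 2" using assms True by (intro powr_mono') auto
    then show ?thesis using assms False by (simp add: powr_numeral add_increasing2)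
  qed (use assms in simp)
next
  case False
  then have "t powr q \<le> t powr r" using assms by (intro powr_mono) auto
  then show ?thesis by (simp add: add_increasing)
qed

lemma powr_young:
  assumes "2 < q" "q < r" "\<eta> > (0::real)" shows "\<exists>C\<ge>0. \<forall>t\<ge>0. t powr q \<le> \<eta> * t powr r + C * t\<^sup>2"
proof -
  \<comment> \<open>The point where \<open>t powr q = \<eta> * t powr r\<close>. Beyond it the
    higher power dominates; below it \<open>t powr (q - 2)\<close> is at most
    \<open>T powr (q - 2)\<close>, which is the constant.\<close>
  define T where "T = (1 / \<eta>) powr (1 / (r - q))"
  have T: "T > 0" using assms by (simp add: T_def)
  have "t powr q \<le> \<eta> * t powr r + T powr (q - 2) * t\<^sup>2" if t: "t \<ge> 0" for t
  proof (cases "t = 0")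
    case False
    then have t0: "t > 0" using t by simp
    show ?thesis
    proof (cases "t \<le> T")
      case True
      have "t powr q = t powr (q - 2) * t\<^sup>2" using t0 powr_add[of t "q - 2" 2] by (simp add: powr_numeral)
      also have "\<dots> \<le> T powr (q - 2) * t\<^sup>2" using True t0 assms by (intro mult_right_mono powr_mono2) auto
      finally show ?thesis using assms by (simp add: add_increasing)
    next
      case F: False
      have "T powr (r - q) \<le> t powr (r - q)" using F T assms by (intro powr_mono2) auto
      moreover have "T powr (r - q) = 1 / \<eta>" using assms by (simp add: T_def powr_powr)
      ultimately have "1 \<le> \<eta> * t powr (r - q)" using assms by (simp add: field_simps)
      then have "t powr q * 1 \<le> t powr q * (\<eta> * t powr (r - q))" by (intro mult_left_mono) auto
      also have "\<dots> = \<eta> * t powr r" using t0 powr_add[of t q "r - q"] by simp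
      finally show ?thesis using T by (simp add: add_increasing2)
    qed
  qed (use assms in simp)
  then show ?thesis by (intro exI[of _ "T powr (q - 2)"]) auto
qed

subsection \<open>Subcritical embeddings\<close>

context bounded_open
begin

lemma poincare_real: "\<exists>C>0. \<forall>v :: 'a \<Rightarrow> real. testfun \<Omega> v \<longrightarrow> nsq lborel v \<le> C * tgr v"
proof -
  obtain C where C: "C > 0" "\<And>\<phi> :: 'a \<Rightarrow> complex. testfun \<Omega> \<phi> \<Longrightarrow> nsq lborel \<phi> \<le> C * tgr \<phi>"
    using poincare_ex by blast
  have "nsq lborel v \<le> C * tgr v" if "testfun \<Omega> v" for v :: "'a \<Rightarrow> real"
    using C(2)[OF tgr_of_real(1)[OF that]] tgr_of_real(2)[OF that] by (simp add: nsq_def)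
  then show ?thesis using C(1) by blast
qed

text \<open>In the plane \<open>gagliardo\<close> with \<open>\<gamma> = k + 1\<close> bounds the
  power \<open>2 * (k + 1)\<close> by the power \<open>2 * k\<close>, so all even exponents follow
  inductively from the Poincare inequality.\<close>

lemma sobolev_dim2:
  assumes N: "DIM('a) = 2" and "k \<ge> 1"
  shows "\<exists>C\<ge>0. \<forall>v :: 'a \<Rightarrow> real. testfun \<Omega> v \<longrightarrow> (\<integral>x. \<bar>v x\<bar> powr (2 * real k) \<partial>lborel) \<le> C * tgr v powr (real k)"
  using assms(2)
proof (induction k rule: nat_induct_at_least)
  case base
  have e: "\<bar>a\<bar> powr 2 = (norm a)\<^sup>2" for a :: real by (cases "a = 0") (auto simp: powr_numeral)
  show ?case using poincare_real by (auto simp: e nsq_def intro: less_imp_le)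
next
  case (Suc k)
  then obtain C where C: "C \<ge> 0" "\<And>v :: 'a \<Rightarrow> real. testfun \<Omega> v \<Longrightarrow> (\<integral>x. \<bar>v x\<bar> powr (2 * real k) \<partial>lborel) \<le> C * tgr v powr (real k)" by blast
  have "(\<integral>x. \<bar>v x\<bar> powr (2 * real (Suc k)) \<partial>lborel) \<le> (real (Suc k))\<^sup>2 * C * tgr v powr (real (Suc k))" if v: "testfun \<Omega> v" for v :: "'a \<Rightarrow> real"
  proof -
    define X where "X = (\<integral>x. \<bar>v x\<bar> powr (2 * real k) \<partial>lborel)"
    have X: "X \<ge> 0" by (simp add: X_def)
    have "(\<integral>x. \<bar>v x\<bar> powr (2 * real (Suc k)) \<partial>lborel) \<le> (real (Suc k) * sqrt X * sqrt (tgr v)) powr 2"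
      using gagliardo[OF v, of "real (Suc k)"] N Suc(1) by (simp add: X_def mult.commute)
    also have "\<dots> = (real (Suc k) * sqrt X * sqrt (tgr v))\<^sup>2" using X by (simp add: powr_numeral)
    also have "\<dots> = (real (Suc k))\<^sup>2 * X * tgr v" using X by (simp add: power_mult_distrib)
    also have "\<dots> \<le> (real (Suc k))\<^sup>2 * (C * tgr v powr (real k)) * tgr v"
      using C(2)[OF v] unfolding X_def[symmetric] by (intro mult_right_mono mult_left_mono) auto
    also have "\<dots> = (real (Suc k))\<^sup>2 * C * tgr v powr (real (Suc k))"
      using powr_add[of "tgr v" "real k" 1] by (cases "tgr v = 0") (auto simp: add.commute less_le)
    finally show ?thesis .
  qed
  then show ?case using C(1) by (intro exI[of _ "(real (Suc k))\<^sup>2 * C"]) auto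
qed

text \<open>A line is the whole space here, so the line bound for the square, with Cauchy--Schwarz
  and Poincare, bounds \<open>v\<close> pointwise by the Dirichlet integral. The power
  \<open>r - 2\<close> is estimated by this bound and the remaining square by Poincare
  again.\<close>

lemma sobolev_dim1:
  assumes N: "DIM('a) = 1" and r: "r > 2"
  shows "\<exists>C\<ge>0. \<forall>v :: 'a \<Rightarrow> real. testfun \<Omega> v \<longrightarrow> (\<integral>x. \<bar>v x\<bar> powr r \<partial>lborel) \<le> C * tgr v powr (r / 2)"
proof -
  obtain C where C: "C > 0" "\<And>v :: 'a \<Rightarrow> real. testfun \<Omega> v \<Longrightarrow> nsq lborel v \<le> C * tgr v" using poincare_real by blast
  obtain b :: 'a where b: "Basis = {b}" using N by (auto simp: card_1_singleton_iff)
  have e2: "\<bar>a\<bar> powr 2 = (norm a)\<^sup>2" for a :: real by (cases "a = 0") (auto simp: powr_numeral)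
  define D where "D = 2 * sqrt C"
  have D: "D > 0" using C by (simp add: D_def)
  have "(\<integral>x. \<bar>v x\<bar> powr r \<partial>lborel) \<le> D powr (r / 2 - 1) * C * tgr v powr (r / 2)" if v: "testfun \<Omega> v" for v :: "'a \<Rightarrow> real"
  proof -
    have [measurable]: "v \<in> borel_measurable borel" "pd v b \<in> borel_measurable borel"
      using testfun_cont[OF v] testfun_pd_cont'[OF v] by (auto intro: borel_measurable_continuous_onI)
    have sup: "(\<bar>v x\<bar>)\<^sup>2 \<le> D * tgr v" for x
    proof -
      define f where "f y = ennreal (2 * \<bar>v y\<bar> powr (2 - 1) * \<bar>pd v b y\<bar>)" for y
      have f: "f \<in> borel_measurable borel" unfolding f_def by measurable
      have "(x \<bullet> b) *\<^sub>R b = x" using euclidean_representation[of x, unfolded b] by simp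
      then have "line_int b f x = line_int b f (0 + (x \<bullet> b) *\<^sub>R b)" by simp
      also have "\<dots> = line_int b f 0" by (rule line_int_shift[OF f])
      also have "\<dots> = (\<integral>\<^sup>+y. f y \<partial>lborel)" using lines_int_Basis[OF f, of "[b]"] b by simp
      also have "\<dots> \<le> ennreal (2 * sqrt (\<integral>x. \<bar>v x\<bar> powr (2 * (2 - 1)) \<partial>lborel) * sqrt (tgr v))"
        unfolding f_def by (rule grad_term_bound[OF v]) (use b in auto)
      also have "\<dots> \<le> ennreal (D * tgr v)"
      proof (rule ennreal_leI)
        have "(\<integral>x. \<bar>v x\<bar> powr (2 * (2 - 1)) \<partial>lborel) = nsq lborel v" by (simp add: e2 nsq_def)
        then have "sqrt (\<integral>x. \<bar>v x\<bar> powr (2 * (2 - 1)) \<partial>lborel) \<le> sqrt C * sqrt (tgr v)"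
          using real_sqrt_le_mono[OF C(2)[OF v]] by (simp add: real_sqrt_mult)
        then have "2 * sqrt (\<integral>x. \<bar>v x\<bar> powr (2 * (2 - 1)) \<partial>lborel) * sqrt (tgr v) \<le> 2 * (sqrt C * sqrt (tgr v)) * sqrt (tgr v)"
          by (intro mult_right_mono mult_left_mono) auto
        also have "\<dots> = D * tgr v" by (simp add: D_def mult.assoc)
        finally show "2 * sqrt (\<integral>x. \<bar>v x\<bar> powr (2 * (2 - 1)) \<partial>lborel) * sqrt (tgr v) \<le> D * tgr v" .
      qed
      finally have "line_int b f x \<le> ennreal (D * tgr v)" .
      then have "ennreal (\<bar>v x\<bar> powr 2) \<le> ennreal (D * tgr v)"
        using testfun_powr_line_bound[OF v, of 2 b x] b unfolding f_def by (auto intro: order_trans)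
      then show ?thesis using D by (simp add: e2 ennreal_le_iff)
    qed
    define t where "t = D * tgr v"
    have t: "t \<ge> 0" using D by (simp add: t_def)
    have pt: "\<bar>v x\<bar> powr r \<le> t powr (r / 2 - 1) * (norm (v x))\<^sup>2" for x
    proof (cases "v x = 0")
      case False
      have "\<bar>v x\<bar> powr r = \<bar>v x\<bar> powr (2 * (r / 2 - 1)) * \<bar>v x\<bar> powr 2"
        using powr_add[of "\<bar>v x\<bar>" "2 * (r / 2 - 1)" 2] by simp
      also have "\<bar>v x\<bar> powr (2 * (r / 2 - 1)) = (\<bar>v x\<bar> powr 2) powr (r / 2 - 1)" by (simp only: powr_powr)
      also have "\<dots> = ((\<bar>v x\<bar>)\<^sup>2) powr (r / 2 - 1)" by (simp add: e2)
      also have "\<dots> * \<bar>v x\<bar> powr 2 \<le> t powr (r / 2 - 1) * \<bar>v x\<bar> powr 2"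
        using sup[of x] r unfolding t_def by (intro mult_right_mono powr_mono2) auto
      finally show ?thesis by (simp add: e2)
    qed (use r in simp)
    have i2: "integrable lborel (\<lambda>x. (norm (v x))\<^sup>2)" using testfun_sqi(1)[OF v] by (simp add: sqi_def)
    have "(\<integral>x. \<bar>v x\<bar> powr r \<partial>lborel) \<le> (\<integral>x. t powr (r / 2 - 1) * (norm (v x))\<^sup>2 \<partial>lborel)"
      using i2 r by (intro integral_mono powr_integrable[OF v] pt) auto
    also have "\<dots> = t powr (r / 2 - 1) * nsq lborel v" by (simp add: nsq_def)
    also have "\<dots> \<le> t powr (r / 2 - 1) * (C * tgr v)" by (intro mult_left_mono C(2)[OF v]) simp
    also have "\<dots> = D powr (r / 2 - 1) * C * (tgr v powr (r / 2 - 1) * tgr v)" using D by (simp add: t_def powr_mult)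
    also have "tgr v powr (r / 2 - 1) * tgr v = tgr v powr (r / 2)"
      using powr_add[of "tgr v" "r / 2 - 1" 1] r by (cases "tgr v = 0") (auto simp: less_le)
    finally show ?thesis .
  qed
  then show ?thesis using C by (intro exI[of _ "D powr (r / 2 - 1) * C"]) auto
qed

text \<open>The strict inequality \<open>r > q\<close> leaves the room for interpolating with
  mean-square convergence, which is where compactness in the subcritical range comes from.\<close>

lemma sobolev_subcritical:
  assumes q: "q > 2" and N: "DIM('a) \<ge> 3 \<longrightarrow> q < twostar DIM('a)"
  shows "\<exists>r>q. \<exists>C\<ge>0. \<forall>v :: 'a \<Rightarrow> real. testfun \<Omega> v \<longrightarrow> (\<integral>x. \<bar>v x\<bar> powr r \<partial>lborel) \<le> C * tgr v powr (r / 2)"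
proof -
  have "DIM('a) \<ge> 1" using DIM_positive[where 'a = 'a] by simp
  then consider "DIM('a) \<ge> 3" | "DIM('a) = 2" | "DIM('a) = 1" by linarith
  then show ?thesis
  proof cases
    case 1
    then show ?thesis
      using sobolev_critical[where 'a = 'a] N testfun_mono[of \<Omega> _ UNIV] by (intro exI[of _ "twostar DIM('a)"]) fastforce
  next
    case 2
    obtain k :: nat where k: "q < real k" using reals_Archimedean2 by blast
    then have "k \<ge> 1" using q by (cases k) auto
    from sobolev_dim2[OF 2 this] show ?thesis using k q by (intro exI[of _ "2 * real k"]) auto
  next
    case 3
    from sobolev_dim1[OF 3, of "q + 1"] q show ?thesis by (intro exI[of _ "q + 1"]) auto
  qed
qed

text \<open>The infimum is itself admissible: divide by the power of the Dirichlet integral, or,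
  where that power is zero, use any admissible constant.\<close>

lemma sobolevS_test:
  assumes N: "DIM('a) \<ge> 3" and v: "testfun \<Omega> (v :: 'a \<Rightarrow> real)"
  shows "sobolevS TYPE('a) \<ge> 0" "(\<integral>x. \<bar>v x\<bar> powr twostar DIM('a) \<partial>lborel) \<le> sobolevS TYPE('a) * tgr v powr (twostar DIM('a) / 2)"
proof -
  have conv: "integral\<^sup>L lebesgue (\<lambda>x. \<bar>w x\<bar> powr twostar DIM('a)) = (\<integral>x. \<bar>w x\<bar> powr twostar DIM('a) \<partial>lborel)"
    "integral\<^sup>L lebesgue (\<lambda>x. \<Sum>b\<in>Basis. (pd w b x)\<^sup>2) = tgr w" if w: "testfun UNIV w" for w :: "'a \<Rightarrow> real"
  proof -
    have [measurable]: "w \<in> borel_measurable borel" "pd w b \<in> borel_measurable borel" for b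
      using testfun_cont[OF w] testfun_pd_cont'[OF w] by (auto intro: borel_measurable_continuous_onI)
    show "integral\<^sup>L lebesgue (\<lambda>x. \<bar>w x\<bar> powr twostar DIM('a)) = (\<integral>x. \<bar>w x\<bar> powr twostar DIM('a) \<partial>lborel)"
      by (rule integral_completion) measurable
    have "integral\<^sup>L lebesgue (\<lambda>x. \<Sum>b\<in>Basis. (pd w b x)\<^sup>2) = (\<integral>x. (\<Sum>b\<in>Basis. (norm (pd w b x))\<^sup>2) \<partial>lborel)"
      by (subst integral_completion) auto
    also have "\<dots> = tgr w" unfolding tgr_def nsq_def
      using testfun_sqi(2)[OF w] by (intro Bochner_Integration.integral_sum) (auto simp: sqi_def)
    finally show "integral\<^sup>L lebesgue (\<lambda>x. \<Sum>b\<in>Basis. (pd w b x)\<^sup>2) = tgr w" .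
  qed
  define A where "A = {S. S \<ge> 0 \<and> (\<forall>v :: 'a \<Rightarrow> real. testfun UNIV v \<longrightarrow>
     (\<integral>x. \<bar>v x\<bar> powr twostar DIM('a) \<partial>lborel) \<le> S * tgr v powr (twostar DIM('a) / 2))}"
  have S: "sobolevS TYPE('a) = Inf A"
    unfolding sobolevS_def A_def by (intro arg_cong[where f = Inf] Collect_cong) (auto simp: conv)
  have ne: "A \<noteq> {}" using sobolev_critical[OF N] unfolding A_def by blast
  show "sobolevS TYPE('a) \<ge> 0" unfolding S by (rule cInf_greatest[OF ne]) (auto simp: A_def)
  have vU: "testfun UNIV v" using testfun_mono[OF v] by blast
  show "(\<integral>x. \<bar>v x\<bar> powr twostar DIM('a) \<partial>lborel) \<le> sobolevS TYPE('a) * tgr v powr (twostar DIM('a) / 2)"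
  proof (cases "tgr v powr (twostar DIM('a) / 2) = 0")
    case True
    then show ?thesis using ne vU unfolding A_def by fastforce
  next
    case False
    then have pos: "tgr v powr (twostar DIM('a) / 2) > 0" by (simp add: less_le)
    have "(\<integral>x. \<bar>v x\<bar> powr twostar DIM('a) \<partial>lborel) / tgr v powr (twostar DIM('a) / 2) \<le> Inf A"
    proof (rule cInf_greatest[OF ne])
      fix T assume "T \<in> A"
      then show "(\<integral>x. \<bar>v x\<bar> powr twostar DIM('a) \<partial>lborel) / tgr v powr (twostar DIM('a) / 2) \<le> T"
        using vU pos unfolding A_def by (simp add: pos_divide_le_eq)
    qed
    then show ?thesis unfolding S using pos by (simp add: pos_divide_le_eq)
  qed
qed

end

subsection \<open>The energy functional\<close>

locale nls = bounded_open \<Omega> for \<Omega> :: "'a::euclidean_space set" +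
  fixes \<mu>1 \<mu>2 \<beta> p :: real
  assumes \<mu>: "\<mu>1 > 0" "\<mu>2 > 0" and p1: "p > 1" and pcrit: "DIM('a) \<ge> 3 \<longrightarrow> p \<le> twostar DIM('a) - 1"
begin

abbreviation "q \<equiv> p + 1"

text \<open>The integrand of the energy as a \<open>q\<close>-homogeneous function on
  \<open>complex \<times> complex\<close>, the form in which \<open>homogeneous_increment\<close>
  and \<open>brezis_lieb\<close> apply.\<close>

definition nl :: "complex \<times> complex \<Rightarrow> real" where
  "nl z = \<mu>1 * cmod (fst z) powr q + 2 * \<beta> * cmod (fst z) powr (q / 2) * cmod (snd z) powr (q / 2) + \<mu>2 * cmod (snd z) powr q"

definition prp :: "'a cpair \<Rightarrow> 'a \<Rightarrow> complex \<times> complex" where "prp u x = (fst u x, snd u x)"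

definition pdiff :: "'a cpair \<Rightarrow> 'a cpair \<Rightarrow> 'a cpair" where
  "pdiff u v = (\<lambda>x. fst u x - fst v x, \<lambda>x. snd u x - snd v x)"

definition GG :: "'a cpair \<Rightarrow> real" where "GG u = gradsq \<Omega> (fst u) + gradsq \<Omega> (snd u)"

definition FF :: "'a cpair \<Rightarrow> real" where "FF u = integral\<^sup>L LO (\<lambda>x. nl (prp u x))"

abbreviation "En \<equiv> energy \<Omega> \<mu>1 \<mu>2 \<beta> p"
abbreviation "absp u \<equiv> (\<lambda>x. complex_of_real (cmod (fst u x)), \<lambda>x. complex_of_real (cmod (snd u x)))"

lemma q2: "q > 2" "q > 0" using p1 by auto

lemma energy_eq: "En u = GG u / 2 - FF u / q"
  by (simp add: energy_def GG_def FF_def set_int_LO nl_def prp_def)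

lemma h10dist_eq: "h10dist \<Omega> u v = sqrt (GG (pdiff u v))"
  by (simp add: h10dist_def h10norm_def GG_def pdiff_def)

lemma GG_nonneg [simp]: "GG u \<ge> 0" by (simp add: GG_def)

lemma H10pair_diff: "H10pair \<Omega> u \<Longrightarrow> H10pair \<Omega> v \<Longrightarrow> H10pair \<Omega> (pdiff u v)"
  by (simp add: H10pair_def pdiff_def H10_diff)

lemma GG_pdiff_commute: "H10pair \<Omega> u \<Longrightarrow> H10pair \<Omega> v \<Longrightarrow> GG (pdiff u v) = GG (pdiff v u)"
  using gradsq_minus_commute[of "fst u" "fst v"] gradsq_minus_commute[of "snd u" "snd v"]
  unfolding GG_def pdiff_def H10pair_def fst_conv snd_conv by (elim conjE) (simp only:)

lemma nl_cont: "continuous_on UNIV nl"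
proof -
  have c: "continuous_on UNIV (\<lambda>z::complex \<times> complex. cmod (fst z) powr a)" "continuous_on UNIV (\<lambda>z::complex \<times> complex. cmod (snd z) powr a)" if "a > 0" for a
    by (rule continuous_on_powr'; use that in \<open>auto intro!: continuous_intros\<close>)+
  show ?thesis unfolding nl_def[abs_def]
    by (intro continuous_on_add continuous_on_mult continuous_on_const c) (use q2 in auto)
qed

lemma nl_hom: "t \<ge> 0 \<Longrightarrow> nl (t *\<^sub>R z) = t powr q * nl z"
proof -
  assume t: "t \<ge> 0"
  have "t powr (q / 2) * t powr (q / 2) = t powr q" by (simp only: powr_add[symmetric] field_sum_of_halves)
  then have "(t * a) powr (q / 2) * (t * b) powr (q / 2) = t powr q * (a powr (q / 2) * b powr (q / 2))" if "a \<ge> 0" "b \<ge> 0" for a b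
    using t that by (simp add: powr_mult algebra_simps)
  from this[of "cmod (fst z)" "cmod (snd z)"] show ?thesis
    using t by (simp add: nl_def powr_mult mult.assoc distrib_left[symmetric]) (simp add: algebra_simps)
qed

lemma prp_diff: "prp (pdiff u v) x = prp u x - prp v x"
  by (simp add: prp_def pdiff_def)

lemma prp_measurable: "H10pair \<Omega> u \<Longrightarrow> prp u \<in> borel_measurable LO"
  using H10_sqi[of "fst u"] H10_sqi[of "snd u"] unfolding prp_def[abs_def] H10pair_def sqi_def
  by (intro borel_measurable_Pair) auto

lemma nsq_prp:
  assumes "H10pair \<Omega> u" shows "sqi LO (\<lambda>x. norm (prp u x))" "nsq LO (\<lambda>x. norm (prp u x)) = mass \<Omega> (fst u) + mass \<Omega> (snd u)"
  using modulus_sqi[of "fst u" "snd u"] H10_sqi[of "fst u"] H10_sqi[of "snd u"] assms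
  by (simp_all add: prp_def mass_eq H10pair_def)

text \<open>Both regimes in one statement, so that integrability and continuity need no case
  distinction. In the critical case the constant is pinned to \<open>sobolevS\<close> because
  \<open>Lambda_bound\<close> must be sharp.\<close>

lemma embedding:
  obtains r C where "r \<ge> q" "C \<ge> 0" "\<not> (DIM('a) \<ge> 3 \<and> p = twostar DIM('a) - 1) \<Longrightarrow> r > q" "(DIM('a) \<ge> 3 \<and> p = twostar DIM('a) - 1) \<Longrightarrow> r = q \<and> C = sobolevS TYPE('a)"
    "\<And>u. H10pair \<Omega> u \<Longrightarrow> integrable LO (\<lambda>x. norm (prp u x) powr r)"
    "\<And>u. H10pair \<Omega> u \<Longrightarrow> integral\<^sup>L LO (\<lambda>x. norm (prp u x) powr r) \<le> C * GG u powr (r / 2)"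
proof (cases "DIM('a) \<ge> 3 \<and> p = twostar DIM('a) - 1")
  case True
  then have q: "twostar DIM('a) = q" by simp
  have S: "sobolevS TYPE('a) \<ge> 0" using sobolevS_test(1)[OF _ testfun_zero] True by blast
  show thesis
  proof (rule that[of q "sobolevS TYPE('a)"])
    fix u assume "H10pair \<Omega> u"
    then have u: "H10 \<Omega> (fst u)" "H10 \<Omega> (snd u)" by (auto simp: H10pair_def)
    have sob: "(\<integral>x. \<bar>f x\<bar> powr q \<partial>lborel) \<le> sobolevS TYPE('a) * tgr f powr (q / 2)" if "testfun \<Omega> f" for f :: "'a \<Rightarrow> real"
      using sobolevS_test(2)[OF conjunct1[OF True] that] by (simp only: q)
    show "integrable LO (\<lambda>x. norm (prp u x) powr q)" "integral\<^sup>L LO (\<lambda>x. norm (prp u x) powr q) \<le> sobolevS TYPE('a) * GG u powr (q / 2)"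
      unfolding prp_def GG_def by (rule sobolev_transfer[OF S q2(2) sob u], assumption)+
  qed (use True S in auto)
next
  case False
  then have "DIM('a) \<ge> 3 \<longrightarrow> q < twostar DIM('a)" using pcrit by auto
  then obtain r C where r: "r > q" "C \<ge> 0" and sob: "\<And>v :: 'a \<Rightarrow> real. testfun \<Omega> v \<Longrightarrow> (\<integral>x. \<bar>v x\<bar> powr r \<partial>lborel) \<le> C * tgr v powr (r / 2)"
    using sobolev_subcritical[OF q2(1)] by blast
  have r0: "r > 0" using r q2 by linarith
  show thesis
  proof (rule that[of r C])
    fix u assume "H10pair \<Omega> u"
    then have u: "H10 \<Omega> (fst u)" "H10 \<Omega> (snd u)" by (auto simp: H10pair_def)
    show "integrable LO (\<lambda>x. norm (prp u x) powr r)" "integral\<^sup>L LO (\<lambda>x. norm (prp u x) powr r) \<le> C * GG u powr (r / 2)"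
      unfolding prp_def GG_def using sobolev_transfer[OF r(2) r0 sob u] by auto
  qed (use False r in auto)
qed

lemma Lq_integrable:
  assumes "H10pair \<Omega> u" shows "integrable LO (\<lambda>x. norm (prp u x) powr q)"
proof -
  obtain r C where r: "r \<ge> q" "\<And>u. H10pair \<Omega> u \<Longrightarrow> integrable LO (\<lambda>x. norm (prp u x) powr r)" by (rule embedding) blast
  note [measurable] = prp_measurable[OF assms]
  show ?thesis
    by (rule Bochner_Integration.integrable_bound[of LO "\<lambda>x. (norm (prp u x))\<^sup>2 + norm (prp u x) powr r"])
      (use r nsq_prp(1)[OF assms] assms q2 in \<open>auto simp: sqi_def intro!: powr_interpolate\<close>)
qed

lemma Lq_le:
  "\<exists>r>0. \<exists>C\<ge>0. \<exists>D>0. \<forall>u. H10pair \<Omega> u \<longrightarrow> integral\<^sup>L LO (\<lambda>x. norm (prp u x) powr q) \<le> D * GG u + C * GG u powr r"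
proof -
  obtain r C where r: "r \<ge> q" "C \<ge> 0" "\<And>u. H10pair \<Omega> u \<Longrightarrow> integrable LO (\<lambda>x. norm (prp u x) powr r)"
    "\<And>u. H10pair \<Omega> u \<Longrightarrow> integral\<^sup>L LO (\<lambda>x. norm (prp u x) powr r) \<le> C * GG u powr (r / 2)" by (rule embedding) blast
  obtain D where D: "D > 0" "\<And>u. H10 \<Omega> u \<Longrightarrow> nsq LO u \<le> D * gradsq \<Omega> u" using poincare_H10 by blast
  have "integral\<^sup>L LO (\<lambda>x. norm (prp u x) powr q) \<le> D * GG u + C * GG u powr (r / 2)" if u: "H10pair \<Omega> u" for u
  proof -
    have i2: "integrable LO (\<lambda>x. (norm (prp u x))\<^sup>2)" using nsq_prp(1)[OF u] by (simp add: sqi_def)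
    have "integral\<^sup>L LO (\<lambda>x. norm (prp u x) powr q) \<le> integral\<^sup>L LO (\<lambda>x. (norm (prp u x))\<^sup>2 + norm (prp u x) powr r)"
      using Lq_integrable[OF u] i2 r q2 u by (intro integral_mono powr_interpolate) auto
    also have "\<dots> = nsq LO (\<lambda>x. norm (prp u x)) + integral\<^sup>L LO (\<lambda>x. norm (prp u x) powr r)"
      using i2 r(3)[OF u] by (simp add: nsq_def)
    also have "\<dots> \<le> D * GG u + C * GG u powr (r / 2)"
      using D(2)[of "fst u"] D(2)[of "snd u"] r(4)[OF u] u unfolding nsq_prp(2)[OF u] mass_eq
      by (simp add: H10pair_def GG_def distrib_left)
    finally show ?thesis .
  qed
  moreover have "r / 2 > 0" using r(1) q2 by simp
  ultimately show ?thesis using D(1) r(2) by blast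
qed

lemma Lq_bounded: "\<exists>B. \<forall>u. H10pair \<Omega> u \<and> GG u \<le> K \<longrightarrow> integral\<^sup>L LO (\<lambda>x. norm (prp u x) powr q) \<le> B"
proof -
  obtain r C D where *: "r > 0" "C \<ge> 0" "D > 0" "\<And>u. H10pair \<Omega> u \<Longrightarrow> integral\<^sup>L LO (\<lambda>x. norm (prp u x) powr q) \<le> D * GG u + C * GG u powr r"
    using Lq_le by blast
  have "integral\<^sup>L LO (\<lambda>x. norm (prp u x) powr q) \<le> D * K + C * K powr r" if "H10pair \<Omega> u" "GG u \<le> K" for u
  proof -
    have "D * GG u + C * GG u powr r \<le> D * K + C * K powr r"
      using * that by (intro add_mono mult_left_mono powr_mono2) auto
    then show ?thesis using *(4)[OF that(1)] by linarith
  qed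
  then show ?thesis by blast
qed

lemma Lq_tendsto_0:
  assumes "\<And>n. H10pair \<Omega> (z n)" "(\<lambda>n. GG (z n)) \<longlonglongrightarrow> 0"
  shows "(\<lambda>n. integral\<^sup>L LO (\<lambda>x. norm (prp (z n) x) powr q)) \<longlonglongrightarrow> 0"
proof -
  obtain r C D where *: "r > 0" "C \<ge> 0" "D > 0" "\<And>u. H10pair \<Omega> u \<Longrightarrow> integral\<^sup>L LO (\<lambda>x. norm (prp u x) powr q) \<le> D * GG u + C * GG u powr r"
    using Lq_le by blast
  have "(\<lambda>n. GG (z n) powr r) \<longlonglongrightarrow> 0 powr r" using * by (intro tendsto_powr' assms tendsto_const disjI2 conjI always_eventually allI GG_nonneg)
  then have "(\<lambda>n. D * GG (z n) + C * GG (z n) powr r) \<longlonglongrightarrow> D * 0 + C * 0 powr r" by (intro tendsto_add tendsto_mult_left assms(2))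
  then have l: "(\<lambda>n. D * GG (z n) + C * GG (z n) powr r) \<longlonglongrightarrow> 0" using *(1) by simp
  show ?thesis by (rule tendsto_0_bound[OF _ l]) (use *(4)[OF assms(1)] in auto)
qed

lemma nl_bound: obtains m where "m \<ge> 0" "\<And>z. \<bar>nl z\<bar> \<le> m * norm z powr q"
  using homogeneous_bound[OF nl_cont nl_hom q2(2)] by blast

lemma nl_measurable: "H10pair \<Omega> u \<Longrightarrow> (\<lambda>x. nl (prp u x)) \<in> borel_measurable LO"
  using measurable_compose[OF prp_measurable borel_measurable_continuous_onI[OF nl_cont]] by simp

lemma FF_integrable:
  assumes "H10pair \<Omega> u" shows "integrable LO (\<lambda>x. nl (prp u x))"
proof -
  obtain m where m: "m \<ge> 0" "\<And>z. \<bar>nl z\<bar> \<le> m * norm z powr q" by (rule nl_bound) blast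
  show ?thesis
    by (rule Bochner_Integration.integrable_bound[of LO "\<lambda>x. m * norm (prp u x) powr q"])
      (use m Lq_integrable[OF assms] nl_measurable[OF assms] in auto)
qed

lemma FF_tendsto_0:
  assumes z: "\<And>n. H10pair \<Omega> (z n)" and l: "(\<lambda>n. integral\<^sup>L LO (\<lambda>x. norm (prp (z n) x) powr q)) \<longlonglongrightarrow> 0"
  shows "(\<lambda>n. FF (z n)) \<longlonglongrightarrow> 0"
proof -
  obtain m where m: "m \<ge> 0" "\<And>z. \<bar>nl z\<bar> \<le> m * norm z powr q" by (rule nl_bound) blast
  show ?thesis
  proof (rule tendsto_0_bound)
    fix n
    have "norm (FF (z n)) \<le> integral\<^sup>L LO (\<lambda>x. m * norm (prp (z n) x) powr q)"
      unfolding FF_def using FF_integrable[OF z] Lq_integrable[OF z] m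
      by (intro order_trans[OF integral_norm_bound] integral_mono) auto
    then show "norm (FF (z n)) \<le> m * integral\<^sup>L LO (\<lambda>x. norm (prp (z n) x) powr q)" by simp
    show "(\<lambda>n. m * integral\<^sup>L LO (\<lambda>x. norm (prp (z n) x) powr q)) \<longlonglongrightarrow> 0" using tendsto_mult_left[OF l, of m] by simp
  qed
qed

text \<open>The increment bound is taken around \<open>v n\<close>, whose integrals of power
  \<open>q\<close> are bounded and enter with a small factor; the difference vanishes in gradient
  norm and carries the large constant.\<close>

lemma FF_diff_tendsto_0:
  assumes v: "\<And>n. H10pair \<Omega> (v n)" and w: "\<And>n. H10pair \<Omega> (w n)" and K: "\<And>n. GG (v n) \<le> K"
    and l: "(\<lambda>n. GG (pdiff (w n) (v n))) \<longlonglongrightarrow> 0"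
  shows "(\<lambda>n. FF (w n) - FF (v n)) \<longlonglongrightarrow> 0"
proof (rule LIMSEQ_I)
  fix e :: real assume e: "e > 0"
  obtain B where B: "\<And>u. H10pair \<Omega> u \<Longrightarrow> GG u \<le> K \<Longrightarrow> integral\<^sup>L LO (\<lambda>x. norm (prp u x) powr q) \<le> B" using Lq_bounded[of K] by blast
  have B0: "B \<ge> 0" using order_trans[OF _ B[OF v[of 0] K[of 0]]] by simp
  define \<eta> where "\<eta> = e / (2 * (B + 1))"
  have \<eta>: "\<eta> > 0" using e B0 by (simp add: \<eta>_def)
  have \<eta>B: "\<eta> * (B + 1) = e / 2"
  proof -
    have "e / (2 * b) * b = e / 2" if "b \<noteq> 0" for b :: real using that by simp
    then show ?thesis unfolding \<eta>_def using B0 by (metis add_nonneg_pos less_irrefl zero_less_one)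
  qed
  obtain C where C: "C \<ge> 0" "\<And>z w. \<bar>nl (z + w) - nl z\<bar> \<le> \<eta> * norm z powr q + C * norm w powr q"
    using homogeneous_increment[OF nl_cont nl_hom q2(2) \<eta>] by blast
  define d where "d n = pdiff (w n) (v n)" for n
  have d: "H10pair \<Omega> (d n)" for n unfolding d_def by (intro H10pair_diff v w)
  have "(\<lambda>n. C * integral\<^sup>L LO (\<lambda>x. norm (prp (d n) x) powr q)) \<longlonglongrightarrow> C * 0"
    by (intro tendsto_intros Lq_tendsto_0[OF d]) (use l in \<open>simp add: d_def\<close>)
  then have "\<forall>\<^sub>F n in sequentially. C * integral\<^sup>L LO (\<lambda>x. norm (prp (d n) x) powr q) < e / 2" using e by (intro order_tendstoD) auto
  then obtain N where N: "\<And>n. n \<ge> N \<Longrightarrow> C * integral\<^sup>L LO (\<lambda>x. norm (prp (d n) x) powr q) < e / 2" unfolding eventually_sequentially by auto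
  have "norm (FF (w n) - FF (v n) - 0) < e" if "n \<ge> N" for n
  proof -
    have "FF (w n) - FF (v n) = integral\<^sup>L LO (\<lambda>x. nl (prp (w n) x) - nl (prp (v n) x))"
      unfolding FF_def using FF_integrable[OF v] FF_integrable[OF w] by simp
    also have "norm \<dots> \<le> integral\<^sup>L LO (\<lambda>x. \<eta> * norm (prp (v n) x) powr q + C * norm (prp (d n) x) powr q)"
    proof (rule order_trans[OF integral_norm_bound integral_mono])
      show "integrable LO (\<lambda>x. norm (nl (prp (w n) x) - nl (prp (v n) x)))"
        using FF_integrable[OF v] FF_integrable[OF w] by (intro integrable_norm Bochner_Integration.integrable_diff)
      show "integrable LO (\<lambda>x. \<eta> * norm (prp (v n) x) powr q + C * norm (prp (d n) x) powr q)"
        using Lq_integrable[OF v] Lq_integrable[OF d] by simp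
      show "norm (nl (prp (w n) x) - nl (prp (v n) x)) \<le> \<eta> * norm (prp (v n) x) powr q + C * norm (prp (d n) x) powr q" for x
        using C(2)[of "prp (v n) x" "prp (d n) x"] by (simp add: d_def prp_diff)
    qed
    also have "\<dots> = \<eta> * integral\<^sup>L LO (\<lambda>x. norm (prp (v n) x) powr q) + C * integral\<^sup>L LO (\<lambda>x. norm (prp (d n) x) powr q)"
      using Lq_integrable[OF v] Lq_integrable[OF d] by simp
    finally have "norm (FF (w n) - FF (v n)) \<le> \<eta> * integral\<^sup>L LO (\<lambda>x. norm (prp (v n) x) powr q) + C * integral\<^sup>L LO (\<lambda>x. norm (prp (d n) x) powr q)" .
    moreover have "\<eta> * integral\<^sup>L LO (\<lambda>x. norm (prp (v n) x) powr q) \<le> \<eta> * (B + 1)" using B[OF v K, of n] \<eta> by (intro mult_left_mono) auto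
    ultimately show ?thesis using N[OF that] \<eta>B by simp
  qed
  then show "\<exists>no. \<forall>n\<ge>no. norm (FF (w n) - FF (v n) - 0) < e" by blast
qed

lemma gradsq_diff_tendsto_0:
  assumes v: "\<And>n. H10 \<Omega> (v n)" and w: "\<And>n. H10 \<Omega> (w n)" and K: "\<And>n. gradsq \<Omega> (v n) \<le> K"
    and l: "(\<lambda>n. gradsq \<Omega> (\<lambda>x. w n x - v n x)) \<longlonglongrightarrow> 0"
  shows "(\<lambda>n. gradsq \<Omega> (w n) - gradsq \<Omega> (v n)) \<longlonglongrightarrow> 0"
proof (rule tendsto_0_bound)
  fix n
  define d where "d x = w n x - v n x" for x
  have d: "H10 \<Omega> d" unfolding d_def by (intro H10_diff v w)
  have "w n = (\<lambda>x. v n x + complex_of_real 1 * d x)" by (auto simp: d_def)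
  then have "gradsq \<Omega> (w n) = gradsq \<Omega> (v n) + 2 * 1 * gip (v n) d + 1\<^sup>2 * gradsq \<Omega> d" using gradsq_expand[OF v d] by metis
  then have "norm (gradsq \<Omega> (w n) - gradsq \<Omega> (v n)) \<le> 2 * \<bar>gip (v n) d\<bar> + gradsq \<Omega> d"
    using abs_triangle_ineq[of "2 * gip (v n) d" "gradsq \<Omega> d"] by simp
  also have "\<dots> \<le> 2 * (sqrt K * sqrt (gradsq \<Omega> d)) + gradsq \<Omega> d"
    using order_trans[OF gip_bound[OF v d] mult_right_mono[OF real_sqrt_le_mono[OF K]]] by simp
  finally show "norm (gradsq \<Omega> (w n) - gradsq \<Omega> (v n)) \<le> 2 * (sqrt K * sqrt (gradsq \<Omega> (\<lambda>x. w n x - v n x))) + gradsq \<Omega> (\<lambda>x. w n x - v n x)"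
    by (simp add: d_def[abs_def])
next
  have "(\<lambda>n. 2 * (sqrt K * sqrt (gradsq \<Omega> (\<lambda>x. w n x - v n x))) + gradsq \<Omega> (\<lambda>x. w n x - v n x)) \<longlonglongrightarrow> 2 * (sqrt K * sqrt 0) + 0"
    by (intro tendsto_intros l)
  then show "(\<lambda>n. 2 * (sqrt K * sqrt (gradsq \<Omega> (\<lambda>x. w n x - v n x))) + gradsq \<Omega> (\<lambda>x. w n x - v n x)) \<longlonglongrightarrow> 0" by simp
qed

text \<open>Both sequences may vary and only a common bound on \<open>GG (v n)\<close> is required:
  this covers convergence to a fixed limit as well as data close to changing ground states.\<close>

lemma energy_diff_tendsto_0:
  assumes v: "\<And>n. H10pair \<Omega> (v n)" and w: "\<And>n. H10pair \<Omega> (w n)" and K: "\<And>n. GG (v n) \<le> K"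
    and l: "(\<lambda>n. GG (pdiff (w n) (v n))) \<longlonglongrightarrow> 0"
  shows "(\<lambda>n. GG (w n) - GG (v n)) \<longlonglongrightarrow> 0" "(\<lambda>n. En (w n) - En (v n)) \<longlonglongrightarrow> 0"
    "(\<lambda>n. nsq LO (\<lambda>x. fst (w n) x - fst (v n) x)) \<longlonglongrightarrow> 0" "(\<lambda>n. nsq LO (\<lambda>x. snd (w n) x - snd (v n) x)) \<longlonglongrightarrow> 0"
proof -
  have H: "H10 \<Omega> (fst (v n))" "H10 \<Omega> (snd (v n))" "H10 \<Omega> (fst (w n))" "H10 \<Omega> (snd (w n))" for n
    using v[of n] w[of n] by (auto simp: H10pair_def)
  have K': "gradsq \<Omega> (fst (v n)) \<le> K" "gradsq \<Omega> (snd (v n)) \<le> K" for n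
    using K[of n] gradsq_nonneg[of "fst (v n)"] gradsq_nonneg[of "snd (v n)"] unfolding GG_def by linarith+
  have l1: "(\<lambda>n. gradsq \<Omega> (\<lambda>x. fst (w n) x - fst (v n) x)) \<longlonglongrightarrow> 0"
    by (rule tendsto_0_bound[OF _ l]) (simp add: GG_def pdiff_def)
  have l2: "(\<lambda>n. gradsq \<Omega> (\<lambda>x. snd (w n) x - snd (v n) x)) \<longlonglongrightarrow> 0"
    by (rule tendsto_0_bound[OF _ l]) (simp add: GG_def pdiff_def)
  show g: "(\<lambda>n. GG (w n) - GG (v n)) \<longlonglongrightarrow> 0"
    using tendsto_add[OF gradsq_diff_tendsto_0[OF H(1,3) K'(1) l1] gradsq_diff_tendsto_0[OF H(2,4) K'(2) l2]]
    by (simp add: GG_def algebra_simps)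
  have "(\<lambda>n. (GG (w n) - GG (v n)) / 2 - (FF (w n) - FF (v n)) / q) \<longlonglongrightarrow> 0 / 2 - 0 / q"
    using q2 by (intro tendsto_intros g FF_diff_tendsto_0[OF v w K l]) auto
  then show "(\<lambda>n. En (w n) - En (v n)) \<longlonglongrightarrow> 0" by (simp add: energy_eq diff_divide_distrib algebra_simps)
  obtain D where D: "D > 0" "\<And>u. H10 \<Omega> u \<Longrightarrow> nsq LO u \<le> D * gradsq \<Omega> u" using poincare_H10 by blast
  show "(\<lambda>n. nsq LO (\<lambda>x. fst (w n) x - fst (v n) x)) \<longlonglongrightarrow> 0"
  proof (rule tendsto_0_bound)
    show "norm (nsq LO (\<lambda>x. fst (w n) x - fst (v n) x)) \<le> D * gradsq \<Omega> (\<lambda>x. fst (w n) x - fst (v n) x)" for n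
      using D(2)[OF H10_diff[OF H(3,1)]] by simp
    show "(\<lambda>n. D * gradsq \<Omega> (\<lambda>x. fst (w n) x - fst (v n) x)) \<longlonglongrightarrow> 0" using tendsto_mult_left[OF l1, of D] by simp
  qed
  show "(\<lambda>n. nsq LO (\<lambda>x. snd (w n) x - snd (v n) x)) \<longlonglongrightarrow> 0"
  proof (rule tendsto_0_bound)
    show "norm (nsq LO (\<lambda>x. snd (w n) x - snd (v n) x)) \<le> D * gradsq \<Omega> (\<lambda>x. snd (w n) x - snd (v n) x)" for n
      using D(2)[OF H10_diff[OF H(4,2)]] by simp
    show "(\<lambda>n. D * gradsq \<Omega> (\<lambda>x. snd (w n) x - snd (v n) x)) \<longlonglongrightarrow> 0" using tendsto_mult_left[OF l2, of D] by simp
  qed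
qed

lemma energy_abs:
  assumes "H10pair \<Omega> u"
  shows "H10pair \<Omega> (absp u)" "GG (absp u) \<le> GG u" "FF (absp u) = FF u" "En (absp u) \<le> En u"
    "mass \<Omega> (fst (absp u)) = mass \<Omega> (fst u)" "mass \<Omega> (snd (absp u)) = mass \<Omega> (snd u)"
proof -
  show "H10pair \<Omega> (absp u)" using assms H10_abs(1) by (simp add: H10pair_def)
  show g: "GG (absp u) \<le> GG u" using assms H10_abs(2)[of "fst u"] H10_abs(2)[of "snd u"] by (simp add: GG_def H10pair_def)
  show f: "FF (absp u) = FF u" by (simp add: FF_def nl_def prp_def)
  show "En (absp u) \<le> En u" using g f by (simp add: energy_eq)
  show "mass \<Omega> (fst (absp u)) = mass \<Omega> (fst u)" "mass \<Omega> (snd (absp u)) = mass \<Omega> (snd u)" by (simp_all add: mass_def)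
qed

lemma Bset_eq: "u \<in> Bset \<Omega> \<rho>1 \<rho>2 \<alpha> \<longleftrightarrow> u \<in> Mset \<Omega> \<rho>1 \<rho>2 \<and> GG u \<le> (\<rho>1 + \<rho>2) * \<alpha>"
  by (simp add: Bset_def GG_def)

lemma absp_Mset:
  "H10pair \<Omega> u \<Longrightarrow> mass \<Omega> (fst u) = \<rho>1 \<Longrightarrow> mass \<Omega> (snd u) = \<rho>2 \<Longrightarrow> absp u \<in> Mset \<Omega> \<rho>1 \<rho>2"
  using energy_abs[of u] by (simp add: Mset_def)

text \<open>\<open>lambda1\<close> is an infimum over real functions; the modulus of
  \<open>u\<close> is an admissible competitor with the same mass and no larger gradient.\<close>

lemma lambda1_le:
  assumes "H10 \<Omega> u" shows "lambda1 \<Omega> * mass \<Omega> u \<le> gradsq \<Omega> u"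
proof (cases "mass \<Omega> u = 0")
  case False
  define w where "w x = complex_of_real (cmod (u x))" for x
  have w: "H10 \<Omega> w" "gradsq \<Omega> w \<le> gradsq \<Omega> u" "mass \<Omega> w = mass \<Omega> u"
    unfolding w_def using H10_abs[OF assms] by (auto simp: mass_def)
  have wr: "\<forall>x\<in>\<Omega>. Im (w x) = 0" by (simp add: w_def)
  have m: "mass \<Omega> u > 0" using False by (simp add: mass_eq less_le)
  have "lambda1 \<Omega> \<le> gradsq \<Omega> w / mass \<Omega> w"
    unfolding lambda1_def
  proof (rule cInf_lower)
    show "gradsq \<Omega> w / mass \<Omega> w \<in> {gradsq \<Omega> u / mass \<Omega> u | u. H10 \<Omega> u \<and> (\<forall>x\<in>\<Omega>. Im (u x) = 0) \<and> mass \<Omega> u \<noteq> 0}"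
      using w wr False by (intro CollectI exI[of _ w]) simp
    show "bdd_below {gradsq \<Omega> u / mass \<Omega> u | u. H10 \<Omega> u \<and> (\<forall>x\<in>\<Omega>. Im (u x) = 0) \<and> mass \<Omega> u \<noteq> 0}"
      by (rule bdd_belowI[of _ 0]) (auto simp: mass_eq)
  qed
  then have "lambda1 \<Omega> * mass \<Omega> u \<le> gradsq \<Omega> w" using m w by (simp add: pos_le_divide_eq)
  then show ?thesis using w by linarith
qed simp

subsection \<open>Compactness of minimising sequences\<close>

text \<open>By homogeneity \<open>nl w\<close> is at most the supremum \<open>Sup A\<close> over the
  unit circle times \<open>norm w powr q\<close>; replacing \<open>\<beta>\<close> by its positive
  part only increases it. The Sobolev inequality for pairs with the sharp scalar constant then
  produces exactly \<open>Lambda\<close>.\<close>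

lemma Lambda_bound:
  assumes cr: "DIM('a) \<ge> 3 \<and> p = twostar DIM('a) - 1" and z: "H10pair \<Omega> z"
  shows "Lambda TYPE('a) \<mu>1 \<mu>2 \<beta> \<ge> 0" "FF z / q \<le> Lambda TYPE('a) \<mu>1 \<mu>2 \<beta> / 2 * GG z powr (q / 2)"
proof -
  have tq: "twostar DIM('a) = q" using cr by simp
  define h where "h x y = \<mu>1 * \<bar>x\<bar> powr q + \<mu>2 * \<bar>y\<bar> powr q + 2 * max \<beta> 0 * \<bar>x * y\<bar> powr (q / 2)" for x y :: real
  define A where "A = {h x y | x y. x\<^sup>2 + y\<^sup>2 = 1}"
  have bdd: "bdd_above A"
  proof (rule bdd_aboveI[of _ "\<mu>1 + \<mu>2 + 2 * max \<beta> 0"])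
    fix a assume "a \<in> A"
    then obtain x y where a: "a = h x y" "x\<^sup>2 + y\<^sup>2 = 1" unfolding A_def by blast
    have "x\<^sup>2 \<le> 1" "y\<^sup>2 \<le> 1" using a(2) zero_le_power2[of x] zero_le_power2[of y] by linarith+
    then have xy: "\<bar>x\<bar> \<le> 1" "\<bar>y\<bar> \<le> 1" by (auto simp: abs_square_le_1)
    then have "\<bar>x * y\<bar> \<le> 1" by (simp add: abs_mult mult_le_one)
    then have "\<bar>x\<bar> powr q \<le> 1" "\<bar>y\<bar> powr q \<le> 1" "\<bar>x * y\<bar> powr (q / 2) \<le> 1" using xy q2 by (auto intro!: powr_le1)
    then have "\<mu>1 * \<bar>x\<bar> powr q \<le> \<mu>1 * 1" "\<mu>2 * \<bar>y\<bar> powr q \<le> \<mu>2 * 1" "2 * max \<beta> 0 * \<bar>x * y\<bar> powr (q / 2) \<le> 2 * max \<beta> 0 * 1"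
      using \<mu> by (intro mult_left_mono; simp)+
    then show "a \<le> \<mu>1 + \<mu>2 + 2 * max \<beta> 0" unfolding a(1) h_def by linarith
  qed
  have L: "Lambda TYPE('a) \<mu>1 \<mu>2 \<beta> = 2 * sobolevS TYPE('a) / q * Sup A"
    unfolding Lambda_def A_def h_def tq by simp
  have Sup0: "Sup A \<ge> 0"
  proof -
    have "h 1 0 \<in> A" unfolding A_def by (intro CollectI exI[of _ 1] exI[of _ 0]) auto
    then have "h 1 0 \<le> Sup A" by (rule cSup_upper[OF _ bdd])
    moreover have "h 1 0 = \<mu>1" using q2 by (simp add: h_def)
    ultimately show ?thesis using \<mu> by linarith
  qed
  have pt: "nl w \<le> Sup A * norm w powr q" for w
  proof (cases "w = 0")
    case True
    then show ?thesis using q2 by (simp add: nl_def)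
  next
    case False
    define t where "t = norm w"
    have t: "t > 0" using False by (simp add: t_def)
    define x y where "x = cmod (fst w) / t" and "y = cmod (snd w) / t"
    have xy: "x \<ge> 0" "y \<ge> 0" using t by (auto simp: x_def y_def)
    have "t\<^sup>2 = (cmod (fst w))\<^sup>2 + (cmod (snd w))\<^sup>2" unfolding t_def by (simp add: norm_prod_def)
    moreover have "x\<^sup>2 + y\<^sup>2 = ((cmod (fst w))\<^sup>2 + (cmod (snd w))\<^sup>2) / t\<^sup>2" by (simp add: x_def y_def power_divide add_divide_distrib)
    ultimately have "x\<^sup>2 + y\<^sup>2 = t\<^sup>2 / t\<^sup>2" by (simp only:)
    then have "x\<^sup>2 + y\<^sup>2 = 1" using t by simp
    then have hA: "h x y \<le> Sup A" by (intro cSup_upper[OF _ bdd]) (auto simp: A_def)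
    have e: "nl w = t powr q * nl (w /\<^sub>R t)" using nl_hom[of t "w /\<^sub>R t"] t by simp
    have "nl (w /\<^sub>R t) = \<mu>1 * x powr q + 2 * \<beta> * (x powr (q / 2) * y powr (q / 2)) + \<mu>2 * y powr q"
    proof -
      have "cmod (fst (w /\<^sub>R t)) = x" "cmod (snd (w /\<^sub>R t)) = y" using t by (simp_all add: x_def y_def divide_inverse mult.commute)
      then show ?thesis unfolding nl_def by (simp only: mult.assoc)
    qed
    also have "\<dots> \<le> \<mu>1 * x powr q + 2 * max \<beta> 0 * (x powr (q / 2) * y powr (q / 2)) + \<mu>2 * y powr q"
      by (intro add_mono mult_right_mono) auto
    also have "\<dots> = h x y" using xy by (simp add: h_def powr_mult)
    finally have "nl (w /\<^sub>R t) \<le> Sup A" using hA by linarith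
    then have "t powr q * nl (w /\<^sub>R t) \<le> t powr q * Sup A" by (intro mult_left_mono) auto
    then show ?thesis unfolding e by (simp add: t_def mult.commute)
  qed
  obtain r C where r: "(DIM('a) \<ge> 3 \<and> p = twostar DIM('a) - 1) \<Longrightarrow> r = q \<and> C = sobolevS TYPE('a)" "C \<ge> 0"
    "\<And>u. H10pair \<Omega> u \<Longrightarrow> integral\<^sup>L LO (\<lambda>x. norm (prp u x) powr r) \<le> C * GG u powr (r / 2)" by (rule embedding) blast
  have S: "sobolevS TYPE('a) \<ge> 0" using r cr by auto
  show "Lambda TYPE('a) \<mu>1 \<mu>2 \<beta> \<ge> 0" unfolding L using S Sup0 q2 by simp
  have "FF z \<le> integral\<^sup>L LO (\<lambda>x. Sup A * norm (prp z x) powr q)"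
    unfolding FF_def using FF_integrable[OF z] Lq_integrable[OF z] pt by (intro integral_mono) auto
  also have "\<dots> = Sup A * integral\<^sup>L LO (\<lambda>x. norm (prp z x) powr q)" by simp
  also have "\<dots> \<le> Sup A * (sobolevS TYPE('a) * GG z powr (q / 2))"
    using r(3)[OF z] r(1)[OF cr] Sup0 by (intro mult_left_mono) auto
  finally have "FF z / q \<le> Sup A * (sobolevS TYPE('a) * GG z powr (q / 2)) / q" using q2 by (intro divide_right_mono) auto
  from this show "FF z / q \<le> Lambda TYPE('a) \<mu>1 \<mu>2 \<beta> / 2 * GG z powr (q / 2)"
  proof -
    have "2 * s / k * a / 2 * g = a * (s * g) / k" for s k a g :: real by simp
    then show ?thesis using \<open>FF z / q \<le> Sup A * (sobolevS TYPE('a) * GG z powr (q / 2)) / q\<close> unfolding L by (simp only:)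
  qed
qed

text \<open>Interpolation: the masses vanish and the integrals of the higher power \<open>r\<close>
  stay bounded, so \<open>powr_young\<close> makes the intermediate ones vanish.\<close>

lemma Lq_subcritical_tendsto_0:
  assumes nc: "\<not> (DIM('a) \<ge> 3 \<and> p = twostar DIM('a) - 1)" and z: "\<And>n. H10pair \<Omega> (z n)" and K: "\<And>n. GG (z n) \<le> K"
    and l1: "(\<lambda>n. mass \<Omega> (fst (z n))) \<longlonglongrightarrow> 0" and l2: "(\<lambda>n. mass \<Omega> (snd (z n))) \<longlonglongrightarrow> 0"
  shows "(\<lambda>n. integral\<^sup>L LO (\<lambda>x. norm (prp (z n) x) powr q)) \<longlonglongrightarrow> 0"
proof (rule LIMSEQ_I)
  fix e :: real assume e: "e > 0"
  obtain r C where r: "\<not> (DIM('a) \<ge> 3 \<and> p = twostar DIM('a) - 1) \<Longrightarrow> r > q" "C \<ge> 0" "\<And>u. H10pair \<Omega> u \<Longrightarrow> integrable LO (\<lambda>x. norm (prp u x) powr r)"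
    "\<And>u. H10pair \<Omega> u \<Longrightarrow> integral\<^sup>L LO (\<lambda>x. norm (prp u x) powr r) \<le> C * GG u powr (r / 2)" by (rule embedding) blast
  define B where "B = C * K powr (r / 2) + 1"
  have B: "B > 0" using r(2) by (simp add: B_def add_nonneg_pos)
  have rB: "integral\<^sup>L LO (\<lambda>x. norm (prp (z n) x) powr r) \<le> B" for n
  proof -
    have "C * GG (z n) powr (r / 2) \<le> C * K powr (r / 2)" using r(1)[OF nc] r(2) q2 K by (intro mult_left_mono powr_mono2) auto
    then show ?thesis using r(4)[OF z, of n] by (simp add: B_def)
  qed
  obtain D where D: "D \<ge> 0" "\<And>t. t \<ge> 0 \<Longrightarrow> t powr q \<le> e / (2 * B) * t powr r + D * t\<^sup>2"
    using powr_young[OF q2(1) r(1)[OF nc], of "e / (2 * B)"] e B by auto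
  have "(\<lambda>n. D * (mass \<Omega> (fst (z n)) + mass \<Omega> (snd (z n)))) \<longlonglongrightarrow> D * (0 + 0)" by (intro tendsto_intros l1 l2)
  then have "\<forall>\<^sub>F n in sequentially. D * (mass \<Omega> (fst (z n)) + mass \<Omega> (snd (z n))) < e / 2" using e by (intro order_tendstoD) auto
  then obtain N where N: "\<And>n. n \<ge> N \<Longrightarrow> D * (mass \<Omega> (fst (z n)) + mass \<Omega> (snd (z n))) < e / 2" unfolding eventually_sequentially by auto
  have "integral\<^sup>L LO (\<lambda>x. norm (prp (z n) x) powr q) < e" if "n \<ge> N" for n
  proof -
    have i2: "integrable LO (\<lambda>x. (norm (prp (z n) x))\<^sup>2)" using nsq_prp(1)[OF z] by (simp add: sqi_def)
    have "integral\<^sup>L LO (\<lambda>x. norm (prp (z n) x) powr q) \<le> integral\<^sup>L LO (\<lambda>x. e / (2 * B) * norm (prp (z n) x) powr r + D * (norm (prp (z n) x))\<^sup>2)"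
      using Lq_integrable[OF z] i2 r(3)[OF z] by (intro integral_mono D(2)) auto
    also have "\<dots> = e / (2 * B) * integral\<^sup>L LO (\<lambda>x. norm (prp (z n) x) powr r) + D * nsq LO (\<lambda>x. norm (prp (z n) x))"
      using i2 r(3)[OF z] by (simp add: nsq_def)
    also have "\<dots> \<le> e / (2 * B) * B + D * nsq LO (\<lambda>x. norm (prp (z n) x))"
      using rB e B D(1) by (intro add_mono mult_left_mono) auto
    also have "\<dots> = e / 2 + D * (mass \<Omega> (fst (z n)) + mass \<Omega> (snd (z n)))" using B nsq_prp(2)[OF z] by simp
    finally show ?thesis using N[OF that] by linarith
  qed
  then show "\<exists>no. \<forall>n\<ge>no. norm (integral\<^sup>L LO (\<lambda>x. norm (prp (z n) x) powr q) - 0) < e" by (intro exI[of _ N]) auto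
qed

text \<open>Suppose \<open>X > 0\<close>. In the subcritical range the nonlinear part vanishes and
  the energies tend to \<open>X / 2\<close>, against the upper bound. In the critical case the limit
  of \<open>Lambda_bound\<close> reads \<open>X \<le> L * X powr (q / 2)\<close>, which forces
  \<open>X\<close> up to the threshold excluded by \<open>cr\<close>.\<close>

lemma coercive:
  assumes z: "\<And>n. H10pair \<Omega> (z n)" and K: "\<And>n. GG (z n) \<le> K"
    and l1: "(\<lambda>n. mass \<Omega> (fst (z n))) \<longlonglongrightarrow> 0" and l2: "(\<lambda>n. mass \<Omega> (snd (z n))) \<longlonglongrightarrow> 0"
    and X: "(\<lambda>n. GG (z n)) \<longlonglongrightarrow> X" and cr: "(DIM('a) \<ge> 3 \<and> p = twostar DIM('a) - 1) \<Longrightarrow> X < Lambda TYPE('a) \<mu>1 \<mu>2 \<beta> powr (- (real DIM('a) - 2) / 2)"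
    and e: "\<And>n. En (z n) \<le> e n" "e \<longlonglongrightarrow> 0"
  shows "X = 0"
proof (rule ccontr)
  assume "X \<noteq> 0"
  moreover have "X \<ge> 0" using X by (rule LIMSEQ_le_const) auto
  ultimately have X0: "X > 0" by simp
  show False
  proof (cases "DIM('a) \<ge> 3 \<and> p = twostar DIM('a) - 1")
    case False
    have "(\<lambda>n. FF (z n)) \<longlonglongrightarrow> 0" by (rule FF_tendsto_0[OF z Lq_subcritical_tendsto_0[OF False z K l1 l2]])
    then have "(\<lambda>n. GG (z n) / 2 - FF (z n) / q) \<longlonglongrightarrow> X / 2 - 0 / q" using q2 by (intro tendsto_intros X) auto
    then have "X / 2 - 0 / q \<le> 0" by (rule LIMSEQ_le[OF _ e(2)]) (use e(1) in \<open>auto simp: energy_eq\<close>)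
    then show False using X0 by simp
  next
    case True
    define L where "L = Lambda TYPE('a) \<mu>1 \<mu>2 \<beta>"
    define n where "n = real DIM('a)"
    have n: "n \<ge> 3" using True by (simp add: n_def)
    have L0: "L \<ge> 0" unfolding L_def by (rule Lambda_bound(1)[OF True z[of 0]])
    have "(\<lambda>n. GG (z n) / 2 - L / 2 * GG (z n) powr (q / 2)) \<longlonglongrightarrow> X / 2 - L / 2 * X powr (q / 2)"
      using X0 by (intro tendsto_intros X) auto
    moreover have "GG (z n) / 2 - L / 2 * GG (z n) powr (q / 2) \<le> e n" for n
      using e(1)[of n] Lambda_bound(2)[OF True z[of n]] unfolding energy_eq L_def by linarith
    ultimately have "X / 2 - L / 2 * X powr (q / 2) \<le> 0" using LIMSEQ_le[OF _ e(2)] by blast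
    then have le: "X \<le> L * X powr (q / 2)" by simp
    \<comment> \<open>The excess \<open>2 / (n - 2)\<close> over 1 is the power left after dividing
      by \<open>X\<close>; raising to \<open>(n - 2) / 2\<close> solves for \<open>X\<close> and
      explains the exponent of the threshold.\<close>
    have q: "q / 2 = 1 + 2 / (n - 2)"
    proof -
      have "q = 2 * n / (n - 2)" using True by (simp add: twostar_def n_def)
      moreover have "2 * n / c / 2 = n / c" for c by simp
      moreover have "n / (n - 2) = 1 + 2 / (n - 2)" using n by (simp add: divide_simps)
      ultimately show ?thesis by (simp only:)
    qed
    have "X * 1 \<le> X * (L * X powr (2 / (n - 2)))" using le X0 unfolding q powr_add by (simp add: mult.left_commute)
    then have le1: "1 \<le> L * X powr (2 / (n - 2))" using X0 by (simp only: mult_le_cancel_left_pos)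
    then have Lp: "L > 0" using L0 by (cases "L = 0") auto
    have "1 / L \<le> X powr (2 / (n - 2))" using le1 Lp by (simp add: field_simps)
    then have "(1 / L) powr ((n - 2) / 2) \<le> (X powr (2 / (n - 2))) powr ((n - 2) / 2)"
      using n Lp by (intro powr_mono2) auto
    also have "\<dots> = X"
    proof -
      have "2 / a * (a / 2) = 1" if "a \<noteq> 0" for a :: real using that by simp
      from this[of "n - 2"] show ?thesis using X0 n by (simp only: powr_powr) simp
    qed
    also have "(1 / L) powr ((n - 2) / 2) = L powr (- (n - 2) / 2)"
    proof -
      have "- (n - 2) / 2 = - ((n - 2) / 2)" by (rule minus_divide_left[symmetric])
      then show ?thesis using Lp by (simp only: powr_minus_divide) (simp add: powr_divide)
    qed
    finally show False using cr[OF True] unfolding L_def n_def by simp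
  qed
qed

end

context bounded_open
begin

lemma gradsq_diff_le:
  assumes "H10 \<Omega> a" "H10 \<Omega> b" shows "gradsq \<Omega> (\<lambda>x. a x - b x) \<le> 2 * gradsq \<Omega> a + 2 * gradsq \<Omega> b"
proof -
  have "gradsq \<Omega> (\<lambda>x. a x - b x) = gradsq \<Omega> a - 2 * gip a b + gradsq \<Omega> b" using gradsq_expand[OF assms, of "-1"] by simp
  moreover have "gradsq \<Omega> (\<lambda>x. a x + b x) = gradsq \<Omega> a + 2 * gip a b + gradsq \<Omega> b" using gradsq_expand[OF assms, of 1] by simp
  ultimately show ?thesis using gradsq_nonneg[of "\<lambda>x. a x + b x"] by linarith
qed

text \<open>The Hilbert space counterpart of Brezis--Lieb: in the expansion of \<open>v n\<close> as
  \<open>u\<close> plus remainder the mixed term vanishes by \<open>gip_tendsto_0\<close>.\<close>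

lemma gradsq_defect_tendsto:
  assumes u: "H10 \<Omega> u" and v: "\<And>n. H10 \<Omega> (v n)" and l: "(\<lambda>n. nsq LO (\<lambda>x. v n x - u x)) \<longlonglongrightarrow> 0"
    and g: "(\<lambda>n. gradsq \<Omega> (v n)) \<longlonglongrightarrow> g"
  shows "(\<lambda>n. gradsq \<Omega> (\<lambda>x. v n x - u x)) \<longlonglongrightarrow> g - gradsq \<Omega> u"
proof -
  define z where "z n x = v n x - u x" for n x
  have z: "H10 \<Omega> (z n)" for n unfolding z_def by (intro H10_diff u v)
  have "Bseq (\<lambda>n. gradsq \<Omega> (v n))" using g by (intro convergent_imp_Bseq convergentI)
  then obtain K where K: "\<And>n. norm (gradsq \<Omega> (v n)) \<le> K" unfolding Bseq_def by blast
  have Z: "gradsq \<Omega> (z n) \<le> 2 * K + 2 * gradsq \<Omega> u" for n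
    using gradsq_diff_le[OF v u, of n] K[of n] by (simp add: z_def[abs_def])
  have c: "(\<lambda>n. gip u (z n)) \<longlonglongrightarrow> 0" by (rule gip_tendsto_0[OF u z _ Z]) (use l in \<open>simp add: z_def[abs_def]\<close>)
  have "gradsq \<Omega> (z n) = gradsq \<Omega> (v n) - gradsq \<Omega> u - 2 * gip u (z n)" for n
  proof -
    have "v n = (\<lambda>x. u x + complex_of_real 1 * z n x)" by (auto simp: z_def)
    then show ?thesis using gradsq_expand[OF u z, of 1 n] by simp
  qed
  moreover have "(\<lambda>n. gradsq \<Omega> (v n) - gradsq \<Omega> u - 2 * gip u (z n)) \<longlonglongrightarrow> g - gradsq \<Omega> u - 2 * 0"
    by (intro tendsto_intros g c)
  ultimately show ?thesis by (simp add: z_def[abs_def])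
qed

lemma mass_zero_tendsto:
  assumes u: "sqi LO u" and v: "\<And>n. sqi LO (v n)" and l: "(\<lambda>n. nsq LO (\<lambda>x. v n x - u x)) \<longlonglongrightarrow> 0"
    and m: "(\<lambda>n. nsq LO (v n)) \<longlonglongrightarrow> \<rho>"
  shows "nsq LO u = \<rho>"
  using LIMSEQ_unique[OF nsq_tendsto_diff[OF v u l] m] .

end

context nls
begin

text \<open>Collects all convergence that bounded gradients provide, through repeated extraction:
  Rellich for each component, limits of the gradient norms, and pointwise convergence for
  Brezis--Lieb. Strong convergence in the gradient norm is missing, and its defect is
  \<open>g - GG u\<close>.\<close>

lemma extract_subsequence:
  assumes v: "\<And>n. H10pair \<Omega> (v n)" and K: "\<And>n. GG (v n) \<le> K"
  obtains s u g where "strict_mono (s :: nat \<Rightarrow> nat)" "H10pair \<Omega> u" "GG u \<le> g" "(\<lambda>n. GG (v (s n))) \<longlonglongrightarrow> g"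
    "(\<lambda>n. mass \<Omega> (fst (pdiff (v (s n)) u))) \<longlonglongrightarrow> 0" "(\<lambda>n. mass \<Omega> (snd (pdiff (v (s n)) u))) \<longlonglongrightarrow> 0"
    "(\<lambda>n. GG (pdiff (v (s n)) u)) \<longlonglongrightarrow> g - GG u" "AE x in LO. (\<lambda>n. prp (pdiff (v (s n)) u) x) \<longlonglongrightarrow> 0"
proof -
  have H: "H10 \<Omega> (fst (v n))" "H10 \<Omega> (snd (v n))" for n using v by (auto simp: H10pair_def)
  have K': "gradsq \<Omega> (fst (v n)) \<le> K" "gradsq \<Omega> (snd (v n)) \<le> K" for n
    using K[of n] gradsq_nonneg[of "fst (v n)"] gradsq_nonneg[of "snd (v n)"] unfolding GG_def by linarith+
  obtain s1 u1 where s1: "strict_mono (s1 :: nat \<Rightarrow> nat)" "sqi LO u1" "(\<lambda>n. nsq LO (\<lambda>x. fst (v (s1 n)) x - u1 x)) \<longlonglongrightarrow> 0"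
    by (rule rellich_H10[OF H(1) K'(1)])
  obtain s2 u2 where s2: "strict_mono (s2 :: nat \<Rightarrow> nat)" "sqi LO u2" "(\<lambda>n. nsq LO (\<lambda>x. snd (v (s1 (s2 n))) x - u2 x)) \<longlonglongrightarrow> 0"
    by (rule rellich_H10[of "\<lambda>n. snd (v (s1 n))", OF H(2) K'(2)])
  define t where "t n = s1 (s2 n)" for n
  have tm: "strict_mono t" unfolding t_def using strict_mono_o[OF s1(1) s2(1)] by (simp add: o_def)
  have lt: "(\<lambda>n. nsq LO (\<lambda>x. fst (v (t n)) x - u1 x)) \<longlonglongrightarrow> 0" "(\<lambda>n. nsq LO (\<lambda>x. snd (v (t n)) x - u2 x)) \<longlonglongrightarrow> 0"
    using LIMSEQ_subseq_LIMSEQ[OF s1(3) s2(1)] s2(3) by (simp_all add: t_def o_def)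
  \<comment> \<open>The two gradient norms must converge separately, since the defect formula is
    applied to each component.\<close>
  have "bounded (range (\<lambda>n. (gradsq \<Omega> (fst (v (t n))), gradsq \<Omega> (snd (v (t n))))))"
  proof (rule boundedI[of _ "K + K"])
    fix y assume "y \<in> range (\<lambda>n. (gradsq \<Omega> (fst (v (t n))), gradsq \<Omega> (snd (v (t n)))))"
    then obtain n where y: "y = (gradsq \<Omega> (fst (v (t n))), gradsq \<Omega> (snd (v (t n))))" by blast
    have "norm y \<le> norm (gradsq \<Omega> (fst (v (t n)))) + norm (gradsq \<Omega> (snd (v (t n))))" unfolding y by (rule norm_Pair_le)
    then show "norm y \<le> K + K" using K'[of "t n"] by simp
  qed
  from bounded_imp_convergent_subsequence[OF this]
  obtain l s3 where s3: "strict_mono (s3 :: nat \<Rightarrow> nat)" and l: "(\<lambda>n. (gradsq \<Omega> (fst (v (t (s3 n)))), gradsq \<Omega> (snd (v (t (s3 n)))))) \<longlonglongrightarrow> l"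
    by (auto simp: o_def)
  define r where "r n = t (s3 n)" for n
  have rm: "strict_mono r" unfolding r_def using strict_mono_o[OF tm s3] by (simp add: o_def)
  have lr: "(\<lambda>n. nsq LO (\<lambda>x. fst (v (r n)) x - u1 x)) \<longlonglongrightarrow> 0" "(\<lambda>n. nsq LO (\<lambda>x. snd (v (r n)) x - u2 x)) \<longlonglongrightarrow> 0"
    using LIMSEQ_subseq_LIMSEQ[OF lt(1) s3] LIMSEQ_subseq_LIMSEQ[OF lt(2) s3] by (simp_all add: r_def o_def)
  have g: "(\<lambda>n. gradsq \<Omega> (fst (v (r n)))) \<longlonglongrightarrow> fst l" "(\<lambda>n. gradsq \<Omega> (snd (v (r n)))) \<longlonglongrightarrow> snd l"
    using tendsto_fst[OF l] tendsto_snd[OF l] by (simp_all add: r_def)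
  define u where "u = (u1, u2)"
  have u1: "H10 \<Omega> u1" "gradsq \<Omega> u1 \<le> fst l" using H10_closed[OF s1(2) H(1) lr(1) order_refl g(1)] by blast+
  have u2: "H10 \<Omega> u2" "gradsq \<Omega> u2 \<le> snd l" using H10_closed[OF s2(2) H(2) lr(2) order_refl g(2)] by blast+
  have u: "H10pair \<Omega> u" using u1 u2 by (simp add: H10pair_def u_def)
  have zn: "H10pair \<Omega> (pdiff (v (r n)) u)" for n by (intro H10pair_diff v u)
  have m: "(\<lambda>n. mass \<Omega> (fst (pdiff (v (r n)) u))) \<longlonglongrightarrow> 0" "(\<lambda>n. mass \<Omega> (snd (pdiff (v (r n)) u))) \<longlonglongrightarrow> 0"
    using lr by (simp_all add: mass_eq pdiff_def u_def)
  have "(\<lambda>n. nsq LO (\<lambda>x. norm (prp (pdiff (v (r n)) u) x))) \<longlonglongrightarrow> 0"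
    unfolding nsq_prp(2)[OF zn] using tendsto_add[OF m] by simp
  from AE_subseq_of_nsq[OF nsq_prp(1)[OF zn] this] obtain s4 :: "nat \<Rightarrow> nat" where s4: "strict_mono s4"
    and ae: "AE x in LO. (\<lambda>n. norm (prp (pdiff (v (r (s4 n))) u) x)) \<longlonglongrightarrow> 0" by blast
  show thesis
  proof (rule that[of "\<lambda>n. r (s4 n)" u "fst l + snd l"])
    show "strict_mono (\<lambda>n. r (s4 n))" using strict_mono_o[OF rm s4] by (simp add: o_def)
    show "H10pair \<Omega> u" by (rule u)
    show "GG u \<le> fst l + snd l" using u1 u2 by (simp add: GG_def u_def)
    show "(\<lambda>n. GG (v (r (s4 n)))) \<longlonglongrightarrow> fst l + snd l"
      using LIMSEQ_subseq_LIMSEQ[OF tendsto_add[OF g] s4] by (simp add: o_def GG_def)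
    show "(\<lambda>n. mass \<Omega> (fst (pdiff (v (r (s4 n))) u))) \<longlonglongrightarrow> 0" "(\<lambda>n. mass \<Omega> (snd (pdiff (v (r (s4 n))) u))) \<longlonglongrightarrow> 0"
      using LIMSEQ_subseq_LIMSEQ[OF m(1) s4] LIMSEQ_subseq_LIMSEQ[OF m(2) s4] by (simp_all add: o_def)
    have "(\<lambda>n. GG (pdiff (v (r n)) u)) \<longlonglongrightarrow> (fst l - gradsq \<Omega> u1) + (snd l - gradsq \<Omega> u2)"
      using tendsto_add[OF gradsq_defect_tendsto[OF u1(1) H(1) lr(1) g(1)] gradsq_defect_tendsto[OF u2(1) H(2) lr(2) g(2)]]
      by (simp add: GG_def pdiff_def u_def)
    then have "(\<lambda>n. GG (pdiff (v (r n)) u)) \<longlonglongrightarrow> fst l + snd l - GG u" by (simp add: GG_def u_def algebra_simps)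
    from LIMSEQ_subseq_LIMSEQ[OF this s4] show "(\<lambda>n. GG (pdiff (v (r (s4 n))) u)) \<longlonglongrightarrow> fst l + snd l - GG u" by (simp add: o_def)
    show "AE x in LO. (\<lambda>n. prp (pdiff (v (r (s4 n))) u) x) \<longlonglongrightarrow> 0"
      using ae by eventually_elim (simp add: tendsto_norm_zero_iff)
  qed
qed

text \<open>The energy splits along a minimising sequence into the energy of the limit and that of the
  vanishing part, which is coercive; since the limit is admissible the latter must disappear.\<close>
lemma minimising_compact:
  assumes v: "\<And>n. H10pair \<Omega> (v n)" and \<tau>: "\<And>n. GG (v n) \<le> \<tau>" "\<tau> < (\<rho>1 + \<rho>2) * \<alpha>"
    and m1: "(\<lambda>n. mass \<Omega> (fst (v n))) \<longlonglongrightarrow> \<rho>1" and m2: "(\<lambda>n. mass \<Omega> (snd (v n))) \<longlonglongrightarrow> \<rho>2"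
    and E: "\<And>n. En (v n) \<le> c + e n" "e \<longlonglongrightarrow> 0"
    and c: "\<And>w. w \<in> Bset \<Omega> \<rho>1 \<rho>2 \<alpha> \<Longrightarrow> c \<le> En w"
    and cr: "DIM('a) \<ge> 3 \<and> p = twostar DIM('a) - 1 \<longrightarrow>
           (\<rho>1 + \<rho>2) * (\<alpha> - lambda1 \<Omega>) \<le> Lambda TYPE('a) \<mu>1 \<mu>2 \<beta> powr (- (real DIM('a) - 2) / 2)"
  obtains s u where "strict_mono (s :: nat \<Rightarrow> nat)" "H10pair \<Omega> u" "absp u \<in> Bset \<Omega> \<rho>1 \<rho>2 \<alpha>" "En u = c"
    "(\<lambda>n. GG (pdiff (v (s n)) u)) \<longlonglongrightarrow> 0" "GG u \<le> \<tau>"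
proof -
  obtain s u g where s: "strict_mono (s :: nat \<Rightarrow> nat)" and u: "H10pair \<Omega> u" and g: "GG u \<le> g" "(\<lambda>n. GG (v (s n))) \<longlonglongrightarrow> g"
    and z1: "(\<lambda>n. mass \<Omega> (fst (pdiff (v (s n)) u))) \<longlonglongrightarrow> 0" and z2: "(\<lambda>n. mass \<Omega> (snd (pdiff (v (s n)) u))) \<longlonglongrightarrow> 0"
    and G: "(\<lambda>n. GG (pdiff (v (s n)) u)) \<longlonglongrightarrow> g - GG u" and ae: "AE x in LO. (\<lambda>n. prp (pdiff (v (s n)) u) x) \<longlonglongrightarrow> 0"
    by (rule extract_subsequence[OF v \<tau>(1)])
  define z where "z n = pdiff (v (s n)) u" for n
  have z: "H10pair \<Omega> (z n)" for n unfolding z_def by (intro H10pair_diff v u)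
  have H: "sqi LO (fst (v n))" "sqi LO (snd (v n))" "sqi LO (fst u)" "sqi LO (snd u)" for n
    using v[of n] u by (auto simp: H10pair_def intro: H10_sqi)
  have "nsq LO (fst u) = \<rho>1"
    by (rule mass_zero_tendsto[OF H(3) H(1)])
      (use z1 LIMSEQ_subseq_LIMSEQ[OF m1 s] in \<open>auto simp: mass_eq pdiff_def o_def\<close>)
  moreover have "nsq LO (snd u) = \<rho>2"
    by (rule mass_zero_tendsto[OF H(4) H(2)])
      (use z2 LIMSEQ_subseq_LIMSEQ[OF m2 s] in \<open>auto simp: mass_eq pdiff_def o_def\<close>)
  ultimately have mu: "mass \<Omega> (fst u) = \<rho>1" "mass \<Omega> (snd u) = \<rho>2" by (simp_all add: mass_eq)
  have g\<tau>: "g \<le> \<tau>" using g(2) by (rule LIMSEQ_le_const2) (use \<tau>(1) in auto)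
  have uB: "absp u \<in> Bset \<Omega> \<rho>1 \<rho>2 \<alpha>"
    using absp_Mset[OF u mu] energy_abs(2)[OF u] g(1) g\<tau> \<tau>(2) unfolding Bset_eq by linarith
  have Eu: "c \<le> En u" using c[OF uB] energy_abs(4)[OF u] by linarith
  have "Bseq (\<lambda>n. GG (z n))" using G unfolding z_def by (intro convergent_imp_Bseq convergentI)
  then obtain K where "\<And>n. norm (GG (z n)) \<le> K" unfolding Bseq_def by blast
  then have K: "GG (z n) \<le> K" for n by (simp add: abs_le_iff)
  obtain B where B: "\<And>u. H10pair \<Omega> u \<Longrightarrow> GG u \<le> K \<Longrightarrow> integral\<^sup>L LO (\<lambda>x. norm (prp u x) powr q) \<le> B" using Lq_bounded[of K] by blast
  have aez: "AE x in LO. (\<lambda>n. prp (z n) x) \<longlonglongrightarrow> 0" using ae by (simp add: z_def)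
  have bl: "(\<lambda>n. integral\<^sup>L LO (\<lambda>x. \<bar>nl (prp (z n) x + prp u x) - nl (prp (z n) x) - nl (prp u x)\<bar>)) \<longlonglongrightarrow> 0"
    by (rule brezis_lieb(1)[OF nl_cont nl_hom q2(2) prp_measurable[OF u] prp_measurable[OF z] Lq_integrable[OF u] Lq_integrable[OF z] B[OF z K] aez])
  have "(\<lambda>n. FF (v (s n)) - FF (z n) - FF u) \<longlonglongrightarrow> 0"
  proof (rule tendsto_0_bound[OF _ bl])
    fix n
    have eq: "FF (v (s n)) - FF (z n) - FF u = integral\<^sup>L LO (\<lambda>x. nl (prp (z n) x + prp u x) - nl (prp (z n) x) - nl (prp u x))"
      unfolding FF_def using FF_integrable[OF v] FF_integrable[OF z] FF_integrable[OF u] by (simp add: z_def prp_diff)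
    show "norm (FF (v (s n)) - FF (z n) - FF u) \<le> integral\<^sup>L LO (\<lambda>x. \<bar>nl (prp (z n) x + prp u x) - nl (prp (z n) x) - nl (prp u x)\<bar>)"
      unfolding eq using integral_norm_bound[of LO "\<lambda>x. nl (prp (z n) x + prp u x) - nl (prp (z n) x) - nl (prp u x)"] by simp
  qed
  then have split: "(\<lambda>n. (GG (z n) + GG u - GG (v (s n))) / 2 + (FF (v (s n)) - FF (z n) - FF u) / q) \<longlonglongrightarrow> ((g - GG u) + GG u - g) / 2 + 0 / q"
    using q2 G unfolding z_def[symmetric] by (intro tendsto_intros g(2)) auto
  define d where "d n = (GG (z n) + GG u - GG (v (s n))) / 2 + (FF (v (s n)) - FF (z n) - FF u) / q" for n
  have d: "d \<longlonglongrightarrow> 0" using split by (simp add: d_def[abs_def])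
  have Ed: "En (z n) = En (v (s n)) - En u + d n" for n
    unfolding energy_eq d_def by (simp add: add_divide_distrib diff_divide_distrib)
  have es: "(\<lambda>n. e (s n) + d n) \<longlonglongrightarrow> 0" using tendsto_add[OF LIMSEQ_subseq_LIMSEQ[OF E(2) s] d] by (simp add: o_def)
  have "g - GG u = 0"
  proof (rule coercive[OF z K])
    show "(\<lambda>n. mass \<Omega> (fst (z n))) \<longlonglongrightarrow> 0" "(\<lambda>n. mass \<Omega> (snd (z n))) \<longlonglongrightarrow> 0" "(\<lambda>n. GG (z n)) \<longlonglongrightarrow> g - GG u"
      using z1 z2 G by (simp_all add: z_def)
    show "(\<lambda>n. e (s n) + d n) \<longlonglongrightarrow> 0" by (rule es)
    show "En (z n) \<le> e (s n) + d n" for n using Ed[of n] E(1)[of "s n"] Eu by linarith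
    assume crit: "DIM('a) \<ge> 3 \<and> p = twostar DIM('a) - 1"
    \<comment> \<open>The Rayleigh quotient reserves this part of the gradient for the limit
      \<open>u\<close>; the remainder gets less than
      \<open>(\<rho>1 + \<rho>2) * (\<alpha> - lambda1 \<Omega>)\<close>, strictly because of
      \<open>\<tau> < (\<rho>1 + \<rho>2) * \<alpha>\<close>.\<close>
    have "lambda1 \<Omega> * \<rho>1 + lambda1 \<Omega> * \<rho>2 \<le> GG u"
      using lambda1_le[of "fst u"] lambda1_le[of "snd u"] u mu by (simp add: GG_def H10pair_def)
    moreover have "(\<rho>1 + \<rho>2) * (\<alpha> - lambda1 \<Omega>) = (\<rho>1 + \<rho>2) * \<alpha> - (lambda1 \<Omega> * \<rho>1 + lambda1 \<Omega> * \<rho>2)" by (simp add: algebra_simps)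
    moreover note mp[OF cr crit] g\<tau> \<tau>(2)
    ultimately show "g - GG u < Lambda TYPE('a) \<mu>1 \<mu>2 \<beta> powr (- (real DIM('a) - 2) / 2)" by linarith
  qed
  then have G0: "(\<lambda>n. GG (pdiff (v (s n)) u)) \<longlonglongrightarrow> 0" using G by simp
  have "(\<lambda>n. En (v (s n)) - En u) \<longlonglongrightarrow> 0"
    by (rule energy_diff_tendsto_0(2)[of "\<lambda>_. u" "\<lambda>n. v (s n)", OF u v order_refl G0])
  moreover have "(\<lambda>n. c + e (s n) - En u) \<longlonglongrightarrow> c + 0 - En u"
    using LIMSEQ_subseq_LIMSEQ[OF E(2) s] by (intro tendsto_intros) (simp add: o_def)
  ultimately have "0 \<le> c + 0 - En u" by (rule LIMSEQ_le) (use E(1) in auto)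
  then have "En u = c" using Eu by simp
  then show thesis using that[OF s u uB _ G0] g(1) g\<tau> by simp
qed

subsection \<open>Ground states stay away from the boundary of the gradient ball\<close>

text \<open>A bump in a cube of side \<open>\<eta>\<close> has no overlap with its shift by
  \<open>2 * \<eta>\<close>, so \<open>poincare_test\<close> bounds its Rayleigh quotient from below
  by \<open>1 / (2 * \<eta>\<^sup>2)\<close>.\<close>

lemma concentrated_bump:
  assumes ne: "\<Omega> \<noteq> {}"
  obtains \<kappa> where "H10 \<Omega> \<kappa>" "\<And>x. Im (\<kappa> x) = 0" "nsq LO \<kappa> = 1" "gradsq \<Omega> \<kappa> \<ge> K"
proof -
  obtain x0 where "x0 \<in> \<Omega>" using ne by blast
  then obtain e where e: "e > 0" "cball x0 e \<subseteq> \<Omega>" using open\<Omega> open_contains_cball by blast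
  \<comment> \<open>The first bound keeps the cube inside the ball of radius \<open>e\<close>, its
    points having coordinate offsets of sum at most \<open>DIM('a) * \<eta>\<close>; the second
    makes the Rayleigh quotient at least \<open>\<bar>K\<bar> + 1\<close>.\<close>
  define \<eta> where "\<eta> = min (e / real DIM('a)) (1 / sqrt (2 * (\<bar>K\<bar> + 1)))"
  have \<eta>: "\<eta> > 0" using e by (simp add: \<eta>_def)
  define c where "c = x0 + \<eta> *\<^sub>R One"
  have bx: "y \<bullet> b - x0 \<bullet> b \<in> {0..\<eta>}" if "y \<in> cbox x0 c" "b \<in> Basis" for y b
    using that by (auto simp: mem_box c_def inner_add_left)
  have sub: "cbox x0 c \<subseteq> \<Omega>"
  proof
    fix y assume y: "y \<in> cbox x0 c"
    have "norm (y - x0) \<le> (\<Sum>b\<in>Basis. \<bar>(y - x0) \<bullet> b\<bar>)" by (rule norm_le_l1)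
    also have "\<dots> \<le> (\<Sum>b\<in>(Basis::'a set). \<eta>)" using bx[OF y] by (intro sum_mono) (auto simp: inner_diff_left)
    also have "\<dots> \<le> e" using \<eta> by (simp add: \<eta>_def min_def field_simps)
    finally have "y \<in> cball x0 e" by (simp add: dist_norm norm_minus_commute)
    then show "y \<in> \<Omega>" using e by blast
  qed
  define \<phi> where "\<phi> x = complex_of_real (box_bump x0 c 1 x)" for x
  have t: "testfun (cbox x0 c) \<phi>"
    unfolding \<phi>_def by (rule testfun_bounded_linear[OF bounded_linear_of_real testfun_box_bump]) auto
  have t\<Omega>: "testfun \<Omega> \<phi>" by (rule testfun_mono[OF t sub])
  obtain b :: 'a where b: "b \<in> Basis" using nonempty_Basis by blast
  have "2 * nsq lborel \<phi> \<le> (norm ((2 * \<eta>) *\<^sub>R b))\<^sup>2 * tgr \<phi>"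
  proof (rule poincare_test[OF t])
    fix x assume x: "x \<in> cbox x0 c"
    show "x + (2 * \<eta>) *\<^sub>R b \<notin> cbox x0 c"
    proof
      assume "x + (2 * \<eta>) *\<^sub>R b \<in> cbox x0 c"
      from bx[OF this b] bx[OF x b] \<eta> b show False by (simp add: inner_add_left)
    qed
  qed
  then have pn: "2 * nsq lborel \<phi> \<le> (2 * \<eta>)\<^sup>2 * tgr \<phi>" using b by simp
  have "nsq lborel \<phi> \<noteq> 0"
  proof
    assume "nsq lborel \<phi> = 0"
    then have "AE x in lborel. (norm (\<phi> x))\<^sup>2 = 0"
      unfolding nsq_def using testfun_sqi(1)[OF t] by (subst (asm) integral_nonneg_eq_0_iff_AE) (auto simp: sqi_def)
    moreover have "box x0 c \<subseteq> {x. (norm (\<phi> x))\<^sup>2 \<noteq> 0}" using box_bump_pos[of 1 x0 c] by (force simp: \<phi>_def)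
    ultimately have "AE x in lborel. x \<notin> box x0 c" by (auto elim!: eventually_mono)
    then have "emeasure lborel (box x0 c) = 0" by (subst (asm) AE_iff_measurable[OF _ refl]) auto
    moreover have "emeasure lborel (box x0 c) = ennreal (\<Prod>b\<in>(Basis::'a set). \<eta>)"
      using \<eta> by (subst emeasure_lborel_box) (auto simp: c_def inner_add_left inner_diff_left)
    ultimately show False using \<eta> by simp
  qed
  then have n: "nsq lborel \<phi> > 0" by (simp add: less_le)
  define a where "a = 1 / sqrt (nsq lborel \<phi>)"
  define \<kappa> where "\<kappa> x = complex_of_real a * \<phi> x" for x
  have a2: "a\<^sup>2 = 1 / nsq lborel \<phi>" using n by (simp add: a_def power_divide)
  show thesis
  proof (rule that[of \<kappa>])
    show "H10 \<Omega> \<kappa>" unfolding \<kappa>_def by (intro H10_cmult H10_test t\<Omega>)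
    show "Im (\<kappa> x) = 0" for x by (simp add: \<kappa>_def \<phi>_def)
    show "nsq LO \<kappa> = 1" unfolding \<kappa>_def nsq_cmult a2 testfun_LO(2)[OF t\<Omega>] using n by simp
    have g: "gradsq \<Omega> \<kappa> = tgr \<phi> / nsq lborel \<phi>"
      unfolding \<kappa>_def gradsq_cmult[OF H10_test(1)[OF t\<Omega>]] a2 H10_test(2)[OF t\<Omega>] by simp
    have "\<eta>\<^sup>2 \<le> (1 / sqrt (2 * (\<bar>K\<bar> + 1)))\<^sup>2" using \<eta> by (intro power_mono) (auto simp: \<eta>_def)
    also have "\<dots> = 1 / (2 * (\<bar>K\<bar> + 1))" by (simp add: power_divide)
    finally have h: "2 * \<eta>\<^sup>2 * (\<bar>K\<bar> + 1) \<le> 1" by (simp add: field_simps)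
    have "nsq lborel \<phi> \<le> 2 * \<eta>\<^sup>2 * tgr \<phi>" using pn by (simp add: power_mult_distrib mult_ac)
    then have "(\<bar>K\<bar> + 1) * nsq lborel \<phi> \<le> (\<bar>K\<bar> + 1) * (2 * \<eta>\<^sup>2 * tgr \<phi>)" by (intro mult_left_mono) auto
    also have "\<dots> = (2 * \<eta>\<^sup>2 * (\<bar>K\<bar> + 1)) * tgr \<phi>" by simp
    also have "\<dots> \<le> 1 * tgr \<phi>" using h by (intro mult_right_mono) auto
    finally have "\<bar>K\<bar> + 1 \<le> tgr \<phi> / nsq lborel \<phi>" using n by (simp add: pos_le_divide_eq)
    then show "gradsq \<Omega> \<kappa> \<ge> K" unfolding g by linarith
  qed
qed

text \<open>The competitor is \<open>u\<close> plus a small multiple of a concentrated bump, renormalised.\<close>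
lemma raise_gradient:
  assumes ne: "\<Omega> \<noteq> {}" and \<rho>: "\<rho> > 0"
  shows "\<exists>C. \<forall>u D. H10 \<Omega> u \<and> (\<forall>x\<in>\<Omega>. Im (u x) = 0) \<and> mass \<Omega> u = \<rho> \<and> gradsq \<Omega> u \<le> K \<and> 0 \<le> D \<and> D \<le> \<rho> / 16 \<longrightarrow>
    (\<exists>y. H10 \<Omega> y \<and> (\<forall>x\<in>\<Omega>. Im (y x) = 0) \<and> mass \<Omega> y = \<rho> \<and> gradsq \<Omega> y = gradsq \<Omega> u + D \<and> gradsq \<Omega> (\<lambda>x. y x - u x) \<le> C * D)"
proof -
  \<comment> \<open>The gradient of the bump exceeds \<open>K / \<rho>\<close> by 1, so that
    \<open>\<rho> * Cc - A \<ge> \<rho>\<close> for every admissible \<open>u\<close>. The bump, and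
    with it the final constant, depends only on \<open>K\<close> and \<open>\<rho>\<close>; this
    uniformity is needed for sequences of \<open>u\<close>.\<close>
  obtain \<kappa> where \<kappa>: "H10 \<Omega> \<kappa>" "\<And>x. Im (\<kappa> x) = 0" "nsq LO \<kappa> = 1" "gradsq \<Omega> \<kappa> \<ge> K / \<rho> + 1"
    by (rule concentrated_bump[OF ne, of "K / \<rho> + 1"]) blast
  define Cc where "Cc = gradsq \<Omega> \<kappa>"
  define r where "r = sqrt \<rho>"
  have r: "r > 0" "r\<^sup>2 = \<rho>" using \<rho> by (auto simp: r_def)
  have "\<exists>y. H10 \<Omega> y \<and> (\<forall>x\<in>\<Omega>. Im (y x) = 0) \<and> mass \<Omega> y = \<rho> \<and> gradsq \<Omega> y = gradsq \<Omega> u + D \<and> gradsq \<Omega> (\<lambda>x. y x - u x) \<le> (32 * K / \<rho> + 32 * Cc) * D"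
    if u: "H10 \<Omega> u" "\<forall>x\<in>\<Omega>. Im (u x) = 0" "mass \<Omega> u = \<rho>" "gradsq \<Omega> u \<le> K" and D: "0 \<le> D" "D \<le> \<rho> / 16" for u D
  proof -
    define A where "A = gradsq \<Omega> u"
    \<comment> \<open>The sign for which adding the bump does not lower the Rayleigh quotient to
      first order: \<open>\<rho> * B - A * b \<ge> 0\<close>.\<close>
    define \<sigma> :: real where "\<sigma> = (if \<rho> * gip u \<kappa> - A * ips LO u \<kappa> \<ge> 0 then 1 else -1)"
    have \<sigma>2: "\<sigma>\<^sup>2 = 1" "\<sigma> * (\<rho> * gip u \<kappa> - A * ips LO u \<kappa>) \<ge> 0" by (auto simp: \<sigma>_def)
    define b where "b = \<sigma> * ips LO u \<kappa>"
    define B where "B = \<sigma> * gip u \<kappa>"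
    have Bb: "\<rho> * B - A * b \<ge> 0" using \<sigma>2(2) by (simp add: B_def b_def algebra_simps)
    define w where "w s x = u x + complex_of_real (s * \<sigma>) * \<kappa> x" for s x
    define m where "m s = \<rho> + 2 * s * b + s\<^sup>2" for s
    have mw: "nsq LO (w s) = m s" for s
      using nsq_expand[OF H10_sqi[OF u(1)] H10_sqi[OF \<kappa>(1)], of "s * \<sigma>"] u(3) \<kappa>(3) \<sigma>2(1)
      by (simp add: w_def[abs_def] m_def b_def mass_eq scaleR_conv_of_real power_mult_distrib)
    have gw: "gradsq \<Omega> (w s) = A + 2 * s * B + s\<^sup>2 * Cc" for s
      using gradsq_expand[OF u(1) \<kappa>(1), of "s * \<sigma>"] \<sigma>2(1)
      by (simp add: w_def[abs_def] B_def A_def Cc_def power_mult_distrib)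
    have wH: "H10 \<Omega> (w s)" for s unfolding w_def by (intro H10_lin u \<kappa>)
    have bb: "\<bar>b\<bar> \<le> r"
      using ips_bound[OF H10_sqi[OF u(1)] H10_sqi[OF \<kappa>(1)]] u(3) \<kappa>(3) by (auto simp: b_def \<sigma>_def mass_eq r_def abs_mult)
    have mlo: "(r - s)\<^sup>2 \<le> m s" and mhi: "m s \<le> (r + s)\<^sup>2" if "s \<ge> 0" for s
    proof -
      have "\<bar>s * b\<bar> \<le> s * r" using bb that by (simp add: abs_mult mult_left_mono)
      then show "(r - s)\<^sup>2 \<le> m s" "m s \<le> (r + s)\<^sup>2"
        unfolding m_def power2_sum power2_diff r(2) by (auto simp: abs_le_iff algebra_simps)
    qed
    \<comment> \<open>From \<open>D \<le> \<rho> / 16\<close> follows \<open>S \<le> r / 2\<close>,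
      which keeps the mass \<open>m s\<close> between \<open>(r / 2)\<^sup>2\<close> and
      \<open>(2 * r)\<^sup>2\<close>. The factor 2 gives
      \<open>S\<^sup>2 * \<rho> = 4 * D * \<rho>\<close>, which is at least \<open>D * m S\<close>,
      so a step of size \<open>S\<close> raises the gradient by at least \<open>D\<close>.\<close>
    define S where "S = 2 * sqrt D"
    have S: "S \<ge> 0" "S\<^sup>2 = 4 * D" "S \<le> r / 2"
    proof -
      show "S \<ge> 0" "S\<^sup>2 = 4 * D" using D by (auto simp: S_def power_mult_distrib)
      have "sqrt D \<le> sqrt (\<rho> / 16)" using D by simp
      also have "\<dots> = r / 4" by (simp add: real_sqrt_divide r_def)
      finally show "S \<le> r / 2" by (simp add: S_def)
    qed
    have mpos: "m s \<ge> (r / 2)\<^sup>2" "m s \<le> (2 * r)\<^sup>2" if "0 \<le> s" "s \<le> S" for s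
    proof -
      have "(r / 2)\<^sup>2 \<le> (r - s)\<^sup>2" using that S r by (intro power_mono) auto
      then show "m s \<ge> (r / 2)\<^sup>2" using mlo[OF that(1)] by linarith
      have "(r + s)\<^sup>2 \<le> (2 * r)\<^sup>2" using that S r by (intro power_mono) auto
      then show "m s \<le> (2 * r)\<^sup>2" using mhi[OF that(1)] by linarith
    qed
    have mp: "m s > 0" if "0 \<le> s" "s \<le> S" for s
    proof -
      have "(r / 2)\<^sup>2 > 0" using r by simp
      then show ?thesis using mpos(1)[OF that] by linarith
    qed
    define g where "g s = \<rho> / m s * (A + 2 * s * B + s\<^sup>2 * Cc)" for s
    have cont: "continuous_on {0..S} g"
      unfolding g_def m_def by (intro continuous_intros) (use mp in \<open>force simp: m_def\<close>)
    have g0: "g 0 = A" using \<rho> by (simp add: g_def m_def)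
    have gS: "A + D \<le> g S"
    proof -
      have mS: "m S > 0" using mp S by simp
      have "\<rho> * Cc - A \<ge> \<rho>"
      proof -
        have "\<rho> * (K / \<rho> + 1) \<le> \<rho> * Cc" using \<kappa>(4) \<rho> by (intro mult_left_mono) (auto simp: Cc_def)
        then show ?thesis using u(4) \<rho> by (simp add: A_def distrib_left)
      qed
      then have "S\<^sup>2 * \<rho> \<le> S\<^sup>2 * (\<rho> * Cc - A)" by (intro mult_left_mono) auto
      moreover have "0 \<le> 2 * S * (\<rho> * B - A * b)" using S Bb by simp
      moreover have "\<rho> * (A + 2 * S * B + S\<^sup>2 * Cc) - A * m S = 2 * S * (\<rho> * B - A * b) + S\<^sup>2 * (\<rho> * Cc - A)"
        by (simp add: m_def algebra_simps)
      moreover have "D * m S \<le> S\<^sup>2 * \<rho>"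
      proof -
        have "m S \<le> 4 * \<rho>" using mpos(2)[of S] S r by (simp add: power_mult_distrib)
        then have "D * m S \<le> D * (4 * \<rho>)" using D by (intro mult_left_mono) auto
        then show ?thesis using S(2) by simp
      qed
      ultimately have "(A + D) * m S \<le> \<rho> * (A + 2 * S * B + S\<^sup>2 * Cc)" by (simp add: distrib_right)
      then show ?thesis using mS by (simp add: g_def pos_le_divide_eq)
    qed
    \<comment> \<open>\<open>g s\<close> is the gradient of \<open>w s\<close> after rescaling to
      mass \<open>\<rho>\<close>. The intermediate value theorem hits \<open>A + D\<close> exactly,
      and \<open>s\<^sup>2 \<le> 4 * D\<close> keeps the squared distance to \<open>u\<close> of
      order \<open>D\<close>.\<close>
    obtain s where s: "0 \<le> s" "s \<le> S" "g s = A + D"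
      using IVT'[of g 0 "A + D" S] g0 gS D S cont by auto
    have ms: "m s > 0" using mp s by simp
    define t where "t = r / sqrt (m s)"
    have t: "t > 0" "t\<^sup>2 = \<rho> / m s" using r ms by (auto simp: t_def power_divide)
    define y where "y x = complex_of_real t * w s x" for x
    have yH: "H10 \<Omega> y" unfolding y_def by (intro H10_cmult wH)
    have smr: "sqrt (m s) \<ge> r / 2" by (rule real_le_rsqrt[OF mpos(1)[OF s(1,2)]])
    have t2: "t \<le> 2" using smr r ms by (simp add: t_def pos_divide_le_eq)
    have t1: "\<bar>t - 1\<bar> \<le> 2 * s / r"
    proof -
      have "sqrt (m s) \<le> r + s" using mhi[OF s(1)] r s by (intro real_le_lsqrt) auto
      moreover have "r - s \<le> sqrt (m s)" using mlo[OF s(1)] by (rule real_le_rsqrt)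
      ultimately have "\<bar>r - sqrt (m s)\<bar> \<le> s" by (simp add: abs_le_iff)
      moreover have "t - 1 = (r - sqrt (m s)) / sqrt (m s)" using ms by (simp add: t_def diff_divide_distrib)
      ultimately have "\<bar>t - 1\<bar> \<le> s / sqrt (m s)" using ms by (simp add: abs_divide divide_right_mono)
      also have "\<dots> \<le> s / (r / 2)" using smr r s ms by (intro divide_left_mono) auto
      finally show ?thesis by (simp add: mult.commute)
    qed
    have "gradsq \<Omega> (\<lambda>x. y x - u x) \<le> (32 * K / \<rho> + 32 * Cc) * D"
    proof -
      have "(\<lambda>x. y x - u x) = (\<lambda>x. complex_of_real (t - 1) * u x - complex_of_real (- t * (s * \<sigma>)) * \<kappa> x)"
        by (auto simp: y_def w_def algebra_simps)
      then have "gradsq \<Omega> (\<lambda>x. y x - u x) \<le> 2 * ((t - 1)\<^sup>2 * A) + 2 * ((- t * (s * \<sigma>))\<^sup>2 * Cc)"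
        using gradsq_diff_le[OF H10_cmult[OF u(1)] H10_cmult[OF \<kappa>(1)], of "t - 1" "- t * (s * \<sigma>)"]
        by (simp only: gradsq_cmult[OF u(1)] gradsq_cmult[OF \<kappa>(1)] A_def Cc_def)
      also have "(- t * (s * \<sigma>))\<^sup>2 = t\<^sup>2 * s\<^sup>2" using \<sigma>2(1) by (simp add: power_mult_distrib)
      finally have 1: "gradsq \<Omega> (\<lambda>x. y x - u x) \<le> 2 * ((t - 1)\<^sup>2 * A) + 2 * (t\<^sup>2 * s\<^sup>2 * Cc)" .
      have s2: "s\<^sup>2 \<le> 4 * D" using s S(2) power_mono[of s S 2] by simp
      have "(t - 1)\<^sup>2 \<le> (2 * s / r)\<^sup>2" using t1 power_mono[of "\<bar>t - 1\<bar>" "2 * s / r" 2] by simp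
      also have "\<dots> = 4 * s\<^sup>2 / \<rho>" using r(2) by (simp add: power_divide power_mult_distrib)
      also have "\<dots> \<le> 4 * (4 * D) / \<rho>" using s2 \<rho> by (intro divide_right_mono) auto
      finally have 2: "(t - 1)\<^sup>2 * A \<le> 16 * D / \<rho> * K"
        using u(4) D \<rho> by (intro mult_mono) (auto simp: A_def)
      have "t\<^sup>2 \<le> 2\<^sup>2" using t2 t by (intro power_mono) auto
      then have "t\<^sup>2 * s\<^sup>2 \<le> 4 * (4 * D)" using s2 by (intro mult_mono) auto
      then have 3: "t\<^sup>2 * s\<^sup>2 * Cc \<le> 16 * D * Cc" by (intro mult_right_mono) (auto simp: Cc_def)
      have "(32 * K / \<rho> + 32 * Cc) * D = 2 * (16 * D / \<rho> * K) + 2 * (16 * D * Cc)" by (simp add: algebra_simps)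
      then show ?thesis using 1 2 3 by linarith
    qed
    moreover have "mass \<Omega> y = \<rho>" unfolding y_def mass_eq nsq_cmult mw t(2) using ms by simp
    moreover have "gradsq \<Omega> y = gradsq \<Omega> u + D"
      unfolding y_def gradsq_cmult[OF wH] gw t(2) using s(3) by (simp add: g_def A_def)
    moreover have "\<forall>x\<in>\<Omega>. Im (y x) = 0" using u(2) \<kappa>(2) by (simp add: y_def w_def)
    ultimately show ?thesis using yH by blast
  qed
  then show ?thesis by blast
qed

text \<open>The missing gradient \<open>D n\<close> is supplied to one component of positive mass by
  \<open>raise_gradient\<close>. The lifted pairs lie in \<open>Uset\<close> and approach the ground
  states, so their energies tend to \<open>c\<close>, although they are at least
  \<open>d > c\<close>.\<close>

lemma GG_ground_states:
  assumes ne: "\<Omega> \<noteq> {}" and c: "\<And>w. w \<in> Bset \<Omega> \<rho>1 \<rho>2 \<alpha> \<Longrightarrow> c \<le> En w"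
    and d: "\<And>w. w \<in> Uset \<Omega> \<rho>1 \<rho>2 \<alpha> \<Longrightarrow> d \<le> En w" "c < d"
    and G: "\<And>u. u \<in> G \<Longrightarrow> H10pair \<Omega> u \<and> absp u \<in> Bset \<Omega> \<rho>1 \<rho>2 \<alpha> \<and> En u = c"
  shows "\<exists>\<tau>. \<tau> < (\<rho>1 + \<rho>2) * \<alpha> \<and> (\<forall>u\<in>G. GG u \<le> \<tau>)"
proof (rule ccontr)
  define T where "T = (\<rho>1 + \<rho>2) * \<alpha>"
  assume "\<not> ?thesis"
  then have "\<exists>u\<in>G. GG u > T - 1 / real (Suc n)" for n
    unfolding T_def by (metis diff_less_eq less_add_same_cancel1 not_le of_nat_0_less_iff zero_less_Suc zero_less_divide_1_iff)
  then obtain u where uG: "\<And>n. u n \<in> G" and uT: "\<And>n. GG (u n) > T - 1 / real (Suc n)" by metis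
  \<comment> \<open>\<open>Bset\<close> and \<open>Uset\<close> consist of real pairs, so the
    competitors are built from moduli.\<close>
  define w where "w n = absp (u n)" for n
  have u: "H10pair \<Omega> (u n)" "w n \<in> Bset \<Omega> \<rho>1 \<rho>2 \<alpha>" "En (u n) = c" for n using G[OF uG[of n]] by (auto simp: w_def)
  have wM: "w n \<in> Mset \<Omega> \<rho>1 \<rho>2" "GG (w n) \<le> T" for n using u(2)[of n] unfolding Bset_eq T_def by auto
  have wH: "H10pair \<Omega> (w n)" for n using wM(1)[of n] by (simp add: Mset_def)
  \<comment> \<open>Minimality forces the modulus to have the same energy; as the nonlinear part is
    the same too, no gradient was lost, and the moduli also approach the sphere.\<close>
  have wE: "En (w n) = c" for n using c[OF u(2)[of n]] energy_abs(4)[OF u(1)[of n]] u(3)[of n] by (simp add: w_def)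
  have wG: "GG (w n) = GG (u n)" for n
    using wE[of n] u(3)[of n] energy_abs(3)[OF u(1)[of n]] by (simp add: energy_eq w_def)
  have Ueq: "y \<in> Uset \<Omega> \<rho>1 \<rho>2 \<alpha> \<longleftrightarrow> y \<in> Mset \<Omega> \<rho>1 \<rho>2 \<and> GG y = T" for y by (simp add: Uset_def GG_def T_def)
  define D where "D n = T - GG (w n)" for n
  have D: "0 \<le> D n" "D n < 1 / real (Suc n)" for n using wM(2)[of n] uT[of n] wG[of n] by (auto simp: D_def)
  have D0: "D \<longlonglongrightarrow> 0"
  proof (rule tendsto_0_bound)
    show "norm (D n) \<le> inverse (real (Suc n))" for n using D[of n] by (simp add: inverse_eq_divide)
  qed (rule LIMSEQ_inverse_real_of_nat)
  have \<rho>0: "\<rho>1 \<ge> 0" "\<rho>2 \<ge> 0" using wM(1)[of 0] by (auto simp: Mset_def mass_eq)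
  \<comment> \<open>The shift \<open>N\<close> skips the indices at which the defect may still be
    too large for \<open>raise_gradient\<close>.\<close>
  have fin: False if y: "\<And>n. y n \<in> Uset \<Omega> \<rho>1 \<rho>2 \<alpha>" and l: "(\<lambda>n. GG (pdiff (y n) (w (n + N)))) \<longlonglongrightarrow> 0" for y :: "nat \<Rightarrow> 'a cpair" and N
  proof -
    have yH: "H10pair \<Omega> (y n)" for n using y[of n] by (simp add: Ueq Mset_def)
    have "(\<lambda>n. En (y n) - En (w (n + N))) \<longlonglongrightarrow> 0"
      by (rule energy_diff_tendsto_0(2)[OF wH yH wM(2) l])
    then have "d - c \<le> 0" by (rule LIMSEQ_le_const) (use d(1)[OF y] wE in \<open>auto intro!: exI[of _ 0]\<close>)
    then show False using d(2) by simp
  qed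
  consider "\<rho>1 > 0" | "\<rho>2 > 0" | "\<rho>1 = 0" "\<rho>2 = 0" using \<rho>0 by linarith
  then show False
  proof cases
    case 1
    obtain C where C: "\<And>u D. H10 \<Omega> u \<Longrightarrow> (\<forall>x\<in>\<Omega>. Im (u x) = 0) \<Longrightarrow> mass \<Omega> u = \<rho>1 \<Longrightarrow> gradsq \<Omega> u \<le> T \<Longrightarrow> 0 \<le> D \<Longrightarrow> D \<le> \<rho>1 / 16 \<Longrightarrow>
      (\<exists>y. H10 \<Omega> y \<and> (\<forall>x\<in>\<Omega>. Im (y x) = 0) \<and> mass \<Omega> y = \<rho>1 \<and> gradsq \<Omega> y = gradsq \<Omega> u + D \<and> gradsq \<Omega> (\<lambda>x. y x - u x) \<le> C * D)"
      using raise_gradient[OF ne 1, of T] by blast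
    have "\<forall>\<^sub>F n in sequentially. D n < \<rho>1 / 16" using D0 1 by (intro order_tendstoD) auto
    then obtain N where N: "\<And>n. n \<ge> N \<Longrightarrow> D n < \<rho>1 / 16" unfolding eventually_sequentially by blast
    have gT: "gradsq \<Omega> (fst (w n)) \<le> T" for n using wM(2)[of n] gradsq_nonneg[of "snd (w n)"] unfolding GG_def by linarith
    have "\<exists>y. H10 \<Omega> y \<and> (\<forall>x\<in>\<Omega>. Im (y x) = 0) \<and> mass \<Omega> y = \<rho>1 \<and> gradsq \<Omega> y = gradsq \<Omega> (fst (w (n + N))) + D (n + N) \<and> gradsq \<Omega> (\<lambda>x. y x - fst (w (n + N)) x) \<le> C * D (n + N)" for n
      by (rule C) (use wM(1)[of "n + N"] gT D(1) N[of "n + N"] in \<open>auto simp: Mset_def H10pair_def\<close>)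
    then obtain y where y: "\<And>n. H10 \<Omega> (y n)" "\<And>n. \<forall>x\<in>\<Omega>. Im (y n x) = 0" "\<And>n. mass \<Omega> (y n) = \<rho>1"
      "\<And>n. gradsq \<Omega> (y n) = gradsq \<Omega> (fst (w (n + N))) + D (n + N)" "\<And>n. gradsq \<Omega> (\<lambda>x. y n x - fst (w (n + N)) x) \<le> C * D (n + N)" by metis
    show False
    proof (rule fin[of "\<lambda>n. (y n, snd (w (n + N)))"])
      show "(y n, snd (w (n + N))) \<in> Uset \<Omega> \<rho>1 \<rho>2 \<alpha>" for n
        using y(1-4)[of n] wM(1)[of "n + N"] unfolding Ueq by (simp add: Mset_def H10pair_def GG_def D_def)
      show "(\<lambda>n. GG (pdiff (y n, snd (w (n + N))) (w (n + N)))) \<longlonglongrightarrow> 0"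
      proof (rule tendsto_0_bound)
        show "norm (GG (pdiff (y n, snd (w (n + N))) (w (n + N)))) \<le> C * D (n + N)" for n
          using y(5)[of n] by (simp add: GG_def pdiff_def H10_zero(2))
        show "(\<lambda>n. C * D (n + N)) \<longlonglongrightarrow> 0" using tendsto_mult_left[OF LIMSEQ_ignore_initial_segment[OF D0, of N], of C] by simp
      qed
    qed
  next
    case 2
    obtain C where C: "\<And>u D. H10 \<Omega> u \<Longrightarrow> (\<forall>x\<in>\<Omega>. Im (u x) = 0) \<Longrightarrow> mass \<Omega> u = \<rho>2 \<Longrightarrow> gradsq \<Omega> u \<le> T \<Longrightarrow> 0 \<le> D \<Longrightarrow> D \<le> \<rho>2 / 16 \<Longrightarrow>
      (\<exists>y. H10 \<Omega> y \<and> (\<forall>x\<in>\<Omega>. Im (y x) = 0) \<and> mass \<Omega> y = \<rho>2 \<and> gradsq \<Omega> y = gradsq \<Omega> u + D \<and> gradsq \<Omega> (\<lambda>x. y x - u x) \<le> C * D)"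
      using raise_gradient[OF ne 2, of T] by blast
    have "\<forall>\<^sub>F n in sequentially. D n < \<rho>2 / 16" using D0 2 by (intro order_tendstoD) auto
    then obtain N where N: "\<And>n. n \<ge> N \<Longrightarrow> D n < \<rho>2 / 16" unfolding eventually_sequentially by blast
    have gT: "gradsq \<Omega> (snd (w n)) \<le> T" for n using wM(2)[of n] gradsq_nonneg[of "fst (w n)"] unfolding GG_def by linarith
    have "\<exists>y. H10 \<Omega> y \<and> (\<forall>x\<in>\<Omega>. Im (y x) = 0) \<and> mass \<Omega> y = \<rho>2 \<and> gradsq \<Omega> y = gradsq \<Omega> (snd (w (n + N))) + D (n + N) \<and> gradsq \<Omega> (\<lambda>x. y x - snd (w (n + N)) x) \<le> C * D (n + N)" for n
      by (rule C) (use wM(1)[of "n + N"] gT D(1) N[of "n + N"] in \<open>auto simp: Mset_def H10pair_def\<close>)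
    then obtain y where y: "\<And>n. H10 \<Omega> (y n)" "\<And>n. \<forall>x\<in>\<Omega>. Im (y n x) = 0" "\<And>n. mass \<Omega> (y n) = \<rho>2"
      "\<And>n. gradsq \<Omega> (y n) = gradsq \<Omega> (snd (w (n + N))) + D (n + N)" "\<And>n. gradsq \<Omega> (\<lambda>x. y n x - snd (w (n + N)) x) \<le> C * D (n + N)" by metis
    show False
    proof (rule fin[of "\<lambda>n. (fst (w (n + N)), y n)"])
      show "(fst (w (n + N)), y n) \<in> Uset \<Omega> \<rho>1 \<rho>2 \<alpha>" for n
        using y(1-4)[of n] wM(1)[of "n + N"] unfolding Ueq by (simp add: Mset_def H10pair_def GG_def D_def)
      show "(\<lambda>n. GG (pdiff (fst (w (n + N)), y n) (w (n + N)))) \<longlonglongrightarrow> 0"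
      proof (rule tendsto_0_bound)
        show "norm (GG (pdiff (fst (w (n + N)), y n) (w (n + N)))) \<le> C * D (n + N)" for n
          using y(5)[of n] by (simp add: GG_def pdiff_def H10_zero(2))
        show "(\<lambda>n. C * D (n + N)) \<longlonglongrightarrow> 0" using tendsto_mult_left[OF LIMSEQ_ignore_initial_segment[OF D0, of N], of C] by simp
      qed
    qed
  next
    case 3
    \<comment> \<open>With both masses zero the sphere has radius zero, and the modulus already lies
      on it.\<close>
    then have "T = 0" by (simp add: T_def)
    then have "GG (w n) = T" for n using wM(2)[of n] GG_nonneg[of "w n"] by linarith
    then have "w 0 \<in> Uset \<Omega> \<rho>1 \<rho>2 \<alpha>" using wM(1) by (simp add: Ueq)
    then show False using d(1)[of "w 0"] wE[of 0] d(2) by simp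
  qed
qed

end

subsection \<open>Trapping and continuation of solutions\<close>

context nls
begin

abbreviation "sol \<equiv> nls_solution \<Omega> \<mu>1 \<mu>2 \<beta> p"

text \<open>\<open>J1\<close>, \<open>J2\<close>, \<open>M1\<close> and \<open>M2\<close> name the
  integrand and the pairing in the weak form of each equation, so that concatenating solutions can
  treat them as black boxes.\<close>

definition J1 :: "('a \<Rightarrow> real) \<Rightarrow> 'a cpair \<Rightarrow> complex" where
  "J1 \<phi> w = set_lebesgue_integral lebesgue \<Omega> (\<lambda>x. \<Sum>b\<in>Basis. wgrad \<Omega> (fst w) b x * complex_of_real (pd \<phi> b x))
     - set_lebesgue_integral lebesgue \<Omega> (\<lambda>x. fst w x *
         complex_of_real (\<mu>1 * cmod (fst w x) powr (p - 1) + \<beta> * cmod (fst w x) powr ((p - 3)/2) * cmod (snd w x) powr ((p + 1)/2))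
         * complex_of_real (\<phi> x))"

definition J2 :: "('a \<Rightarrow> real) \<Rightarrow> 'a cpair \<Rightarrow> complex" where
  "J2 \<phi> w = set_lebesgue_integral lebesgue \<Omega> (\<lambda>x. \<Sum>b\<in>Basis. wgrad \<Omega> (snd w) b x * complex_of_real (pd \<phi> b x))
     - set_lebesgue_integral lebesgue \<Omega> (\<lambda>x. snd w x *
         complex_of_real (\<mu>2 * cmod (snd w x) powr (p - 1) + \<beta> * cmod (snd w x) powr ((p - 3)/2) * cmod (fst w x) powr ((p + 1)/2))
         * complex_of_real (\<phi> x))"

definition M1 :: "('a \<Rightarrow> real) \<Rightarrow> 'a cpair \<Rightarrow> complex" where
  "M1 \<phi> w = set_lebesgue_integral lebesgue \<Omega> (\<lambda>x. fst w x * complex_of_real (\<phi> x))"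

definition M2 :: "('a \<Rightarrow> real) \<Rightarrow> 'a cpair \<Rightarrow> complex" where
  "M2 \<phi> w = set_lebesgue_integral lebesgue \<Omega> (\<lambda>x. snd w x * complex_of_real (\<phi> x))"

definition Dom :: "ereal \<Rightarrow> real set" where "Dom T = {t. 0 \<le> t \<and> ereal t < T}"

lemma sol_iff:
  "sol \<psi> T \<Psi> \<longleftrightarrow> (\<forall>t\<in>Dom T. H10pair \<Omega> (\<Psi> t)) \<and> ae_eq_pair \<Omega> (\<Psi> 0) \<psi> \<and>
     (\<forall>t0\<in>Dom T. ((\<lambda>t. h10dist \<Omega> (\<Psi> t) (\<Psi> t0)) \<longlongrightarrow> 0) (at t0 within Dom T)) \<and>
     (\<forall>\<phi>. testfun \<Omega> \<phi> \<longrightarrow> (\<forall>t\<in>Dom T.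
        ((\<lambda>s. J1 \<phi> (\<Psi> s)) has_integral (\<i> * (M1 \<phi> (\<Psi> t) - M1 \<phi> \<psi>))) {0..t} \<and>
        ((\<lambda>s. J2 \<phi> (\<Psi> s)) has_integral (\<i> * (M2 \<phi> (\<Psi> t) - M2 \<phi> \<psi>))) {0..t}))"
  unfolding nls_solution_def J1_def J2_def M1_def M2_def Dom_def by (simp only: mem_Collect_eq Ball_def)

text \<open>Minkowski's inequality in the plane, applied to the two component norms.\<close>

lemma GG_sqrt_triangle:
  assumes "H10pair \<Omega> u" "H10pair \<Omega> v" shows "sqrt (GG u) \<le> sqrt (GG v) + sqrt (GG (pdiff u v))"
proof -
  define a where "a = (sqrt (gradsq \<Omega> (fst v)), sqrt (gradsq \<Omega> (snd v)))"
  define b where "b = (sqrt (gradsq \<Omega> (fst (pdiff u v))), sqrt (gradsq \<Omega> (snd (pdiff u v))))"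
  have H: "H10 \<Omega> (fst u)" "H10 \<Omega> (snd u)" "H10 \<Omega> (fst v)" "H10 \<Omega> (snd v)" using assms by (auto simp: H10pair_def)
  have n: "norm a = sqrt (GG v)" "norm b = sqrt (GG (pdiff u v))" by (auto simp: a_def b_def norm_Pair GG_def)
  have "sqrt (gradsq \<Omega> (fst u)) \<le> fst a + fst b" "sqrt (gradsq \<Omega> (snd u)) \<le> snd a + snd b"
    using gradsq_triangle[OF H(3) H10_diff[OF H(1,3)]] gradsq_triangle[OF H(4) H10_diff[OF H(2,4)]]
    by (simp_all add: a_def b_def pdiff_def)
  then have "(sqrt (gradsq \<Omega> (fst u)))\<^sup>2 + (sqrt (gradsq \<Omega> (snd u)))\<^sup>2 \<le> (fst a + fst b)\<^sup>2 + (snd a + snd b)\<^sup>2"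
    by (intro add_mono power_mono) auto
  then have "GG u \<le> (norm (a + b))\<^sup>2" by (simp add: GG_def norm_prod_def)
  then have "sqrt (GG u) \<le> norm (a + b)" by (intro real_le_lsqrt) auto
  then show ?thesis using norm_triangle_ineq[of a b] n by linarith
qed

lemma h10dist_triangle:
  assumes "H10pair \<Omega> u" "H10pair \<Omega> v" "H10pair \<Omega> w" shows "h10dist \<Omega> u w \<le> h10dist \<Omega> u v + h10dist \<Omega> v w"
proof -
  have "pdiff (pdiff u w) (pdiff v w) = pdiff u v" by (simp add: pdiff_def)
  then show ?thesis
    using GG_sqrt_triangle[OF H10pair_diff[OF assms(1,3)] H10pair_diff[OF assms(2,3)]] by (simp add: h10dist_eq)
qed

lemma h10dist_commute: "H10pair \<Omega> u \<Longrightarrow> H10pair \<Omega> v \<Longrightarrow> h10dist \<Omega> u v = h10dist \<Omega> v u"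
  by (simp add: h10dist_eq GG_pdiff_commute)

text \<open>Solutions meet their data only almost everywhere; this turns such agreement into
  distance zero.\<close>

lemma ae_eq_dist_0:
  assumes "H10pair \<Omega> u" "H10pair \<Omega> v" "ae_eq_pair \<Omega> u v" shows "h10dist \<Omega> u v = 0"
proof -
  have H: "H10 \<Omega> (fst (pdiff u v))" "H10 \<Omega> (snd (pdiff u v))" using H10pair_diff[OF assms(1,2)] by (auto simp: H10pair_def)
  have ae: "AE x in LO. fst u x = fst v x \<and> snd u x = snd v x"
    using assms(3) unfolding ae_eq_pair_def AE_restrict_space_iff[OF meas\<Omega>(3)] .
  have "nsq LO (fst (pdiff u v)) = 0" "nsq LO (snd (pdiff u v)) = 0"
    unfolding nsq_def pdiff_def by (rule integral_eq_zero_AE, use ae in eventually_elim, simp)+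
  then have "gradsq \<Omega> (fst (pdiff u v)) = 0" "gradsq \<Omega> (snd (pdiff u v)) = 0"
    using H10_null(2) H10_sqi H by blast+
  then show ?thesis by (simp add: h10dist_eq GG_def)
qed

lemma h10norm_eq: "h10norm \<Omega> u = sqrt (GG u)" by (simp add: h10norm_def GG_def)

lemma sol_GG_continuous:
  assumes S: "sol \<psi> T \<Psi>" and t1: "t1 \<in> Dom T"
  shows "continuous_on {0..t1} (\<lambda>t. sqrt (GG (\<Psi> t)))"
  unfolding continuous_on_def
proof
  fix t0 assume t0: "t0 \<in> {0..t1}"
  have sub: "{0..t1} \<subseteq> Dom T" using t1 by (auto simp: Dom_def intro: le_less_trans[of "ereal _" "ereal t1"])
  have H: "H10pair \<Omega> (\<Psi> t)" if "t \<in> {0..t1}" for t using S sub that unfolding sol_iff by blast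
  have "((\<lambda>t. h10dist \<Omega> (\<Psi> t) (\<Psi> t0)) \<longlongrightarrow> 0) (at t0 within Dom T)" using S sub t0 unfolding sol_iff by blast
  then have l: "((\<lambda>t. h10dist \<Omega> (\<Psi> t) (\<Psi> t0)) \<longlongrightarrow> 0) (at t0 within {0..t1})" by (rule tendsto_within_subset[OF _ sub])
  have "((\<lambda>t. sqrt (GG (\<Psi> t)) - sqrt (GG (\<Psi> t0))) \<longlongrightarrow> 0) (at t0 within {0..t1})"
  proof (rule Lim_null_comparison[OF _ l])
    show "\<forall>\<^sub>F t in at t0 within {0..t1}. norm (sqrt (GG (\<Psi> t)) - sqrt (GG (\<Psi> t0))) \<le> h10dist \<Omega> (\<Psi> t) (\<Psi> t0)"
      unfolding eventually_at_filter
    proof (rule always_eventually, intro allI impI)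
      fix t assume "t \<in> {0..t1}"
      then show "norm (sqrt (GG (\<Psi> t)) - sqrt (GG (\<Psi> t0))) \<le> h10dist \<Omega> (\<Psi> t) (\<Psi> t0)"
        using GG_sqrt_triangle[OF H[of t] H[OF t0]] GG_sqrt_triangle[OF H[OF t0] H[of t]] GG_pdiff_commute[OF H[of t] H[OF t0]]
        by (simp add: h10dist_eq abs_le_iff)
    qed
  qed
  then show "((\<lambda>t. sqrt (GG (\<Psi> t))) \<longlongrightarrow> sqrt (GG (\<Psi> t0))) (at t0 within {0..t1})" by (simp add: LIM_zero_iff)
qed

lemma sol_initial:
  assumes S: "sol \<psi> T \<Psi>" and T: "0 < T" and \<psi>: "H10pair \<Omega> \<psi>" shows "GG (\<Psi> 0) = GG \<psi>"
proof -
  have "0 \<in> Dom T" using T by (simp add: Dom_def zero_ereal_def)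
  then have H: "H10pair \<Omega> (\<Psi> 0)" and ae: "ae_eq_pair \<Omega> (\<Psi> 0) \<psi>" using S unfolding sol_iff by blast+
  have "GG (pdiff (\<Psi> 0) \<psi>) = 0" "GG (pdiff \<psi> (\<Psi> 0)) = 0"
    using ae_eq_dist_0[OF H \<psi> ae] GG_pdiff_commute[OF H \<psi>] by (auto simp: h10dist_eq)
  then have "sqrt (GG (\<Psi> 0)) = sqrt (GG \<psi>)" using GG_sqrt_triangle[OF H \<psi>] GG_sqrt_triangle[OF \<psi> H] by simp
  then show ?thesis by simp
qed

text \<open>To reach a value above \<open>\<tau>\<close> the continuous gradient norm would have to
  equal \<open>\<tau>\<close> at some time; there conservation gives the state the masses and energy
  of the datum, which \<open>trap\<close> excludes.\<close>

lemma sol_trapped: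
  assumes S: "sol \<psi> T \<Psi>" and T: "0 < T" and \<psi>: "H10pair \<Omega> \<psi>" "GG \<psi> < \<tau>" and cons: "conservation \<Omega> \<mu>1 \<mu>2 \<beta> p"
    and trap: "\<And>v. H10pair \<Omega> v \<Longrightarrow> mass \<Omega> (fst v) = mass \<Omega> (fst \<psi>) \<Longrightarrow> mass \<Omega> (snd v) = mass \<Omega> (snd \<psi>) \<Longrightarrow> En v = En \<psi> \<Longrightarrow> GG v \<noteq> \<tau>"
    and t1: "t1 \<in> Dom T"
  shows "GG (\<Psi> t1) < \<tau>"
proof (rule ccontr)
  assume "\<not> GG (\<Psi> t1) < \<tau>"
  then have "\<exists>t\<ge>0. t \<le> t1 \<and> sqrt (GG (\<Psi> t)) = sqrt \<tau>"
    using sol_initial[OF S T \<psi>(1)] \<psi>(2) t1 sol_GG_continuous[OF S t1] by (intro IVT') (auto simp: Dom_def)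
  then obtain t where t: "0 \<le> t" "t \<le> t1" "GG (\<Psi> t) = \<tau>" by auto
  then have tD: "t \<in> Dom T" using t1 by (auto simp: Dom_def intro: le_less_trans[of "ereal _" "ereal t1"])
  have "H10pair \<Omega> (\<Psi> t)" using S tD unfolding sol_iff by blast
  moreover have "mass \<Omega> (fst (\<Psi> t)) = mass \<Omega> (fst \<psi>) \<and> mass \<Omega> (snd (\<Psi> t)) = mass \<Omega> (snd \<psi>) \<and> En (\<Psi> t) = En \<psi>"
    using cons S tD unfolding conservation_def Dom_def by blast
  ultimately show False using trap[of "\<Psi> t"] t(3) by blast
qed

text \<open>\<open>J\<close> and \<open>P\<close> are arbitrary so that the same statement serves
  both equations. The terms at \<open>T1\<close> cancel when the integral identities of the two
  pieces are added.\<close>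

lemma has_integral_glue:
  fixes J :: "'w \<Rightarrow> complex" and T1 B t :: real
  assumes a: "\<And>t. t \<in> {0..T1} \<Longrightarrow> ((\<lambda>s. J (\<Psi>a s)) has_integral (\<i> * (P (\<Psi>a t) - P0))) {0..t}"
    and b: "\<And>t. t \<in> {0..<B} \<Longrightarrow> ((\<lambda>s. J (\<Psi>b s)) has_integral (\<i> * (P (\<Psi>b t) - P (\<Psi>a T1)))) {0..t}"
    and T1: "0 < T1" and t: "0 \<le> t" "t < T1 + B"
  shows "((\<lambda>s. J (if s < T1 then \<Psi>a s else \<Psi>b (s - T1))) has_integral (\<i> * (P (if t < T1 then \<Psi>a t else \<Psi>b (t - T1)) - P0))) {0..t}"
proof (cases "t < T1")
  case True
  have "((\<lambda>s. J (if s < T1 then \<Psi>a s else \<Psi>b (s - T1))) has_integral (\<i> * (P (\<Psi>a t) - P0))) {0..t}"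
    by (rule has_integral_eq[OF _ a[of t]]) (use True t in auto)
  then show ?thesis using True by simp
next
  case False
  \<comment> \<open>At time \<open>T1\<close> the glued function takes the value
    \<open>\<Psi>b 0\<close>, which need not equal \<open>\<Psi>a T1\<close> pointwise; a single
    time does not affect the integral.\<close>
  have 1: "((\<lambda>s. J (if s < T1 then \<Psi>a s else \<Psi>b (s - T1))) has_integral (\<i> * (P (\<Psi>a T1) - P0))) {0..T1}"
    by (rule has_integral_spike_finite[of "{T1}" _ _ "\<lambda>s. J (\<Psi>a s)"]) (use a[of T1] T1 in auto)
  have "((\<lambda>s. J (\<Psi>b (s - T1))) \<circ> ((+) T1) has_integral (\<i> * (P (\<Psi>b (t - T1)) - P (\<Psi>a T1)))) {0..t - T1}"
    using b[of "t - T1"] False t by (simp add: o_def)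
  then have 2: "((\<lambda>s. J (\<Psi>b (s - T1))) has_integral (\<i> * (P (\<Psi>b (t - T1)) - P (\<Psi>a T1)))) {T1..t}"
    unfolding has_integral_shift_Icc_real by simp
  have 3: "((\<lambda>s. J (if s < T1 then \<Psi>a s else \<Psi>b (s - T1))) has_integral (\<i> * (P (\<Psi>b (t - T1)) - P (\<Psi>a T1)))) {T1..t}"
    by (rule has_integral_eq[OF _ 2]) auto
  have "((\<lambda>s. J (if s < T1 then \<Psi>a s else \<Psi>b (s - T1))) has_integral (\<i> * (P (\<Psi>a T1) - P0) + \<i> * (P (\<Psi>b (t - T1)) - P (\<Psi>a T1)))) {0..t}"
    by (rule has_integral_combine[OF _ _ 1 3]) (use T1 False in auto)
  then show ?thesis using False by (simp add: algebra_simps)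
qed

lemma Dom_ereal: "Dom (ereal A) = {0..<A}" by (auto simp: Dom_def)

text \<open>Time intervals are half-open, so \<open>T1\<close> must lie strictly inside the first
  one for the state there to serve as a datum. At \<open>T1\<close> the pieces agree only almost
  everywhere, hence at distance zero, which is enough for continuity from the left.\<close>

lemma sol_glue:
  assumes a: "sol \<psi> (ereal A) \<Psi>a" and b: "sol (\<Psi>a T1) (ereal B) \<Psi>b" and T: "0 < T1" "T1 < A" "0 < B"
  shows "sol \<psi> (ereal (T1 + B)) (\<lambda>t. if t < T1 then \<Psi>a t else \<Psi>b (t - T1))"
proof -
  define \<Psi> where "\<Psi> t = (if t < T1 then \<Psi>a t else \<Psi>b (t - T1))" for t
  note a' = a[unfolded sol_iff Dom_ereal] and b' = b[unfolded sol_iff Dom_ereal]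
  have Ha: "H10pair \<Omega> (\<Psi>a t)" if "0 \<le> t" "t < A" for t using a' that by auto
  have Hb: "H10pair \<Omega> (\<Psi>b t)" if "0 \<le> t" "t < B" for t using b' that by auto
  have H: "H10pair \<Omega> (\<Psi> t)" if "t \<in> {0..<T1 + B}" for t using that Ha Hb T by (auto simp: \<Psi>_def)
  have ca: "((\<lambda>t. h10dist \<Omega> (\<Psi>a t) (\<Psi>a t0)) \<longlongrightarrow> 0) (at t0 within {0..<A})" if "t0 \<in> {0..<A}" for t0 using a' that by blast
  have cb: "((\<lambda>t. h10dist \<Omega> (\<Psi>b t) (\<Psi>b t0)) \<longlongrightarrow> 0) (at t0 within {0..<B})" if "t0 \<in> {0..<B}" for t0 using b' that by blast
  have j: "h10dist \<Omega> (\<Psi>a T1) (\<Psi>b 0) = 0"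
    using ae_eq_dist_0[OF Hb[of 0] Ha[of T1]] b' T h10dist_commute[OF Hb[of 0] Ha[of T1]] by auto
  have "((\<lambda>t. h10dist \<Omega> (\<Psi> t) (\<Psi> t0)) \<longlongrightarrow> 0) (at t0 within {0..<T1 + B})" if t0: "t0 \<in> {0..<T1 + B}" for t0
    unfolding Lim_within
  proof (intro allI impI)
    fix e :: real assume e: "e > 0"
    have left: "\<exists>d>0. \<forall>t. 0 \<le> t \<and> t < T1 \<and> \<bar>t - t0\<bar> < d \<longrightarrow> h10dist \<Omega> (\<Psi> t) (\<Psi> t0) < e" if "t0 \<le> T1"
    proof -
      obtain d where d: "d > 0" "\<And>t. t \<in> {0..<A} \<Longrightarrow> 0 < dist t t0 \<and> dist t t0 < d \<Longrightarrow> dist (h10dist \<Omega> (\<Psi>a t) (\<Psi>a t0)) 0 < e"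
        using ca[of t0] e t0 \<open>t0 \<le> T1\<close> T unfolding Lim_within by fastforce
      have 0: "h10dist \<Omega> (\<Psi>a t) (\<Psi>a t) = 0" if "0 \<le> t" "t < A" for t
        using Ha[OF that] by (intro ae_eq_dist_0) (auto simp: ae_eq_pair_def)
      have "h10dist \<Omega> (\<Psi> t) (\<Psi> t0) < e" if t: "0 \<le> t" "t < T1" "\<bar>t - t0\<bar> < d" for t
      proof -
        have ta: "h10dist \<Omega> (\<Psi>a t) (\<Psi>a t0) < e"
          using d(2)[of t] t T e 0[of t] by (cases "t = t0") (auto simp: dist_real_def)
        show ?thesis
        proof (cases "t0 < T1")
          case True
          then show ?thesis using ta t by (simp add: \<Psi>_def)
        next
          case False
          then have t0T: "t0 = T1" using \<open>t0 \<le> T1\<close> by simp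
          have "h10dist \<Omega> (\<Psi>a t) (\<Psi>b 0) \<le> h10dist \<Omega> (\<Psi>a t) (\<Psi>a T1) + h10dist \<Omega> (\<Psi>a T1) (\<Psi>b 0)"
            by (rule h10dist_triangle) (use Ha Hb t T in auto)
          then show ?thesis using ta t j t0T by (simp add: \<Psi>_def)
        qed
      qed
      then show ?thesis using d(1) by blast
    qed
    have right: "\<exists>d>0. \<forall>t. T1 \<le> t \<and> t < T1 + B \<and> \<bar>t - t0\<bar> < d \<longrightarrow> h10dist \<Omega> (\<Psi> t) (\<Psi> t0) < e" if "t0 \<ge> T1"
    proof -
      have tb: "t0 - T1 \<in> {0..<B}" using that t0 by auto
      obtain d where d: "d > 0" "\<And>t. t \<in> {0..<B} \<Longrightarrow> 0 < dist t (t0 - T1) \<and> dist t (t0 - T1) < d \<Longrightarrow> dist (h10dist \<Omega> (\<Psi>b t) (\<Psi>b (t0 - T1))) 0 < e"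
        using cb[OF tb] e unfolding Lim_within by fastforce
      have 0: "h10dist \<Omega> (\<Psi>b t) (\<Psi>b t) = 0" if "0 \<le> t" "t < B" for t
        using Hb[OF that] by (intro ae_eq_dist_0) (auto simp: ae_eq_pair_def)
      have "h10dist \<Omega> (\<Psi> t) (\<Psi> t0) < e" if t: "T1 \<le> t" "t < T1 + B" "\<bar>t - t0\<bar> < d" for t
        using d(2)[of "t - T1"] t T e 0[of "t - T1"] \<open>t0 \<ge> T1\<close> by (cases "t = t0") (auto simp: dist_real_def \<Psi>_def)
      then show ?thesis using d(1) by blast
    qed
    have nn: "h10dist \<Omega> u v \<ge> 0" for u v by (simp add: h10dist_eq)
    consider "t0 < T1" | "t0 > T1" | "t0 = T1" by linarith
    then show "\<exists>d>0. \<forall>t\<in>{0..<T1 + B}. 0 < dist t t0 \<and> dist t t0 < d \<longrightarrow> dist (h10dist \<Omega> (\<Psi> t) (\<Psi> t0)) 0 < e"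
    proof cases
      case 1
      then obtain d where "d > 0" "\<And>t. 0 \<le> t \<Longrightarrow> t < T1 \<Longrightarrow> \<bar>t - t0\<bar> < d \<Longrightarrow> h10dist \<Omega> (\<Psi> t) (\<Psi> t0) < e" using left by auto
      then show ?thesis using 1 nn by (intro exI[of _ "min d (T1 - t0)"]) (auto simp: dist_real_def)
    next
      case 2
      then obtain d where "d > 0" "\<And>t. T1 \<le> t \<Longrightarrow> t < T1 + B \<Longrightarrow> \<bar>t - t0\<bar> < d \<Longrightarrow> h10dist \<Omega> (\<Psi> t) (\<Psi> t0) < e" using right by auto
      then show ?thesis using 2 nn by (intro exI[of _ "min d (t0 - T1)"]) (auto simp: dist_real_def)
    next
      case 3
      then obtain d where "d > 0" "\<And>t. 0 \<le> t \<Longrightarrow> t < T1 \<Longrightarrow> \<bar>t - t0\<bar> < d \<Longrightarrow> h10dist \<Omega> (\<Psi> t) (\<Psi> t0) < e" using left by auto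
      moreover from 3 obtain d' where "d' > 0" "\<And>t. T1 \<le> t \<Longrightarrow> t < T1 + B \<Longrightarrow> \<bar>t - t0\<bar> < d' \<Longrightarrow> h10dist \<Omega> (\<Psi> t) (\<Psi> t0) < e" using right by auto
      ultimately have "h10dist \<Omega> (\<Psi> t) (\<Psi> t0) < e" if "t \<in> {0..<T1 + B}" "dist t t0 < min d d'" for t
        using that by (cases "t < T1") (auto simp: dist_real_def)
      then show ?thesis using nn \<open>d > 0\<close> \<open>d' > 0\<close> by (intro exI[of _ "min d d'"]) (auto simp: dist_real_def)
    qed
  qed
  moreover have "((\<lambda>s. J1 \<phi> (\<Psi> s)) has_integral (\<i> * (M1 \<phi> (\<Psi> t) - M1 \<phi> \<psi>))) {0..t} \<and>
        ((\<lambda>s. J2 \<phi> (\<Psi> s)) has_integral (\<i> * (M2 \<phi> (\<Psi> t) - M2 \<phi> \<psi>))) {0..t}" if \<phi>: "testfun \<Omega> \<phi>" and t: "t \<in> {0..<T1 + B}" for \<phi> t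
  proof
    show "((\<lambda>s. J1 \<phi> (\<Psi> s)) has_integral (\<i> * (M1 \<phi> (\<Psi> t) - M1 \<phi> \<psi>))) {0..t}"
      unfolding \<Psi>_def by (rule has_integral_glue) (use a' b' \<phi> t T in auto)
    show "((\<lambda>s. J2 \<phi> (\<Psi> s)) has_integral (\<i> * (M2 \<phi> (\<Psi> t) - M2 \<phi> \<psi>))) {0..t}"
      unfolding \<Psi>_def by (rule has_integral_glue) (use a' b' \<phi> t T in auto)
  qed
  moreover have "ae_eq_pair \<Omega> (\<Psi> 0) \<psi>" using a' T by (simp add: \<Psi>_def)
  ultimately show ?thesis unfolding \<Psi>_def[symmetric] sol_iff Dom_ereal using H by blast
qed

lemma sol_cong:
  assumes S: "sol \<psi> (ereal A) \<Phi>" and A: "A > 0" and eq: "\<And>t. 0 \<le> t \<Longrightarrow> t < A \<Longrightarrow> \<Psi> t = \<Phi> t"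
  shows "sol \<psi> (ereal A) \<Psi>"
proof -
  note S' = S[unfolded sol_iff Dom_ereal]
  have "((\<lambda>t. h10dist \<Omega> (\<Psi> t) (\<Psi> t0)) \<longlongrightarrow> 0) (at t0 within {0..<A})" if "t0 \<in> {0..<A}" for t0
  proof (rule Lim_transform_eventually)
    show "((\<lambda>t. h10dist \<Omega> (\<Phi> t) (\<Phi> t0)) \<longlongrightarrow> 0) (at t0 within {0..<A})" using S' that by blast
    show "\<forall>\<^sub>F t in at t0 within {0..<A}. h10dist \<Omega> (\<Phi> t) (\<Phi> t0) = h10dist \<Omega> (\<Psi> t) (\<Psi> t0)"
      unfolding eventually_at_filter using eq that by (intro always_eventually) auto
  qed
  moreover have "((\<lambda>s. J1 \<phi> (\<Psi> s)) has_integral (\<i> * (M1 \<phi> (\<Psi> t) - M1 \<phi> \<psi>))) {0..t} \<and>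
        ((\<lambda>s. J2 \<phi> (\<Psi> s)) has_integral (\<i> * (M2 \<phi> (\<Psi> t) - M2 \<phi> \<psi>))) {0..t}" if \<phi>: "testfun \<Omega> \<phi>" and t: "t \<in> {0..<A}" for \<phi> t
  proof
    show "((\<lambda>s. J1 \<phi> (\<Psi> s)) has_integral (\<i> * (M1 \<phi> (\<Psi> t) - M1 \<phi> \<psi>))) {0..t}"
      by (rule has_integral_eq[of _ "\<lambda>s. J1 \<phi> (\<Phi> s)"]) (use S' \<phi> t eq in auto)
    show "((\<lambda>s. J2 \<phi> (\<Psi> s)) has_integral (\<i> * (M2 \<phi> (\<Psi> t) - M2 \<phi> \<psi>))) {0..t}"
      by (rule has_integral_eq[of _ "\<lambda>s. J2 \<phi> (\<Phi> s)"]) (use S' \<phi> t eq in auto)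
  qed
  moreover have "ae_eq_pair \<Omega> (\<Psi> 0) \<psi>" using S' eq[of 0] A by simp
  moreover have "\<forall>t\<in>{0..<A}. H10pair \<Omega> (\<Psi> t)" using S' eq by simp
  ultimately show ?thesis unfolding sol_iff Dom_ereal by blast
qed

lemma sol_restrict: "sol \<psi> (ereal A) \<Psi> \<Longrightarrow> A' \<le> A \<Longrightarrow> sol \<psi> (ereal A') \<Psi>"
proof -
  assume S: "sol \<psi> (ereal A) \<Psi>" and le: "A' \<le> A"
  have sub: "{0..<A'} \<subseteq> {0..<A}" using le by auto
  show ?thesis using S sub tendsto_within_subset[OF _ sub] unfolding sol_iff Dom_ereal by blast
qed

lemma sol_infinite:
  assumes "\<And>A. A > 0 \<Longrightarrow> sol \<psi> (ereal A) \<Psi>" shows "sol \<psi> \<infinity> \<Psi>"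
proof -
  have D: "Dom \<infinity> = {0..}" by (auto simp: Dom_def)
  have "((\<lambda>t. h10dist \<Omega> (\<Psi> t) (\<Psi> t0)) \<longlongrightarrow> 0) (at t0 within {0..})" if t0: "t0 \<in> {0..}" for t0
  proof -
    have "((\<lambda>t. h10dist \<Omega> (\<Psi> t) (\<Psi> t0)) \<longlongrightarrow> 0) (at t0 within {0..<t0 + 1})"
      using assms[of "t0 + 1"] t0 unfolding sol_iff Dom_ereal by auto
    moreover have "at t0 within {0..<t0 + 1} = at t0 within {0..}"
      by (rule at_within_nhd[of _ "{..<t0 + 1}"]) auto
    ultimately show ?thesis by simp
  qed
  moreover have "H10pair \<Omega> (\<Psi> t)" if "t \<in> {0..}" for t
    using assms[of "t + 1"] that unfolding sol_iff Dom_ereal by auto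
  moreover have "((\<lambda>s. J1 \<phi> (\<Psi> s)) has_integral (\<i> * (M1 \<phi> (\<Psi> t) - M1 \<phi> \<psi>))) {0..t} \<and>
        ((\<lambda>s. J2 \<phi> (\<Psi> s)) has_integral (\<i> * (M2 \<phi> (\<Psi> t) - M2 \<phi> \<psi>))) {0..t}" if "testfun \<Omega> \<phi>" "t \<in> {0..}" for \<phi> t
    using assms[of "t + 1"] that unfolding sol_iff Dom_ereal by auto
  moreover have "ae_eq_pair \<Omega> (\<Psi> 0) \<psi>" using assms[of 1] unfolding sol_iff by simp
  ultimately show ?thesis unfolding sol_iff D by blast
qed

text \<open>Local solutions on time intervals of a fixed length are concatenated; the a priori bound keeps
  the data of each step in the ball where that length is available.\<close>
lemma sol_global:
  assumes T0: "T0 > 0" and ex: "\<And>\<psi>. H10pair \<Omega> \<psi> \<Longrightarrow> GG \<psi> < \<tau> \<Longrightarrow> \<exists>\<Psi>. sol \<psi> (ereal T0) \<Psi>"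
    and \<psi>: "H10pair \<Omega> \<psi>" "GG \<psi> < \<tau>"
    and bound: "\<And>A \<Psi> t. A > 0 \<Longrightarrow> sol \<psi> (ereal A) \<Psi> \<Longrightarrow> t \<in> {0..<A} \<Longrightarrow> GG (\<Psi> t) < \<tau>"
  shows "\<exists>\<Psi>. sol \<psi> \<infinity> \<Psi>"
proof -
  \<comment> \<open>Half steps: each approximant reaches one \<open>T\<close> beyond the next
    restart time, which \<open>sol_glue\<close> requires to be interior.\<close>
  define T where "T = T0 / 2"
  have T: "T > 0" "T0 = 2 * T" using T0 by (auto simp: T_def)
  have "\<exists>\<Phi>. \<forall>n. sol \<psi> (ereal (real (n + 2) * T)) (\<Phi> n) \<and> (\<forall>t < real (n + 1) * T. \<Phi> (Suc n) t = \<Phi> n t)"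
  proof (rule dependent_nat_choice)
    show "\<exists>\<Phi>. sol \<psi> (ereal (real (0 + 2) * T)) \<Phi>" using ex[OF \<psi>] T by simp
    fix \<Phi> n assume S: "sol \<psi> (ereal (real (n + 2) * T)) \<Phi>"
    define T1 where "T1 = real (n + 1) * T"
    have T1: "T1 < real (n + 2) * T" "T1 + T0 = real (Suc n + 2) * T" using T by (auto simp: T1_def algebra_simps)
    have T1pos: "0 < T1" using T by (simp add: T1_def)
    have "GG (\<Phi> T1) < \<tau>" by (rule bound[OF _ S]) (use T1 T1pos in auto)
    moreover have "H10pair \<Omega> (\<Phi> T1)" using S T1 T1pos unfolding sol_iff Dom_ereal by auto
    ultimately obtain \<Psi>b where "sol (\<Phi> T1) (ereal T0) \<Psi>b" using ex by blast
    from sol_glue[OF S this T1pos T1(1) T0] show "\<exists>\<Phi>'. sol \<psi> (ereal (real (Suc n + 2) * T)) \<Phi>' \<and> (\<forall>t < real (n + 1) * T. \<Phi>' t = \<Phi> t)"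
      unfolding T1(2) by (intro exI conjI, assumption) (simp add: T1_def)
  qed
  then obtain \<Phi> where S: "\<And>n. sol \<psi> (ereal (real (n + 2) * T)) (\<Phi> n)" and eq: "\<And>n t. t < real (n + 1) * T \<Longrightarrow> \<Phi> (Suc n) t = \<Phi> n t" by blast
  have eq': "\<Phi> (n + k) t = \<Phi> n t" if "t < real (n + 1) * T" for n k t
  proof (induction k)
    case (Suc k)
    have "real (n + 1) * T \<le> real (n + k + 1) * T" using T by (intro mult_right_mono) auto
    then show ?case using eq[of t "n + k"] that Suc by simp
  qed simp
  \<comment> \<open>The approximant with index \<open>\<lfloor>t / T\<rfloor>\<close> is already
    final at \<open>t\<close>, since from index \<open>n\<close> on nothing changes before time
    \<open>(n + 1) * T\<close>.\<close>
  define \<Psi> where "\<Psi> t = \<Phi> (nat \<lfloor>t / T\<rfloor>) t" for t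
  have \<Psi>: "\<Psi> t = \<Phi> m t" if t: "0 \<le> t" "t < real (m + 1) * T" for t m
  proof -
    define n where "n = nat \<lfloor>t / T\<rfloor>"
    have "t / T < real (m + 1)" using t T by (simp add: pos_divide_less_eq)
    then have "\<lfloor>t / T\<rfloor> < int m + 1" by (subst floor_less_iff) simp
    then have nm: "n \<le> m" by (simp add: n_def)
    have "real n = of_int \<lfloor>t / T\<rfloor>" using t T by (simp add: n_def)
    then have "t / T < real n + 1" by linarith
    then have "t < real (n + 1) * T" using T by (simp add: pos_divide_less_eq add.commute)
    from eq'[OF this, of "m - n"] nm show ?thesis by (simp add: \<Psi>_def n_def)
  qed
  have "sol \<psi> (ereal A) \<Psi>" if A: "A > 0" for A
  proof -
    obtain m :: nat where "A / T < real m" using reals_Archimedean2 by blast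
    then have m: "A \<le> real (m + 1) * T" using T by (simp add: pos_divide_less_eq algebra_simps)
    have "sol \<psi> (ereal (real (m + 1) * T)) (\<Phi> m)" by (rule sol_restrict[OF S[of m]]) (use T in auto)
    then have "sol \<psi> (ereal (real (m + 1) * T)) \<Psi>" by (rule sol_cong) (use T \<Psi> in auto)
    then show ?thesis using m by (rule sol_restrict)
  qed
  then show ?thesis using sol_infinite by blast
qed

text \<open>States violating the claim with \<open>\<eta> = 1 / (n + 1)\<close> would form a
  minimising sequence inside the sphere of level \<open>\<tau>\<close>. By compactness a subsequence
  converges to a ground state, whose gradient is at most \<open>\<tau>0 < \<tau>\<close>, so
  eventually neither failure is possible. The same \<open>\<eta>\<close> thus yields both the
  barrier at \<open>\<tau>\<close> and the closeness to \<open>G\<close>.\<close>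

lemma trapping_region:
  assumes \<tau>: "\<tau>0 < \<tau>" "\<tau> < (\<rho>1 + \<rho>2) * \<alpha>" and G0: "\<And>u. u \<in> G \<Longrightarrow> GG u \<le> \<tau>0"
    and c: "\<And>w. w \<in> Bset \<Omega> \<rho>1 \<rho>2 \<alpha> \<Longrightarrow> c \<le> En w"
    and G: "\<And>u. H10pair \<Omega> u \<Longrightarrow> absp u \<in> Bset \<Omega> \<rho>1 \<rho>2 \<alpha> \<Longrightarrow> En u = c \<Longrightarrow> u \<in> G"
    and cr: "DIM('a) \<ge> 3 \<and> p = twostar DIM('a) - 1 \<longrightarrow>
           (\<rho>1 + \<rho>2) * (\<alpha> - lambda1 \<Omega>) \<le> Lambda TYPE('a) \<mu>1 \<mu>2 \<beta> powr (- (real DIM('a) - 2) / 2)"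
    and \<epsilon>: "\<epsilon> > 0"
  shows "\<exists>\<eta>>0. \<forall>v. H10pair \<Omega> v \<and> \<bar>mass \<Omega> (fst v) - \<rho>1\<bar> < \<eta> \<and> \<bar>mass \<Omega> (snd v) - \<rho>2\<bar> < \<eta> \<and> En v < c + \<eta> \<and> GG v \<le> \<tau> \<longrightarrow>
    GG v < \<tau> \<and> (\<exists>u\<in>G. h10dist \<Omega> v u < \<epsilon>)"
proof (rule ccontr)
  assume neg: "\<not> ?thesis"
  define \<eta> where "\<eta> n = inverse (real (Suc n))" for n
  have \<eta>: "\<eta> n > 0" for n by (simp add: \<eta>_def)
  have \<eta>0: "\<eta> \<longlonglongrightarrow> 0" unfolding \<eta>_def by (rule LIMSEQ_inverse_real_of_nat)
  have "\<exists>v. H10pair \<Omega> v \<and> \<bar>mass \<Omega> (fst v) - \<rho>1\<bar> < \<eta> n \<and> \<bar>mass \<Omega> (snd v) - \<rho>2\<bar> < \<eta> n \<and> En v < c + \<eta> n \<and> GG v \<le> \<tau> \<and>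
    \<not> (GG v < \<tau> \<and> (\<exists>u\<in>G. h10dist \<Omega> v u < \<epsilon>))" for n
    using neg \<eta>[of n] by blast
  then obtain v where v: "\<And>n. H10pair \<Omega> (v n)" and m1: "\<And>n. \<bar>mass \<Omega> (fst (v n)) - \<rho>1\<bar> < \<eta> n" and m2: "\<And>n. \<bar>mass \<Omega> (snd (v n)) - \<rho>2\<bar> < \<eta> n"
    and E: "\<And>n. En (v n) < c + \<eta> n" and t: "\<And>n. GG (v n) \<le> \<tau>" and bad: "\<And>n. \<not> (GG (v n) < \<tau> \<and> (\<exists>u\<in>G. h10dist \<Omega> (v n) u < \<epsilon>))"
    by metis
  have l1: "(\<lambda>n. mass \<Omega> (fst (v n))) \<longlonglongrightarrow> \<rho>1"
    using tendsto_0_bound[of "\<lambda>n. mass \<Omega> (fst (v n)) - \<rho>1" \<eta>] m1 \<eta>0 by (simp add: less_imp_le LIM_zero_iff)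
  have l2: "(\<lambda>n. mass \<Omega> (snd (v n))) \<longlonglongrightarrow> \<rho>2"
    using tendsto_0_bound[of "\<lambda>n. mass \<Omega> (snd (v n)) - \<rho>2" \<eta>] m2 \<eta>0 by (simp add: less_imp_le LIM_zero_iff)
  obtain s u where s: "strict_mono (s :: nat \<Rightarrow> nat)" and u: "H10pair \<Omega> u" "absp u \<in> Bset \<Omega> \<rho>1 \<rho>2 \<alpha>" "En u = c"
    and l: "(\<lambda>n. GG (pdiff (v (s n)) u)) \<longlonglongrightarrow> 0"
    by (rule minimising_compact[OF v t \<tau>(2) l1 l2 less_imp_le[OF E] \<eta>0 c cr])
  have uG: "u \<in> G" using G u by blast
  have "(\<lambda>n. GG (v (s n)) - GG u) \<longlonglongrightarrow> 0"
    by (rule energy_diff_tendsto_0(1)[of "\<lambda>_. u" "\<lambda>n. v (s n)", OF u(1) v order_refl l])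
  then have "(\<lambda>n. GG (v (s n))) \<longlonglongrightarrow> GG u" by (simp add: LIM_zero_iff)
  then have "\<forall>\<^sub>F n in sequentially. GG (v (s n)) < \<tau>" by (rule order_tendstoD) (use G0[OF uG] \<tau>(1) in linarith)
  moreover have "(\<lambda>n. h10dist \<Omega> (v (s n)) u) \<longlonglongrightarrow> 0" unfolding h10dist_eq using tendsto_real_sqrt[OF l] by simp
  then have "\<forall>\<^sub>F n in sequentially. h10dist \<Omega> (v (s n)) u < \<epsilon>" using \<epsilon> by (intro order_tendstoD) auto
  ultimately have "\<forall>\<^sub>F n in sequentially. False" by eventually_elim (use bad uG in blast)
  then show False by simp
qed

text \<open>The nearby ground state varies with the datum, so a uniform \<open>\<delta>\<close> does
  not follow from continuity at one point; the sequential form of continuity with two moving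
  sequences supplies it.\<close>

lemma data_near_ground_states:
  assumes \<tau>: "\<tau>0 < \<tau>" and G: "\<And>u. u \<in> G \<Longrightarrow> H10pair \<Omega> u \<and> GG u \<le> \<tau>0 \<and> mass \<Omega> (fst u) = \<rho>1 \<and> mass \<Omega> (snd u) = \<rho>2 \<and> En u = c"
    and \<eta>: "\<eta> > 0"
  shows "\<exists>\<delta>>0. \<forall>\<psi> u. H10pair \<Omega> \<psi> \<and> u \<in> G \<and> h10dist \<Omega> \<psi> u < \<delta> \<longrightarrow>
    \<bar>mass \<Omega> (fst \<psi>) - \<rho>1\<bar> < \<eta> \<and> \<bar>mass \<Omega> (snd \<psi>) - \<rho>2\<bar> < \<eta> \<and> En \<psi> < c + \<eta> \<and> GG \<psi> < \<tau>"
proof (rule ccontr)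
  assume neg: "\<not> ?thesis"
  define d where "d n = inverse (real (Suc n))" for n
  have d: "d n > 0" for n by (simp add: d_def)
  have d0: "d \<longlonglongrightarrow> 0" unfolding d_def by (rule LIMSEQ_inverse_real_of_nat)
  have "\<exists>\<psi> u. H10pair \<Omega> \<psi> \<and> u \<in> G \<and> h10dist \<Omega> \<psi> u < d n \<and>
    \<not> (\<bar>mass \<Omega> (fst \<psi>) - \<rho>1\<bar> < \<eta> \<and> \<bar>mass \<Omega> (snd \<psi>) - \<rho>2\<bar> < \<eta> \<and> En \<psi> < c + \<eta> \<and> GG \<psi> < \<tau>)" for n
    using neg d[of n] by blast
  then obtain \<psi> u where \<psi>: "\<And>n. H10pair \<Omega> (\<psi> n)" and u: "\<And>n. u n \<in> G" and dist: "\<And>n. h10dist \<Omega> (\<psi> n) (u n) < d n"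
    and bad: "\<And>n. \<not> (\<bar>mass \<Omega> (fst (\<psi> n)) - \<rho>1\<bar> < \<eta> \<and> \<bar>mass \<Omega> (snd (\<psi> n)) - \<rho>2\<bar> < \<eta> \<and> En (\<psi> n) < c + \<eta> \<and> GG (\<psi> n) < \<tau>)" by metis
  have uG: "H10pair \<Omega> (u n)" "GG (u n) \<le> \<tau>0" "mass \<Omega> (fst (u n)) = \<rho>1" "mass \<Omega> (snd (u n)) = \<rho>2" "En (u n) = c" for n using G[OF u[of n]] by auto
  have l: "(\<lambda>n. GG (pdiff (\<psi> n) (u n))) \<longlonglongrightarrow> 0"
  proof (rule tendsto_0_bound)
    have "(sqrt (GG (pdiff (\<psi> n) (u n))))\<^sup>2 \<le> (d n)\<^sup>2" for n using dist[of n] by (intro power_mono) (auto simp: h10dist_eq)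
    then show "norm (GG (pdiff (\<psi> n) (u n))) \<le> (d n)\<^sup>2" for n by simp
    show "(\<lambda>n. (d n)\<^sup>2) \<longlonglongrightarrow> 0" using tendsto_power[OF d0, of 2] by simp
  qed
  note el = energy_diff_tendsto_0[OF uG(1) \<psi> uG(2) l]
  have H: "sqi LO (fst (\<psi> n))" "sqi LO (snd (\<psi> n))" "sqi LO (fst (u n))" "sqi LO (snd (u n))" for n
    using \<psi>[of n] uG(1)[of n] by (auto simp: H10pair_def intro: H10_sqi)
  have ml: "(\<lambda>n. nsq LO (f n)) \<longlonglongrightarrow> \<rho>" if f: "\<And>n. sqi LO (f n)" and g: "\<And>n. sqi LO (g n)" "\<And>n. nsq LO (g n) = \<rho>"
    and fg: "(\<lambda>n. nsq LO (\<lambda>x. f n x - g n x)) \<longlonglongrightarrow> 0" for f g :: "nat \<Rightarrow> 'a \<Rightarrow> complex" and \<rho>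
  proof -
    have "(\<lambda>n. sqrt (nsq LO (f n)) - sqrt \<rho>) \<longlonglongrightarrow> 0"
    proof (rule tendsto_0_bound)
      fix n
      have "sqrt (nsq LO (f n)) \<le> sqrt (nsq LO (\<lambda>x. f n x - g n x)) + sqrt (nsq LO (g n))"
        using nsq_triangle[OF sqi_diff[OF f g(1)] g(1), of n n n] by simp
      moreover have "sqrt (nsq LO (g n)) \<le> sqrt (nsq LO (\<lambda>x. g n x - f n x)) + sqrt (nsq LO (f n))"
        using nsq_triangle[OF sqi_diff[OF g(1) f] f, of n n n] by simp
      moreover have "nsq LO (\<lambda>x. g n x - f n x) = nsq LO (\<lambda>x. f n x - g n x)" by (rule nsq_minus_commute)
      ultimately show "norm (sqrt (nsq LO (f n)) - sqrt \<rho>) \<le> sqrt (nsq LO (\<lambda>x. f n x - g n x))"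
        using g(2)[of n] by (simp add: abs_le_iff)
    next
      show "(\<lambda>n. sqrt (nsq LO (\<lambda>x. f n x - g n x))) \<longlonglongrightarrow> 0" using tendsto_real_sqrt[OF fg] by simp
    qed
    then have "(\<lambda>n. sqrt (nsq LO (f n))) \<longlonglongrightarrow> sqrt \<rho>" by (simp add: LIM_zero_iff)
    from tendsto_power[OF this, of 2] show ?thesis using g(2)[of 0] nsq_nonneg[of LO "g 0"] by simp
  qed
  have "(\<lambda>n. mass \<Omega> (fst (\<psi> n))) \<longlonglongrightarrow> \<rho>1" unfolding mass_eq by (rule ml[OF H(1) H(3) _ el(3)]) (use uG in \<open>simp add: mass_eq\<close>)
  then have "(\<lambda>n. \<bar>mass \<Omega> (fst (\<psi> n)) - \<rho>1\<bar>) \<longlonglongrightarrow> \<bar>\<rho>1 - \<rho>1\<bar>" by (intro tendsto_intros)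
  then have e1: "\<forall>\<^sub>F n in sequentially. \<bar>mass \<Omega> (fst (\<psi> n)) - \<rho>1\<bar> < \<eta>" using \<eta> by (intro order_tendstoD) auto
  have "(\<lambda>n. mass \<Omega> (snd (\<psi> n))) \<longlonglongrightarrow> \<rho>2" unfolding mass_eq by (rule ml[OF H(2) H(4) _ el(4)]) (use uG in \<open>simp add: mass_eq\<close>)
  then have "(\<lambda>n. \<bar>mass \<Omega> (snd (\<psi> n)) - \<rho>2\<bar>) \<longlonglongrightarrow> \<bar>\<rho>2 - \<rho>2\<bar>" by (intro tendsto_intros)
  then have e2: "\<forall>\<^sub>F n in sequentially. \<bar>mass \<Omega> (snd (\<psi> n)) - \<rho>2\<bar> < \<eta>" using \<eta> by (intro order_tendstoD) auto
  have e3: "\<forall>\<^sub>F n in sequentially. En (\<psi> n) - En (u n) < \<eta>" using el(2) \<eta> by (intro order_tendstoD) auto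
  have e4: "\<forall>\<^sub>F n in sequentially. GG (\<psi> n) - GG (u n) < \<tau> - \<tau>0" using el(1) \<tau> by (intro order_tendstoD) auto
  from e1 e2 e3 e4 have "\<forall>\<^sub>F n in sequentially. False"
  proof eventually_elim
    case (elim n)
    have "En (\<psi> n) < c + \<eta>" using elim(3) uG(5)[of n] by linarith
    moreover have "GG (\<psi> n) < \<tau>" using elim(4) uG(2)[of n] by linarith
    ultimately show ?case using elim bad[of n] by blast
  qed
  then show False by simp
qed

end

theorem theorem1p10:
  fixes \<Omega> :: "'a::euclidean_space set"
    and \<mu>1 \<mu>2 \<beta> p \<rho>1 \<rho>2 \<alpha> :: real
  assumes "bounded \<Omega>" and "lipschitz_domain \<Omega>"
    and "\<mu>1 > 0" and "\<mu>2 > 0"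
    and "1 + 4 / real DIM('a) < p"
    and "DIM('a) \<ge> 3 \<longrightarrow> p \<le> twostar DIM('a) - 1"
    and "(\<rho>1, \<rho>2) \<in> Aset \<Omega> \<mu>1 \<mu>2 \<beta> p"
    and "\<alpha> \<ge> lambda1 \<Omega>"
    and "cB \<Omega> \<mu>1 \<mu>2 \<beta> p \<rho>1 \<rho>2 \<alpha> < cU \<Omega> \<mu>1 \<mu>2 \<beta> p \<rho>1 \<rho>2 \<alpha>"
    and "DIM('a) \<ge> 3 \<and> p = twostar DIM('a) - 1 \<longrightarrow>
           (\<rho>1 + \<rho>2) * (\<alpha> - lambda1 \<Omega>) \<le> Lambda TYPE('a) \<mu>1 \<mu>2 \<beta> powr (- (real DIM('a) - 2) / 2)"
  shows "cond_orbitally_stable \<Omega> \<mu>1 \<mu>2 \<beta> p (Gset \<Omega> \<mu>1 \<mu>2 \<beta> p \<rho>1 \<rho>2 \<alpha>)"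
proof -
  have "4 / real DIM('a) \<ge> 0" by simp
  then have p1: "p > 1" using assms(5) by linarith
  interpret nls \<Omega> \<mu>1 \<mu>2 \<beta> p
    using assms p1 by unfold_locales (auto simp: lipschitz_domain_def)
  have ne: "\<Omega> \<noteq> {}" using assms(2) by (simp add: lipschitz_domain_def)
  define G where "G = Gset \<Omega> \<mu>1 \<mu>2 \<beta> p \<rho>1 \<rho>2 \<alpha>"
  have "\<exists>\<delta>>0. \<forall>\<psi>. H10pair \<Omega> \<psi> \<and> h10distset \<Omega> \<psi> G < ereal \<delta> \<longrightarrow>
          (\<exists>\<Psi>. sol \<psi> \<infinity> \<Psi> \<and> (SUP t\<in>{0<..}. h10distset \<Omega> (\<Psi> t) G) < ereal \<epsilon>)"
    if wp: "local_wellposed \<Omega> \<mu>1 \<mu>2 \<beta> p" and cons: "conservation \<Omega> \<mu>1 \<mu>2 \<beta> p" and \<epsilon>: "\<epsilon> > 0" for \<epsilon>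
  proof (cases "G = {}")
    case True
    \<comment> \<open>The distance to the empty set is infinite, so no datum qualifies.\<close>
    then show ?thesis by (intro exI[of _ 1]) (auto simp: h10distset_def top_ereal_def)
  next
    case False
    then obtain u0 where u0: "u0 \<in> G" by blast
    define c where "c = En u0"
    have cB: "cB \<Omega> \<mu>1 \<mu>2 \<beta> p \<rho>1 \<rho>2 \<alpha> = ereal c" using u0 by (simp add: G_def Gset_def c_def)
    have Giff: "u \<in> G \<longleftrightarrow> H10pair \<Omega> u \<and> absp u \<in> Bset \<Omega> \<rho>1 \<rho>2 \<alpha> \<and> En u = c" for u
      unfolding G_def Gset_def cB by simp
    have c: "c \<le> En w" if "w \<in> Bset \<Omega> \<rho>1 \<rho>2 \<alpha>" for w
    proof -
      have "cB \<Omega> \<mu>1 \<mu>2 \<beta> p \<rho>1 \<rho>2 \<alpha> \<le> ereal (En w)" unfolding cB_def by (rule INF_lower[OF that])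
      then show ?thesis by (simp add: cB)
    qed
    \<comment> \<open>A real level is taken between the infima because the one over the sphere may
      be infinite.\<close>
    obtain d where d: "c < d" "ereal d < cU \<Omega> \<mu>1 \<mu>2 \<beta> p \<rho>1 \<rho>2 \<alpha>"
      using ereal_dense2[OF assms(9)] cB by auto
    have dU: "d \<le> En w" if "w \<in> Uset \<Omega> \<rho>1 \<rho>2 \<alpha>" for w
    proof -
      have "cU \<Omega> \<mu>1 \<mu>2 \<beta> p \<rho>1 \<rho>2 \<alpha> \<le> ereal (En w)" unfolding cU_def by (rule INF_lower[OF that])
      then have "ereal d \<le> ereal (En w)" using d(2) by (meson less_le_trans less_imp_le)
      then show ?thesis by simp
    qed
    obtain \<tau>0 where \<tau>0: "\<tau>0 < (\<rho>1 + \<rho>2) * \<alpha>" "\<And>u. u \<in> G \<Longrightarrow> GG u \<le> \<tau>0"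
    proof -
      have "\<exists>\<tau>. \<tau> < (\<rho>1 + \<rho>2) * \<alpha> \<and> (\<forall>u\<in>G. GG u \<le> \<tau>)"
        by (rule GG_ground_states[OF ne c dU d(1)]) (use Giff in blast)+
      then show ?thesis using that by blast
    qed
    \<comment> \<open>The trapping level lies strictly above all ground states, so that nearby data
      start inside, and strictly below the boundary, which the critical case of compactness
      needs.\<close>
    define \<tau> where "\<tau> = (\<tau>0 + (\<rho>1 + \<rho>2) * \<alpha>) / 2"
    have \<tau>: "\<tau>0 < \<tau>" "\<tau> < (\<rho>1 + \<rho>2) * \<alpha>" using \<tau>0(1) by (auto simp: \<tau>_def field_simps)
    \<comment> \<open>Half of \<open>\<epsilon>\<close> is used because the supremum over time must
      stay strictly below \<open>\<epsilon>\<close>.\<close>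
    obtain \<eta> where \<eta>: "\<eta> > 0" and trap: "\<And>v. H10pair \<Omega> v \<Longrightarrow> \<bar>mass \<Omega> (fst v) - \<rho>1\<bar> < \<eta> \<Longrightarrow> \<bar>mass \<Omega> (snd v) - \<rho>2\<bar> < \<eta> \<Longrightarrow>
        En v < c + \<eta> \<Longrightarrow> GG v \<le> \<tau> \<Longrightarrow> GG v < \<tau> \<and> (\<exists>u\<in>G. h10dist \<Omega> v u < \<epsilon> / 2)"
    proof -
      have "\<exists>\<eta>>0. \<forall>v. H10pair \<Omega> v \<and> \<bar>mass \<Omega> (fst v) - \<rho>1\<bar> < \<eta> \<and> \<bar>mass \<Omega> (snd v) - \<rho>2\<bar> < \<eta> \<and> En v < c + \<eta> \<and> GG v \<le> \<tau> \<longrightarrow>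
        GG v < \<tau> \<and> (\<exists>u\<in>G. h10dist \<Omega> v u < \<epsilon> / 2)"
        by (rule trapping_region[OF \<tau> \<tau>0(2) c _ assms(10)]) (use Giff \<epsilon> in auto)
      then show ?thesis using that by blast
    qed
    have Gm: "H10pair \<Omega> u \<and> GG u \<le> \<tau>0 \<and> mass \<Omega> (fst u) = \<rho>1 \<and> mass \<Omega> (snd u) = \<rho>2 \<and> En u = c" if u: "u \<in> G" for u
    proof -
      have uH: "H10pair \<Omega> u" "absp u \<in> Mset \<Omega> \<rho>1 \<rho>2" "En u = c" using u unfolding Giff Bset_eq by auto
      then show ?thesis using energy_abs(5,6)[OF uH(1)] \<tau>0(2)[OF u] by (simp add: Mset_def)
    qed
    obtain \<delta> where \<delta>: "\<delta> > 0" and near: "\<And>\<psi> u. H10pair \<Omega> \<psi> \<Longrightarrow> u \<in> G \<Longrightarrow> h10dist \<Omega> \<psi> u < \<delta> \<Longrightarrow>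
        \<bar>mass \<Omega> (fst \<psi>) - \<rho>1\<bar> < \<eta> \<and> \<bar>mass \<Omega> (snd \<psi>) - \<rho>2\<bar> < \<eta> \<and> En \<psi> < c + \<eta> \<and> GG \<psi> < \<tau>"
    proof -
      have "\<exists>\<delta>>0. \<forall>\<psi> u. H10pair \<Omega> \<psi> \<and> u \<in> G \<and> h10dist \<Omega> \<psi> u < \<delta> \<longrightarrow>
        \<bar>mass \<Omega> (fst \<psi>) - \<rho>1\<bar> < \<eta> \<and> \<bar>mass \<Omega> (snd \<psi>) - \<rho>2\<bar> < \<eta> \<and> En \<psi> < c + \<eta> \<and> GG \<psi> < \<tau>"
        by (rule data_near_ground_states[OF \<tau>(1) _ \<eta>]) (rule Gm)
      then obtain \<delta> where "\<delta> > 0" and n: "\<forall>\<psi> u. H10pair \<Omega> \<psi> \<and> u \<in> G \<and> h10dist \<Omega> \<psi> u < \<delta> \<longrightarrow>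
        \<bar>mass \<Omega> (fst \<psi>) - \<rho>1\<bar> < \<eta> \<and> \<bar>mass \<Omega> (snd \<psi>) - \<rho>2\<bar> < \<eta> \<and> En \<psi> < c + \<eta> \<and> GG \<psi> < \<tau>" by (elim exE conjE)
      then show ?thesis by (intro that[of \<delta>]) (assumption, rule n[rule_format], intro conjI)
    qed
    have \<tau>pos: "\<tau> > 0" using \<tau>0(2)[OF u0] GG_nonneg[of u0] \<tau>(1) by linarith
    \<comment> \<open>Trapped states have norm below \<open>sqrt \<tau>\<close>, so the existence
      time for this one radius serves every restart.\<close>
    obtain T0 where T0: "T0 > 0" and loc: "\<And>\<psi>. H10pair \<Omega> \<psi> \<Longrightarrow> h10norm \<Omega> \<psi> \<le> sqrt \<tau> \<Longrightarrow> \<exists>\<Psi>. sol \<psi> (ereal T0) \<Psi>"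
    proof -
      have "sqrt \<tau> > 0" using \<tau>pos by simp
      from wp[unfolded local_wellposed_def, rule_format, OF this] obtain T0 where "T0 > 0"
        and "\<forall>\<psi>. H10pair \<Omega> \<psi> \<and> h10norm \<Omega> \<psi> \<le> sqrt \<tau> \<longrightarrow> (\<exists>\<Psi>. sol \<psi> (ereal T0) \<Psi>)" by meson
      then show ?thesis by (intro that[of T0]) auto
    qed
    show ?thesis
    proof (intro exI[of _ \<delta>] conjI allI impI \<delta>)
      fix \<psi> assume A: "H10pair \<Omega> \<psi> \<and> h10distset \<Omega> \<psi> G < ereal \<delta>"
      then obtain u where u: "u \<in> G" "h10dist \<Omega> \<psi> u < \<delta>" unfolding h10distset_def INF_less_iff by auto
      have \<psi>: "H10pair \<Omega> \<psi>" "\<bar>mass \<Omega> (fst \<psi>) - \<rho>1\<bar> < \<eta>" "\<bar>mass \<Omega> (snd \<psi>) - \<rho>2\<bar> < \<eta>" "En \<psi> < c + \<eta>" "GG \<psi> < \<tau>"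
        using near[OF conjunct1[OF A] u] A by auto
      have tr: "GG v \<noteq> \<tau>" if "H10pair \<Omega> v" "mass \<Omega> (fst v) = mass \<Omega> (fst \<psi>)" "mass \<Omega> (snd v) = mass \<Omega> (snd \<psi>)" "En v = En \<psi>" for v
        using trap[of v] that \<psi> by auto
      have "\<exists>\<Psi>. sol \<psi> \<infinity> \<Psi>"
      proof (rule sol_global[OF T0 _ \<psi>(1,5)])
        show "\<exists>\<Psi>. sol \<xi> (ereal T0) \<Psi>" if "H10pair \<Omega> \<xi>" "GG \<xi> < \<tau>" for \<xi>
          using loc[OF that(1)] that(2) by (simp add: h10norm_eq)
        show "GG (\<Psi> t) < \<tau>" if "A > 0" "sol \<psi> (ereal A) \<Psi>" "t \<in> {0..<A}" for A \<Psi> t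
          by (rule sol_trapped[OF that(2) _ \<psi>(1,5) cons tr]) (use that in \<open>auto simp: Dom_ereal\<close>)
      qed
      then obtain \<Psi> where \<Psi>: "sol \<psi> \<infinity> \<Psi>" by blast
      have "h10distset \<Omega> (\<Psi> t) G \<le> ereal (\<epsilon> / 2)" if t: "t > 0" for t
      proof -
        have tD: "t \<in> Dom \<infinity>" using t by (simp add: Dom_def)
        have "GG (\<Psi> t) < \<tau>" by (rule sol_trapped[OF \<Psi> _ \<psi>(1,5) cons tr tD]) simp
        moreover have "H10pair \<Omega> (\<Psi> t)" using \<Psi> tD unfolding sol_iff by blast
        moreover have "mass \<Omega> (fst (\<Psi> t)) = mass \<Omega> (fst \<psi>) \<and> mass \<Omega> (snd (\<Psi> t)) = mass \<Omega> (snd \<psi>) \<and> En (\<Psi> t) = En \<psi>"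
          using cons \<Psi> tD unfolding conservation_def Dom_def by blast
        ultimately obtain v where v: "v \<in> G" "h10dist \<Omega> (\<Psi> t) v < \<epsilon> / 2" using trap[of "\<Psi> t"] \<psi> by auto
        have "h10distset \<Omega> (\<Psi> t) G \<le> ereal (h10dist \<Omega> (\<Psi> t) v)" unfolding h10distset_def by (rule INF_lower[OF v(1)])
        also have "\<dots> \<le> ereal (\<epsilon> / 2)" using v(2) by simp
        finally show ?thesis .
      qed
      then have "(SUP t\<in>{0<..}. h10distset \<Omega> (\<Psi> t) G) \<le> ereal (\<epsilon> / 2)" by (intro SUP_least) auto
      also have "\<dots> < ereal \<epsilon>" using \<epsilon> by simp
      finally show "\<exists>\<Psi>. sol \<psi> \<infinity> \<Psi> \<and> (SUP t\<in>{0<..}. h10distset \<Omega> (\<Psi> t) G) < ereal \<epsilon>" using \<Psi> by blast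
    qed
  qed
  then show ?thesis unfolding cond_orbitally_stable_def G_def by blast
qed

end
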